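(* Let $s\in(0,1)$, $a=1-2s\in(-1,1)$, and $f\in C^{1,\gamma}(\mathbb{R})$ with $\gamma>\max\{0,1-2s\}$. Let $u\in C^2(\widehat{\mathbb{H}})$ be a bounded and stable weak solution of $$\operatorname{div}_{\widehat{\mathbb{H}}}(y^a\nabla_{\widehat{\mathbb{H}}}u)=0\ \text{ in }\mathbb{H}\times(0,\infty),\qquad -y^a u_y=f(u)\ \text{ on }\mathbb{H}\times\{0\}.$$ Assume furthermore that $|\nabla_{\mathbb{H}}u|\in L^\infty(\overline{B_R^+})$ for all $R>0$. Let $\mathcal{R}^4_+=\{(x,y)\in\mathbb{H}\times(0,+\infty):\nabla_{\mathbb{H}}u(x,y)\neq0\}$. Then, for any $\phi\in C_0^\infty(\mathbb{R}^4)$, $$\int_{\widehat{\mathbb{H}}}y^a|\nabla_{\mathbb{H}}u|^2|\nabla_{\widehat{\mathbb{H}}}\phi|^2\ \ge\ \int_{\mathcal{R}^4_+}y^a\Big(|Hu|^2-\langle(Hu)^2\nu_{x,y},\nu_{x,y}\rangle_{\mathbb{H}}-2(TYu\,Xu-TXu\,Yu)\Big)\phi^2$$ $$=\int_{\mathcal{R}^4_+}y^a|\nabla_{\mathbb{H}}u|^2\left[h_{x,y}^2+\left(p_{x,y}+\frac{\langle Hu\,v_{x,y},\nu_{x,y}\rangle_{\mathbb{H}}}{|\nabla_{\mathbb{H}}u|}\right)^2+2\langle T\nu_{x,y},v_{x,y}\rangle_{\mathbb{H}}\right]\phi^2 .$$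
   Context: Heisenberg group: $\mathbb{H}=\mathbb{R}^3$ with law $(x_1,x_2,x_3)\circ(y_1,y_2,y_3)=(x_1+y_1,\,x_2+y_2,\,x_3+y_3+2(x_2y_1-x_1y_2))$. Vector fields: $X=\partial_{x_1}+2x_2\partial_{x_3}$, $Y=\partial_{x_2}-2x_1\partial_{x_3}$, $T=[X,Y]=-4\partial_{x_3}$. On horizontal vectors, written in coordinates with respect to the frame $(X,Y)$, $\langle\cdot,\cdot\rangle_{\mathbb{H}}$ is the inner product making $X,Y$ orthonormal. $\nabla_{\mathbb{H}}u=(Xu,Yu)$ and $\operatorname{div}_{\mathbb{H}}(w_1,w_2)=Xw_1+Yw_2$. Let $\widehat{\mathbb{H}}=\mathbb{H}\times(0,\infty)=\mathbb{R}^4_+=\mathbb{R}^3\times(0,\infty)$ with points $(x,y)$; $\nabla_{\widehat{\mathbb{H}}}u=(Xu,Yu,u_y)$, $\operatorname{div}_{\widehat{\mathbb{H}}}(w_1,w_2,w_3)=Xw_1+Yw_2+\partial_yw_3$, with $\langle\cdot,\cdot\rangle_{\widehat{\mathbb{H}}}$ the standard inner product of these coordinates. Integrals are with respect to Lebesgue measure; $\int_{\mathbb{H}}$ is over $\{y=0\}$. $B_R$ is the Euclidean ball of radius $R$ centered at $0$ in $\mathbb{R}^4$ and $B_R^+=B_R\cap\mathbb{R}^4_+$. Weak solution: $u\in L^\infty_{\mathrm{loc}}(\overline{\mathbb{R}^4_+})$, $y^a|\nabla_{\widehat{\mathbb{H}}}u|^2\in L^1(B_R^+)$ for every $R>0$,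 and $$\int_{\widehat{\mathbb{H}}}y^a\langle\nabla_{\widehat{\mathbb{H}}}u,\nabla_{\widehat{\mathbb{H}}}\xi\rangle_{\widehat{\mathbb{H}}}=\int_{\mathbb{H}}f(u)\xi$$ for all admissible $\xi$, i.e. all $\xi:\mathbb{R}^4_+\to\mathbb{R}$ bounded, locally Lipschitz, vanishing on $\mathbb{R}^4_+\setminus B_R$ for some $R>0$, with $y^a|\nabla_{\widehat{\mathbb{H}}}\xi|^2\in L^1(B_R^+)$. Stable: $\int_{\widehat{\mathbb{H}}}y^a|\nabla_{\widehat{\mathbb{H}}}\xi|^2-\int_{\mathbb{H}}f'(u)\xi^2\ge0$ for all admissible $\xi$. Values on $\{y=0\}$ are boundary values (traces). Hessian: $Hu=\begin{bmatrix} XXu & YXu \\ XYu & YYu \end{bmatrix}$, $|Hu|^2$ is the sum of the squares of its entries, and $(Hu)^2:=(Hu)(Hu)^T$ (matrix transpose). Here $TYu=T(Yu)$, etc. At points $(x,y)$ with $\nabla_{\mathbb{H}}u(x,y)\ne0$: intrinsic normal $\nu_{x,y}=\nabla_{\mathbb{H}}u/|\nabla_{\mathbb{H}}u|$; intrinsic unit tangent $v_{x,y}=(Yu,-Xu)/|\nabla_{\mathbb{H}}u|$; intrinsic mean curvature $h_{x,y}=\operatorname{div}_{\mathbb{H}}\nu_{x,y}$; imaginary curvature $p_{x,y}=-Tu/|\nabla_{\mathbb{H}}u|$ (all of the level set of $u(\cdot,y)$ through $x$, with $y$ fixed). $T\nu_{x,y}$ means $T$ applied to each of the two components of $\nu_{x,y}$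 in the $(X,Y)$-frame. *)

theory Defs
  imports "HOL-Analysis.Analysis"
begin

section \<open>Points, half-space, regularity classes\<close>

text \<open>
  The Heisenberg group is \<open>real^3\<close>, and its extension lies in \<open>real^3 \<times> real\<close>, whose norm and
  Lebesgue measure are those of the Euclidean 4-space. Functions on the open half-space are
  total functions on \<open>real^3 \<times> real\<close>, of which only the restriction to the half-space matters.
\<close>

type_synonym heis = "real^3"
type_synonym hpt = "heis \<times> real"

definition half_space :: "hpt set" where
  "half_space = {p. snd p > 0}"

definition half_ball :: "real \<Rightarrow> hpt set" where
  "half_ball R = ball 0 R \<inter> half_space"

definition Linf_on :: "hpt set \<Rightarrow> (hpt \<Rightarrow> real) \<Rightarrow> bool" where
  "Linf_on S g \<longleftrightarrow>
     g \<in> borel_measurable (lebesgue_on S) \<and> (\<exists>C. AE p in lebesgue_on S. \<bar>g p\<bar> \<le> C)"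

text \<open>
  The partial derivative in direction \<open>b\<close>. For a locally Lipschitz function it is meaningful
  almost everywhere (Rademacher); its values on the exceptional null set are irrelevant.
\<close>

definition pd :: "'a::euclidean_space \<Rightarrow> ('a \<Rightarrow> real) \<Rightarrow> 'a \<Rightarrow> real" where
  "pd b g p = frechet_derivative g (at p) b"

text \<open>\<open>Ck_on k S g\<close>: the function \<open>g\<close> is of class \<open>C^k\<close> on the open set \<open>S\<close>.\<close>

primrec Ck_on :: "nat \<Rightarrow> 'a::euclidean_space set \<Rightarrow> ('a \<Rightarrow> real) \<Rightarrow> bool" where
  "Ck_on 0 S g \<longleftrightarrow> continuous_on S g"
| "Ck_on (Suc k) S g \<longleftrightarrow>
     (\<forall>p\<in>S. g differentiable (at p)) \<and> (\<forall>b\<in>Basis. Ck_on k S (pd b g))"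

definition smooth_compact_support :: "(hpt \<Rightarrow> real) \<Rightarrow> bool" where
  "smooth_compact_support \<phi> \<longleftrightarrow>
     (\<forall>k. Ck_on k UNIV \<phi>) \<and> compact (closure {p. \<phi> p \<noteq> 0})"

definition locally_lipschitz_on :: "hpt set \<Rightarrow> (hpt \<Rightarrow> real) \<Rightarrow> bool" where
  "locally_lipschitz_on S g \<longleftrightarrow> (\<forall>p\<in>S. \<exists>r>0. \<exists>L. L-lipschitz_on (ball p r \<inter> S) g)"

text \<open>The class \<open>C^{1,\<gamma>}\<close>, with the Hoelder condition on the derivative required on bounded
  intervals only.\<close>

definition C1_hoelder :: "real \<Rightarrow> (real \<Rightarrow> real) \<Rightarrow> bool" where
  "C1_hoelder \<gamma> f \<longleftrightarrow>
     (\<forall>t. f differentiable (at t)) \<and> continuous_on UNIV (deriv f) \<and>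
     (\<forall>K. \<exists>C. \<forall>t\<in>{-K..K}. \<forall>r\<in>{-K..K}. \<bar>deriv f t - deriv f r\<bar> \<le> C * \<bar>t - r\<bar> powr \<gamma>)"

section \<open>Heisenberg vector fields\<close>

definition hX :: "(hpt \<Rightarrow> real) \<Rightarrow> hpt \<Rightarrow> real" where
  "hX g p = pd (axis 1 1, 0) g p + 2 * (fst p $ 2) * pd (axis 3 1, 0) g p"

definition hY :: "(hpt \<Rightarrow> real) \<Rightarrow> hpt \<Rightarrow> real" where
  "hY g p = pd (axis 2 1, 0) g p - 2 * (fst p $ 1) * pd (axis 3 1, 0) g p"

text \<open>The commutator of \<open>hX\<close> and \<open>hY\<close>, written as the first-order operator it is, so that
  it applies to functions that are only once differentiable.\<close>

definition hT :: "(hpt \<Rightarrow> real) \<Rightarrow> hpt \<Rightarrow> real" where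
  "hT g p = - 4 * pd (axis 3 1, 0) g p"

definition dy :: "(hpt \<Rightarrow> real) \<Rightarrow> hpt \<Rightarrow> real" where
  "dy g p = pd (0, 1) g p"

text \<open>Horizontal vectors are given by their coordinates in the orthonormal frame \<open>(X, Y)\<close>, so
  that the inner product and norm of \<open>real^2\<close> are the Heisenberg ones; likewise \<open>real^3\<close> for the
  frame \<open>(X, Y, \<partial>y)\<close>.\<close>

definition gradH :: "(hpt \<Rightarrow> real) \<Rightarrow> hpt \<Rightarrow> real^2" where
  "gradH g p = vector [hX g p, hY g p]"

definition gradHh :: "(hpt \<Rightarrow> real) \<Rightarrow> hpt \<Rightarrow> real^3" where
  "gradHh g p = vector [hX g p, hY g p, dy g p]"

definition divH :: "(hpt \<Rightarrow> real^2) \<Rightarrow> hpt \<Rightarrow> real" where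
  "divH w p = hX (\<lambda>q. w q $ 1) p + hY (\<lambda>q. w q $ 2) p"

definition hess :: "(hpt \<Rightarrow> real) \<Rightarrow> hpt \<Rightarrow> real^2^2" where
  "hess u p = vector [vector [hX (hX u) p, hY (hX u) p],
                      vector [hX (hY u) p, hY (hY u) p]]"

definition sum_sq_entries :: "real^2^2 \<Rightarrow> real" where
  "sum_sq_entries A = (\<Sum>i\<in>UNIV. \<Sum>j\<in>UNIV. (A $ i $ j)\<^sup>2)"

definition mat_sq :: "real^2^2 \<Rightarrow> real^2^2" where
  "mat_sq A = A ** transpose A"

section \<open>Geometry of the level sets\<close>

definition regular_set :: "(hpt \<Rightarrow> real) \<Rightarrow> hpt set" where
  "regular_set u = {p \<in> half_space. gradH u p \<noteq> 0}"

definition nu :: "(hpt \<Rightarrow> real) \<Rightarrow> hpt \<Rightarrow> real^2" where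
  "nu u p = gradH u p /\<^sub>R norm (gradH u p)"

definition tang :: "(hpt \<Rightarrow> real) \<Rightarrow> hpt \<Rightarrow> real^2" where
  "tang u p = vector [hY u p, - hX u p] /\<^sub>R norm (gradH u p)"

definition mean_curv :: "(hpt \<Rightarrow> real) \<Rightarrow> hpt \<Rightarrow> real" where
  "mean_curv u p = divH (nu u) p"

definition imag_curv :: "(hpt \<Rightarrow> real) \<Rightarrow> hpt \<Rightarrow> real" where
  "imag_curv u p = - hT u p / norm (gradH u p)"

definition T_nu :: "(hpt \<Rightarrow> real) \<Rightarrow> hpt \<Rightarrow> real^2" where
  "T_nu u p = vector [hT (\<lambda>q. nu u q $ 1) p, hT (\<lambda>q. nu u q $ 2) p]"

section \<open>Weak and stable solutions\<close>

text \<open>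
  The trace on \<open>y = 0\<close> as the limit along vertical lines. This limit exists for almost every
  \<open>x\<close> whenever \<open>y^a |\<partial>y g|^2\<close> is locally integrable up to \<open>y = 0\<close> and \<open>a < 1\<close>, because then
  \<open>\<partial>y g (x, \<cdot>)\<close> is integrable near \<open>0\<close> for almost every \<open>x\<close>.
\<close>

definition trace0 :: "(hpt \<Rightarrow> real) \<Rightarrow> heis \<Rightarrow> real" where
  "trace0 g x = Lim (at_right 0) (\<lambda>y. g (x, y))"

definition admissible :: "real \<Rightarrow> (hpt \<Rightarrow> real) \<Rightarrow> bool" where
  "admissible a \<xi> \<longleftrightarrow>
     bounded (\<xi> ` half_space) \<and> locally_lipschitz_on half_space \<xi> \<and>
     (\<exists>R>0. (\<forall>p \<in> half_space - ball 0 R. \<xi> p = 0) \<and>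
            set_integrable lebesgue (half_ball R) (\<lambda>p. snd p powr a * (norm (gradHh \<xi> p))\<^sup>2))"

definition weak_solution :: "real \<Rightarrow> (real \<Rightarrow> real) \<Rightarrow> (hpt \<Rightarrow> real) \<Rightarrow> bool" where
  "weak_solution a f u \<longleftrightarrow>
     (\<forall>R>0. Linf_on (half_ball R) u) \<and>
     (\<forall>R>0. set_integrable lebesgue (half_ball R) (\<lambda>p. snd p powr a * (norm (gradHh u p))\<^sup>2)) \<and>
     (\<forall>\<xi>. admissible a \<xi> \<longrightarrow>
        (LINT p:half_space|lebesgue. snd p powr a * (gradHh u p \<bullet> gradHh \<xi> p))
          = (LINT x|lebesgue. f (trace0 u x) * trace0 \<xi> x))"

definition stable :: "real \<Rightarrow> (real \<Rightarrow> real) \<Rightarrow> (hpt \<Rightarrow> real) \<Rightarrow> bool" where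
  "stable a f u \<longleftrightarrow>
     (\<forall>\<xi>. admissible a \<xi> \<longrightarrow>
        (LINT p:half_space|lebesgue. snd p powr a * (norm (gradHh \<xi> p))\<^sup>2)
          - (LINT x|lebesgue. deriv f (trace0 u x) * (trace0 \<xi> x)\<^sup>2) \<ge> 0)"

section \<open>The three integrands\<close>

definition lhs_integrand :: "real \<Rightarrow> (hpt \<Rightarrow> real) \<Rightarrow> (hpt \<Rightarrow> real) \<Rightarrow> hpt \<Rightarrow> real" where
  "lhs_integrand a u \<phi> p =
     snd p powr a * (norm (gradH u p))\<^sup>2 * (norm (gradHh \<phi> p))\<^sup>2"

definition hessian_integrand :: "real \<Rightarrow> (hpt \<Rightarrow> real) \<Rightarrow> (hpt \<Rightarrow> real) \<Rightarrow> hpt \<Rightarrow> real" where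
  "hessian_integrand a u \<phi> p =
     snd p powr a *
     (sum_sq_entries (hess u p) - (mat_sq (hess u p) *v nu u p) \<bullet> nu u p
      - 2 * (hT (hY u) p * hX u p - hT (hX u) p * hY u p)) * (\<phi> p)\<^sup>2"

definition curvature_integrand :: "real \<Rightarrow> (hpt \<Rightarrow> real) \<Rightarrow> (hpt \<Rightarrow> real) \<Rightarrow> hpt \<Rightarrow> real" where
  "curvature_integrand a u \<phi> p =
     snd p powr a * (norm (gradH u p))\<^sup>2 *
     ((mean_curv u p)\<^sup>2
      + (imag_curv u p + ((hess u p *v tang u p) \<bullet> nu u p) / norm (gradH u p))\<^sup>2
      + 2 * (T_nu u p \<bullet> tang u p)) * (\<phi> p)\<^sup>2"

end

theory Submission
  imports Defs
begin

text \<open>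
  Translating in the direction of a vector field that generates left translations leaves the
  weighted energy and the measure invariant. Difference quotients of \<open>u\<close> along \<open>\<partial>\<^sub>3\<close> and the two
  right-invariant fields hence solve difference quotients of the equation, and a Caccioppoli argument
  bounds their energy. For \<open>\<partial>\<^sub>3\<close> this starts from the bound on \<open>Xu\<close> and \<open>Yu\<close>, because
  \<open>4 \<partial>\<^sub>3 = - [X, Y]\<close>. In the limit, \<open>Xu\<close> and \<open>Yu\<close>, which are combinations of these derivatives with affine
  coefficients, solve the linearised equation up to commutator terms. Testing with \<open>Xu \<phi>\<^sup>2\<close> and
  \<open>Yu \<phi>\<^sup>2\<close>, and testing stability with \<open>|\<nabla>u| \<phi>\<close>, gives the inequality; it agrees with the geometric
  form pointwise.
\<close>

section \<open>Directional derivatives\<close>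

text \<open>Obstacle: u is C^2 only in the open half-space, so nothing bounds its second derivatives
  near y = 0, where the boundary terms live. Quotients along X and Y themselves would not help:
  their flows are right translations, which do not preserve the energy. Hence the detour through the
  right-invariant fields X - 4 x_2 d_3 and Y + 4 x_1 d_3, and so through d_3 u, on which no bound is
  assumed. Its L^2 estimate is a bootstrap: integration by parts bounds the squared quotient D by a
  first power of the gradient of D, Caccioppoli bounds the square of that gradient by the square of
  D, and Young's inequality with a small parameter closes the loop. On the boundary, f'(u) |grad
  u|^2 \<phi>^2 occurs both in the tested equations and in the stability inequality, and cancels.
  Since |grad u| need not be differentiable at its zeros, sqrt(|grad u|^2 + \<epsilon>^2) stands in
  for it; the error is \<epsilon>^2 times a fixed number. Every integration by parts is tangential
  to y = 0 and comes from the invariance of the measure under flows, so it leaves no boundary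
  term.\<close>

lemma pd_eqI: "(g has_derivative D) (at p) \<Longrightarrow> pd v g p = D v"
  unfolding pd_def using frechet_derivative_at by metis

lemma has_derivative_pd: "g differentiable (at p) \<Longrightarrow> (g has_derivative (\<lambda>v. pd v g p)) (at p)"
  unfolding pd_def using frechet_derivative_works by blast

lemma linear_pd: "g differentiable (at p) \<Longrightarrow> linear (\<lambda>v. pd v g p)"
  using has_derivative_pd has_derivative_linear by blast

lemma pd_add_dir: "g differentiable (at p) \<Longrightarrow> pd (v + w) g p = pd v g p + pd w g p"
  using linear_pd linear_add by blast

lemma pd_scale_dir: "g differentiable (at p) \<Longrightarrow> pd (c *\<^sub>R v) g p = c * pd v g p"
  using linear_pd linear_scale by fastforce

lemma pd_mult:
  assumes "f differentiable (at p)" "g differentiable (at p)"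
  shows "pd v (\<lambda>q. f q * g q) p = f p * pd v g p + pd v f p * g p"
  using has_derivative_mult[OF assms[THEN has_derivative_pd]] by (rule pd_eqI)

lemma pd_add:
  assumes "f differentiable (at p)" "g differentiable (at p)"
  shows "pd v (\<lambda>q. f q + g q) p = pd v f p + pd v g p"
  using has_derivative_add[OF assms[THEN has_derivative_pd]] by (rule pd_eqI)

lemma pd_diff:
  assumes "f differentiable (at p)" "g differentiable (at p)"
  shows "pd v (\<lambda>q. f q - g q) p = pd v f p - pd v g p"
  using has_derivative_diff[OF assms[THEN has_derivative_pd]] by (rule pd_eqI)

lemma pd_const [simp]: "pd v (\<lambda>q. c) p = 0"
  using has_derivative_const by (rule pd_eqI)

lemma pd_bounded_linear: "bounded_linear l \<Longrightarrow> pd v l p = l v"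
  using bounded_linear_imp_has_derivative by (rule pd_eqI)

lemma pd_chain:
  assumes "g differentiable (at p)" "(h has_real_derivative h') (at (g p))"
  shows "pd v (\<lambda>q. h (g q)) p = h' * pd v g p"
proof -
  have "(h has_derivative (\<lambda>x. h' * x)) (at (g p))"
    using assms(2) unfolding has_field_derivative_def .
  from has_derivative_compose[OF has_derivative_pd[OF assms(1)] this]
  show ?thesis by (rule pd_eqI)
qed

lemma pd_cong:
  assumes "open S" "p \<in> S" "\<And>q. q \<in> S \<Longrightarrow> f q = g q"
  shows "pd v f p = pd v g p"
proof -
  \<comment> \<open>\<open>frechet_derivative\<close> is a choice among all derivatives, so
    equivalence of the \<open>has_derivative\<close> statements yields equality even where no
    derivative exists.\<close>
  have "\<And>D. (f has_derivative D) (at p) \<longleftrightarrow> (g has_derivative D) (at p)"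
    using assms has_derivative_transform_within_open by (metis (no_types, lifting))
  then show ?thesis unfolding pd_def frechet_derivative_def by simp
qed

lemma pd_line:
  assumes "u differentiable (at (q + s *\<^sub>R v))"
  shows "((\<lambda>s. u (q + s *\<^sub>R v)) has_real_derivative pd v u (q + s *\<^sub>R v)) (at s)"
proof -
  have 1: "((\<lambda>s. q + s *\<^sub>R v) has_derivative (\<lambda>h. h *\<^sub>R v)) (at s)"
    by (auto intro!: derivative_eq_intros)
  show ?thesis
    using has_derivative_compose[OF 1 has_derivative_pd[OF assms]] 
    unfolding has_field_derivative_def pd_scale_dir[OF assms] by (simp add: mult.commute[of "pd v u _"] mult_commute_abs)
qed

section \<open>Continuously differentiable functions and their calculus\<close>

definition C1 :: "'a::euclidean_space set \<Rightarrow> ('a \<Rightarrow> real) \<Rightarrow> bool" where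
  "C1 S g \<longleftrightarrow> (\<forall>p\<in>S. g differentiable (at p)) \<and> (\<forall>v. continuous_on S (pd v g))"

lemma C1_diff: "C1 S g \<Longrightarrow> p \<in> S \<Longrightarrow> g differentiable (at p)"
  by (simp add: C1_def)

lemma C1_pd: "C1 S g \<Longrightarrow> continuous_on S (pd v g)"
  by (simp add: C1_def)

lemma C1_cont: "C1 S g \<Longrightarrow> continuous_on S g"
  unfolding C1_def by (meson continuous_at_imp_continuous_on differentiable_imp_continuous_within)

lemma C1_subset: "C1 S g \<Longrightarrow> T \<subseteq> S \<Longrightarrow> C1 T g"
  unfolding C1_def by (meson continuous_on_subset subsetD)

lemma pd_basis_sum:
  assumes "g differentiable (at p)"
  shows "pd v g p = (\<Sum>b\<in>Basis. (v \<bullet> b) * pd b g p)"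
proof -
  have "pd v g p = pd (\<Sum>b\<in>Basis. (v \<bullet> b) *\<^sub>R b) g p" by (simp add: euclidean_representation)
  also have "\<dots> = (\<Sum>b\<in>Basis. (v \<bullet> b) * pd b g p)"
    using linear_sum[OF linear_pd[OF assms], of "\<lambda>b. (v \<bullet> b) *\<^sub>R b" Basis] linear_scale[OF linear_pd[OF assms]] by simp
  finally show ?thesis .
qed

lemma Ck_on_1_imp_C1: "Ck_on (Suc 0) S g \<Longrightarrow> C1 S g"
proof -
  assume A: "Ck_on (Suc 0) S g"
  have "continuous_on S (pd v g)" for v
  proof (subst continuous_on_cong[OF refl])
    show "pd v g p = (\<Sum>b\<in>Basis. (v \<bullet> b) * pd b g p)" if "p \<in> S" for p
      using A that pd_basis_sum by auto
    show "continuous_on S (\<lambda>p. \<Sum>b\<in>Basis. (v \<bullet> b) * pd b g p)"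
      using A by (auto intro!: continuous_intros)
  qed
  then show ?thesis using A by (auto simp: C1_def)
qed

lemma C1I:
  assumes "\<And>p. p \<in> S \<Longrightarrow> (g has_derivative D p) (at p)" "\<And>v. continuous_on S (\<lambda>p. D p v)"
  shows "C1 S g"
  unfolding C1_def
proof safe
  show "g differentiable (at p)" if "p \<in> S" for p using assms(1)[OF that] by (auto simp: differentiable_def)
  show "continuous_on S (pd v g)" for v
    by (subst continuous_on_cong[OF refl, of _ _ "\<lambda>p. D p v"]) (use assms pd_eqI[OF assms(1)] in auto)
qed

lemma C1_cong:
  assumes "open S" "C1 S f" "\<And>q. q \<in> S \<Longrightarrow> f q = g q"
  shows "C1 S g"
proof (rule C1I)
  show "(g has_derivative (\<lambda>v. pd v f p)) (at p)" if "p \<in> S" for p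
    using has_derivative_transform_within_open[OF has_derivative_pd[OF C1_diff[OF assms(2) that]] assms(1) that assms(3)] .
  show "continuous_on S (pd v f)" for v using assms(2) by (rule C1_pd)
qed

lemma C1_const [intro, simp]: "C1 S (\<lambda>q. c)"
  by (rule C1I[of _ _ "\<lambda>_ _. 0"]) auto

lemma C1_bounded_linear: "bounded_linear l \<Longrightarrow> C1 S l"
  by (rule C1I[of _ _ "\<lambda>_. l"]) (auto simp: bounded_linear_imp_has_derivative)

lemma C1_mult [intro]:
  assumes "C1 S f" "C1 S g"
  shows "C1 S (\<lambda>q. f q * g q)"
proof (rule C1I)
  show "((\<lambda>q. f q * g q) has_derivative (\<lambda>v. f p * pd v g p + pd v f p * g p)) (at p)" if "p \<in> S" for p
    using has_derivative_mult[OF has_derivative_pd has_derivative_pd] assms that C1_diff by blast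
qed (intro continuous_intros C1_cont C1_pd assms)

lemma C1_add [intro]:
  assumes "C1 S f" "C1 S g"
  shows "C1 S (\<lambda>q. f q + g q)"
proof (rule C1I)
  show "((\<lambda>q. f q + g q) has_derivative (\<lambda>v. pd v f p + pd v g p)) (at p)" if "p \<in> S" for p
    using has_derivative_add[OF has_derivative_pd has_derivative_pd] assms that C1_diff by blast
qed (intro continuous_intros C1_cont C1_pd assms)

lemma C1_minus [intro]:
  assumes "C1 S f" "C1 S g"
  shows "C1 S (\<lambda>q. f q - g q)"
proof (rule C1I)
  show "((\<lambda>q. f q - g q) has_derivative (\<lambda>v. pd v f p - pd v g p)) (at p)" if "p \<in> S" for p
    using has_derivative_diff[OF has_derivative_pd has_derivative_pd] assms that C1_diff by blast
qed (intro continuous_intros C1_cont C1_pd assms)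

lemma C1_cmult: "C1 S f \<Longrightarrow> C1 S (\<lambda>q. c * f q)"
  using C1_mult[OF C1_const] .

lemma C1_power2: "C1 S f \<Longrightarrow> C1 S (\<lambda>q. (f q)\<^sup>2)"
  unfolding power2_eq_square by (rule C1_mult)

lemma C1_chain:
  assumes "C1 S g" "\<And>p. p \<in> S \<Longrightarrow> (h has_real_derivative h' (g p)) (at (g p))"
    and "continuous_on (g ` S) h'"
  shows "C1 S (\<lambda>q. h (g q))"
proof (rule C1I)
  show "((\<lambda>q. h (g q)) has_derivative (\<lambda>v. h' (g p) * pd v g p)) (at p)" if "p \<in> S" for p
  proof -
    have "(h has_derivative (\<lambda>x. h' (g p) * x)) (at (g p))"
      using assms(2)[OF that] unfolding has_field_derivative_def .
    from has_derivative_compose[OF has_derivative_pd[OF C1_diff[OF assms(1) that]] this]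
    show ?thesis .
  qed
  show "continuous_on S (\<lambda>p. h' (g p) * pd v g p)" for v
    by (intro continuous_on_mult continuous_on_compose2[OF assms(3)] C1_cont[OF assms(1)] C1_pd[OF assms(1)]) auto
qed

section \<open>Symmetry of second derivatives\<close>

lemma second_difference_mvt:
  fixes u :: "'a::euclidean_space \<Rightarrow> real"
  assumes "C1 S u" "C1 S (pd v u)" "h > 0"
    and in_S: "\<And>s t. s \<in> {0..h} \<Longrightarrow> t \<in> {0..h} \<Longrightarrow> p + s *\<^sub>R v + t *\<^sub>R w \<in> S"
  obtains s t where "s \<in> {0..h}" "t \<in> {0..h}"
    "u (p + h *\<^sub>R v + h *\<^sub>R w) - u (p + h *\<^sub>R v) - u (p + h *\<^sub>R w) + u p
       = h * h * pd w (pd v u) (p + s *\<^sub>R v + t *\<^sub>R w)"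
proof -
  have D: "((\<lambda>s. u (p + s *\<^sub>R v + t *\<^sub>R w)) has_real_derivative pd v u (p + s *\<^sub>R v + t *\<^sub>R w)) (at s)"
    if "s \<in> {0..h}" "t \<in> {0..h}" for s t
    using pd_line[of u "p + t *\<^sub>R w" s v] C1_diff[OF assms(1) in_S[OF that]] by (simp add: algebra_simps)
  have "\<exists>s. 0 < s \<and> s < h \<and> 
    (\<lambda>s. u (p + s *\<^sub>R v + h *\<^sub>R w) - u (p + s *\<^sub>R v + 0 *\<^sub>R w)) h - (\<lambda>s. u (p + s *\<^sub>R v + h *\<^sub>R w) - u (p + s *\<^sub>R v + 0 *\<^sub>R w)) 0
     = (h - 0) * (pd v u (p + s *\<^sub>R v + h *\<^sub>R w) - pd v u (p + s *\<^sub>R v + 0 *\<^sub>R w))"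
    by (rule MVT2[OF \<open>h > 0\<close>]) (intro DERIV_diff D, use \<open>h > 0\<close> in auto)
  then obtain s where s: "0 < s" "s < h" and
    e1: "u (p + h *\<^sub>R v + h *\<^sub>R w) - u (p + h *\<^sub>R v) - u (p + h *\<^sub>R w) + u p
     = h * (pd v u (p + s *\<^sub>R v + h *\<^sub>R w) - pd v u (p + s *\<^sub>R v))" by (auto simp: algebra_simps)
  have "\<exists>t. 0 < t \<and> t < h \<and> pd v u (p + s *\<^sub>R v + h *\<^sub>R w) - pd v u (p + s *\<^sub>R v + 0 *\<^sub>R w)
      = (h - 0) * pd w (pd v u) (p + s *\<^sub>R v + t *\<^sub>R w)"
    by (rule MVT2[OF \<open>h > 0\<close>]) (intro pd_line C1_diff[OF assms(2)] in_S, use s in auto)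
  then obtain t where t: "0 < t" "t < h" and
    e2: "pd v u (p + s *\<^sub>R v + h *\<^sub>R w) - pd v u (p + s *\<^sub>R v)
      = h * pd w (pd v u) (p + s *\<^sub>R v + t *\<^sub>R w)" by auto
  show ?thesis using that[of s t] s t e1 e2 by (auto simp: mult.assoc)
qed

text \<open>The mean value theorem, applied in either order, evaluates the same second difference of
  u. So the two mixed derivatives coincide at two points of an arbitrarily small parallelogram, and
  continuity forces equality at p.\<close>

lemma pd_commute:
  fixes u :: "'a::euclidean_space \<Rightarrow> real"
  assumes "open S" "p \<in> S" "C1 S u" "C1 S (pd v u)" "C1 S (pd w u)"
  shows "pd v (pd w u) p = pd w (pd v u) p"
proof (rule ccontr)
  assume ne: "pd v (pd w u) p \<noteq> pd w (pd v u) p"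
  define e where "e = \<bar>pd v (pd w u) p - pd w (pd v u) p\<bar> / 2"
  have e: "e > 0" using ne by (simp add: e_def)
  have c: "continuous (at p) (pd v (pd w u))" "continuous (at p) (pd w (pd v u))"
    using assms C1_pd continuous_on_eq_continuous_at by blast+
  obtain d1 where d1: "d1 > 0" "\<And>q. dist q p < d1 \<Longrightarrow> \<bar>pd v (pd w u) q - pd v (pd w u) p\<bar> < e"
    using c(1) e unfolding continuous_at_eps_delta dist_real_def by blast
  obtain d2 where d2: "d2 > 0" "\<And>q. dist q p < d2 \<Longrightarrow> \<bar>pd w (pd v u) q - pd w (pd v u) p\<bar> < e"
    using c(2) e unfolding continuous_at_eps_delta dist_real_def by blast
  obtain d3 where d3: "d3 > 0" "ball p d3 \<subseteq> S" using assms(1,2) openE by blast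
  define d where "d = min d1 (min d2 d3)"
  have d: "d > 0" using d1 d2 d3 by (simp add: d_def)
  \<comment> \<open>All points p + s v + t w with s, t in [0, h] then lie within d of p; the summand
    1 keeps the denominator positive when v = w = 0.\<close>
  define h where "h = d / (norm v + norm w + 1)"
  have den: "norm v + norm w + 1 > 0" by (smt (verit) norm_ge_zero)
  have h: "h > 0" using d den by (simp add: h_def)
  have near: "dist (p + s *\<^sub>R v + t *\<^sub>R w) p < d" if "s \<in> {0..h}" "t \<in> {0..h}" for s t
  proof -
    have "dist (p + s *\<^sub>R v + t *\<^sub>R w) p \<le> norm (s *\<^sub>R v) + norm (t *\<^sub>R w)"
      using norm_triangle_ineq[of "s *\<^sub>R v" "t *\<^sub>R w"] by (simp add: dist_norm add.assoc)
    also have "\<dots> \<le> h * norm v + h * norm w"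
      using that by (intro add_mono) (auto intro: mult_right_mono)
    also have "\<dots> < h * (norm v + norm w + 1)" using h by (simp add: algebra_simps)
    also have "\<dots> = d" using den by (simp add: h_def)
    finally show ?thesis .
  qed
  have inS: "p + s *\<^sub>R v + t *\<^sub>R w \<in> S" if "s \<in> {0..h}" "t \<in> {0..h}" for s t
    using near[OF that] d3 unfolding d_def by (auto simp: dist_commute)
  have inS': "p + s *\<^sub>R w + t *\<^sub>R v \<in> S" if "s \<in> {0..h}" "t \<in> {0..h}" for s t
    using inS[OF that(2,1)] by (simp add: algebra_simps)
  obtain s t where st: "s \<in> {0..h}" "t \<in> {0..h}"
    "u (p + h *\<^sub>R v + h *\<^sub>R w) - u (p + h *\<^sub>R v) - u (p + h *\<^sub>R w) + u p
       = h * h * pd w (pd v u) (p + s *\<^sub>R v + t *\<^sub>R w)"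
    using second_difference_mvt[OF assms(3,4) h inS] by blast
  obtain s' t' where st': "s' \<in> {0..h}" "t' \<in> {0..h}"
    "u (p + h *\<^sub>R w + h *\<^sub>R v) - u (p + h *\<^sub>R w) - u (p + h *\<^sub>R v) + u p
       = h * h * pd v (pd w u) (p + s' *\<^sub>R w + t' *\<^sub>R v)"
    using second_difference_mvt[OF assms(3,5) h inS'] by blast
  have "h * h * pd w (pd v u) (p + s *\<^sub>R v + t *\<^sub>R w) = h * h * pd v (pd w u) (p + t' *\<^sub>R v + s' *\<^sub>R w)"
    using st(3) st'(3) by (simp add: algebra_simps)
  then have eq: "pd w (pd v u) (p + s *\<^sub>R v + t *\<^sub>R w) = pd v (pd w u) (p + t' *\<^sub>R v + s' *\<^sub>R w)"
    using h by simp
  have "\<bar>pd w (pd v u) (p + s *\<^sub>R v + t *\<^sub>R w) - pd w (pd v u) p\<bar> < e"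
    using near[OF st(1,2)] by (intro d2(2)) (simp add: d_def)
  moreover have "\<bar>pd v (pd w u) (p + t' *\<^sub>R v + s' *\<^sub>R w) - pd v (pd w u) p\<bar> < e"
    using near[OF st'(2,1)] by (intro d1(2)) (simp add: d_def)
  ultimately have "\<bar>pd v (pd w u) p - pd w (pd v u) p\<bar> < 2 * e" using eq by linarith
  then show False by (simp add: e_def)
qed

section \<open>The vector fields and their flows\<close>

abbreviation b1 :: hpt where "b1 \<equiv> (axis 1 1, 0)"
abbreviation b2 :: hpt where "b2 \<equiv> (axis 2 1, 0)"
abbreviation b3 :: hpt where "b3 \<equiv> (axis 3 1, 0)"

text \<open>k = 2 gives the left-invariant fields X = \<open>fld 2 1 0 0\<close> and Y =
  \<open>fld 2 0 1 0\<close>; k = -2 gives the right-invariant ones, whose flows are left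
  translations; \<alpha> = \<beta> = 0 with \<tau> = 1 gives d_3 for every k. One family lets flows,
  invariance of measure and integration by parts be treated once.\<close>

definition fld :: "real \<Rightarrow> real \<Rightarrow> real \<Rightarrow> real \<Rightarrow> hpt \<Rightarrow> hpt" where
  "fld k \<alpha> \<beta> \<tau> p = (vector [\<alpha>, \<beta>, k * (\<alpha> * fst p $ 2 - \<beta> * fst p $ 1) + \<tau>], 0)"

text \<open>The straight line is the exact flow of \<open>fld\<close>, because such a field is
  constant along its own lines (\<open>fld_flow\<close>).\<close>

definition flow :: "(hpt \<Rightarrow> hpt) \<Rightarrow> real \<Rightarrow> hpt \<Rightarrow> hpt" where
  "flow V t p = p + t *\<^sub>R V p"

definition energy :: "(hpt \<Rightarrow> real) \<Rightarrow> (hpt \<Rightarrow> real) \<Rightarrow> hpt \<Rightarrow> real" where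
  "energy w z p = hX w p * hX z p + hY w p * hY z p + dy w p * dy z p"

lemma open_half_space: "open half_space"
proof -
  have "half_space = snd -` {0<..}" by (auto simp: half_space_def)
  then show ?thesis using open_vimage_snd[OF open_greaterThan] by metis
qed

lemma axis_nth_3 [simp]:
  "(axis 1 1 :: real^3) $ 1 = 1" "(axis 1 1 :: real^3) $ 2 = 0" "(axis 1 1 :: real^3) $ 3 = 0"
  "(axis 2 1 :: real^3) $ 1 = 0" "(axis 2 1 :: real^3) $ 2 = 1" "(axis 2 1 :: real^3) $ 3 = 0"
  "(axis 3 1 :: real^3) $ 1 = 0" "(axis 3 1 :: real^3) $ 2 = 0" "(axis 3 1 :: real^3) $ 3 = 1"
  by (simp_all add: axis_def)

lemma fst_fld [simp]:
  "fst (fld k \<alpha> \<beta> \<tau> p) $ 1 = \<alpha>" "fst (fld k \<alpha> \<beta> \<tau> p) $ 2 = \<beta>"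
  "fst (fld k \<alpha> \<beta> \<tau> p) $ 3 = k * (\<alpha> * fst p $ 2 - \<beta> * fst p $ 1) + \<tau>"
  by (simp_all add: fld_def)

lemma fld_eq: "fld k \<alpha> \<beta> \<tau> p = \<alpha> *\<^sub>R b1 + \<beta> *\<^sub>R b2 + (k * (\<alpha> * fst p $ 2 - \<beta> * fst p $ 1) + \<tau>) *\<^sub>R b3"
  by (simp add: fld_def prod_eq_iff vec_eq_iff forall_3 axis_def)

lemma pd_fld:
  assumes "g differentiable (at p)"
  shows "pd (fld k \<alpha> \<beta> \<tau> q) g p = \<alpha> * pd b1 g p + \<beta> * pd b2 g p + (k * (\<alpha> * fst q $ 2 - \<beta> * fst q $ 1) + \<tau>) * pd b3 g p"
  unfolding fld_eq pd_add_dir[OF assms] pd_scale_dir[OF assms] by simp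

lemma hX_pd: "g differentiable (at p) \<Longrightarrow> hX g p = pd (fld 2 1 0 0 p) g p"
  by (simp add: pd_fld hX_def)

lemma hY_pd: "g differentiable (at p) \<Longrightarrow> hY g p = pd (fld 2 0 1 0 p) g p"
  by (simp add: pd_fld hY_def)

section \<open>Calculus of X, Y, d_y and of the energy form\<close>

lemmas diff_rules = differentiable_add differentiable_diff differentiable_mult differentiable_const

lemma h_const [simp]: "hX (\<lambda>q. c) p = 0" "hY (\<lambda>q. c) p = 0" "dy (\<lambda>q. c) p = 0"
  by (simp_all add: hX_def hY_def dy_def)

lemma h_mult:
  assumes "f differentiable (at p)" "g differentiable (at p)"
  shows "hX (\<lambda>q. f q * g q) p = f p * hX g p + g p * hX f p"
    "hY (\<lambda>q. f q * g q) p = f p * hY g p + g p * hY f p"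
    "dy (\<lambda>q. f q * g q) p = f p * dy g p + g p * dy f p"
  by (simp_all add: hX_def hY_def dy_def pd_mult[OF assms] algebra_simps)

lemma h_add:
  assumes "f differentiable (at p)" "g differentiable (at p)"
  shows "hX (\<lambda>q. f q + g q) p = hX f p + hX g p"
    "hY (\<lambda>q. f q + g q) p = hY f p + hY g p"
    "dy (\<lambda>q. f q + g q) p = dy f p + dy g p"
  by (simp_all add: hX_def hY_def dy_def pd_add[OF assms] algebra_simps)

lemma h_diff:
  assumes "f differentiable (at p)" "g differentiable (at p)"
  shows "hX (\<lambda>q. f q - g q) p = hX f p - hX g p"
    "hY (\<lambda>q. f q - g q) p = hY f p - hY g p"
    "dy (\<lambda>q. f q - g q) p = dy f p - dy g p"
  by (simp_all add: hX_def hY_def dy_def pd_diff[OF assms] algebra_simps)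

lemma h_cmult:
  assumes "f differentiable (at p)"
  shows "hX (\<lambda>q. c * f q) p = c * hX f p"
    "hY (\<lambda>q. c * f q) p = c * hY f p"
    "dy (\<lambda>q. c * f q) p = c * dy f p"
  by (simp_all add: h_mult assms)

lemma h_chain:
  assumes "g differentiable (at p)" "(h has_real_derivative h') (at (g p))"
  shows "hX (\<lambda>q. h (g q)) p = h' * hX g p" "hY (\<lambda>q. h (g q)) p = h' * hY g p"
    "dy (\<lambda>q. h (g q)) p = h' * dy g p"
  by (simp_all add: hX_def hY_def dy_def pd_chain[OF assms] algebra_simps)

lemma h_cong:
  assumes "open S" "p \<in> S" "\<And>q. q \<in> S \<Longrightarrow> f q = g q"
  shows "hX f p = hX g p" "hY f p = hY g p" "dy f p = dy g p"
  by (simp_all add: hX_def hY_def dy_def pd_cong[OF assms])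

lemma bounded_linear_coord: "bounded_linear (\<lambda>q::hpt. fst q $ i)"
  by (rule bounded_linear_compose[OF bounded_linear_vec_nth bounded_linear_fst])

lemma pd_coord [simp]: "pd v (\<lambda>q::hpt. fst q $ i) p = fst v $ i"
  by (rule pd_bounded_linear[OF bounded_linear_coord])

lemma differentiable_coord [simp]: "(\<lambda>q::hpt. fst q $ i) differentiable (at p)"
  using bounded_linear_imp_differentiable[OF bounded_linear_coord] .

lemma C1_coord [intro, simp]: "C1 S (\<lambda>q::hpt. fst q $ i)"
  by (rule C1_bounded_linear[OF bounded_linear_coord])

lemma h_coord [simp]:
  "hX (\<lambda>q. fst q $ 1) p = 1" "hY (\<lambda>q. fst q $ 1) p = 0" "dy (\<lambda>q. fst q $ i) p = 0"
  "hX (\<lambda>q. fst q $ 2) p = 0" "hY (\<lambda>q. fst q $ 2) p = 1"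
  by (simp_all add: hX_def hY_def dy_def)

lemma energy_sym: "energy w z p = energy z w p"
  by (simp add: energy_def mult.commute)

lemma energy_nonneg [simp]: "0 \<le> energy w w p"
  by (simp add: energy_def)

lemma energy_components:
  "(hX w p)\<^sup>2 \<le> energy w w p" "(hY w p)\<^sup>2 \<le> energy w w p" "(dy w p)\<^sup>2 \<le> energy w w p"
  by (simp_all add: energy_def power2_eq_square)

lemma energy_mult:
  assumes "f differentiable (at p)" "g differentiable (at p)"
  shows "energy (\<lambda>q. f q * g q) z p = f p * energy g z p + g p * energy f z p"
    "energy z (\<lambda>q. f q * g q) p = f p * energy z g p + g p * energy z f p"
  by (simp_all add: energy_def h_mult[OF assms] algebra_simps)

lemma energy_add:
  assumes "f differentiable (at p)" "g differentiable (at p)"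
  shows "energy (\<lambda>q. f q + g q) z p = energy f z p + energy g z p"
    "energy z (\<lambda>q. f q + g q) p = energy z f p + energy z g p"
  by (simp_all add: energy_def h_add[OF assms] algebra_simps)

lemma energy_diff:
  assumes "f differentiable (at p)" "g differentiable (at p)"
  shows "energy (\<lambda>q. f q - g q) z p = energy f z p - energy g z p"
    "energy z (\<lambda>q. f q - g q) p = energy z f p - energy z g p"
  by (simp_all add: energy_def h_diff[OF assms] algebra_simps)

lemma energy_cmult:
  assumes "f differentiable (at p)"
  shows "energy (\<lambda>q. c * f q) z p = c * energy f z p" "energy z (\<lambda>q. c * f q) p = c * energy z f p"
  by (simp_all add: energy_def h_cmult[OF assms] algebra_simps)

lemma energy_young:
  "2 * \<bar>s * t * energy w z p\<bar> \<le> s\<^sup>2 * energy w w p + t\<^sup>2 * energy z z p"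
proof -
  have "s\<^sup>2 * energy w w p + t\<^sup>2 * energy z z p - 2 * (s * t * energy w z p) 
     = (s * hX w p - t * hX z p)\<^sup>2 + (s * hY w p - t * hY z p)\<^sup>2 + (s * dy w p - t * dy z p)\<^sup>2"
   "s\<^sup>2 * energy w w p + t\<^sup>2 * energy z z p + 2 * (s * t * energy w z p) 
     = (s * hX w p + t * hX z p)\<^sup>2 + (s * hY w p + t * hY z p)\<^sup>2 + (s * dy w p + t * dy z p)\<^sup>2"
    by (simp_all add: energy_def power2_eq_square algebra_simps)
  moreover have "0 \<le> (s * hX w p - t * hX z p)\<^sup>2 + (s * hY w p - t * hY z p)\<^sup>2 + (s * dy w p - t * dy z p)\<^sup>2"
    "0 \<le> (s * hX w p + t * hX z p)\<^sup>2 + (s * hY w p + t * hY z p)\<^sup>2 + (s * dy w p + t * dy z p)\<^sup>2"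
    by simp_all
  ultimately show ?thesis by linarith
qed

lemma energy_mult_le:
  assumes "f differentiable (at p)" "g differentiable (at p)"
  shows "energy (\<lambda>q. f q * g q) (\<lambda>q. f q * g q) p \<le> 2 * (f p)\<^sup>2 * energy g g p + 2 * (g p)\<^sup>2 * energy f f p"
proof -
  have "energy (\<lambda>q. f q * g q) (\<lambda>q. f q * g q) p = (f p)\<^sup>2 * energy g g p + (g p)\<^sup>2 * energy f f p + 2 * (f p * g p * energy g f p)"
    by (simp add: energy_mult[OF assms] energy_sym[of f g] power2_eq_square algebra_simps)
  then show ?thesis using energy_young[of "f p" "g p" g f p] by linarith
qed

lemma energy_diff_le:
  assumes "f differentiable (at p)" "g differentiable (at p)"
  shows "energy (\<lambda>q. f q - g q) (\<lambda>q. f q - g q) p \<le> 2 * energy f f p + 2 * energy g g p"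
proof -
  have "energy (\<lambda>q. f q - g q) (\<lambda>q. f q - g q) p = energy f f p + energy g g p - 2 * (1 * 1 * energy f g p)"
    by (simp add: energy_diff[OF assms] energy_sym[of g f])
  then show ?thesis using energy_young[of 1 1 f g p] by (simp add: abs_if split: if_splits)
qed

lemma gradHh_inner: "gradHh u p \<bullet> gradHh z p = energy u z p"
  by (simp add: gradHh_def energy_def inner_vec_def sum_3)

lemma norm_gradHh_sq: "(norm (gradHh z p))\<^sup>2 = energy z z p"
  by (simp add: power2_norm_eq_inner gradHh_inner)

lemma norm_gradH_sq: "(norm (gradH u p))\<^sup>2 = (hX u p)\<^sup>2 + (hY u p)\<^sup>2"
  unfolding power2_norm_eq_inner by (simp add: gradH_def inner_vec_def sum_2 power2_eq_square)

lemma h_cont: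
  assumes "C1 S g"
  shows "continuous_on S (hX g)" "continuous_on S (hY g)" "continuous_on S (dy g)"
  unfolding hX_def hY_def dy_def by (intro continuous_intros C1_pd assms)+

lemma energy_cont:
  assumes "C1 S w" "C1 S z"
  shows "continuous_on S (energy w z)"
  unfolding energy_def by (intro continuous_intros h_cont assms)

section \<open>Second derivatives and commutators\<close>

definition C2 :: "(hpt \<Rightarrow> real) \<Rightarrow> bool" where
  "C2 u \<longleftrightarrow> C1 half_space u \<and> (\<forall>v. C1 half_space (pd v u))"

lemma C1_sum: "finite I \<Longrightarrow> (\<And>i. i \<in> I \<Longrightarrow> C1 S (g i)) \<Longrightarrow> C1 S (\<lambda>q. \<Sum>i\<in>I. g i q)"
  by (induction I rule: finite_induct) auto

lemma Ck_on_2_imp_C2: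
  assumes "Ck_on 2 half_space u"
  shows "C2 u"
proof -
  have A: "(\<forall>p\<in>half_space. u differentiable (at p)) \<and> (\<forall>b\<in>Basis. Ck_on (Suc 0) half_space (pd b u))"
    using assms unfolding numeral_2_eq_2 by (rule iffD1[OF Ck_on.simps(2)])
  note d = A[THEN conjunct1]
  have b: "C1 half_space (pd b u)" if "b \<in> Basis" for b
    by (rule Ck_on_1_imp_C1[OF bspec[OF A[THEN conjunct2] that]])
  have c: "C1 half_space (pd v u)" for v
  proof (rule C1_cong[OF open_half_space])
    show "C1 half_space (\<lambda>q. \<Sum>b\<in>Basis. (v \<bullet> b) * pd b u q)"
      by (intro C1_sum C1_cmult b finite_Basis)
      show "(\<Sum>b\<in>Basis. (v \<bullet> b) * pd b u q) = pd v u q" if "q \<in> half_space" for q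
      by (rule pd_basis_sum[OF bspec[OF d that], symmetric])
  qed
  then show ?thesis unfolding C2_def C1_def[of _ u] using d C1_cont by blast
qed

lemma C2_C1:
  assumes "C2 u"
  shows "C1 half_space u" "C1 half_space (pd v u)" "C1 half_space (hX u)" "C1 half_space (hY u)" "C1 half_space (dy u)"
proof -
  show "C1 half_space u" and p: "C1 half_space (pd v u)" for v using assms unfolding C2_def by blast+
  show "C1 half_space (hX u)" "C1 half_space (hY u)" "C1 half_space (dy u)"
    unfolding hX_def[abs_def] hY_def[abs_def] dy_def[abs_def]
    by (intro C1_add C1_minus C1_mult C1_const C1_coord p)+
qed

lemma C2_fld:
  assumes "C2 u"
  shows "C1 half_space (\<lambda>q. pd (fld k \<alpha> \<beta> \<tau> q) u q)"
proof (rule C1_cong[OF open_half_space])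
  show "C1 half_space (\<lambda>q. \<alpha> * pd b1 u q + \<beta> * pd b2 u q + (k * (\<alpha> * fst q $ 2 - \<beta> * fst q $ 1) + \<tau>) * pd b3 u q)"
    by (intro C1_add C1_minus C1_mult C1_const C1_coord C2_C1(2)[OF assms])
qed (simp only: pd_fld[OF C1_diff[OF C2_C1(1)[OF assms]]])

lemma C2_commute:
  "C2 u \<Longrightarrow> p \<in> half_space \<Longrightarrow> pd v (pd w u) p = pd w (pd v u) p"
  using pd_commute[OF open_half_space] C2_C1 by blast

text \<open>The coefficients of \<open>fld\<close> are affine, so differentiating them contributes
  only a constant multiple of d_3 u; symmetry of second derivatives then moves the field to the
  outside.\<close>

lemma pd_pd_fld:
  assumes u: "C2 u" and p: "p \<in> half_space"
  shows "pd v (\<lambda>q. pd (fld k \<alpha> \<beta> \<tau> q) u q) p =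
     pd (fld k \<alpha> \<beta> \<tau> p) (pd v u) p + k * (\<alpha> * fst v $ 2 - \<beta> * fst v $ 1) * pd b3 u p"
proof -
  have d: "pd w u differentiable (at p)" for w using C1_diff[OF C2_C1(2)[OF u] p] .
  have "pd v (\<lambda>q. pd (fld k \<alpha> \<beta> \<tau> q) u q) p = pd v (\<lambda>q. \<alpha> * pd b1 u q + \<beta> * pd b2 u q + (k * (\<alpha> * fst q $ 2 - \<beta> * fst q $ 1) + \<tau>) * pd b3 u q) p"
    by (rule pd_cong[OF open_half_space p]) (simp add: pd_fld C1_diff[OF C2_C1(1)[OF u]])
  also have "\<dots> = pd (fld k \<alpha> \<beta> \<tau> p) (pd v u) p + k * (\<alpha> * fst v $ 2 - \<beta> * fst v $ 1) * pd b3 u p"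
    by (simp add: pd_add pd_mult pd_diff d pd_fld diff_rules C2_commute[OF u p, of v b1] C2_commute[OF u p, of v b2] C2_commute[OF u p, of v b3] algebra_simps)
  finally show ?thesis .
qed

text \<open>The fields with \<open>k = - 2\<close> generate left translations and hence commute with \<open>X\<close>, \<open>Y\<close>.\<close>

lemma fld_commute:
  fixes \<alpha> \<beta> \<tau> :: real
  assumes u: "C2 u" and p: "p \<in> half_space"
  defines "V \<equiv> fld (- 2) \<alpha> \<beta> \<tau>"
  shows "hX (\<lambda>q. pd (V q) u q) p = pd (V p) (hX u) p"
    "hY (\<lambda>q. pd (V q) u q) p = pd (V p) (hY u) p"
    "dy (\<lambda>q. pd (V q) u q) p = pd (V p) (dy u) p"
proof -
  have d: "pd w u differentiable (at p)" for w using C1_diff[OF C2_C1(2)[OF u] p] .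
  have d': "hX u differentiable (at p)" "hY u differentiable (at p)" using C1_diff[OF _ p] C2_C1[OF u] by blast+
  have s: "pd v (hX u) p = pd v (pd b1 u) p + 2 * fst p $ 2 * pd v (pd b3 u) p + 2 * fst v $ 2 * pd b3 u p"
    "pd v (hY u) p = pd v (pd b2 u) p - 2 * fst p $ 1 * pd v (pd b3 u) p - 2 * fst v $ 1 * pd b3 u p" for v
    unfolding hX_def[abs_def] hY_def[abs_def]
    by (simp_all add: pd_add pd_diff pd_mult d diff_rules algebra_simps)
  show "hX (\<lambda>q. pd (V q) u q) p = pd (V p) (hX u) p" "hY (\<lambda>q. pd (V q) u q) p = pd (V p) (hY u) p"
    unfolding V_def s hX_def[of "\<lambda>q. pd (fld (- 2) \<alpha> \<beta> \<tau> q) u q"] hY_def[of "\<lambda>q. pd (fld (- 2) \<alpha> \<beta> \<tau> q) u q"] pd_pd_fld[OF u p]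
    by (simp_all add: algebra_simps)
  show "dy (\<lambda>q. pd (V q) u q) p = pd (V p) (dy u) p"
    unfolding V_def dy_def[abs_def] pd_pd_fld[OF u p] by simp
qed

text \<open>By symmetry of second derivatives only the derivatives of the coefficients 2 x_2 and -2
  x_1 survive; each contributes -2 d_3 u.\<close>

lemma hX_hY_commutator:
  assumes u: "C2 u" and p: "p \<in> half_space"
  shows "hX (hY u) p - hY (hX u) p = - 4 * pd b3 u p"
proof -
  have d: "pd w u differentiable (at p)" for w using C1_diff[OF C2_C1(2)[OF u] p] .
  have s: "pd v (hX u) p = pd v (pd b1 u) p + 2 * fst p $ 2 * pd v (pd b3 u) p + 2 * fst v $ 2 * pd b3 u p"
    "pd v (hY u) p = pd v (pd b2 u) p - 2 * fst p $ 1 * pd v (pd b3 u) p - 2 * fst v $ 1 * pd b3 u p" for v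
    unfolding hX_def[abs_def] hY_def[abs_def]
    by (simp_all add: pd_add pd_diff pd_mult d diff_rules algebra_simps)
  show ?thesis 
    unfolding hX_def[of "hY u"] hY_def[of "hX u"] s
    using C2_commute[OF u p, of b1 b2] C2_commute[OF u p, of b1 b3] C2_commute[OF u p, of b2 b3] by (simp add: algebra_simps)
qed

lemma b3_commute:
  assumes u: "C2 u" and p: "p \<in> half_space"
  shows "hX (pd b3 u) p = pd b3 (hX u) p" "hY (pd b3 u) p = pd b3 (hY u) p" "dy (pd b3 u) p = pd b3 (dy u) p"
proof -
  have "fld (-2) 0 0 1 q = b3" for q by (simp add: fld_eq)
  then show "hX (pd b3 u) p = pd b3 (hX u) p" "hY (pd b3 u) p = pd b3 (hY u) p" "dy (pd b3 u) p = pd b3 (dy u) p"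
    using fld_commute[OF u p, of 0 0 1] by simp_all
qed

section \<open>Flows of the fields\<close>

lemma snd_fld [simp]: "snd (fld k \<alpha> \<beta> \<tau> p) = 0"
  by (simp add: fld_def)

lemma snd_flow [simp]: "snd (flow (fld k \<alpha> \<beta> \<tau>) t p) = snd p"
  by (simp add: flow_def)

lemma flow_half_space [simp]: "flow (fld k \<alpha> \<beta> \<tau>) t p \<in> half_space \<longleftrightarrow> p \<in> half_space"
  by (simp add: half_space_def)

lemma fld_flow [simp]: "fld k \<alpha> \<beta> \<tau> (flow (fld k \<alpha> \<beta> \<tau>) t p) = fld k \<alpha> \<beta> \<tau> p"
  by (simp add: flow_def fld_def algebra_simps)

lemma flow_0 [simp]: "flow V 0 p = p"
  by (simp add: flow_def)

lemma flow_flow: "flow (fld k \<alpha> \<beta> \<tau>) s (flow (fld k \<alpha> \<beta> \<tau>) t p) = flow (fld k \<alpha> \<beta> \<tau>) (s + t) p"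
proof -
  have "flow (fld k \<alpha> \<beta> \<tau>) s (flow (fld k \<alpha> \<beta> \<tau>) t p) = flow (fld k \<alpha> \<beta> \<tau>) t p + s *\<^sub>R fld k \<alpha> \<beta> \<tau> p"
    by (subst flow_def) (simp only: fld_flow)
  then show ?thesis by (simp only: flow_def scaleR_left_distrib ac_simps)
qed

lemma flow_inverse [simp]: "flow (fld k \<alpha> \<beta> \<tau>) (- t) (flow (fld k \<alpha> \<beta> \<tau>) t p) = p"
  "flow (fld k \<alpha> \<beta> \<tau>) t (flow (fld k \<alpha> \<beta> \<tau>) (- t) p) = p"
  by (simp_all only: flow_flow left_minus right_minus flow_0)

lemma continuous_on_fld [continuous_intros]:
  "continuous_on S g \<Longrightarrow> continuous_on S (\<lambda>x. fld k \<alpha> \<beta> \<tau> (g x))"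
  unfolding fld_eq by (intro continuous_intros)

lemma continuous_on_flow [continuous_intros]:
  "continuous_on S g \<Longrightarrow> continuous_on S t \<Longrightarrow> continuous_on S (\<lambda>x. flow (fld k \<alpha> \<beta> \<tau>) (t x) (g x))"
  unfolding flow_def by (intro continuous_intros)

lemma flow_has_derivative:
  "(flow (fld k \<alpha> \<beta> \<tau>) t has_derivative (\<lambda>v. v + (t * (k * (\<alpha> * fst v $ 2 - \<beta> * fst v $ 1))) *\<^sub>R b3)) (at p)"
proof -
  let ?L = "\<lambda>p::hpt. p + (t * (k * (\<alpha> * fst p $ 2 - \<beta> * fst p $ 1))) *\<^sub>R b3"
  let ?c = "t *\<^sub>R (\<alpha> *\<^sub>R b1 + \<beta> *\<^sub>R b2 + \<tau> *\<^sub>R b3)"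
  have eq: "flow (fld k \<alpha> \<beta> \<tau>) t = (\<lambda>p. ?L p + ?c)"
    by (rule ext) (simp only: flow_def fld_eq scaleR_right_distrib scaleR_left_distrib scaleR_scaleR distrib_left ac_simps)
  have bl: "bounded_linear ?L"
    by (intro bounded_linear_add bounded_linear_ident bounded_linear_scaleR_const
      bounded_linear_const_mult bounded_linear_sub bounded_linear_coord)
  show ?thesis
    unfolding eq by (rule has_derivative_add_const[OF bounded_linear_imp_has_derivative[OF bl]])
qed

lemma pd_flow:
  assumes "g differentiable (at (flow (fld k \<alpha> \<beta> \<tau>) t p))"
  shows "((\<lambda>q. g (flow (fld k \<alpha> \<beta> \<tau>) t q)) has_derivative
    (\<lambda>v. pd (v + (t * (k * (\<alpha> * fst v $ 2 - \<beta> * fst v $ 1))) *\<^sub>R b3) g (flow (fld k \<alpha> \<beta> \<tau>) t p))) (at p)"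
  using has_derivative_compose[OF flow_has_derivative has_derivative_pd[OF assms]] by simp

lemma C1_flow:
  assumes "C1 half_space g"
  shows "C1 half_space (\<lambda>q. g (flow (fld k \<alpha> \<beta> \<tau>) t q))"
proof (rule C1I)
  fix v
  show "continuous_on half_space (\<lambda>p. pd (v + (t * (k * (\<alpha> * fst v $ 2 - \<beta> * fst v $ 1))) *\<^sub>R b3) g (flow (fld k \<alpha> \<beta> \<tau>) t p))"
    by (rule continuous_on_compose2[OF C1_pd[OF assms]]) (auto intro!: continuous_intros)
qed (rule pd_flow, use C1_diff[OF assms] in simp)

text \<open>The flow with k = -2 is a left translation. Shifting x_2 by t \<beta> changes the
  coefficient 2 x_2 of X by 2 t \<beta>, which is exactly the shear that the derivative of the flow
  adds in direction d_3; for Y the same happens with x_1 and \<alpha>.\<close>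

lemma h_flow:
  fixes \<alpha> \<beta> \<tau> k t :: real
  assumes "C1 half_space g" "p \<in> half_space"
  defines "\<theta> \<equiv> flow (fld (- 2) \<alpha> \<beta> \<tau>) t"
  shows "hX (\<lambda>q. g (\<theta> q)) p = hX g (\<theta> p)" "hY (\<lambda>q. g (\<theta> q)) p = hY g (\<theta> p)" "dy (\<lambda>q. g (\<theta> q)) p = dy g (\<theta> p)"
proof -
  have d: "g differentiable (at (\<theta> p))" using C1_diff[OF assms(1)] assms(2) by (simp add: \<theta>_def)
  have e: "pd v (\<lambda>q. g (\<theta> q)) p = pd (v + (t * (- 2 * (\<alpha> * fst v $ 2 - \<beta> * fst v $ 1))) *\<^sub>R b3) g (\<theta> p)" for v
    unfolding \<theta>_def by (rule pd_eqI[OF pd_flow]) (use d in \<open>simp add: \<theta>_def\<close>)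
  show "hX (\<lambda>q. g (\<theta> q)) p = hX g (\<theta> p)" "hY (\<lambda>q. g (\<theta> q)) p = hY g (\<theta> p)" "dy (\<lambda>q. g (\<theta> q)) p = dy g (\<theta> p)"
    unfolding hX_def hY_def dy_def e pd_add_dir[OF d] pd_scale_dir[OF d]
    by (simp_all add: \<theta>_def flow_def algebra_simps)
qed

lemma energy_flow:
  fixes \<alpha> \<beta> \<tau> k t :: real
  assumes "C1 half_space g" "C1 half_space z" "p \<in> half_space"
  defines "\<theta> \<equiv> flow (fld (- 2) \<alpha> \<beta> \<tau>) t"
  shows "energy (\<lambda>q. g (\<theta> q)) (\<lambda>q. z (\<theta> q)) p = energy g z (\<theta> p)"
  by (simp add: energy_def \<theta>_def h_flow assms)

lemma flow_line_deriv:
  fixes \<alpha> \<beta> \<tau> k t :: real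
  assumes "C1 half_space g" "p \<in> half_space"
  defines "V \<equiv> fld k \<alpha> \<beta> \<tau>"
  shows "((\<lambda>t. g (flow V t p)) has_real_derivative pd (V (flow V t p)) g (flow V t p)) (at t)"
  unfolding V_def fld_flow unfolding flow_def
  by (rule pd_line[OF C1_diff[OF assms(1)]]) (use assms in \<open>simp add: half_space_def\<close>)

section \<open>The weighted measure\<close>

text \<open>The Borel measure y^a dx dy on the half-space. Working below the completion keeps the
  product structure for Tonelli and Fubini; \<open>wmeas_set_integral\<close> returns to the
  Lebesgue integrals of the statement.\<close>

definition wmeas :: "real \<Rightarrow> hpt measure" where
  "wmeas a = density (restrict_space lborel half_space) (\<lambda>p. ennreal (snd p powr a))"

lemma half_space_borel [measurable, simp]: "half_space \<in> sets borel"
  using open_half_space by simp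

lemma space_wmeas [simp]: "space (wmeas a) = half_space"
  by (simp add: wmeas_def space_restrict_space)

lemma sets_wmeas: "sets (wmeas a) = sets (restrict_space borel half_space)"
  by (simp add: wmeas_def sets_restrict_space)

lemma measurable_wmeas_eq: "measurable (wmeas a) N = measurable (restrict_space borel half_space) N"
  by (rule measurable_cong_sets[OF sets_wmeas refl])

lemma continuous_wmeas_measurable:
  fixes g :: "hpt \<Rightarrow> 'b::topological_space"
  shows "continuous_on half_space g \<Longrightarrow> g \<in> borel_measurable (wmeas a)"
  unfolding measurable_wmeas_eq by (rule borel_measurable_continuous_on_restrict)

lemma borel_wmeas_measurable: "g \<in> borel_measurable borel \<Longrightarrow> g \<in> borel_measurable (wmeas a)"
  unfolding measurable_wmeas_eq by (rule measurable_restrict_space1)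

lemma borel_set_wmeas: "A \<in> sets borel \<Longrightarrow> A \<subseteq> half_space \<Longrightarrow> A \<in> sets (wmeas a)"
  unfolding sets_wmeas sets_restrict_space by (auto simp: image_iff intro!: bexI[of _ A])

lemma snd_powr_measurable [measurable]: "(\<lambda>p::hpt. snd p powr a) \<in> borel_measurable borel"
proof -
  have "(snd :: hpt \<Rightarrow> real) \<in> borel_measurable borel"
    by (intro borel_measurable_continuous_onI continuous_intros)
  moreover have "(\<lambda>y::real. y powr a) \<in> borel_measurable borel" by measurable
  ultimately show ?thesis by (rule measurable_compose)
qed

lemma wmeas_measurable_iff:
  "F \<in> borel_measurable (wmeas a) \<longleftrightarrow> (\<lambda>p. (F p :: ennreal) * indicator half_space p) \<in> borel_measurable borel"
  unfolding measurable_wmeas_eq by (rule borel_measurable_restrict_space_iff_ennreal) simp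

lemma wmeas_measurable_iff_real:
  "g \<in> borel_measurable (wmeas a) \<longleftrightarrow> (\<lambda>p. indicator half_space p *\<^sub>R (g p :: real)) \<in> borel_measurable borel"
  unfolding measurable_wmeas_eq by (rule borel_measurable_restrict_space_iff) simp

lemma restrict_lborel_measurable: "g \<in> measurable (restrict_space lborel half_space) N \<longleftrightarrow> g \<in> measurable (wmeas a) N"
  unfolding measurable_wmeas_eq by (simp add: measurable_cong_sets[of "restrict_space lborel half_space" "restrict_space borel half_space" N N] sets_restrict_space)

lemma weight_restrict_measurable: "(\<lambda>p. snd p powr a) \<in> borel_measurable (restrict_space lborel half_space)"
  by (rule measurable_restrict_space1) simp

lemma weighted_measurable:
  assumes "F \<in> borel_measurable (wmeas a)"
  shows "(\<lambda>p. ennreal (snd p powr b) * F p * indicator half_space p) \<in> borel_measurable borel"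
proof -
  have "(\<lambda>p::hpt. ennreal (snd p powr b)) \<in> borel_measurable borel" by simp
  from borel_measurable_times_ennreal[OF this assms[unfolded wmeas_measurable_iff]]
  show ?thesis by (simp only: mult.assoc)
qed

lemma nn_integral_wmeas:
  assumes "F \<in> borel_measurable (wmeas a)"
  shows "(\<integral>\<^sup>+p. F p \<partial>wmeas a) = (\<integral>\<^sup>+p. ennreal (snd p powr a) * F p * indicator half_space p \<partial>lborel)"
proof -
  have "F \<in> borel_measurable (restrict_space lborel half_space)" using assms restrict_lborel_measurable by blast
  moreover have "(\<lambda>p. ennreal (snd p powr a)) \<in> borel_measurable (restrict_space lborel half_space)"
    using weight_restrict_measurable by simp
  ultimately show ?thesis
    unfolding wmeas_def by (simp add: nn_integral_density nn_integral_restrict_space)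
qed

lemma nn_integral_wmeas_slices:
  assumes "F \<in> borel_measurable (wmeas a)"
  shows "(\<lambda>x. \<integral>\<^sup>+y. ennreal (y powr a) * F (x, y) * indicator {0<..} y \<partial>lborel) \<in> borel_measurable lborel"
    "(\<integral>\<^sup>+p. F p \<partial>wmeas a) = (\<integral>\<^sup>+x. \<integral>\<^sup>+y. ennreal (y powr a) * F (x, y) * indicator {0<..} y \<partial>lborel \<partial>lborel)"
proof -
  let ?G = "\<lambda>p::hpt. ennreal (snd p powr a) * F p * indicator half_space p"
  have m: "?G \<in> borel_measurable (lborel \<Otimes>\<^sub>M lborel)" unfolding lborel_prod using weighted_measurable[OF assms] by simp
  have e: "?G (x, y) = ennreal (y powr a) * F (x, y) * indicator {0<..} y" for x y
    by (simp add: half_space_def indicator_def)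
  show "(\<integral>\<^sup>+p. F p \<partial>wmeas a) = (\<integral>\<^sup>+x. \<integral>\<^sup>+y. ennreal (y powr a) * F (x, y) * indicator {0<..} y \<partial>lborel \<partial>lborel)"
    unfolding nn_integral_wmeas[OF assms] e[symmetric] lborel.nn_integral_fst[OF m] lborel_prod ..
  show "(\<lambda>x. \<integral>\<^sup>+y. ennreal (y powr a) * F (x, y) * indicator {0<..} y \<partial>lborel) \<in> borel_measurable lborel"
    unfolding e[symmetric] by (rule lborel.borel_measurable_nn_integral_fst[OF m])
qed

text \<open>For a Borel integrand, completing the measure changes neither integrability nor the
  integral, so the density and restriction rules over \<open>lborel\<close> apply.\<close>

lemma wmeas_set_integral:
  assumes g: "g \<in> borel_measurable (wmeas a)"
  shows "set_integrable lebesgue half_space (\<lambda>p. snd p powr a * g p) \<longleftrightarrow> integrable (wmeas a) g"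
    "(LINT p:half_space|lebesgue. snd p powr a * g p) = (\<integral>p. g p \<partial>wmeas a)"
proof -
  let ?h = "\<lambda>p. indicator half_space p *\<^sub>R (snd p powr a * g p)"
  have g': "g \<in> borel_measurable (restrict_space lborel half_space)" using g restrict_lborel_measurable by blast
  have "(\<lambda>p. snd p powr a * (indicator half_space p *\<^sub>R g p)) \<in> borel_measurable borel"
    using g unfolding wmeas_measurable_iff_real by (intro borel_measurable_times) auto
  moreover have "(\<lambda>p. snd p powr a * (indicator half_space p *\<^sub>R g p)) = ?h" by auto
  ultimately have m: "?h \<in> borel_measurable lborel" by simp
  show "set_integrable lebesgue half_space (\<lambda>p. snd p powr a * g p) \<longleftrightarrow> integrable (wmeas a) g"
    unfolding set_integrable_def wmeas_def
    by (subst integrable_density[OF g' weight_restrict_measurable])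
       (use integrable_completion[OF m] in \<open>simp_all add: integrable_restrict_space\<close>)
  show "(LINT p:half_space|lebesgue. snd p powr a * g p) = (\<integral>p. g p \<partial>wmeas a)"
    unfolding set_lebesgue_integral_def wmeas_def
    by (subst integral_density[OF g' weight_restrict_measurable])
       (use integral_completion[OF m] in \<open>simp_all add: integral_restrict_space\<close>)
qed

lemma wmeas_set_integral_subset:
  assumes g: "(\<lambda>p. indicator S p * g p) \<in> borel_measurable (wmeas a)" and S: "S \<subseteq> half_space"
  shows "set_integrable lebesgue S (\<lambda>p. snd p powr a * g p) \<longleftrightarrow> integrable (wmeas a) (\<lambda>p. indicator S p * g p)"
    "(LINT p:S|lebesgue. snd p powr a * g p) = (\<integral>p. indicator S p * g p \<partial>wmeas a)"
proof -
  have e: "indicator half_space p *\<^sub>R (snd p powr a * (indicator S p * g p)) = indicator S p *\<^sub>R (snd p powr a * g p)" for p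
    using S by (auto simp: indicator_def)
  show "set_integrable lebesgue S (\<lambda>p. snd p powr a * g p) \<longleftrightarrow> integrable (wmeas a) (\<lambda>p. indicator S p * g p)"
    using wmeas_set_integral(1)[OF g] unfolding set_integrable_def e .
  show "(LINT p:S|lebesgue. snd p powr a * g p) = (\<integral>p. indicator S p * g p \<partial>wmeas a)"
    using wmeas_set_integral(2)[OF g] unfolding set_lebesgue_integral_def e .
qed

lemma nn_integral_powr:
  fixes a c :: real
  assumes "a > -1" "c \<ge> 0"
  shows "(\<integral>\<^sup>+y. ennreal (y powr a) * indicator {0..c} y \<partial>lborel) = ennreal (c powr (a + 1) / (a + 1))"
  using nn_integral_has_integral_lebesgue'[OF _ has_integral_powr_from_0[OF assms]] by simp

text \<open>The half-ball lies in a cylinder of height |R| over the base ball, and y^a is integrable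
  at 0 because a > -1. The absolute value covers negative R.\<close>

lemma emeasure_half_ball:
  assumes "a > -1"
  shows "emeasure (wmeas a) (half_ball R) < \<infinity>"
proof -
  have hb: "half_ball R \<in> sets (wmeas a)" by (rule borel_set_wmeas) (auto simp: half_ball_def)
  have "emeasure (wmeas a) (half_ball R) = (\<integral>\<^sup>+p. indicator (half_ball R) p \<partial>wmeas a)" by (simp add: hb)
  also have "\<dots> = (\<integral>\<^sup>+x. \<integral>\<^sup>+y. ennreal (y powr a) * indicator (half_ball R) (x, y) * indicator {0<..} y \<partial>lborel \<partial>lborel)"
    using hb by (intro nn_integral_wmeas_slices(2)) simp
  also have "\<dots> \<le> (\<integral>\<^sup>+(x::heis). indicator (ball 0 R) x * (\<integral>\<^sup>+y. ennreal (y powr a) * indicator {0..\<bar>R\<bar>} y \<partial>lborel) \<partial>lborel)"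
  proof (rule nn_integral_mono)
    fix x :: heis
    show "(\<integral>\<^sup>+y. ennreal (y powr a) * indicator (half_ball R) (x, y) * indicator {0<..} y \<partial>lborel)
      \<le> indicator (ball 0 R) x * (\<integral>\<^sup>+y. ennreal (y powr a) * indicator {0..\<bar>R\<bar>} y \<partial>lborel)"
    proof (subst nn_integral_cmult[symmetric])
      have n: "norm x < R \<and> y \<le> \<bar>R\<bar>" if "(x, y) \<in> half_ball R" for y
      proof -
        have "norm (x, y) < R" using that by (simp add: half_ball_def)
        moreover have "norm x \<le> norm (x, y)" "norm y \<le> norm (x, y)" by (metis norm_fst_le, metis norm_snd_le)
        ultimately show ?thesis by auto
      qed
      show "(\<integral>\<^sup>+y. ennreal (y powr a) * indicator (half_ball R) (x, y) * indicator {0<..} y \<partial>lborel)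
        \<le> (\<integral>\<^sup>+y. indicator (ball 0 R) x * (ennreal (y powr a) * indicator {0..\<bar>R\<bar>} y) \<partial>lborel)"
        by (intro nn_integral_mono) (use n in \<open>auto simp: indicator_def\<close>)
    qed simp
  qed
  also have "\<dots> = emeasure lborel (ball (0::heis) R) * ennreal (\<bar>R\<bar> powr (a + 1) / (a + 1))"
    unfolding nn_integral_powr[OF assms abs_ge_zero] by (subst nn_integral_multc) (auto intro!: borel_measurable_indicator)
  also have "\<dots> < \<infinity>"
    using emeasure_lborel_ball_finite[of "0::heis" R] by (simp add: ennreal_mult_less_top)
  finally show ?thesis .
qed

subsection \<open>Flows preserve the measure\<close>

text \<open>A shear along x_3 whose coefficient ignores x_3 is inverted by the opposite shear and
  has determinant 1, so boxes keep their volume.\<close>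

lemma distr_shear:
  fixes \<alpha> \<beta> :: real
  defines "S \<equiv> \<lambda>x::heis. x + (\<alpha> * x $ 2 - \<beta> * x $ 1) *\<^sub>R axis 3 1"
  shows "distr lborel lborel S = lborel"
proof -
  define S' where "S' = (\<lambda>x::heis. x - (\<alpha> * x $ 2 - \<beta> * x $ 1) *\<^sub>R axis 3 1)"
  have bl: "bounded_linear S" "bounded_linear S'" unfolding S_def S'_def
    by (intro bounded_linear_add bounded_linear_sub bounded_linear_ident bounded_linear_scaleR_const
      bounded_linear_const_mult bounded_linear_vec_nth)+
  have inv: "S (S' x) = x" "S' (S x) = x" for x
    by (simp_all add: S_def S'_def vec_eq_iff)
  have det: "det (matrix S') = 1"
    by (simp add: det_3 matrix_def S'_def axis_def)
  have vim: "S -` A = S' ` A" for A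
    using inv by (auto simp: image_iff) metis
  have mS: "S \<in> borel_measurable borel"
    using bl(1) by (intro borel_measurable_continuous_onI linear_continuous_on)
  show ?thesis
  proof (rule lborel_eqI[symmetric])
    fix l u :: heis
    assume lu: "\<And>b. b \<in> Basis \<Longrightarrow> l \<bullet> b \<le> u \<bullet> b"
    have m: "S' ` box l u \<in> sets lborel"
      using measurable_sets_borel[OF mS, of "box l u"] by (simp add: vim)
    have lm: "S' ` box l u \<in> lmeasurable"
      using measurable_linear_image[OF bounded_linear.linear[OF bl(2)], of "box l u"] by simp
    have "emeasure (distr lborel lborel S) (box l u) = emeasure lborel (S' ` box l u)"
      using mS by (subst emeasure_distr) (simp_all add: vim)
    also have "\<dots> = emeasure lebesgue (S' ` box l u)" using m by simp
    also have "\<dots> = ennreal (measure lebesgue (S' ` box l u))"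
      using lm by (simp add: emeasure_eq_measure2)
    also have "\<dots> = ennreal (measure lebesgue (box l u))"
      using measure_linear_image[OF bounded_linear.linear[OF bl(2)], of "box l u"] det by simp
    also have "\<dots> = (\<Prod>b\<in>Basis. (u - l) \<bullet> b)"
      using lu by (simp add: measure_lborel_box_eq inner_diff_left)
    finally show "emeasure (distr lborel lborel S) (box l u) = (\<Prod>b\<in>Basis. (u - l) \<bullet> b)" .
  qed simp
qed

text \<open>The flow does not move y, so it acts on the boundary, and on every level of y, by this
  one map.\<close>

definition bflow :: "(hpt \<Rightarrow> hpt) \<Rightarrow> real \<Rightarrow> heis \<Rightarrow> heis" where
  "bflow V t x = fst (flow V t (x, 0))"

lemma flow_pair: "flow (fld k \<alpha> \<beta> \<tau>) t (x, y) = (bflow (fld k \<alpha> \<beta> \<tau>) t x, y)"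
  by (simp add: bflow_def flow_def fld_def prod_eq_iff)

lemma distr_bflow: "distr lborel lborel (bflow (fld k \<alpha> \<beta> \<tau>) t) = lborel"
proof -
  define S where "S = (\<lambda>x::heis. x + ((t * k * \<alpha>) * x $ 2 - (t * k * \<beta>) * x $ 1) *\<^sub>R axis 3 1)"
  define c :: heis where "c = (t * \<alpha>) *\<^sub>R axis 1 1 + (t * \<beta>) *\<^sub>R axis 2 1 + (t * \<tau>) *\<^sub>R axis 3 1"
  have dS: "distr lborel lborel S = lborel" unfolding S_def by (rule distr_shear)
  have mS: "S \<in> measurable lborel lborel" unfolding S_def measurable_lborel1 measurable_lborel2
    by (intro borel_measurable_continuous_onI continuous_intros)
  have "distr lborel lborel (\<lambda>x. c + S x) = distr (distr lborel lborel S) lborel ((+) c)"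
    using mS by (subst distr_distr) (auto simp: comp_def)
  also have "\<dots> = lborel" unfolding dS using lborel_distr_plus[of c] by (simp cong: distr_cong)
  finally have d: "distr lborel lborel (\<lambda>x. c + S x) = lborel" .
  have e: "bflow (fld k \<alpha> \<beta> \<tau>) t = (\<lambda>x. c + S x)"
    by (rule ext) (simp add: bflow_def flow_def fld_eq S_def c_def vec_eq_iff forall_3 algebra_simps)
  show ?thesis unfolding e by (rule d)
qed

lemma bflow_measurable: "bflow (fld k \<alpha> \<beta> \<tau>) t \<in> measurable lborel lborel"
  unfolding bflow_def measurable_lborel1 measurable_lborel2
  by (intro borel_measurable_continuous_onI continuous_intros)

lemma distr_flow_lborel: "distr lborel lborel (flow (fld k \<alpha> \<beta> \<tau>) t) = lborel"
proof -
  have i: "distr lborel lborel (\<lambda>y::real. y) = lborel" by (rule distr_id2) simp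
  have e: "flow (fld k \<alpha> \<beta> \<tau>) t = (\<lambda>(x, y). (bflow (fld k \<alpha> \<beta> \<tau>) t x, y))"
    by (rule ext) (auto simp: flow_pair split: prod.split)
  have "lborel = distr lborel lborel (bflow (fld k \<alpha> \<beta> \<tau>) t) \<Otimes>\<^sub>M distr lborel lborel (\<lambda>y::real. y)"
    unfolding distr_bflow i lborel_prod ..
  also have "\<dots> = distr (lborel \<Otimes>\<^sub>M lborel) (lborel \<Otimes>\<^sub>M lborel) (\<lambda>(x, y). (bflow (fld k \<alpha> \<beta> \<tau>) t x, y))"
    using bflow_measurable by (intro pair_measure_distr) (auto simp: i lborel.sigma_finite_measure_axioms)
  finally show ?thesis unfolding e lborel_prod by simp
qed

lemma flow_measurable [measurable]: "flow (fld k \<alpha> \<beta> \<tau>) t \<in> borel_measurable borel"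
  by (intro borel_measurable_continuous_onI continuous_on_flow continuous_on_id continuous_on_const)

lemma flow_wmeas_measurable: "flow (fld k \<alpha> \<beta> \<tau>) t \<in> measurable (wmeas a) (wmeas a)"
proof -
  have "flow (fld k \<alpha> \<beta> \<tau>) t \<in> measurable (restrict_space borel half_space) (restrict_space borel half_space)"
    by (intro measurable_restrict_space3) auto
  then show ?thesis by (simp add: measurable_cong_sets[OF sets_wmeas sets_wmeas])
qed

text \<open>The flow preserves \<open>lborel\<close> and fixes y, hence also the weight y^a and the
  half-space.\<close>

lemma nn_integral_flow:
  assumes F: "F \<in> borel_measurable (wmeas a)"
  shows "(\<integral>\<^sup>+p. F (flow (fld k \<alpha> \<beta> \<tau>) t p) \<partial>wmeas a) = (\<integral>\<^sup>+p. F p \<partial>wmeas a)"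
proof -
  let ?\<theta> = "flow (fld k \<alpha> \<beta> \<tau>) t"
  let ?G = "\<lambda>p::hpt. ennreal (snd p powr a) * F p * indicator half_space p"
  have m: "?G \<in> borel_measurable lborel" using weighted_measurable[OF F] by simp
  have "(\<integral>\<^sup>+p. F (?\<theta> p) \<partial>wmeas a) = (\<integral>\<^sup>+p. ?G (?\<theta> p) \<partial>lborel)"
    using measurable_compose[OF flow_wmeas_measurable F]
    by (simp add: nn_integral_wmeas indicator_def)
  also have "\<dots> = (\<integral>\<^sup>+p. ?G p \<partial>distr lborel lborel ?\<theta>)"
    using m by (subst nn_integral_distr) auto
  also have "\<dots> = (\<integral>\<^sup>+p. F p \<partial>wmeas a)" unfolding distr_flow_lborel nn_integral_wmeas[OF F] ..
  finally show ?thesis .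
qed

lemma distr_flow: "distr (wmeas a) (wmeas a) (flow (fld k \<alpha> \<beta> \<tau>) t) = wmeas a"
proof (rule measure_eqI)
  fix A assume "A \<in> sets (distr (wmeas a) (wmeas a) (flow (fld k \<alpha> \<beta> \<tau>) t))"
  then have A: "A \<in> sets (wmeas a)" by simp
  have "emeasure (distr (wmeas a) (wmeas a) (flow (fld k \<alpha> \<beta> \<tau>) t)) A
    = (\<integral>\<^sup>+p. indicator A p \<partial>distr (wmeas a) (wmeas a) (flow (fld k \<alpha> \<beta> \<tau>) t))" using A by simp
  also have "\<dots> = (\<integral>\<^sup>+p. indicator A (flow (fld k \<alpha> \<beta> \<tau>) t p) \<partial>wmeas a)"
    using A by (intro nn_integral_distr flow_wmeas_measurable) simp
  also have "\<dots> = emeasure (wmeas a) A" using A nn_integral_flow[of "indicator A"] by simp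
  finally show "emeasure (distr (wmeas a) (wmeas a) (flow (fld k \<alpha> \<beta> \<tau>) t)) A = emeasure (wmeas a) A" .
qed simp

lemma integrable_flow:
  fixes g :: "hpt \<Rightarrow> real"
  assumes "g \<in> borel_measurable (wmeas a)"
  shows "integrable (wmeas a) (\<lambda>p. g (flow (fld k \<alpha> \<beta> \<tau>) t p)) \<longleftrightarrow> integrable (wmeas a) g"
  using integrable_distr_eq[OF flow_wmeas_measurable assms] unfolding distr_flow by simp

lemma integral_flow:
  fixes g :: "hpt \<Rightarrow> real"
  assumes "g \<in> borel_measurable (wmeas a)"
  shows "(\<integral>p. g (flow (fld k \<alpha> \<beta> \<tau>) t p) \<partial>wmeas a) = (\<integral>p. g p \<partial>wmeas a)"
  using integral_distr[OF flow_wmeas_measurable assms] unfolding distr_flow by simp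

lemma sigma_finite_wmeas: "sigma_finite_measure (wmeas a)"
proof -
  interpret R: sigma_finite_measure "restrict_space (lborel :: hpt measure) half_space"
    by (rule sigma_finite_measure_restrict_space) (auto simp: lborel.sigma_finite_measure_axioms)
  show ?thesis unfolding wmeas_def
    using weight_restrict_measurable R.sigma_finite_measure_axioms
    by (intro R.sigma_finite_iff_density_finite[THEN iffD2]) auto
qed

section \<open>Weighted one-dimensional estimates on vertical slices\<close>

lemma greaterThanLessThan_subseteq_greaterThan:
  fixes l u c :: real
  shows "c \<le> l \<Longrightarrow> {l<..<u} \<subseteq> {c<..}"
  by auto

lemma continuous_indicator_measurable:
  fixes g :: "real \<Rightarrow> real"
  assumes "continuous_on {0<..} g" "A \<in> sets borel" "A \<subseteq> {0<..}"
  shows "(\<lambda>y. g y * indicator A y) \<in> borel_measurable borel"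
  using borel_measurable_continuous_on_indicator[OF assms(2) continuous_on_subset[OF assms(1,3)]]
  by (simp add: mult.commute)

text \<open>The extended nonnegative integral on the right makes the bound meaningful before z' is
  known to be integrable near 0.\<close>

lemma ftc_nn:
  fixes z z' :: "real \<Rightarrow> real"
  assumes d: "\<And>y. 0 < y \<Longrightarrow> (z has_real_derivative z' y) (at y)" and c: "continuous_on {0<..} z'"
    and "0 < s" "s \<le> t" "t < \<delta>"
  shows "ennreal \<bar>z t - z s\<bar> \<le> (\<integral>\<^sup>+y. ennreal \<bar>z' y\<bar> * indicator {0<..<\<delta>} y \<partial>lborel)"
proof -
  have sub: "{s..t} \<subseteq> {0<..}" using assms by auto
  have i: "(z' has_integral z t - z s) {s..t}"
    using assms sub by (intro fundamental_theorem_of_calculus)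
      (auto intro!: has_field_derivative_at_within d simp: has_real_derivative_iff_has_vector_derivative[symmetric])
  have ia: "(\<lambda>y. \<bar>z' y\<bar>) integrable_on {s..t}"
    using continuous_on_subset[OF c sub] by (intro integrable_continuous_interval continuous_intros)
  have "\<bar>z t - z s\<bar> \<le> integral {s..t} (\<lambda>y. \<bar>z' y\<bar>)"
    using integral_norm_bound_integral[of z' "{s..t}" "\<lambda>y. \<bar>z' y\<bar>"] i ia by (auto simp: integral_unique)
  then have "ennreal \<bar>z t - z s\<bar> \<le> ennreal (integral {s..t} (\<lambda>y. \<bar>z' y\<bar>))" by (rule ennreal_leI)
  also have "\<dots> = (\<integral>\<^sup>+y. ennreal \<bar>z' y\<bar> * indicator {s..t} y \<partial>lborel)"
    by (rule nn_integral_has_integral_lebesgue'[symmetric]) (use ia in auto)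
  also have "\<dots> \<le> (\<integral>\<^sup>+y. ennreal \<bar>z' y\<bar> * indicator {0<..<\<delta>} y \<partial>lborel)"
    using assms by (intro nn_integral_mono) (auto simp: indicator_def)
  finally show ?thesis .
qed

text \<open>Split |z'| as y^(a/2) |z'| times y^(-a/2); the second factor is square integrable near 0
  because a < 1.\<close>

lemma weighted_cauchy_schwarz:
  fixes z' :: "real \<Rightarrow> real"
  assumes a: "a < 1" and c: "continuous_on {0<..} z'" and "\<delta> > 0"
  shows "(\<integral>\<^sup>+y. ennreal \<bar>z' y\<bar> * indicator {0<..<\<delta>} y \<partial>lborel)\<^sup>2
    \<le> ennreal (\<delta> powr (1 - a) / (1 - a)) * (\<integral>\<^sup>+y. ennreal (y powr a * (z' y)\<^sup>2) * indicator {0<..<\<delta>} y \<partial>lborel)"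
proof -
  let ?I = "indicator {0<..<\<delta>} :: real \<Rightarrow> real"
  let ?f = "\<lambda>y. ennreal (y powr (a / 2) * \<bar>z' y\<bar> * ?I y)"
  let ?g = "\<lambda>y. ennreal (y powr (- a / 2) * ?I y)"
  have cc: "continuous_on {0<..} (\<lambda>y. y powr (a / 2) * \<bar>z' y\<bar>)" by (intro continuous_intros c) auto
  have mf: "?f \<in> borel_measurable lborel"
    using continuous_indicator_measurable[OF cc, of "{0<..<\<delta>}"] by (simp add: greaterThanLessThan_subseteq_greaterThan)
  have mg: "?g \<in> borel_measurable lborel" by measurable
  have fg: "?f y * ?g y = ennreal \<bar>z' y\<bar> * indicator {0<..<\<delta>} y" for y
  proof -
    have "y powr (a / 2) * \<bar>z' y\<bar> * (y powr (- a / 2)) = \<bar>z' y\<bar>" if "y > 0"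
      using that by (simp add: powr_minus_divide)
    then show ?thesis by (auto simp: indicator_def ennreal_mult'[symmetric])
  qed
  have f2: "(?f y)\<^sup>2 = ennreal (y powr a * (z' y)\<^sup>2) * indicator {0<..<\<delta>} y" for y
  proof -
    have "y powr (a / 2) * y powr (a / 2) = y powr a" unfolding powr_add[symmetric] by simp
    then have "(y powr (a / 2) * \<bar>z' y\<bar>)\<^sup>2 = y powr a * (z' y)\<^sup>2"
      by (simp add: power_mult_distrib power2_eq_square[of "y powr (a / 2)"])
    then show ?thesis by (simp add: ennreal_power indicator_def)
  qed
  have g2: "(?g y)\<^sup>2 = ennreal (y powr (- a)) * indicator {0<..<\<delta>} y" for y
  proof -
    have "y powr (- a / 2) * y powr (- a / 2) = y powr (- a)" unfolding powr_add[symmetric] by simp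
    then show ?thesis by (simp add: ennreal_power indicator_def power2_eq_square ennreal_mult'[symmetric])
  qed
  have "(\<integral>\<^sup>+y. (?g y)\<^sup>2 \<partial>lborel) \<le> (\<integral>\<^sup>+y. ennreal (y powr (- a)) * indicator {0..\<delta>} y \<partial>lborel)"
    unfolding g2 by (intro nn_integral_mono) (auto simp: indicator_def)
  also have "\<dots> = ennreal (\<delta> powr (1 - a) / (1 - a))"
    using nn_integral_powr[of "- a" \<delta>] assms by simp
  finally have G: "(\<integral>\<^sup>+y. (?g y)\<^sup>2 \<partial>lborel) \<le> ennreal (\<delta> powr (1 - a) / (1 - a))" .
  have "(\<integral>\<^sup>+y. ?f y * ?g y \<partial>lborel)\<^sup>2 \<le> (\<integral>\<^sup>+y. (?f y)\<^sup>2 \<partial>lborel) * (\<integral>\<^sup>+y. (?g y)\<^sup>2 \<partial>lborel)"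
    by (rule Cauchy_Schwarz_nn_integral[OF mf mg])
  also have "\<dots> \<le> (\<integral>\<^sup>+y. (?f y)\<^sup>2 \<partial>lborel) * ennreal (\<delta> powr (1 - a) / (1 - a))"
    by (rule mult_left_mono[OF G]) simp
  finally show ?thesis unfolding fg f2 by (simp add: mult.commute)
qed

text \<open>On (\<delta>/2, \<delta>) the weight lies between its values at the two ends, whatever
  the sign of a.\<close>

lemma weight_mass:
  fixes a \<delta> :: real
  assumes "\<delta> > 0"
  obtains m where "m > 0" "(\<integral>\<^sup>+y. ennreal (y powr a) * indicator {\<delta>/2<..<\<delta>} y \<partial>lborel) = ennreal m"
proof -
  let ?J = "\<integral>\<^sup>+y. ennreal (y powr a) * indicator {\<delta>/2<..<\<delta>} y \<partial>lborel"
  define l where "l = min ((\<delta>/2) powr a) (\<delta> powr a)"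
  define L where "L = max ((\<delta>/2) powr a) (\<delta> powr a)"
  have b: "l \<le> y powr a \<and> y powr a \<le> L" if "y \<in> {\<delta>/2<..<\<delta>}" for y
  proof (cases "a \<ge> 0")
    case True
    then have "(\<delta>/2) powr a \<le> y powr a" "y powr a \<le> \<delta> powr a" using that assms by (auto intro!: powr_mono2)
    then show ?thesis by (auto simp: l_def L_def)
  next
    case False
    then have "y powr a \<le> (\<delta>/2) powr a" "\<delta> powr a \<le> y powr a" using that assms by (auto intro!: powr_mono2')
    then show ?thesis by (auto simp: l_def L_def)
  qed
  have l: "l > 0" using assms by (simp add: l_def)
  have e: "(\<integral>\<^sup>+y. ennreal c * indicator {\<delta>/2<..<\<delta>} y \<partial>lborel) = ennreal (c * (\<delta>/2))" if "c \<ge> 0" for c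
    using assms that by (simp add: nn_integral_cmult ennreal_mult'[symmetric])
  have "ennreal (l * (\<delta>/2)) \<le> ?J"
    unfolding e[OF less_imp_le[OF l], symmetric] using b by (intro nn_integral_mono) (auto simp: indicator_def intro!: ennreal_leI)
  moreover have "L \<ge> 0" unfolding L_def by (rule max.coboundedI1) simp
  then have "?J \<le> ennreal (L * (\<delta>/2))"
    unfolding e[OF \<open>L \<ge> 0\<close>, symmetric] using b by (intro nn_integral_mono) (auto simp: indicator_def intro!: ennreal_leI)
  then have "?J < \<infinity>" by (rule order_le_less_trans) simp
  then obtain m where m: "?J = ennreal m" "m \<ge> 0" by (cases ?J) auto
  moreover have "ennreal (l * (\<delta>/2)) \<le> ?J" by fact
  ultimately have "l * (\<delta>/2) \<le> m" by simp
  then have "m > 0" using mult_pos_pos[OF l, of "\<delta>/2"] assms by linarith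
  then show ?thesis using that m by blast
qed

text \<open>z(s)^2 is compared with z(y)^2 at heights y in (\<delta>/2, \<delta>) and averaged there
  against the weight; the increment z(s) - z(y) costs slice energy by Cauchy-Schwarz. K depends on a
  and \<delta> alone, and the factor of the derivative term tends to 0 with \<delta>, which later
  permits absorption.\<close>

lemma slice_bound:
  fixes a \<delta> :: real
  assumes a: "a < 1" and \<delta>: "\<delta> > 0"
  shows "\<exists>K\<ge>0. \<forall>z z' s. (\<forall>y>0. (z has_real_derivative z' y) (at y)) \<longrightarrow> continuous_on {0<..} z' \<longrightarrow> 0 < s \<longrightarrow> s < \<delta> \<longrightarrow>
    ennreal ((z s)\<^sup>2) \<le> ennreal (2 * \<delta> powr (1 - a) / (1 - a)) * (\<integral>\<^sup>+y. ennreal (y powr a * (z' y)\<^sup>2) * indicator {0<..<\<delta>} y \<partial>lborel)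
      + ennreal K * (\<integral>\<^sup>+y. ennreal (y powr a * (z y)\<^sup>2) * indicator {\<delta>/2<..<\<delta>} y \<partial>lborel)"
proof -
  obtain m where m: "m > 0" "(\<integral>\<^sup>+y. ennreal (y powr a) * indicator {\<delta>/2<..<\<delta>} y \<partial>lborel) = ennreal m"
    using weight_mass[OF \<delta>] .
  let ?\<kappa> = "\<delta> powr (1 - a) / (1 - a)"
  have \<kappa>: "?\<kappa> \<ge> 0" using a by simp
  show ?thesis
  proof (intro exI[of _ "2 / m"] conjI allI impI)
    show "0 \<le> 2 / m" using m by simp
    fix z z' :: "real \<Rightarrow> real" and s :: real
    assume d: "\<forall>y>0. (z has_real_derivative z' y) (at y)" and c: "continuous_on {0<..} z'" and s: "0 < s" "s < \<delta>"
    let ?A = "\<integral>\<^sup>+y. ennreal (y powr a * (z' y)\<^sup>2) * indicator {0<..<\<delta>} y \<partial>lborel"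
    let ?B = "\<integral>\<^sup>+y. ennreal \<bar>z' y\<bar> * indicator {0<..<\<delta>} y \<partial>lborel"
    let ?Z = "\<integral>\<^sup>+y. ennreal (y powr a * (z y)\<^sup>2) * indicator {\<delta>/2<..<\<delta>} y \<partial>lborel"
    have cz: "continuous_on {0<..} z" by (rule continuous_at_imp_continuous_on) (use d DERIV_isCont in fastforce)
    have diff: "ennreal ((z s - z y)\<^sup>2) \<le> ennreal ?\<kappa> * ?A" if y: "0 < y" "y < \<delta>" for y
    proof -
      have "ennreal \<bar>z s - z y\<bar> \<le> ?B"
      proof (cases "y \<le> s")
        case True then show ?thesis using ftc_nn[of z z' y s \<delta>] d c s y by auto
      next
        case False then show ?thesis using ftc_nn[of z z' s y \<delta>] d c s y by (auto simp: abs_minus_commute)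
      qed
      then have "(ennreal \<bar>z s - z y\<bar>)\<^sup>2 \<le> ?B\<^sup>2" by (rule power_mono) simp
      also have "\<dots> \<le> ennreal ?\<kappa> * ?A" by (rule weighted_cauchy_schwarz[OF a c \<delta>])
      finally show ?thesis by (simp add: ennreal_power)
    qed
    have pt: "ennreal ((z s)\<^sup>2) \<le> 2 * ennreal ((z y)\<^sup>2) + 2 * (ennreal ?\<kappa> * ?A)" if y: "0 < y" "y < \<delta>" for y
    proof -
      have "(z s)\<^sup>2 \<le> 2 * (z y)\<^sup>2 + 2 * (z s - z y)\<^sup>2"
        using zero_le_power2[of "z s - 2 * z y"] by (simp add: power2_eq_square algebra_simps)
      then have "ennreal ((z s)\<^sup>2) \<le> ennreal (2 * (z y)\<^sup>2 + 2 * (z s - z y)\<^sup>2)" by (rule ennreal_leI)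
      also have "\<dots> = 2 * ennreal ((z y)\<^sup>2) + 2 * ennreal ((z s - z y)\<^sup>2)" by (simp add: ennreal_mult')
      also have "\<dots> \<le> 2 * ennreal ((z y)\<^sup>2) + 2 * (ennreal ?\<kappa> * ?A)"
        by (intro add_left_mono mult_left_mono diff y) simp
      finally show ?thesis .
    qed
    let ?w = "\<lambda>y. ennreal (y powr a) * indicator {\<delta>/2<..<\<delta>} y"
    have mzz: "(\<lambda>y. ennreal (y powr a * (z y)\<^sup>2) * indicator {\<delta>/2<..<\<delta>} y) \<in> borel_measurable lborel"
    proof -
      have "continuous_on {0<..} (\<lambda>y. y powr a * (z y)\<^sup>2)" by (intro continuous_intros cz) auto
      from continuous_indicator_measurable[OF this, of "{\<delta>/2<..<\<delta>}"] greaterThanLessThan_subseteq_greaterThan[of 0 "\<delta>/2" \<delta>] \<delta>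
      have "(\<lambda>y. ennreal (y powr a * (z y)\<^sup>2 * indicator {\<delta>/2<..<\<delta>} y)) \<in> borel_measurable lborel" by auto
      moreover have "(\<lambda>y. ennreal (y powr a * (z y)\<^sup>2 * indicator {\<delta>/2<..<\<delta>} y)) = (\<lambda>y. ennreal (y powr a * (z y)\<^sup>2) * indicator {\<delta>/2<..<\<delta>} y)"
        by (auto simp: indicator_def)
      ultimately show ?thesis by simp
    qed
    \<comment> \<open>The weighted average of \<open>pt\<close> over (\<delta>/2, \<delta>):
      multiply by the mass m, integrate in y, and divide by m again. This is where K = 2 / m comes
      from.\<close>
    have "ennreal ((z s)\<^sup>2) * ennreal m = (\<integral>\<^sup>+y. ennreal ((z s)\<^sup>2) * ?w y \<partial>lborel)"
      unfolding m(2)[symmetric] by (rule nn_integral_cmult[symmetric]) simp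
    also have "\<dots> \<le> (\<integral>\<^sup>+y. 2 * (ennreal (y powr a * (z y)\<^sup>2) * indicator {\<delta>/2<..<\<delta>} y) + 2 * (ennreal ?\<kappa> * ?A) * ?w y \<partial>lborel)"
    proof (intro nn_integral_mono)
      fix y
      show "ennreal ((z s)\<^sup>2) * ?w y \<le> 2 * (ennreal (y powr a * (z y)\<^sup>2) * indicator {\<delta>/2<..<\<delta>} y) + 2 * (ennreal ?\<kappa> * ?A) * ?w y"
      proof (cases "y \<in> {\<delta>/2<..<\<delta>}")
        case True
        then have "ennreal ((z s)\<^sup>2) * ennreal (y powr a) \<le> (2 * ennreal ((z y)\<^sup>2) + 2 * (ennreal ?\<kappa> * ?A)) * ennreal (y powr a)"
          using \<delta> by (intro mult_right_mono pt) auto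
        then show ?thesis using True by (simp add: ennreal_mult' distrib_right mult.assoc mult.commute[of "ennreal (y powr a)" "ennreal ((z y)\<^sup>2)"])
      qed simp
    qed
    also have "\<dots> = 2 * ?Z + 2 * (ennreal ?\<kappa> * ?A) * ennreal m"
      unfolding m(2)[symmetric] using mzz
      by (subst nn_integral_add) (auto simp: nn_integral_cmult)
    finally have "ennreal ((z s)\<^sup>2) * ennreal m * ennreal (1 / m) \<le> (2 * ?Z + 2 * (ennreal ?\<kappa> * ?A) * ennreal m) * ennreal (1 / m)"
      by (rule mult_right_mono) simp
    moreover have "ennreal m * ennreal (1 / m) = 1" using m(1) by (simp add: ennreal_mult'[symmetric])
    moreover have "2 * ennreal (1 / m) = ennreal (2 / m)"
      using m(1) ennreal_mult'[of 2 "1 / m"] by simp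
    moreover have "2 * ennreal ?\<kappa> = ennreal (2 * \<delta> powr (1 - a) / (1 - a))"
      using a ennreal_mult'[of 2 ?\<kappa>] by simp
    ultimately have e: "ennreal m * ennreal (1 / m) = 1" "2 * ennreal (1 / m) = ennreal (2 / m)"
      "2 * ennreal ?\<kappa> = ennreal (2 * \<delta> powr (1 - a) / (1 - a))"
      and le: "ennreal ((z s)\<^sup>2) * ennreal m * ennreal (1 / m) \<le> (2 * ?Z + 2 * (ennreal ?\<kappa> * ?A) * ennreal m) * ennreal (1 / m)"
      by blast+
    have "ennreal ((z s)\<^sup>2) * ennreal m * ennreal (1 / m) = ennreal ((z s)\<^sup>2) * (ennreal m * ennreal (1 / m))"
      by (rule mult.assoc)
    moreover have "(2 * ?Z + 2 * (ennreal ?\<kappa> * ?A) * ennreal m) * ennreal (1 / m)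
      = (2 * ennreal (1 / m)) * ?Z + (2 * ennreal ?\<kappa>) * ?A * (ennreal m * ennreal (1 / m))"
      by (simp only: distrib_right distrib_left ac_simps)
    ultimately show "ennreal ((z s)\<^sup>2) \<le> ennreal (2 * \<delta> powr (1 - a) / (1 - a)) * ?A + ennreal (2 / m) * ?Z"
      using le unfolding e by (simp only: mult_1_right add.commute)
  qed
qed

text \<open>Finite weighted energy makes z' integrable on (0, \<delta>), so z(y), being
  z(\<delta>/2) minus the integral of z' over [y, \<delta>/2], extends continuously to 0.\<close>

lemma slice_trace_exists:
  fixes z z' :: "real \<Rightarrow> real"
  assumes a: "a < 1" and \<delta>: "\<delta> > 0"
    and d: "\<And>y. 0 < y \<Longrightarrow> (z has_real_derivative z' y) (at y)" and c: "continuous_on {0<..} z'"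
    and fin: "(\<integral>\<^sup>+y. ennreal (y powr a * (z' y)\<^sup>2) * indicator {0<..<\<delta>} y \<partial>lborel) < \<infinity>"
  shows "\<exists>L. (z \<longlongrightarrow> L) (at_right 0)"
proof -
  let ?B = "\<integral>\<^sup>+y. ennreal \<bar>z' y\<bar> * indicator {0<..<\<delta>} y \<partial>lborel"
  have "?B\<^sup>2 < \<infinity>"
    using weighted_cauchy_schwarz[OF a c \<delta>] fin by (auto simp: ennreal_mult_less_top elim: order_le_less_trans)
  then have B: "?B < \<infinity>"
    by (cases "?B = \<infinity>") (auto simp: power2_eq_square less_top)
  have "integrable lborel (\<lambda>y. indicator {0<..<\<delta>} y *\<^sub>R z' y)"
  proof (rule integrableI_bounded)
    show "(\<lambda>y. indicator {0<..<\<delta>} y *\<^sub>R z' y) \<in> borel_measurable lborel"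
      using borel_measurable_continuous_on_indicator[OF _ continuous_on_subset[OF c], of "{0<..<\<delta>}"] by (simp add: greaterThanLessThan_subseteq_greaterThan)
    show "(\<integral>\<^sup>+y. ennreal (norm (indicator {0<..<\<delta>} y *\<^sub>R z' y)) \<partial>lborel) < \<infinity>"
    proof -
      have "ennreal (norm (indicator {0<..<\<delta>} y *\<^sub>R z' y)) = ennreal \<bar>z' y\<bar> * indicator {0<..<\<delta>} y" for y
        by (auto simp: indicator_def)
      then show ?thesis using B by simp
    qed
  qed
  then have "z' integrable_on {0<..<\<delta>}"
    using set_borel_integral_eq_integral(1) unfolding set_integrable_def by blast
  then have "z' integrable_on {0..\<delta>}"
    by (simp add: integrable_on_Icc_iff_Ioo)
  then have i: "z' integrable_on {0..\<delta>/2}"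
    using \<delta> by (auto intro: integrable_on_subinterval)
  have "continuous_on {0..\<delta>/2} (\<lambda>y. integral {y..\<delta>/2} z')" by (rule indefinite_integral_continuous_1'[OF i])
  then have "((\<lambda>y. integral {y..\<delta>/2} z') \<longlongrightarrow> integral {0..\<delta>/2} z') (at 0 within {0..\<delta>/2})"
    using \<delta> by (auto simp: continuous_on)
  then have "((\<lambda>y. integral {y..\<delta>/2} z') \<longlongrightarrow> integral {0..\<delta>/2} z') (at_right 0)"
    using \<delta> by (simp add: at_within_Icc_at_right)
  then have t: "((\<lambda>y. z (\<delta>/2) - integral {y..\<delta>/2} z') \<longlongrightarrow> z (\<delta>/2) - integral {0..\<delta>/2} z') (at_right 0)"
    by (intro tendsto_intros)
  have e: "z (\<delta>/2) - integral {y..\<delta>/2} z' = z y" if "y > 0" "y < \<delta>/2" for y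
  proof -
    have "(z' has_integral z (\<delta>/2) - z y) {y..\<delta>/2}"
      using that by (intro fundamental_theorem_of_calculus)
        (auto intro!: has_field_derivative_at_within d simp: has_real_derivative_iff_has_vector_derivative[symmetric])
    then show ?thesis by (simp add: integral_unique)
  qed
  have "eventually (\<lambda>y. z (\<delta>/2) - integral {y..\<delta>/2} z' = z y) (at_right 0)"
    unfolding eventually_at_right_field using e \<delta> by (intro exI[of _ "\<delta>/2"]) auto
  from Lim_transform_eventually[OF t this] show ?thesis by blast
qed

section \<open>Boundary traces\<close>

definition has_tr :: "(hpt \<Rightarrow> real) \<Rightarrow> heis \<Rightarrow> bool" where
  "has_tr w x \<longleftrightarrow> (\<exists>L. ((\<lambda>y. w (x, y)) \<longlongrightarrow> L) (at_right 0))"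

text \<open>A version of the trace that is Borel measurable for every continuous function.\<close>

definition btr :: "(hpt \<Rightarrow> real) \<Rightarrow> heis \<Rightarrow> real" where
  "btr w x = lim (\<lambda>n. w (x, inverse (real (Suc n))))"

lemma btrI:
  assumes "((\<lambda>y. w (x, y)) \<longlongrightarrow> L) (at_right 0)"
  shows "has_tr w x" "btr w x = L" "trace0 w x = L"
proof -
  show "has_tr w x" using assms by (auto simp: has_tr_def)
  have "filterlim (\<lambda>n. inverse (real (Suc n))) (at_right 0) sequentially"
    unfolding filterlim_at using LIMSEQ_inverse_real_of_nat by simp
  from filterlim_compose[OF assms this] show "btr w x = L" unfolding btr_def by (rule limI)
  show "trace0 w x = L" unfolding trace0_def using assms by (intro tendsto_Lim) simp_all
qed

lemma has_tr_tendsto: "has_tr w x \<Longrightarrow> ((\<lambda>y. w (x, y)) \<longlongrightarrow> btr w x) (at_right 0)"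
  using btrI unfolding has_tr_def by blast

lemma has_tr_trace0: "has_tr w x \<Longrightarrow> trace0 w x = btr w x"
  using btrI has_tr_tendsto by blast

lemma half_space_pair [simp]: "(x, y) \<in> half_space \<longleftrightarrow> y > 0"
  by (simp add: half_space_def)

lemma btr_measurable:
  assumes "continuous_on half_space w"
  shows "btr w \<in> borel_measurable borel"
  unfolding btr_def
proof (rule borel_measurable_lim_metric)
  show "(\<lambda>x. w (x, inverse (real (Suc n)))) \<in> borel_measurable borel" for n
    by (intro borel_measurable_continuous_onI continuous_on_compose2[OF assms] continuous_intros) auto
qed

text \<open>Needed for \<open>trace0\<close>, which agrees with the Borel function
  \<open>btr\<close> only where a limit exists. On the exceptional null set it may be arbitrary;
  completeness of Lebesgue measure makes it measurable nevertheless.\<close>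

lemma lebesgue_integral_AE_borel:
  fixes g h :: "heis \<Rightarrow> real"
  assumes g: "g \<in> borel_measurable borel" and ae: "AE x in lborel. h x = g x"
  shows "(\<integral>x. h x \<partial>lebesgue) = (\<integral>x. g x \<partial>lborel)"
proof -
  have g': "g \<in> borel_measurable lebesgue" using g by (intro measurable_completion) simp
  have ae': "AE x in lebesgue. h x = g x" using ae by (rule AE_completion)
  have h': "h \<in> borel_measurable lebesgue"
  proof (rule measurableI)
    fix A :: "real set" assume A: "A \<in> sets borel"
    have n1: "{x \<in> space lebesgue. h x \<noteq> g x} \<in> sets lebesgue"
      using sets_completion_AE[where M = lborel and P = "\<lambda>x. h x \<noteq> g x"] ae by (simp add: pred_def)
    have "AE x in lborel. \<not> (h x \<noteq> g x \<and> h x \<in> A)" using ae by (rule AE_mp) auto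
    from sets_completion_AE[OF this]
    have n2: "{x \<in> space lebesgue. h x \<noteq> g x \<and> h x \<in> A} \<in> sets lebesgue" by (simp add: pred_def)
    have "h -` A \<inter> space lebesgue = (g -` A \<inter> space lebesgue - {x \<in> space lebesgue. h x \<noteq> g x}) \<union> {x \<in> space lebesgue. h x \<noteq> g x \<and> h x \<in> A}"
      by auto
    also have "\<dots> \<in> sets lebesgue" using measurable_sets[OF g' A] n1 n2 by blast
    finally show "h -` A \<inter> space lebesgue \<in> sets lebesgue" .
  qed simp
  have "(\<integral>x. h x \<partial>lebesgue) = (\<integral>x. g x \<partial>lebesgue)"
    by (rule integral_cong_AE[OF h' g' ae'])
  then show ?thesis using g by (simp add: integral_completion)
qed

text \<open>A weighted local H^1 class. The half-balls touch y = 0, so finiteness is a statement up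
  to the boundary, whereas C^1 is asked only inside.\<close>

definition Hloc :: "real \<Rightarrow> (hpt \<Rightarrow> real) \<Rightarrow> bool" where
  "Hloc a w \<longleftrightarrow> C1 half_space w \<and>
    (\<forall>R. (\<integral>\<^sup>+p. ennreal ((w p)\<^sup>2 + energy w w p) * indicator (half_ball R) p \<partial>wmeas a) < \<infinity>)"

lemma slice_deriv:
  assumes "C1 half_space w" "y > 0"
  shows "((\<lambda>y. w (x, y)) has_real_derivative dy w (x, y)) (at y)"
  using pd_line[of w "(x, 0)" y "(0, 1)"] C1_diff[OF assms(1), of "(x, y)"] assms(2)
  by (simp add: dy_def)

lemma slice_cont:
  assumes "continuous_on half_space g"
  shows "continuous_on {0<..} (\<lambda>y. g (x, y))"
  by (rule continuous_on_compose2[OF assms]) (auto intro!: continuous_intros)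

lemma half_ball_sets [measurable, simp]: "half_ball R \<in> sets (wmeas a)" "half_ball R \<in> sets borel"
  by (auto intro!: borel_set_wmeas simp: half_ball_def)

text \<open>By Tonelli the energy in each half-ball has finite slices for almost every x, and the
  segment of height 1 above x lies in the half-ball of radius n once n > |x| + 1. On such a slice
  the one-dimensional criterion applies.\<close>

lemma Hloc_has_tr:
  assumes a: "-1 < a" "a < 1" and w: "Hloc a w"
  shows "AE x in lborel. has_tr w x"
proof -
  have C: "C1 half_space w" using w by (simp add: Hloc_def)
  let ?F = "\<lambda>n::nat. \<lambda>p. ennreal ((dy w p)\<^sup>2) * indicator (half_ball (real n)) p"
  let ?I = "\<lambda>n x. \<integral>\<^sup>+y. ennreal (y powr a) * ?F n (x, y) * indicator {0<..} y \<partial>lborel"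
  have mdy: "(\<lambda>p. (dy w p)\<^sup>2) \<in> borel_measurable (wmeas a)"
    by (intro continuous_wmeas_measurable continuous_intros h_cont C)
  have mF: "?F n \<in> borel_measurable (wmeas a)" for n
    using mdy by (intro borel_measurable_times_ennreal) auto
  have "AE x in lborel. ?I n x \<noteq> \<infinity>" for n
  proof (rule nn_integral_PInf_AE)
    show "?I n \<in> borel_measurable lborel" by (rule nn_integral_wmeas_slices(1)[OF mF])
    have "(\<integral>\<^sup>+p. ?F n p \<partial>wmeas a) \<le> (\<integral>\<^sup>+p. ennreal ((w p)\<^sup>2 + energy w w p) * indicator (half_ball n) p \<partial>wmeas a)"
      using energy_components(3)[of w] by (intro nn_integral_mono mult_right_mono ennreal_leI) (auto simp: add_increasing)
    also have "\<dots> < \<infinity>" using w by (simp add: Hloc_def)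
    finally show "(\<integral>\<^sup>+x. ?I n x \<partial>lborel) \<noteq> \<infinity>" using nn_integral_wmeas_slices(2)[OF mF, of n] by auto
  qed
  then have "AE x in lborel. \<forall>n. ?I n x \<noteq> \<infinity>" by (simp add: AE_all_countable)
  then show ?thesis
  proof (rule AE_mp, intro AE_I2 impI)
    fix x :: heis assume fin: "\<forall>n. ?I n x \<noteq> \<infinity>"
    obtain n :: nat where n: "norm x + 1 < real n" using reals_Archimedean2 by blast
    have hb: "(x, y) \<in> half_ball n" if "0 < y" "y < 1" for y
    proof -
      have "norm (x, y) \<le> norm x + norm y" by (rule norm_Pair_le)
      then show ?thesis using that n by (simp add: half_ball_def)
    qed
    have "(\<integral>\<^sup>+y. ennreal (y powr a * (dy w (x, y))\<^sup>2) * indicator {0<..<1} y \<partial>lborel) \<le> ?I n x"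
      by (intro nn_integral_mono) (auto simp: indicator_def hb ennreal_mult')
    also have "\<dots> < \<infinity>" using fin by (simp add: less_top)
    finally show "has_tr w x" unfolding has_tr_def
      by (intro slice_trace_exists[OF a(2), of 1 _ "\<lambda>y. dy w (x, y)"] slice_deriv C slice_cont h_cont) auto
  qed
qed

text \<open>The slice estimate integrated over x. Its point is the free \<epsilon>: energy enters
  with an arbitrarily small factor, and the remaining term sees only heights above a positive
  \<delta>, where functions are controlled without any information at y = 0.\<close>

lemma trace_inequality:
  assumes a: "-1 < a" "a < 1" and \<epsilon>: "\<epsilon> > 0"
  obtains C \<delta> where "C \<ge> 0" "\<delta> > 0"
    "\<And>z. C1 half_space z \<Longrightarrow> (AE x in lborel. has_tr z x) \<Longrightarrow>
      (\<integral>\<^sup>+x. ennreal ((btr z x)\<^sup>2) \<partial>lborel) \<le> ennreal \<epsilon> * (\<integral>\<^sup>+p. ennreal ((dy z p)\<^sup>2) \<partial>wmeas a)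
        + ennreal C * (\<integral>\<^sup>+p. ennreal ((z p)\<^sup>2) * indicator {p. snd p > \<delta>} p \<partial>wmeas a)"
proof -
  \<comment> \<open>Solves 2 \<delta>^(1-a) / (1-a) = \<epsilon>, the factor of the derivative term
    in \<open>slice_bound\<close>.\<close>
  define \<delta> where "\<delta> = (\<epsilon> * (1 - a) / 2) powr (1 / (1 - a))"
  have \<delta>: "\<delta> > 0" using \<epsilon> a by (simp add: \<delta>_def)
  have "2 * \<delta> powr (1 - a) = \<epsilon> * (1 - a)" using a \<epsilon> by (simp add: \<delta>_def powr_powr)
  then have \<kappa>: "2 * \<delta> powr (1 - a) / (1 - a) = \<epsilon>" using a by simp
  obtain K where K: "K \<ge> 0" "\<And>z z' s. (\<forall>y>0. (z has_real_derivative z' y) (at y)) \<Longrightarrow> continuous_on {0<..} z' \<Longrightarrow> 0 < s \<Longrightarrow> s < \<delta> \<Longrightarrow>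
    ennreal ((z s)\<^sup>2) \<le> ennreal \<epsilon> * (\<integral>\<^sup>+y. ennreal (y powr a * (z' y)\<^sup>2) * indicator {0<..<\<delta>} y \<partial>lborel)
      + ennreal K * (\<integral>\<^sup>+y. ennreal (y powr a * (z y)\<^sup>2) * indicator {\<delta>/2<..<\<delta>} y \<partial>lborel)"
    using slice_bound[OF a(2) \<delta>] unfolding \<kappa> by blast
  show ?thesis
  \<comment> \<open>The slice estimate averages over (\<delta>/2, \<delta>), so the threshold is
    \<delta>/2.\<close>
  proof (rule that[of K "\<delta>/2"])
    fix z assume C: "C1 half_space z" and tr: "AE x in lborel. has_tr z x"
    let ?F = "\<lambda>p. ennreal ((dy z p)\<^sup>2)"
    let ?G = "\<lambda>p. ennreal ((z p)\<^sup>2) * indicator {p. snd p > \<delta>/2} p"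
    let ?I = "\<lambda>F x. \<integral>\<^sup>+y. ennreal (y powr a) * F (x, y) * indicator {0<..} y \<partial>lborel"
    have mF: "?F \<in> borel_measurable (wmeas a)"
      by (intro measurable_compose[OF _ measurable_ennreal] continuous_wmeas_measurable continuous_intros h_cont C)
    have mG: "?G \<in> borel_measurable (wmeas a)"
    proof (rule borel_measurable_times_ennreal)
      show "(\<lambda>p. ennreal ((z p)\<^sup>2)) \<in> borel_measurable (wmeas a)"
        by (intro measurable_compose[OF _ measurable_ennreal] continuous_wmeas_measurable continuous_intros C1_cont C)
      have "{p::hpt. \<delta>/2 < snd p} \<in> sets borel"
        by (intro borel_open open_Collect_less continuous_intros)
      then show "indicator {p::hpt. \<delta>/2 < snd p} \<in> borel_measurable (wmeas a)"
        by (intro borel_wmeas_measurable borel_measurable_indicator)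
    qed
    have "(\<integral>\<^sup>+x. ennreal ((btr z x)\<^sup>2) \<partial>lborel) \<le> (\<integral>\<^sup>+x. ennreal \<epsilon> * ?I ?F x + ennreal K * ?I ?G x \<partial>lborel)"
    proof (rule nn_integral_mono_AE, use tr in \<open>rule AE_mp\<close>, intro AE_I2 impI)
      fix x assume "has_tr z x"
      then have "((\<lambda>s. ennreal ((z (x, s))\<^sup>2)) \<longlongrightarrow> ennreal ((btr z x)\<^sup>2)) (at_right 0)"
        by (intro tendsto_ennrealI tendsto_power has_tr_tendsto)
      then show "ennreal ((btr z x)\<^sup>2) \<le> ennreal \<epsilon> * ?I ?F x + ennreal K * ?I ?G x"
      proof (rule tendsto_upperbound)
        have "ennreal ((z (x, s))\<^sup>2) \<le> ennreal \<epsilon> * ?I ?F x + ennreal K * ?I ?G x" if s: "0 < s" "s < \<delta>" for s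
        proof -
          have "ennreal ((z (x, s))\<^sup>2) \<le> ennreal \<epsilon> * (\<integral>\<^sup>+y. ennreal (y powr a * (dy z (x, y))\<^sup>2) * indicator {0<..<\<delta>} y \<partial>lborel)
      + ennreal K * (\<integral>\<^sup>+y. ennreal (y powr a * (z (x, y))\<^sup>2) * indicator {\<delta>/2<..<\<delta>} y \<partial>lborel)"
            by (rule K(2)) (use s in \<open>auto intro!: slice_deriv C slice_cont h_cont\<close>)
          also have "\<dots> \<le> ennreal \<epsilon> * ?I ?F x + ennreal K * ?I ?G x"
            using \<delta> by (intro add_mono mult_left_mono nn_integral_mono) (auto simp: indicator_def ennreal_mult')
          finally show ?thesis .
        qed
        then show "\<forall>\<^sub>F s in at_right 0. ennreal ((z (x, s))\<^sup>2) \<le> ennreal \<epsilon> * ?I ?F x + ennreal K * ?I ?G x"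
          unfolding eventually_at_right_field using \<delta> by (intro exI[of _ \<delta>]) auto
      qed simp
    qed
    also have "\<dots> = ennreal \<epsilon> * (\<integral>\<^sup>+p. ?F p \<partial>wmeas a) + ennreal K * (\<integral>\<^sup>+p. ?G p \<partial>wmeas a)"
      using nn_integral_wmeas_slices(1)[OF mF] nn_integral_wmeas_slices(1)[OF mG]
      unfolding nn_integral_wmeas_slices(2)[OF mF] nn_integral_wmeas_slices(2)[OF mG]
      by (subst nn_integral_add) (auto simp: nn_integral_cmult)
    finally show "(\<integral>\<^sup>+x. ennreal ((btr z x)\<^sup>2) \<partial>lborel) \<le> ennreal \<epsilon> * (\<integral>\<^sup>+p. ?F p \<partial>wmeas a) + ennreal K * (\<integral>\<^sup>+p. ?G p \<partial>wmeas a)" .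
  qed (use K \<delta> in auto)
qed

section \<open>Test functions\<close>

text \<open>C^1 on the whole four-space and not only on the half-space, so a cutoff need not vanish
  at y = 0 and its trace is its restriction. Products with coordinates stay in the class.\<close>

definition cut :: "(hpt \<Rightarrow> real) \<Rightarrow> bool" where
  "cut \<psi> \<longleftrightarrow> C1 UNIV \<psi> \<and> (\<exists>R. \<forall>p. R \<le> norm p \<longrightarrow> \<psi> p = 0)"

text \<open>A C^1 subclass of \<open>admissible\<close> phrased with \<open>wmeas\<close>; it is
  stable under left translations (\<open>tst_flow\<close>), which is what testing the translated
  equation requires.\<close>

definition tst :: "real \<Rightarrow> (hpt \<Rightarrow> real) \<Rightarrow> bool" where
  "tst a \<xi> \<longleftrightarrow> C1 half_space \<xi> \<and> (\<exists>B. \<forall>p\<in>half_space. \<bar>\<xi> p\<bar> \<le> B) \<and>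
     (\<exists>R. \<forall>p\<in>half_space. R \<le> norm p \<longrightarrow> \<xi> p = 0) \<and>
     (\<integral>\<^sup>+p. ennreal (energy \<xi> \<xi> p) \<partial>wmeas a) < \<infinity>"

definition locbdd :: "(hpt \<Rightarrow> real) \<Rightarrow> bool" where
  "locbdd w \<longleftrightarrow> (\<forall>R. \<exists>B. \<forall>p\<in>half_ball R. \<bar>w p\<bar> \<le> B)"

lemma bounded_image_abs:
  fixes g :: "'a \<Rightarrow> real"
  assumes "bounded (g ` S)"
  obtains B where "\<And>q. q \<in> S \<Longrightarrow> \<bar>g q\<bar> \<le> B"
  using assms unfolding bounded_iff by (metis imageI real_norm_def)

lemma pd_vanish:
  assumes "open S" "p \<in> S" "\<And>q. q \<in> S \<Longrightarrow> g q = 0"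
  shows "pd v g p = 0"
  using pd_cong[OF assms(1,2), of g "\<lambda>_. 0" v] assms(3) by simp

lemma h_vanish:
  assumes "open S" "p \<in> S" "\<And>q. q \<in> S \<Longrightarrow> g q = 0"
  shows "hX g p = 0" "hY g p = 0" "dy g p = 0" "energy g w p = 0" "energy w g p = 0"
  using pd_vanish[OF assms] by (simp_all add: hX_def hY_def dy_def energy_def)

lemma open_outside: "open {p::hpt. R < norm p}"
  by (intro open_Collect_less continuous_intros)

lemma cut_bounds:
  assumes "cut \<psi>"
  obtains R B where "R > 0" "B \<ge> 0" "\<And>p. \<bar>\<psi> p\<bar> \<le> B" "\<And>p. energy \<psi> \<psi> p \<le> B"
    "\<And>p. R \<le> norm p \<Longrightarrow> \<psi> p = 0" "\<And>p. R \<le> norm p \<Longrightarrow> energy \<psi> \<psi> p = 0"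
proof -
  obtain R0 where R0: "\<And>p. R0 \<le> norm p \<Longrightarrow> \<psi> p = 0" and C: "C1 UNIV \<psi>" using assms by (auto simp: cut_def)
  define R where "R = \<bar>R0\<bar> + 1"
  have z: "energy \<psi> \<psi> p = 0" if "R \<le> norm p" for p
    by (rule h_vanish(4)[OF open_outside[of "\<bar>R0\<bar>"]]) (use that in \<open>auto simp: R_def intro!: R0\<close>)
  have z': "\<psi> p = 0" if "R \<le> norm p" for p using that by (intro R0) (auto simp: R_def)
  have "bounded (\<psi> ` cball 0 R)" "bounded (energy \<psi> \<psi> ` cball 0 R)"
    by (intro compact_imp_bounded compact_continuous_image continuous_on_subset[OF C1_cont[OF C]]
      continuous_on_subset[OF energy_cont[OF C C]] compact_cball subset_UNIV)+
  then obtain B1 B2 where B: "\<And>p. p \<in> cball 0 R \<Longrightarrow> \<bar>\<psi> p\<bar> \<le> B1" "\<And>p. p \<in> cball 0 R \<Longrightarrow> \<bar>energy \<psi> \<psi> p\<bar> \<le> B2"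
    unfolding bounded_iff real_norm_def by blast
  show ?thesis
  proof (rule that[of R "\<bar>B1\<bar> + \<bar>B2\<bar>"])
    show "\<bar>\<psi> p\<bar> \<le> \<bar>B1\<bar> + \<bar>B2\<bar>" for p
      using B(1)[of p] z'[of p] by (cases "norm p \<le> R") auto
    show "energy \<psi> \<psi> p \<le> \<bar>B1\<bar> + \<bar>B2\<bar>" for p
      using B(2)[of p] z[of p] by (cases "norm p \<le> R") auto
  qed (use z z' in \<open>auto simp: R_def\<close>)
qed

lemma cut_C1: "cut \<psi> \<Longrightarrow> C1 S \<psi>"
  unfolding cut_def using C1_subset by blast

lemma cut_mult_C1:
  assumes "cut \<psi>" "C1 UNIV g"
  shows "cut (\<lambda>p. \<psi> p * g p)"
  using assms by (auto simp: cut_def)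

lemma cut_mult: "cut \<psi> \<Longrightarrow> cut \<eta> \<Longrightarrow> cut (\<lambda>p. \<psi> p * \<eta> p)"
  by (rule cut_mult_C1) (simp_all add: cut_def)

text \<open>Squaring smooths the corner: at 0 the difference quotient max(0,h)^2 / h is at most |h|
  in absolute value.\<close>

lemma max0_sq_deriv: "((\<lambda>t::real. (max 0 t)\<^sup>2) has_real_derivative 2 * max 0 t) (at t)"
proof (cases t "0::real" rule: linorder_cases)
  case less
  have "((\<lambda>t::real. 0) has_real_derivative 0) (at t)" by simp
  from has_field_derivative_transform_within_open[OF this open_lessThan[of 0]] less
  show ?thesis by auto
next
  case equal
  have "((\<lambda>h::real. (max 0 h)\<^sup>2 / h) \<longlongrightarrow> 0) (at 0)"
  proof (rule Lim_null_comparison)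
    show "\<forall>\<^sub>F h in at (0::real). norm ((max 0 h)\<^sup>2 / h) \<le> \<bar>h\<bar>"
      by (intro always_eventually allI) (auto simp: max_def power2_eq_square)
    show "((\<lambda>h::real. \<bar>h\<bar>) \<longlongrightarrow> 0) (at 0)" by (intro tendsto_rabs_zero tendsto_ident_at)
  qed
  then show ?thesis using equal by (simp add: DERIV_def)
next
  case greater
  have "((\<lambda>t::real. t\<^sup>2) has_real_derivative 2 * t) (at t)" by (auto intro!: derivative_eq_intros)
  from has_field_derivative_transform_within_open[OF this open_greaterThan[of 0]] greater
  show ?thesis by auto
qed

text \<open>With g = 1 - |p|^2 / (4 R^2) the function 2 max(0,g)^2 is C^1 and vanishes for |p| \<ge>
  2 R. For |p| \<le> R one has g \<ge> 3/4, so its value is at least 2 (3/4)^2 = 9/8; only a lower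
  bound by 1 is asked for.\<close>

lemma cut_exists:
  assumes "R > 0"
  obtains \<psi> where "cut \<psi>" "\<And>p. \<psi> p \<ge> 0" "\<And>p. norm p \<le> R \<Longrightarrow> \<psi> p \<ge> 1"
proof -
  define g where "g = (\<lambda>p::hpt. 1 - (p \<bullet> p) / (4 * R\<^sup>2))"
  have "C1 UNIV (\<lambda>p::hpt. p \<bullet> p)"
    by (rule C1I[of _ _ "\<lambda>p v. 2 * (p \<bullet> v)"])
       (auto intro!: derivative_eq_intros continuous_intros simp: inner_commute)
  then have "C1 UNIV g" unfolding g_def divide_inverse mult.commute[of _ "inverse _"]
    by (intro C1_minus C1_const C1_cmult)
  then have C: "C1 UNIV (\<lambda>p. 2 * (max 0 (g p))\<^sup>2)"
    by (intro C1_cmult C1_chain[where h = "\<lambda>t. (max 0 t)\<^sup>2" and h' = "\<lambda>t. 2 * max 0 t"] max0_sq_deriv)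
       (auto intro!: continuous_intros)
  show ?thesis
  proof (rule that)
    have "g p \<le> 0" if "2 * R \<le> norm p" for p
    proof -
      have "(2 * R)\<^sup>2 \<le> (norm p)\<^sup>2" using that assms by (intro power_mono) auto
      then show ?thesis using assms by (simp add: g_def power2_norm_eq_inner power_mult_distrib)
    qed
    then show "cut (\<lambda>p. 2 * (max 0 (g p))\<^sup>2)" using C unfolding cut_def by (intro conjI exI[of _ "2 * R"]) auto
    show "1 \<le> 2 * (max 0 (g p))\<^sup>2" if "norm p \<le> R" for p
    proof -
      have "(norm p)\<^sup>2 \<le> R\<^sup>2" using that by (intro power_mono) auto
      then have "3/4 \<le> g p" using assms by (simp add: g_def power2_norm_eq_inner field_simps)
      then have "(3/4)\<^sup>2 \<le> (max 0 (g p))\<^sup>2" by (intro power_mono) auto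
      then show ?thesis by (simp add: power2_eq_square)
    qed
  qed simp
qed

lemma C1_locally_lipschitz:
  assumes C: "C1 half_space g"
  shows "locally_lipschitz_on half_space g"
  unfolding locally_lipschitz_on_def
proof
  fix p assume "p \<in> half_space"
  then obtain r where r: "r > 0" "cball p r \<subseteq> half_space"
    using open_half_space open_contains_cball by blast
  have "\<exists>B. \<forall>q\<in>cball p r. \<bar>pd b g q\<bar> \<le> B" for b
  proof -
    have "bounded (pd b g ` cball p r)"
      by (intro compact_imp_bounded compact_continuous_image continuous_on_subset[OF C1_pd[OF C] r(2)] compact_cball)
    then show ?thesis by (rule bounded_image_abs) blast
  qed
  then have "\<forall>b. \<exists>B. \<forall>q\<in>cball p r. \<bar>pd b g q\<bar> \<le> B" by (rule allI)
  then obtain B where "\<forall>b. \<forall>q\<in>cball p r. \<bar>pd b g q\<bar> \<le> B b" by (rule choice[THEN exE])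
  then have B: "\<bar>pd b g q\<bar> \<le> B b" if "q \<in> cball p r" for b q using that by blast
  \<comment> \<open>Each coordinate of v is at most |v|, so the sum of the bounds over the basis
    dominates the operator norm of the derivative.\<close>
  define L where "L = (\<Sum>b\<in>(Basis::hpt set). \<bar>B b\<bar>)"
  have "L-lipschitz_on (cball p r) g"
  proof (rule bounded_derivative_imp_lipschitz)
    show "(g has_derivative (\<lambda>v. pd v g q)) (at q within cball p r)" if "q \<in> cball p r" for q
      by (rule has_derivative_at_withinI[OF has_derivative_pd[OF C1_diff[OF C subsetD[OF r(2) that]]]])
    show "onorm (\<lambda>v. pd v g q) \<le> L" if q: "q \<in> cball p r" for q
    proof (rule onorm_bound)
      show "norm (pd v g q) \<le> L * norm v" for v
      proof -
        have "\<bar>pd v g q\<bar> \<le> (\<Sum>b\<in>Basis. \<bar>(v \<bullet> b) * pd b g q\<bar>)"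
          unfolding pd_basis_sum[OF C1_diff[OF C subsetD[OF r(2) q]], of v] by (rule sum_abs)
        also have "\<dots> \<le> (\<Sum>b\<in>Basis. norm v * \<bar>B b\<bar>)"
        proof (rule sum_mono)
          fix b :: hpt assume b: "b \<in> Basis"
          have "\<bar>pd b g q\<bar> \<le> \<bar>B b\<bar>" using B[OF q, of b] by linarith
          then show "\<bar>(v \<bullet> b) * pd b g q\<bar> \<le> norm v * \<bar>B b\<bar>"
            unfolding abs_mult by (intro mult_mono Basis_le_norm b) simp_all
        qed
        finally show ?thesis by (simp add: L_def sum_distrib_left mult.commute)
      qed
    qed (simp add: L_def sum_nonneg)
  qed (auto simp: L_def sum_nonneg)
  then have "L-lipschitz_on (ball p r \<inter> half_space) g" by (rule lipschitz_on_subset) auto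
  then show "\<exists>r>0. \<exists>L. L-lipschitz_on (ball p r \<inter> half_space) g" using r by blast
qed

lemma integrable_nn_bound:
  fixes F G :: "hpt \<Rightarrow> real"
  assumes "F \<in> borel_measurable (wmeas a)" "(\<integral>\<^sup>+p. ennreal (G p) \<partial>wmeas a) < \<infinity>"
    "\<And>p. p \<in> half_space \<Longrightarrow> \<bar>F p\<bar> \<le> G p"
  shows "integrable (wmeas a) F"
proof (rule integrableI_bounded[OF assms(1)])
  have "(\<integral>\<^sup>+p. ennreal (norm (F p)) \<partial>wmeas a) \<le> (\<integral>\<^sup>+p. ennreal (G p) \<partial>wmeas a)"
    using assms(3) by (intro nn_integral_mono ennreal_leI) auto
  then show "(\<integral>\<^sup>+p. ennreal (norm (F p)) \<partial>wmeas a) < \<infinity>" using assms(2) by (rule order_le_less_trans)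
qed

lemma tst_admissible:
  assumes "tst a \<xi>"
  shows "admissible a \<xi>"
proof -
  obtain B R where B: "\<And>p. p \<in> half_space \<Longrightarrow> \<bar>\<xi> p\<bar> \<le> B" and R: "\<And>p. p \<in> half_space \<Longrightarrow> R \<le> norm p \<Longrightarrow> \<xi> p = 0"
    and C: "C1 half_space \<xi>" and fin: "(\<integral>\<^sup>+p. ennreal (energy \<xi> \<xi> p) \<partial>wmeas a) < \<infinity>"
    using assms by (auto simp: tst_def)
  have me: "energy \<xi> \<xi> \<in> borel_measurable (wmeas a)" by (intro continuous_wmeas_measurable energy_cont C)
  have m: "(\<lambda>p. indicator (half_ball (\<bar>R\<bar> + 1)) p * energy \<xi> \<xi> p) \<in> borel_measurable (wmeas a)"
    using me by (intro borel_measurable_times) auto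
  have "integrable (wmeas a) (\<lambda>p. indicator (half_ball (\<bar>R\<bar> + 1)) p * energy \<xi> \<xi> p)"
    by (rule integrable_nn_bound[OF m fin]) (auto simp: indicator_def)
  then have "set_integrable lebesgue (half_ball (\<bar>R\<bar> + 1)) (\<lambda>p. snd p powr a * (norm (gradHh \<xi> p))\<^sup>2)"
    using wmeas_set_integral_subset(1)[OF m] by (auto simp: norm_gradHh_sq half_ball_def)
  moreover have "\<xi> p = 0" if "p \<in> half_space - ball 0 (\<bar>R\<bar> + 1)" for p
    using that by (intro R) auto
  moreover have "bounded (\<xi> ` half_space)" using B unfolding bounded_iff real_norm_def by blast
  ultimately show ?thesis unfolding admissible_def using C1_locally_lipschitz[OF C]
    by (intro conjI exI[of _ "\<bar>R\<bar> + 1"]) auto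
qed

text \<open>\<open>locbdd\<close> serves the boundedness clause of test functions and
  \<open>Hloc\<close> the energy clause. In 2 B + 2 B^2 the B bounds the energy of \<psi>, the B^2
  bounds \<psi>^2.\<close>

lemma tst_mult_cut:
  assumes w: "Hloc a w" "locbdd w" and \<psi>: "cut \<psi>"
  shows "tst a (\<lambda>p. w p * \<psi> p)"
proof -
  have C: "C1 half_space w" using w by (simp add: Hloc_def)
  obtain R B where RB: "R > 0" "B \<ge> 0" "\<And>p. \<bar>\<psi> p\<bar> \<le> B" "\<And>p. energy \<psi> \<psi> p \<le> B"
    "\<And>p. R \<le> norm p \<Longrightarrow> \<psi> p = 0" "\<And>p. R \<le> norm p \<Longrightarrow> energy \<psi> \<psi> p = 0"
    using cut_bounds[OF \<psi>] by metis
  obtain D where D: "\<And>p. p \<in> half_ball R \<Longrightarrow> \<bar>w p\<bar> \<le> D" using w(2) unfolding locbdd_def by blast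
  have hb: "p \<in> half_ball R" if "p \<in> half_space" "\<not> R \<le> norm p" for p using that by (auto simp: half_ball_def)
  have bd: "\<bar>w p * \<psi> p\<bar> \<le> \<bar>D\<bar> * B" if "p \<in> half_space" for p
  proof (cases "R \<le> norm p")
    case False
    then have "\<bar>w p\<bar> \<le> \<bar>D\<bar>" using D[OF hb[OF that]] by simp
    then show ?thesis unfolding abs_mult using RB by (intro mult_mono) auto
  qed (use RB in simp)
  have le: "(\<integral>\<^sup>+p. ennreal (energy (\<lambda>p. w p * \<psi> p) (\<lambda>p. w p * \<psi> p) p) \<partial>wmeas a)
    \<le> (\<integral>\<^sup>+p. ennreal (2 * B + 2 * B\<^sup>2) * (ennreal ((w p)\<^sup>2 + energy w w p) * indicator (half_ball R) p) \<partial>wmeas a)" (is "_ \<le> ?U")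
  proof (rule nn_integral_mono)
    fix p assume "p \<in> space (wmeas a)"
    then have p: "p \<in> half_space" by simp
    have le: "energy (\<lambda>p. w p * \<psi> p) (\<lambda>p. w p * \<psi> p) p \<le> 2 * (w p)\<^sup>2 * energy \<psi> \<psi> p + 2 * (\<psi> p)\<^sup>2 * energy w w p"
      by (rule energy_mult_le) (use p C1_diff[OF C] C1_diff[OF cut_C1[OF \<psi>]] in auto)
    show "ennreal (energy (\<lambda>p. w p * \<psi> p) (\<lambda>p. w p * \<psi> p) p) \<le> ennreal (2 * B + 2 * B\<^sup>2) * (ennreal ((w p)\<^sup>2 + energy w w p) * indicator (half_ball R) p)"
    proof (cases "R \<le> norm p")
      case True
      then have "energy (\<lambda>p. w p * \<psi> p) (\<lambda>p. w p * \<psi> p) p \<le> 0" using le RB by simp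
      then show ?thesis by (simp add: ennreal_neg)
    next
      case False
      have "(w p)\<^sup>2 * energy \<psi> \<psi> p \<le> (w p)\<^sup>2 * B" using RB by (intro mult_left_mono) auto
      moreover have "(\<psi> p)\<^sup>2 \<le> B\<^sup>2" using RB(3)[of p] by (metis abs_ge_zero power2_abs power_mono)
      then have "(\<psi> p)\<^sup>2 * energy w w p \<le> B\<^sup>2 * energy w w p" by (intro mult_right_mono) auto
      moreover have "0 \<le> B * energy w w p" "0 \<le> B\<^sup>2 * (w p)\<^sup>2" using RB by auto
      moreover have "(2 * B + 2 * B\<^sup>2) * ((w p)\<^sup>2 + energy w w p) =
         2 * ((w p)\<^sup>2 * B) + 2 * (B * energy w w p) + 2 * (B\<^sup>2 * (w p)\<^sup>2) + 2 * (B\<^sup>2 * energy w w p)"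
        by (simp add: algebra_simps)
      ultimately have "energy (\<lambda>p. w p * \<psi> p) (\<lambda>p. w p * \<psi> p) p \<le> (2 * B + 2 * B\<^sup>2) * ((w p)\<^sup>2 + energy w w p)"
        using le unfolding mult.assoc by linarith
      note le' = ennreal_leI[OF this]
      have c0: "0 \<le> 2 * B + 2 * B\<^sup>2" using RB by simp
      have ind: "indicator (half_ball R) p = (1 :: ennreal)" using hb[OF p False] by simp
      show ?thesis using le' unfolding ennreal_mult'[OF c0] ind mult_1_right .
    qed
  qed
  have fin: "?U < \<infinity>"
  proof -
    have "(\<lambda>p. ennreal ((w p)\<^sup>2 + energy w w p)) \<in> borel_measurable (wmeas a)"
      by (intro measurable_compose[OF _ measurable_ennreal] continuous_wmeas_measurable continuous_intros energy_cont C1_cont C)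
    then have "(\<lambda>p. ennreal ((w p)\<^sup>2 + energy w w p) * indicator (half_ball R) p) \<in> borel_measurable (wmeas a)"
      by (rule borel_measurable_times_ennreal) simp
    then show ?thesis using w(1) by (subst nn_integral_cmult) (auto simp: Hloc_def ennreal_mult_less_top)
  qed
  show ?thesis unfolding tst_def
  proof (intro conjI)
    show "C1 half_space (\<lambda>p. w p * \<psi> p)" by (rule C1_mult[OF C cut_C1[OF \<psi>]])
    show "\<exists>B. \<forall>p\<in>half_space. \<bar>w p * \<psi> p\<bar> \<le> B" using bd by blast
    show "\<exists>R. \<forall>p\<in>half_space. R \<le> norm p \<longrightarrow> w p * \<psi> p = 0" by (intro exI[of _ R]) (simp add: RB(5))
  qed (rule order_le_less_trans[OF le fin])
qed

text \<open>Joint continuity on a compact set. The time interval is symmetric so that the inverse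
  flow is covered too.\<close>

lemma flow_bounded_image:
  "\<exists>R2. \<forall>t\<in>{-1..1}. \<forall>q. norm q \<le> R \<longrightarrow> norm (flow (fld k \<alpha> \<beta> \<tau>) t q) \<le> R2"
proof -
  have "compact ((\<lambda>z. flow (fld k \<alpha> \<beta> \<tau>) (fst z) (snd z)) ` ({-1..1} \<times> cball 0 R))"
    by (intro compact_continuous_image continuous_on_flow continuous_intros compact_Times compact_Icc compact_cball)
  then have "bounded ((\<lambda>z. flow (fld k \<alpha> \<beta> \<tau>) (fst z) (snd z)) ` ({-1..1} \<times> cball 0 R))"
    by (rule compact_imp_bounded)
  then obtain R2 where R2: "\<And>z. z \<in> {-1..1} \<times> cball 0 R \<Longrightarrow> norm (flow (fld k \<alpha> \<beta> \<tau>) (fst z) (snd z)) \<le> R2"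
    unfolding bounded_iff by blast
  show ?thesis
  proof (intro exI[of _ R2] ballI allI impI)
    fix t :: real and q :: hpt assume "t \<in> {-1..1}" "norm q \<le> R"
    then show "norm (flow (fld k \<alpha> \<beta> \<tau>) t q) \<le> R2" using R2[of "(t, q)"] by auto
  qed
qed

section \<open>Compact slabs away from y = 0 and integration along flows\<close>

definition slab :: "real \<Rightarrow> real \<Rightarrow> hpt set" where
  "slab \<delta> R = {p. norm p \<le> R \<and> \<delta> \<le> snd p}"

lemma slab_half_space: "\<delta> > 0 \<Longrightarrow> slab \<delta> R \<subseteq> half_space"
  by (auto simp: slab_def half_space_def)

lemma compact_slab: "compact (slab \<delta> R)"
proof -
  have "slab \<delta> R = cball 0 R \<inter> {p. \<delta> \<le> snd p}" by (auto simp: slab_def)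
  moreover have "closed {p::hpt. \<delta> \<le> snd p}" by (intro closed_Collect_le continuous_intros)
  ultimately show ?thesis by (simp add: compact_Int_closed)
qed

lemma slab_sets: "\<delta> > 0 \<Longrightarrow> slab \<delta> R \<in> sets (wmeas a)"
  using compact_slab slab_half_space by (intro borel_set_wmeas borel_compact) auto

lemma slab_finite:
  assumes "a > -1" "\<delta> > 0"
  shows "emeasure (wmeas a) (slab \<delta> R) < \<infinity>"
proof -
  have "slab \<delta> R \<subseteq> half_ball (R + 1)" using assms by (auto simp: slab_def half_ball_def half_space_def)
  then have "emeasure (wmeas a) (slab \<delta> R) \<le> emeasure (wmeas a) (half_ball (R + 1))" by (intro emeasure_mono) auto
  then show ?thesis using emeasure_half_ball[OF assms(1)] by (rule order_le_less_trans)
qed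

lemma continuous_slab_bounded:
  assumes "continuous_on half_space g" "\<delta> > 0"
  obtains B :: real where "B \<ge> 0" "\<And>p. p \<in> slab \<delta> R \<Longrightarrow> \<bar>g p\<bar> \<le> B"
proof -
  have "bounded (g ` slab \<delta> R)"
    by (intro compact_imp_bounded compact_continuous_image compact_slab continuous_on_subset[OF assms(1)] slab_half_space assms(2))
  then obtain B where B: "\<And>p. p \<in> slab \<delta> R \<Longrightarrow> \<bar>g p\<bar> \<le> B" by (rule bounded_image_abs) blast
  show ?thesis
  proof (rule that[of "\<bar>B\<bar>"])
    fix p assume "p \<in> slab \<delta> R"
    then have "\<bar>g p\<bar> \<le> B" by (rule B)
    then show "\<bar>g p\<bar> \<le> \<bar>B\<bar>" by linarith
  qed (rule abs_ge_zero)
qed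

text \<open>Integrate the derivative of F along flow lines from 0 to h and exchange the order of
  integration. The weight k lives in a slab, so the double integrand is bounded and vanishes off a
  set of finite measure.\<close>

lemma flow_fubini:
  fixes k F :: "hpt \<Rightarrow> real" and \<alpha> \<beta> \<tau> \<kappa> :: real
  defines "V \<equiv> fld \<kappa> \<alpha> \<beta> \<tau>"
  assumes a: "a > -1" and F: "C1 half_space F" and F': "continuous_on half_space (\<lambda>p. pd (V p) F p)"
    and k: "k \<in> borel_measurable (wmeas a)" "\<And>p. \<bar>k p\<bar> \<le> B" "\<And>p. p \<notin> slab \<delta> R \<Longrightarrow> k p = 0" and \<delta>: "\<delta> > 0"
    and h: "h \<ge> 0"
  shows "(\<integral>p. k p * (F (flow V h p) - F p) \<partial>wmeas a)
     = (\<integral>t. (\<integral>p. k p * pd (V (flow V t p)) F (flow V t p) \<partial>wmeas a) * indicator {0..h} t \<partial>lborel)"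
    (is "?L = ?R")
proof -
  let ?M = "wmeas a"
  interpret M: sigma_finite_measure ?M by (rule sigma_finite_wmeas)
  interpret P: pair_sigma_finite ?M "lborel :: real measure" ..
  let ?F' = "\<lambda>p. pd (V p) F p"
  let ?f = "\<lambda>p t. k p * ?F' (flow V t p) * indicator {0..h} t"
  have mf: "(\<lambda>z. flow V (snd z) (fst z)) \<in> measurable (?M \<Otimes>\<^sub>M lborel) ?M"
  proof -
    have i: "(\<lambda>p. p) \<in> measurable ?M borel" by (rule borel_wmeas_measurable) simp
    have 1: "fst \<in> measurable (?M \<Otimes>\<^sub>M (lborel :: real measure)) borel"
      using measurable_compose[OF measurable_fst i] .
    have 2: "snd \<in> measurable (?M \<Otimes>\<^sub>M (lborel :: real measure)) borel"
      using measurable_snd[of ?M "lborel :: real measure"] by simp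
    have 3: "(\<lambda>z. (snd z, fst z)) \<in> measurable (?M \<Otimes>\<^sub>M (lborel :: real measure)) (borel \<Otimes>\<^sub>M borel)"
      using 1 2 by (intro measurable_Pair)
    have 4: "(\<lambda>z. flow V (fst z) (snd z)) \<in> borel_measurable (borel :: (real \<times> hpt) measure)"
      unfolding V_def by (intro borel_measurable_continuous_onI continuous_on_flow continuous_intros)
    have "(\<lambda>z. flow V (snd z) (fst z)) \<in> measurable (?M \<Otimes>\<^sub>M (lborel :: real measure)) borel"
      using measurable_compose[OF 3[unfolded borel_prod] 4] by (simp only: fst_conv snd_conv)
    then have "(\<lambda>z. flow V (snd z) (fst z)) \<in> measurable (?M \<Otimes>\<^sub>M (lborel :: real measure)) (restrict_space borel half_space)"
      by (intro measurable_restrict_space2) (auto simp: V_def space_pair_measure)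
    then show ?thesis by (simp add: measurable_cong_sets[OF refl sets_wmeas])
  qed
  have mF: "?F' \<in> borel_measurable ?M" by (rule continuous_wmeas_measurable[OF F'])
  have m: "case_prod ?f \<in> borel_measurable (?M \<Otimes>\<^sub>M lborel)"
    unfolding split_beta'
    by (intro borel_measurable_times measurable_compose[OF mf mF] measurable_compose[OF measurable_fst k(1)]
       measurable_compose[OF measurable_snd]) auto
  \<comment> \<open>The slab swept out by the flow for times in [0, h] is a compact subset of the
    half-space, because y is kept; so the derivative of F is bounded there.\<close>
  have "compact ((\<lambda>z. flow V (fst z) (snd z)) ` ({0..h} \<times> slab \<delta> R))"
    unfolding V_def by (intro compact_continuous_image continuous_on_flow continuous_intros compact_Times compact_Icc compact_slab)
  moreover have "(\<lambda>z. flow V (fst z) (snd z)) ` ({0..h} \<times> slab \<delta> R) \<subseteq> half_space"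
  proof (rule image_subsetI)
    fix z assume "z \<in> {0..h} \<times> slab \<delta> R"
    then have "snd z \<in> half_space" using slab_half_space[OF \<delta>, of R] unfolding mem_Times_iff by blast
    then show "flow V (fst z) (snd z) \<in> half_space" unfolding V_def by simp
  qed
  ultimately have "compact (?F' ` ((\<lambda>z. flow V (fst z) (snd z)) ` ({0..h} \<times> slab \<delta> R)))"
    using compact_continuous_image[OF continuous_on_subset[OF F']] by blast
  then have "bounded (?F' ` ((\<lambda>z. flow V (fst z) (snd z)) ` ({0..h} \<times> slab \<delta> R)))" by (rule compact_imp_bounded)
  then obtain D where D: "\<And>z. z \<in> {0..h} \<times> slab \<delta> R \<Longrightarrow> \<bar>?F' (flow V (fst z) (snd z))\<bar> \<le> D"
    unfolding bounded_iff real_norm_def by blast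
  have int: "integrable (?M \<Otimes>\<^sub>M lborel) (case_prod ?f)"
  proof (rule integrableI_bounded_set[OF _ m])
    show "slab \<delta> R \<times> {0..h} \<in> sets (?M \<Otimes>\<^sub>M lborel)" using slab_sets[OF \<delta>] by (intro pair_measureI) auto
    have "emeasure (?M \<Otimes>\<^sub>M lborel) (slab \<delta> R \<times> {0..h}) = emeasure ?M (slab \<delta> R) * emeasure lborel {0..h}"
      using slab_sets[OF \<delta>] by (intro lborel.emeasure_pair_measure_Times) auto
    then show "emeasure (?M \<Otimes>\<^sub>M lborel) (slab \<delta> R \<times> {0..h}) < \<infinity>"
      using slab_finite[OF a \<delta>, of R] h by (simp add: ennreal_mult_less_top)
    show "AE x\<in>slab \<delta> R \<times> {0..h} in ?M \<Otimes>\<^sub>M lborel. norm (case_prod ?f x) \<le> \<bar>B\<bar> * \<bar>D\<bar>"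
    proof (intro AE_I2 impI)
      fix x assume x: "x \<in> slab \<delta> R \<times> {0..h}"
      obtain p t where pt: "x = (p, t)" by (cases x)
      have "\<bar>k p\<bar> * \<bar>?F' (flow V t p)\<bar> \<le> \<bar>B\<bar> * \<bar>D\<bar>"
        using k(2)[of p] D[of "(t, p)"] x pt by (intro mult_mono) auto
      then show "norm (case_prod ?f x) \<le> \<bar>B\<bar> * \<bar>D\<bar>" by (auto simp: pt abs_mult indicator_def)
    qed
    show "AE x in ?M \<Otimes>\<^sub>M lborel. x \<notin> slab \<delta> R \<times> {0..h} \<longrightarrow> case_prod ?f x = 0"
    proof (intro AE_I2 impI)
      fix x assume x: "x \<notin> slab \<delta> R \<times> {0..h}"
      obtain p t where pt: "x = (p, t)" by (cases x)
      show "case_prod ?f x = 0" using x k(3)[of p] unfolding pt by (cases "t \<in> {0..h}") auto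
    qed
  qed
  have "?L = (\<integral>p. (\<integral>t. ?f p t \<partial>lborel) \<partial>?M)"
  proof (rule Bochner_Integration.integral_cong[OF refl])
    fix p assume "p \<in> space ?M"
    then have p: "p \<in> half_space" by simp
    have "(\<integral>t. ?F' (flow V t p) * indicator {0..h} t \<partial>lborel) = F (flow V h p) - F (flow V 0 p)"
    proof (rule integral_FTC_Icc_real[OF h])
      show "((\<lambda>t. F (flow V t p)) has_real_derivative ?F' (flow V t p)) (at t)" for t
        unfolding V_def by (rule flow_line_deriv[OF F p])
      have "continuous_on UNIV (\<lambda>t. ?F' (flow V t p))"
        by (rule continuous_on_compose2[OF F']) (auto simp: V_def p intro!: continuous_intros)
      then show "isCont (\<lambda>t. ?F' (flow V t p)) t" for t using continuous_on_eq_continuous_at by blast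
    qed
    then show "k p * (F (flow V h p) - F p) = (\<integral>t. ?f p t \<partial>lborel)"
      by (simp add: mult.assoc)
  qed
  also have "\<dots> = (\<integral>t. (\<integral>p. ?f p t \<partial>?M) \<partial>lborel)" by (rule P.Fubini_integral[OF int, symmetric])
  also have "\<dots> = ?R" by simp
  finally show ?thesis .
qed

lemma flow_difference_bound:
  fixes k F :: "hpt \<Rightarrow> real" and \<alpha> \<beta> \<tau> \<kappa> :: real
  defines "V \<equiv> fld \<kappa> \<alpha> \<beta> \<tau>"
  assumes a: "a > -1" and F: "C1 half_space F" and F': "continuous_on half_space (\<lambda>p. pd (V p) F p)"
    and k: "k \<in> borel_measurable (wmeas a)" "\<And>p. \<bar>k p\<bar> \<le> B" "\<And>p. p \<notin> slab \<delta> R \<Longrightarrow> k p = 0" and \<delta>: "\<delta> > 0"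
    and h: "h \<ge> 0" and N: "\<And>t. t \<in> {0..h} \<Longrightarrow> \<bar>\<integral>p. k p * pd (V (flow V t p)) F (flow V t p) \<partial>wmeas a\<bar> \<le> N"
  shows "\<bar>\<integral>p. k p * (F (flow V h p) - F p) \<partial>wmeas a\<bar> \<le> h * N"
proof -
  let ?J = "\<lambda>t. (\<integral>p. k p * pd (V (flow V t p)) F (flow V t p) \<partial>wmeas a) * indicator {0..h} t"
  have N0: "N \<ge> 0" using N[of 0] h by (auto intro: order_trans[OF abs_ge_zero])
  have i: "integrable lborel (\<lambda>t. N * indicator {0..h} t)" using h by simp
  have "norm (\<integral>t. ?J t \<partial>lborel) \<le> (\<integral>t. N * indicator {0..h} t \<partial>lborel)"
  \<comment> \<open>Integrability in t of the inner integral is not examined: if it failed, the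
    Bochner integral would be 0 by default and the bound would hold because N \<ge> 0.\<close>
  proof (cases "integrable lborel ?J")
    case True
    show ?thesis
      by (rule Bochner_Integration.integral_norm_bound_integral[OF True i]) (use N N0 in \<open>auto simp: indicator_def\<close>)
  next
    case False
    then show ?thesis using N0 h by (simp add: not_integrable_integral_eq)
  qed
  also have "\<dots> = h * N" using h by simp
  finally show ?thesis
    using flow_fubini[OF a F F'[unfolded V_def] k \<delta> h] unfolding V_def by simp
qed

text \<open>Integration by parts from invariance: F and its translate along the flow have the same
  integral, and their difference is the time integral of the derivative, whose space integral does
  not depend on time. Cutting at y \<ge> \<delta> is compatible with the flow, which keeps y, and
  avoids any integrability question at y = 0.\<close>

lemma integral_slab_derivative_zero:
  fixes F :: "hpt \<Rightarrow> real" and \<alpha> \<beta> \<tau> \<kappa> :: real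
  defines "V \<equiv> fld \<kappa> \<alpha> \<beta> \<tau>"
  assumes a: "a > -1" and F: "C1 half_space F" and F': "continuous_on half_space (\<lambda>p. pd (V p) F p)"
    and F0: "\<And>p. p \<in> half_space \<Longrightarrow> R \<le> norm p \<Longrightarrow> F p = 0" and \<delta>: "\<delta> > 0"
  shows "(\<integral>p. indicator {p. \<delta> \<le> snd p} p * pd (V p) F p \<partial>wmeas a) = 0"
proof -
  let ?M = "wmeas a"
  let ?F' = "\<lambda>p. pd (V p) F p"
  let ?c = "\<lambda>p::hpt. indicator {p. \<delta> \<le> snd p} p :: real"
  have F'0: "?F' p = 0" if p: "p \<in> half_space" and n: "\<bar>R\<bar> < norm p" for p
  proof (rule pd_vanish)
    show "open (half_space \<inter> {p. \<bar>R\<bar> < norm p})" by (intro open_Int open_half_space open_outside)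
    show "p \<in> half_space \<inter> {p. \<bar>R\<bar> < norm p}" using p n by blast
    show "F q = 0" if "q \<in> half_space \<inter> {p. \<bar>R\<bar> < norm p}" for q
      using that by (intro F0) (auto intro: order_trans[OF abs_ge_self])
  qed
  obtain R2 where R2: "\<And>t q. t \<in> {-1..1} \<Longrightarrow> norm q \<le> \<bar>R\<bar> \<Longrightarrow> norm (flow V t q) \<le> R2"
    using flow_bounded_image[of "\<bar>R\<bar>" \<kappa> \<alpha> \<beta> \<tau>] unfolding V_def by blast
  have out: "\<bar>R\<bar> < norm (flow V t p)" if "t \<in> {-1..1}" "\<not> norm p \<le> R2" for t p
  proof (rule ccontr)
    assume "\<not> \<bar>R\<bar> < norm (flow V t p)"
    then have "norm (flow V (- t) (flow V t p)) \<le> R2" using that by (intro R2) auto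
    then show False using that by (simp add: V_def)
  qed
  \<comment> \<open>R2 is so large that, for times in [-1, 1], the flow can enter the support of F
    only from points with |p| \<le> R2. So this fixed indicator may replace the half-space cutoff
    composed with the flow.\<close>
  define k where "k = (\<lambda>p. indicator (slab \<delta> R2) p :: real)"
  have km: "k \<in> borel_measurable ?M" unfolding k_def using slab_sets[OF \<delta>] by simp
  have cm: "?c \<in> borel_measurable ?M"
    by (intro borel_wmeas_measurable borel_measurable_indicator borel_closed closed_Collect_le continuous_intros)
  have snd_V: "snd (flow V t p) = snd p" "flow V t p \<in> half_space \<longleftrightarrow> p \<in> half_space" for t p by (simp_all add: V_def)
  have eq: "k p * G (flow V t p) = ?c (flow V t p) * G (flow V t p)"
    if p: "p \<in> half_space" and t: "t \<in> {-1..1}" and G: "\<And>p. p \<in> half_space \<Longrightarrow> \<bar>R\<bar> < norm p \<Longrightarrow> G p = 0" for p t and G :: "hpt \<Rightarrow> real"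
    using out[OF t, of p] G[of "flow V t p"] p snd_V by (auto simp: k_def slab_def indicator_def)
  have mF: "F \<in> borel_measurable ?M" "?F' \<in> borel_measurable ?M"
    by (rule continuous_wmeas_measurable[OF C1_cont[OF F]], rule continuous_wmeas_measurable[OF F'])
  have F0': "F p = 0" if "p \<in> half_space" "\<bar>R\<bar> < norm p" for p using that by (intro F0) auto
  have Gint: "(\<integral>p. k p * G (flow V t p) \<partial>?M) = (\<integral>p. ?c p * G p \<partial>?M)"
    if t: "t \<in> {-1..1}" and G: "\<And>p. p \<in> half_space \<Longrightarrow> \<bar>R\<bar> < norm p \<Longrightarrow> G p = 0" and m: "G \<in> borel_measurable ?M" for t G
  proof -
    have "(\<integral>p. k p * G (flow V t p) \<partial>?M) = (\<integral>p. ?c (flow V t p) * G (flow V t p) \<partial>?M)"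
      by (rule Bochner_Integration.integral_cong[OF refl]) (rule eq, use t G in simp_all)
    also have "\<dots> = (\<integral>p. ?c p * G p \<partial>?M)"
      unfolding V_def by (rule integral_flow) (intro borel_measurable_times cm m)
    finally show ?thesis .
  qed
  have Fint: "integrable ?M (\<lambda>p. k p * F p)"
  proof -
    obtain B where B: "\<And>p. p \<in> slab \<delta> R2 \<Longrightarrow> \<bar>F p\<bar> \<le> B" using continuous_slab_bounded[OF C1_cont[OF F] \<delta>] by blast
    show ?thesis
    proof (rule integrableI_bounded_set[where A = "slab \<delta> R2" and B = B])
      show "AE p\<in>slab \<delta> R2 in ?M. norm (k p * F p) \<le> B" using B by (intro AE_I2 impI) (simp add: k_def)
      show "AE p in ?M. p \<notin> slab \<delta> R2 \<longrightarrow> k p * F p = 0" by (intro AE_I2 impI) (simp add: k_def)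
    qed (use km mF slab_finite[OF a \<delta>] slab_sets[OF \<delta>] in auto)
  qed
  have "(\<integral>p. k p * (F (flow V 1 p) - F p) \<partial>?M) = (\<integral>t. (\<integral>p. k p * ?F' (flow V t p) \<partial>?M) * indicator {0..1} t \<partial>lborel)"
    unfolding V_def by (rule flow_fubini[OF a F F'[unfolded V_def] km _ _ \<delta>, where B = 1 and R = R2])
      (auto simp: k_def indicator_def)
  also have "\<dots> = (\<integral>t. (\<integral>p. ?c p * ?F' p \<partial>?M) * indicator {0..1} t \<partial>(lborel :: real measure))"
    by (rule Bochner_Integration.integral_cong[OF refl])
       (use Gint[OF _ F'0 mF(2)] in \<open>simp add: indicator_def\<close>)
  also have "\<dots> = (\<integral>p. ?c p * ?F' p \<partial>?M)" by simp
  finally have e: "(\<integral>p. k p * (F (flow V 1 p) - F p) \<partial>?M) = (\<integral>p. ?c p * ?F' p \<partial>?M)" .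
  have e0: "(\<integral>p. k p * F p \<partial>?M) = (\<integral>p. ?c p * F p \<partial>?M)" using Gint[OF _ F0' mF(1), of 0] by simp
  have e1: "(\<integral>p. k p * F (flow V 1 p) \<partial>?M) = (\<integral>p. ?c p * F p \<partial>?M)" using Gint[OF _ F0' mF(1), of 1] by simp
  have F1: "integrable ?M (\<lambda>p. k p * F (flow V 1 p))"
  proof -
    have "integrable ?M (\<lambda>p. ?c p * F p)"
      by (rule Bochner_Integration.integrable_cong[THEN iffD1, OF refl _ Fint]) (use eq[of _ 0 F] F0' in simp)
    then have "integrable ?M (\<lambda>p. ?c (flow V 1 p) * F (flow V 1 p))"
      unfolding V_def by (subst integrable_flow) (intro borel_measurable_times cm mF)
    then show ?thesis
      by (rule Bochner_Integration.integrable_cong[THEN iffD1, OF refl, rotated]) (rule eq[symmetric], simp_all add: F0')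
  qed
  have "(\<integral>p. k p * (F (flow V 1 p) - F p) \<partial>?M) = 0"
    unfolding right_diff_distrib using Fint F1 e0 e1 by simp
  then show ?thesis using e by simp
qed

section \<open>The local energy space\<close>

lemma wmeas_le_real:
  assumes "integrable (wmeas a) F" "integrable (wmeas a) G" "\<And>p. p \<in> half_space \<Longrightarrow> F p \<le> G p"
  shows "(\<integral>p. F p \<partial>wmeas a) \<le> (\<integral>p. (G p :: real) \<partial>wmeas a)"
  using assms by (intro integral_mono) auto

lemma wmeas_cong:
  assumes "\<And>p. p \<in> half_space \<Longrightarrow> F p = (G p :: real)"
  shows "(\<integral>p. F p \<partial>wmeas a) = (\<integral>p. G p \<partial>wmeas a)" "integrable (wmeas a) F \<longleftrightarrow> integrable (wmeas a) G"
  using assms by (auto intro!: Bochner_Integration.integral_cong Bochner_Integration.integrable_cong)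

lemma tst_C1: "tst a \<xi> \<Longrightarrow> C1 half_space \<xi>"
  by (simp add: tst_def)

lemma tst_support:
  assumes "tst a \<xi>"
  obtains R where "R > 0" "\<And>p. p \<in> half_space \<Longrightarrow> R \<le> norm p \<Longrightarrow> \<xi> p = 0"
    "\<And>p w. p \<in> half_space \<Longrightarrow> R \<le> norm p \<Longrightarrow> energy w \<xi> p = 0"
proof -
  obtain R0 where R0: "\<And>p. p \<in> half_space \<Longrightarrow> R0 \<le> norm p \<Longrightarrow> \<xi> p = 0" using assms unfolding tst_def by blast
  show ?thesis
  proof (rule that[of "\<bar>R0\<bar> + 1"])
    fix p w assume p: "p \<in> half_space" "\<bar>R0\<bar> + 1 \<le> norm p"
    show "\<xi> p = 0" using p by (intro R0) auto
    show "energy w \<xi> p = 0"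
    proof (rule h_vanish(5))
      show "open (half_space \<inter> {p. \<bar>R0\<bar> < norm p})" by (intro open_Int open_half_space open_outside)
      show "p \<in> half_space \<inter> {p. \<bar>R0\<bar> < norm p}" using p by auto
      show "\<xi> q = 0" if "q \<in> half_space \<inter> {p. \<bar>R0\<bar> < norm p}" for q
        using that by (intro R0) (auto intro: order_trans[OF abs_ge_self])
    qed
  qed simp
qed

lemma half_ballI: "p \<in> half_space \<Longrightarrow> \<not> R \<le> norm p \<Longrightarrow> p \<in> half_ball R"
  by (simp add: half_ball_def)

lemma half_ballD: "p \<in> half_ball R \<Longrightarrow> p \<in> half_space" "p \<in> half_ball R \<Longrightarrow> norm p < R"
  by (simp_all add: half_ball_def)

lemma Hloc_C1: "Hloc a w \<Longrightarrow> C1 half_space w"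
  by (simp add: Hloc_def)

lemma Hloc_measurable:
  assumes "C1 half_space w"
  shows "w \<in> borel_measurable (wmeas a)" "(\<lambda>p. (w p)\<^sup>2) \<in> borel_measurable (wmeas a)"
    "energy w w \<in> borel_measurable (wmeas a)" "hX w \<in> borel_measurable (wmeas a)"
    "hY w \<in> borel_measurable (wmeas a)" "dy w \<in> borel_measurable (wmeas a)"
  by (intro continuous_wmeas_measurable C1_cont[OF assms] energy_cont h_cont assms continuous_intros)+

lemma Hloc_integrable:
  assumes w: "Hloc a w" and g: "g \<in> borel_measurable (wmeas a)" "\<And>p. p \<in> half_space \<Longrightarrow> \<bar>g p\<bar> \<le> B"
    "\<And>p. p \<in> half_space \<Longrightarrow> R \<le> norm p \<Longrightarrow> g p = 0"
  shows "integrable (wmeas a) (\<lambda>p. g p * (w p)\<^sup>2)" "integrable (wmeas a) (\<lambda>p. g p * energy w w p)"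
proof -
  note C = Hloc_C1[OF w] note m = Hloc_measurable[OF C, of a]
  have m1: "(\<lambda>p. (w p)\<^sup>2 + energy w w p) \<in> borel_measurable (wmeas a)" using m by (intro borel_measurable_add)
  have m2: "(\<lambda>p. indicator (half_ball R) p * ((w p)\<^sup>2 + energy w w p)) \<in> borel_measurable (wmeas a)"
    by (intro borel_measurable_times m1 borel_measurable_indicator) simp
  have i: "integrable (wmeas a) (\<lambda>p. indicator (half_ball R) p * ((w p)\<^sup>2 + energy w w p))"
  proof (rule integrableI_bounded[OF m2])
    have "(\<integral>\<^sup>+p. ennreal (norm (indicator (half_ball R) p * ((w p)\<^sup>2 + energy w w p))) \<partial>wmeas a)
      = (\<integral>\<^sup>+p. ennreal ((w p)\<^sup>2 + energy w w p) * indicator (half_ball R) p \<partial>wmeas a)"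
      by (intro nn_integral_cong) (auto simp: indicator_def simp del: ennreal_plus)
    then show "(\<integral>\<^sup>+p. ennreal (norm (indicator (half_ball R) p * ((w p)\<^sup>2 + energy w w p))) \<partial>wmeas a) < \<infinity>"
      using w by (simp add: Hloc_def)
  qed
  then have i': "integrable (wmeas a) (\<lambda>p. \<bar>B\<bar> * (indicator (half_ball R) p * ((w p)\<^sup>2 + energy w w p)))" by simp
  have b: "\<bar>g p * x\<bar> \<le> \<bar>B\<bar> * (indicator (half_ball R) p * ((w p)\<^sup>2 + energy w w p))"
    if p: "p \<in> half_space" and x: "\<bar>x\<bar> \<le> (w p)\<^sup>2 + energy w w p" for p x
  proof (cases "R \<le> norm p")
    case False
    then have "indicator (half_ball R) p = (1::real)" using half_ballI[OF p] by simp
    moreover have "\<bar>g p\<bar> * \<bar>x\<bar> \<le> \<bar>B\<bar> * ((w p)\<^sup>2 + energy w w p)"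
      using g(2)[OF p] x by (intro mult_mono) auto
    ultimately show ?thesis by (simp add: abs_mult)
  qed (use g(3) p in simp)
  show "integrable (wmeas a) (\<lambda>p. g p * (w p)\<^sup>2)"
    by (rule Bochner_Integration.integrable_bound[OF i']) (use b m g(1) in \<open>auto intro!: AE_I2 borel_measurable_times\<close>)
  show "integrable (wmeas a) (\<lambda>p. g p * energy w w p)"
    by (rule Bochner_Integration.integrable_bound[OF i']) (use b m g(1) in \<open>auto intro!: AE_I2 borel_measurable_times\<close>)
qed

lemma half_ball_indicator:
  "(\<lambda>p. indicator (half_ball R) p :: real) \<in> borel_measurable (wmeas a)"
  "\<bar>indicator (half_ball R) p :: real\<bar> \<le> 1" "R \<le> norm p \<Longrightarrow> indicator (half_ball R) p = (0 :: real)"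
  by (rule borel_measurable_indicator, simp, simp add: indicator_def, simp add: indicator_def half_ball_def)

lemma tst_integrable:
  assumes "tst a \<xi>"
  shows "integrable (wmeas a) (energy \<xi> \<xi>)"
  using assms Hloc_measurable(3)[OF tst_C1[OF assms]] unfolding tst_def
  by (intro integrable_nn_bound[where G = "energy \<xi> \<xi>"]) auto

lemma tst_Hloc:
  assumes a: "a > -1" and t: "tst a \<xi>"
  shows "Hloc a \<xi>"
  unfolding Hloc_def
proof (intro conjI allI)
  show C: "C1 half_space \<xi>" by (rule tst_C1[OF t])
  fix R
  obtain B where B: "\<And>p. p \<in> half_space \<Longrightarrow> \<bar>\<xi> p\<bar> \<le> B" using t unfolding tst_def by blast
  have "(\<integral>\<^sup>+p. ennreal ((\<xi> p)\<^sup>2 + energy \<xi> \<xi> p) * indicator (half_ball R) p \<partial>wmeas a)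
    \<le> (\<integral>\<^sup>+p. ennreal (B\<^sup>2) * indicator (half_ball R) p + ennreal (energy \<xi> \<xi> p) \<partial>wmeas a)"
  proof (rule nn_integral_mono)
    fix p assume "p \<in> space (wmeas a)"
    then have "\<bar>\<xi> p\<bar> \<le> B" using B by simp
    then have "(\<xi> p)\<^sup>2 \<le> B\<^sup>2" by (metis abs_ge_zero power2_abs power_mono)
    then show "ennreal ((\<xi> p)\<^sup>2 + energy \<xi> \<xi> p) * indicator (half_ball R) p \<le> ennreal (B\<^sup>2) * indicator (half_ball R) p + ennreal (energy \<xi> \<xi> p)"
      by (auto simp: indicator_def add_mono ennreal_leI)
  qed
  also have "\<dots> = ennreal (B\<^sup>2) * emeasure (wmeas a) (half_ball R) + (\<integral>\<^sup>+p. ennreal (energy \<xi> \<xi> p) \<partial>wmeas a)"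
    using Hloc_measurable(3)[OF C, of a]
    by (subst nn_integral_add) (simp_all add: nn_integral_cmult_indicator borel_measurable_times_ennreal)
  also have "\<dots> < \<infinity>" using emeasure_half_ball[OF a, of R] t by (simp add: tst_def ennreal_mult_less_top)
  finally show "(\<integral>\<^sup>+p. ennreal ((\<xi> p)\<^sup>2 + energy \<xi> \<xi> p) * indicator (half_ball R) p \<partial>wmeas a) < \<infinity>" .
qed

lemma tst_sq_integrable:
  assumes a: "a > -1" and t: "tst a \<xi>"
  shows "integrable (wmeas a) (\<lambda>p. (\<xi> p)\<^sup>2)"
proof -
  obtain R where R: "\<And>p. p \<in> half_space \<Longrightarrow> R \<le> norm p \<Longrightarrow> \<xi> p = 0" using tst_support[OF t] by metis
  have "integrable (wmeas a) (\<lambda>p. indicator (half_ball R) p * (\<xi> p)\<^sup>2)"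
    by (rule Hloc_integrable(1)[OF tst_Hloc[OF a t] half_ball_indicator])
  then show ?thesis
    by (rule wmeas_cong(2)[THEN iffD1, rotated]) (use R half_ballI in \<open>force simp: indicator_def\<close>)
qed

lemma energy_tst_integrable:
  assumes w: "Hloc a w" and t: "tst a \<xi>"
  shows "integrable (wmeas a) (energy w \<xi>)"
proof -
  obtain R where R: "\<And>p w. p \<in> half_space \<Longrightarrow> R \<le> norm p \<Longrightarrow> energy w \<xi> p = 0" using tst_support[OF t] by metis
  have 1: "integrable (wmeas a) (\<lambda>p. indicator (half_ball R) p * energy w w p)"
    by (rule Hloc_integrable(2)[OF w half_ball_indicator])
  show ?thesis
  proof (rule Bochner_Integration.integrable_bound[OF Bochner_Integration.integrable_add[OF 1 tst_integrable[OF t]]])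
    show "energy w \<xi> \<in> borel_measurable (wmeas a)"
      by (intro continuous_wmeas_measurable energy_cont Hloc_C1[OF w] tst_C1[OF t])
    show "AE p in wmeas a. norm (energy w \<xi> p) \<le> norm (indicator (half_ball R) p * energy w w p + energy \<xi> \<xi> p)"
    proof (rule AE_I2)
      fix p assume "p \<in> space (wmeas a)"
      then have p: "p \<in> half_space" by simp
      show "norm (energy w \<xi> p) \<le> norm (indicator (half_ball R) p * energy w w p + energy \<xi> \<xi> p)"
      proof (cases "R \<le> norm p")
        case False
        then have "indicator (half_ball R) p = (1::real)" using half_ballI[OF p] by simp
        then show ?thesis using energy_young[of 1 1 w \<xi> p] by simp
      qed (use R[OF p] in simp)
    qed
  qed
qed

lemma tst_has_tr: "-1 < a \<Longrightarrow> a < 1 \<Longrightarrow> tst a \<xi> \<Longrightarrow> AE x in lborel. has_tr \<xi> x"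
  using Hloc_has_tr tst_Hloc by blast

text \<open>The local energy space with support bounded in \<open>\<real>\<^sup>4\<close>, possibly reaching \<open>y = 0\<close>; unlike test
  functions, its elements need not be bounded.\<close>

definition hcs :: "real \<Rightarrow> (hpt \<Rightarrow> real) \<Rightarrow> bool" where
  "hcs a z \<longleftrightarrow> Hloc a z \<and> (\<exists>R. \<forall>p\<in>half_space. R \<le> norm p \<longrightarrow> z p = 0)"

lemma tst_hcs: "-1 < a \<Longrightarrow> tst a z \<Longrightarrow> hcs a z"
  unfolding hcs_def using tst_Hloc tst_def by blast

lemma hcs_C1: "hcs a z \<Longrightarrow> C1 half_space z"
  by (simp add: hcs_def Hloc_def)

lemma hcs_integrable:
  assumes "hcs a z"
  shows "integrable (wmeas a) (\<lambda>p. (z p)\<^sup>2)" "integrable (wmeas a) (energy z z)"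
proof -
  obtain R where R: "\<And>p. p \<in> half_space \<Longrightarrow> R \<le> norm p \<Longrightarrow> z p = 0" and H: "Hloc a z"
    using assms unfolding hcs_def by blast
  have E0: "energy z z p = 0" if p: "p \<in> half_space" "\<bar>R\<bar> + 1 \<le> norm p" for p
  proof (rule h_vanish(5))
    show "open (half_space \<inter> {p. \<bar>R\<bar> < norm p})" by (intro open_Int open_half_space open_outside)
    show "p \<in> half_space \<inter> {p. \<bar>R\<bar> < norm p}" using p by auto
    show "z q = 0" if "q \<in> half_space \<inter> {p. \<bar>R\<bar> < norm p}" for q
      using that by (intro R) (auto intro: order_trans[OF abs_ge_self])
  qed
  have z0: "z p = 0" if p: "p \<in> half_space" "\<bar>R\<bar> + 1 \<le> norm p" for p using p by (intro R) auto
  have i: "indicator (half_ball (\<bar>R\<bar> + 1)) p = (1 :: real)" if "p \<in> half_space" "\<not> \<bar>R\<bar> + 1 \<le> norm p" for p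
    using half_ballI[OF that] by simp
  show "integrable (wmeas a) (\<lambda>p. (z p)\<^sup>2)"
  proof (rule wmeas_cong(2)[THEN iffD1])
    show "integrable (wmeas a) (\<lambda>p. indicator (half_ball (\<bar>R\<bar> + 1)) p * (z p)\<^sup>2)"
      by (rule Hloc_integrable(1)[OF H half_ball_indicator])
    show "indicator (half_ball (\<bar>R\<bar> + 1)) p * (z p)\<^sup>2 = (z p)\<^sup>2" if "p \<in> half_space" for p
      using i[OF that] z0[OF that] by (cases "\<bar>R\<bar> + 1 \<le> norm p") simp_all
  qed
  show "integrable (wmeas a) (energy z z)"
  proof (rule wmeas_cong(2)[THEN iffD1])
    show "integrable (wmeas a) (\<lambda>p. indicator (half_ball (\<bar>R\<bar> + 1)) p * energy z z p)"
      by (rule Hloc_integrable(2)[OF H half_ball_indicator])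
    show "indicator (half_ball (\<bar>R\<bar> + 1)) p * energy z z p = energy z z p" if "p \<in> half_space" for p
      using i[OF that] E0[OF that] by (cases "\<bar>R\<bar> + 1 \<le> norm p") simp_all
  qed
qed

text \<open>The trace inequality in real numbers, with d_y enlarged to the full energy, the form in
  which it is absorbed by Caccioppoli's left-hand side.\<close>

lemma trace_inequality_hcs:
  assumes a: "-1 < a" "a < 1" and \<epsilon>: "\<epsilon> > 0"
  obtains C \<delta> where "C \<ge> 0" "\<delta> > 0"
    "\<And>z. hcs a z \<Longrightarrow> integrable lborel (\<lambda>x. (btr z x)\<^sup>2)"
    "\<And>z. hcs a z \<Longrightarrow> (\<integral>x. (btr z x)\<^sup>2 \<partial>lborel) \<le> \<epsilon> * (\<integral>p. energy z z p \<partial>wmeas a)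
        + C * (\<integral>p. indicator {p. snd p > \<delta>} p * (z p)\<^sup>2 \<partial>wmeas a)"
proof -
  obtain C \<delta> where C: "C \<ge> 0" "\<delta> > 0"
    and tr: "\<And>z. C1 half_space z \<Longrightarrow> (AE x in lborel. has_tr z x) \<Longrightarrow>
      (\<integral>\<^sup>+x. ennreal ((btr z x)\<^sup>2) \<partial>lborel) \<le> ennreal \<epsilon> * (\<integral>\<^sup>+p. ennreal ((dy z p)\<^sup>2) \<partial>wmeas a)
        + ennreal C * (\<integral>\<^sup>+p. ennreal ((z p)\<^sup>2) * indicator {p. snd p > \<delta>} p \<partial>wmeas a)"
    by (rule trace_inequality[OF a \<epsilon>]) (rule that)
  have main: "integrable lborel (\<lambda>x. (btr z x)\<^sup>2) \<and> (\<integral>x. (btr z x)\<^sup>2 \<partial>lborel) \<le> \<epsilon> * (\<integral>p. energy z z p \<partial>wmeas a)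
        + C * (\<integral>p. indicator {p. snd p > \<delta>} p * (z p)\<^sup>2 \<partial>wmeas a)" if t: "hcs a z" for z
  proof -
    let ?E = "\<integral>p. energy z z p \<partial>wmeas a"
    let ?S = "\<integral>p. indicator {p. snd p > \<delta>} p * (z p)\<^sup>2 \<partial>wmeas a"
    have "{p::hpt. snd p > \<delta>} \<in> sets borel" by (intro borel_open open_Collect_less continuous_intros)
    then have im: "(\<lambda>p. indicator {p. snd p > \<delta>} p) \<in> borel_measurable (wmeas a)"
      by (intro borel_wmeas_measurable borel_measurable_indicator)
    have iS: "integrable (wmeas a) (\<lambda>p. indicator {p. snd p > \<delta>} p * (z p)\<^sup>2)"
      by (rule Bochner_Integration.integrable_bound[OF hcs_integrable(1)[OF t]])
         (rule borel_measurable_times[OF im Hloc_measurable(2)[OF hcs_C1[OF t]]], simp add: indicator_def)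
    have e1: "(\<integral>\<^sup>+p. ennreal ((dy z p)\<^sup>2) \<partial>wmeas a) \<le> ennreal ?E"
    proof -
      have "(\<integral>\<^sup>+p. ennreal ((dy z p)\<^sup>2) \<partial>wmeas a) \<le> (\<integral>\<^sup>+p. ennreal (energy z z p) \<partial>wmeas a)"
        by (intro nn_integral_mono ennreal_leI energy_components)
      also have "\<dots> = ennreal ?E" by (rule nn_integral_eq_integral[OF hcs_integrable(2)[OF t]]) simp
      finally show ?thesis .
    qed
    have e2: "(\<integral>\<^sup>+p. ennreal ((z p)\<^sup>2) * indicator {p. snd p > \<delta>} p \<partial>wmeas a) = ennreal ?S"
      by (subst nn_integral_eq_integral[OF iS, symmetric]) (auto intro!: nn_integral_cong simp: indicator_def)
    have "(\<integral>\<^sup>+x. ennreal ((btr z x)\<^sup>2) \<partial>lborel) \<le> ennreal \<epsilon> * ennreal ?E + ennreal C * ennreal ?S"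
      using tr[OF hcs_C1[OF t] Hloc_has_tr[OF a conjunct1[OF t[unfolded hcs_def]]]] mult_left_mono[OF e1, of "ennreal \<epsilon>"] unfolding e2
      by (auto intro: order_trans add_right_mono)
    also have "\<dots> = ennreal (\<epsilon> * ?E + C * ?S)"
    proof -
      have "0 \<le> ?E" "0 \<le> ?S" by (intro integral_nonneg_AE AE_I2; simp)+
      then show ?thesis using C \<epsilon> by (subst ennreal_plus) (simp_all add: ennreal_mult')
    qed
    finally have le: "(\<integral>\<^sup>+x. ennreal ((btr z x)\<^sup>2) \<partial>lborel) \<le> ennreal (\<epsilon> * ?E + C * ?S)" .
    have m: "(\<lambda>x. (btr z x)\<^sup>2) \<in> borel_measurable lborel"
      using btr_measurable[OF C1_cont[OF hcs_C1[OF t]]] by simp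
    have i: "integrable lborel (\<lambda>x. (btr z x)\<^sup>2)"
      by (rule integrableI_bounded[OF m]) (use order_le_less_trans[OF le ennreal_less_top] in simp)
    moreover have "0 \<le> \<epsilon> * ?E + C * ?S" using C \<epsilon> by (simp add: integral_nonneg_AE)
    then have "(\<integral>x. (btr z x)\<^sup>2 \<partial>lborel) \<le> \<epsilon> * ?E + C * ?S"
      using le nn_integral_eq_integral[OF i] by simp
    ultimately show ?thesis by blast
  qed
  show ?thesis by (rule that[OF C]) (use main in blast)+
qed

text \<open>Left translations preserve both energy and measure; the bound on t keeps the translated
  supports in a common ball.\<close>

lemma tst_flow:
  fixes \<alpha> \<beta> \<tau> :: real
  assumes t: "tst a \<xi>" and h: "t \<in> {-1..1}"
  shows "tst a (\<lambda>p. \<xi> (flow (fld (-2) \<alpha> \<beta> \<tau>) t p))"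
proof -
  let ?\<theta> = "flow (fld (-2) \<alpha> \<beta> \<tau>)"
  obtain R where R: "\<And>p. p \<in> half_space \<Longrightarrow> R \<le> norm p \<Longrightarrow> \<xi> p = 0" using tst_support[OF t] by metis
  obtain B where B: "\<And>p. p \<in> half_space \<Longrightarrow> \<bar>\<xi> p\<bar> \<le> B" using t unfolding tst_def by blast
  obtain R2 where R2: "\<And>t q. t \<in> {-1..1} \<Longrightarrow> norm q \<le> R \<Longrightarrow> norm (?\<theta> t q) \<le> R2"
    using flow_bounded_image[of R "-2" \<alpha> \<beta> \<tau>] by blast
  show ?thesis unfolding tst_def
  proof (intro conjI)
    show "C1 half_space (\<lambda>p. \<xi> (?\<theta> t p))" by (rule C1_flow[OF tst_C1[OF t]])
    show "\<exists>B. \<forall>p\<in>half_space. \<bar>\<xi> (?\<theta> t p)\<bar> \<le> B"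
      by (intro exI[of _ B] ballI B) simp
    have "R \<le> norm (?\<theta> t p)" if n: "R2 + 1 \<le> norm p" for p
    proof (rule ccontr)
      assume "\<not> R \<le> norm (?\<theta> t p)"
      then have "norm (?\<theta> (-t) (?\<theta> t p)) \<le> R2" using h by (intro R2) auto
      then show False using n by simp
    qed
    then show "\<exists>R. \<forall>p\<in>half_space. R \<le> norm p \<longrightarrow> \<xi> (?\<theta> t p) = 0"
      by (intro exI[of _ "R2 + 1"] ballI impI R) simp_all
  next
    have "(\<integral>\<^sup>+p. ennreal (energy (\<lambda>p. \<xi> (?\<theta> t p)) (\<lambda>p. \<xi> (?\<theta> t p)) p) \<partial>wmeas a) = (\<integral>\<^sup>+p. ennreal (energy \<xi> \<xi> (?\<theta> t p)) \<partial>wmeas a)"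
      by (rule nn_integral_cong) (use energy_flow[OF tst_C1[OF t] tst_C1[OF t]] in simp)
    also have "\<dots> = (\<integral>\<^sup>+p. ennreal (energy \<xi> \<xi> p) \<partial>wmeas a)"
      by (rule nn_integral_flow) (use Hloc_measurable(3)[OF tst_C1[OF t], of a] in simp)
    finally show "(\<integral>\<^sup>+p. ennreal (energy (\<lambda>p. \<xi> (?\<theta> t p)) (\<lambda>p. \<xi> (?\<theta> t p)) p) \<partial>wmeas a) < \<infinity>"
      using t by (simp add: tst_def)
  qed
qed

lemma Hloc_flow:
  fixes \<alpha> \<beta> \<tau> :: real
  assumes w: "Hloc a w" and h: "t \<in> {-1..1}"
  shows "Hloc a (\<lambda>p. w (flow (fld (-2) \<alpha> \<beta> \<tau>) t p))"
  unfolding Hloc_def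
proof (intro conjI allI)
  let ?\<theta> = "flow (fld (-2) \<alpha> \<beta> \<tau>)"
  note C = Hloc_C1[OF w]
  show "C1 half_space (\<lambda>p. w (?\<theta> t p))" by (rule C1_flow[OF C])
  fix R
  obtain R2 where R2: "\<And>t q. t \<in> {-1..1} \<Longrightarrow> norm q \<le> R \<Longrightarrow> norm (?\<theta> t q) \<le> R2"
    using flow_bounded_image[of R "-2" \<alpha> \<beta> \<tau>] by blast
  let ?G = "\<lambda>p. ennreal ((w p)\<^sup>2 + energy w w p) * indicator (half_ball (R2 + 1)) p"
  have m: "?G \<in> borel_measurable (wmeas a)"
    using Hloc_measurable[OF C, of a] by (intro borel_measurable_times_ennreal) auto
  have "(\<integral>\<^sup>+p. ennreal ((w (?\<theta> t p))\<^sup>2 + energy (\<lambda>p. w (?\<theta> t p)) (\<lambda>p. w (?\<theta> t p)) p) * indicator (half_ball R) p \<partial>wmeas a)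
    \<le> (\<integral>\<^sup>+p. ?G (?\<theta> t p) \<partial>wmeas a)"
  proof (rule nn_integral_mono)
    fix p assume "p \<in> space (wmeas a)"
    then have p: "p \<in> half_space" by simp
    show "ennreal ((w (?\<theta> t p))\<^sup>2 + energy (\<lambda>p. w (?\<theta> t p)) (\<lambda>p. w (?\<theta> t p)) p) * indicator (half_ball R) p \<le> ?G (?\<theta> t p)"
    proof (cases "p \<in> half_ball R")
      case True
      then have "norm (?\<theta> t p) \<le> R2" using half_ballD(2)[OF True] h by (intro R2) auto
      then have "?\<theta> t p \<in> half_ball (R2 + 1)" using p by (intro half_ballI) auto
      then show ?thesis using True energy_flow[OF C C p, of \<alpha> \<beta> \<tau> t] by simp
    qed simp
  qed
  also have "\<dots> = (\<integral>\<^sup>+p. ?G p \<partial>wmeas a)" by (rule nn_integral_flow[OF m])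
  also have "\<dots> < \<infinity>" using w by (simp add: Hloc_def)
  finally show "(\<integral>\<^sup>+p. ennreal ((w (?\<theta> t p))\<^sup>2 + energy (\<lambda>p. w (?\<theta> t p)) (\<lambda>p. w (?\<theta> t p)) p) * indicator (half_ball R) p \<partial>wmeas a) < \<infinity>" .
qed

text \<open>Two majorants cover differences, products with C^1 functions and Euclidean lengths; c
  may depend on R, as it must for unbounded coefficients such as coordinates.\<close>

lemma HlocI:
  assumes C: "C1 half_space w" and "\<And>R. \<exists>c g h. Hloc a g \<and> Hloc a h \<and> (\<forall>p\<in>half_ball R.
    (w p)\<^sup>2 + energy w w p \<le> c * ((g p)\<^sup>2 + energy g g p) + c * ((h p)\<^sup>2 + energy h h p))"
  shows "Hloc a w"
  unfolding Hloc_def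
proof (intro conjI allI C)
  fix R
  obtain c g h where g: "Hloc a g" and h: "Hloc a h" and le: "\<And>p. p \<in> half_ball R \<Longrightarrow>
    (w p)\<^sup>2 + energy w w p \<le> c * ((g p)\<^sup>2 + energy g g p) + c * ((h p)\<^sup>2 + energy h h p)"
    using assms(2)[of R] by blast
  have m: "(\<lambda>p. ennreal ((g p)\<^sup>2 + energy g g p) * indicator (half_ball R) p) \<in> borel_measurable (wmeas a)"
    if "C1 half_space g" for g
    using Hloc_measurable[OF that, of a] by (intro borel_measurable_times_ennreal) auto
  have "(\<integral>\<^sup>+p. ennreal ((w p)\<^sup>2 + energy w w p) * indicator (half_ball R) p \<partial>wmeas a)
   \<le> (\<integral>\<^sup>+p. ennreal \<bar>c\<bar> * (ennreal ((g p)\<^sup>2 + energy g g p) * indicator (half_ball R) p)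
         + ennreal \<bar>c\<bar> * (ennreal ((h p)\<^sup>2 + energy h h p) * indicator (half_ball R) p) \<partial>wmeas a)"
  proof (rule nn_integral_mono)
    fix p
    show "ennreal ((w p)\<^sup>2 + energy w w p) * indicator (half_ball R) p \<le>
      ennreal \<bar>c\<bar> * (ennreal ((g p)\<^sup>2 + energy g g p) * indicator (half_ball R) p)
         + ennreal \<bar>c\<bar> * (ennreal ((h p)\<^sup>2 + energy h h p) * indicator (half_ball R) p)"
    proof (cases "p \<in> half_ball R")
      case True
      have "c * x \<le> \<bar>c\<bar> * x" if "x \<ge> 0" for x using that by (intro mult_right_mono) auto
      then have "(w p)\<^sup>2 + energy w w p \<le> \<bar>c\<bar> * ((g p)\<^sup>2 + energy g g p) + \<bar>c\<bar> * ((h p)\<^sup>2 + energy h h p)"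
        by (intro order_trans[OF le[OF True]] add_mono) auto
      from ennreal_leI[OF this]
      have "ennreal ((w p)\<^sup>2 + energy w w p) \<le> ennreal \<bar>c\<bar> * ennreal ((g p)\<^sup>2 + energy g g p) + ennreal \<bar>c\<bar> * ennreal ((h p)\<^sup>2 + energy h h p)"
        unfolding ennreal_mult'[OF abs_ge_zero, symmetric]
        by (subst ennreal_plus[symmetric]) (simp_all del: ennreal_plus)
      with True show ?thesis by simp
    qed simp
  qed
  also have "\<dots> = ennreal \<bar>c\<bar> * (\<integral>\<^sup>+p. ennreal ((g p)\<^sup>2 + energy g g p) * indicator (half_ball R) p \<partial>wmeas a)
     + ennreal \<bar>c\<bar> * (\<integral>\<^sup>+p. ennreal ((h p)\<^sup>2 + energy h h p) * indicator (half_ball R) p \<partial>wmeas a)"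
    using m[OF Hloc_C1[OF g]] m[OF Hloc_C1[OF h]]
    by (subst nn_integral_add) (simp_all add: nn_integral_cmult borel_measurable_times_ennreal del: ennreal_plus)
  also have "\<dots> < \<infinity>" using g h by (simp add: Hloc_def ennreal_mult_less_top)
  finally show "(\<integral>\<^sup>+p. ennreal ((w p)\<^sup>2 + energy w w p) * indicator (half_ball R) p \<partial>wmeas a) < \<infinity>" .
qed

lemma sq_diff_le: "(x - y)\<^sup>2 \<le> 2 * x\<^sup>2 + 2 * (y::real)\<^sup>2"
  using zero_le_power2[of "x + y"] by (simp add: power2_eq_square algebra_simps)

lemma Hloc_diff:
  assumes "Hloc a g" "Hloc a h"
  shows "Hloc a (\<lambda>p. g p - h p)"
proof (rule HlocI)
  note C = assms[THEN Hloc_C1]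
  show "C1 half_space (\<lambda>p. g p - h p)" by (rule C1_minus[OF C])
  show "\<exists>c g' h'. Hloc a g' \<and> Hloc a h' \<and> (\<forall>p\<in>half_ball R.
    (g p - h p)\<^sup>2 + energy (\<lambda>p. g p - h p) (\<lambda>p. g p - h p) p \<le> c * ((g' p)\<^sup>2 + energy g' g' p) + c * ((h' p)\<^sup>2 + energy h' h' p))" for R
  proof (rule exI[of _ 2], rule exI[of _ g], rule exI[of _ h], intro conjI ballI assms)
    fix p assume "p \<in> half_ball R"
    then have p: "p \<in> half_space" by (rule half_ballD)
    show "(g p - h p)\<^sup>2 + energy (\<lambda>p. g p - h p) (\<lambda>p. g p - h p) p \<le> 2 * ((g p)\<^sup>2 + energy g g p) + 2 * ((h p)\<^sup>2 + energy h h p)"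
      using sq_diff_le[of "g p" "h p"] energy_diff_le[OF C1_diff[OF C(1) p] C1_diff[OF C(2) p]] by simp
  qed
qed

lemma Hloc_mult_C1:
  assumes g: "Hloc a g" and b: "C1 UNIV b"
  shows "Hloc a (\<lambda>p. g p * b p)"
proof (rule HlocI)
  note C = Hloc_C1[OF g]
  have Cb: "C1 half_space b" using C1_subset[OF b] by simp
  show "C1 half_space (\<lambda>p. g p * b p)" by (rule C1_mult[OF C Cb])
  fix R
  have "bounded (b ` cball 0 R)" "bounded (energy b b ` cball 0 R)"
    by (intro compact_imp_bounded compact_continuous_image continuous_on_subset[OF C1_cont[OF b]]
      continuous_on_subset[OF energy_cont[OF b b]] compact_cball subset_UNIV)+
  then obtain B1 B2 where B: "\<And>p. p \<in> cball 0 R \<Longrightarrow> \<bar>b p\<bar> \<le> B1" "\<And>p. p \<in> cball 0 R \<Longrightarrow> \<bar>energy b b p\<bar> \<le> B2"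
    unfolding bounded_iff real_norm_def by blast
  show "\<exists>c g' h'. Hloc a g' \<and> Hloc a h' \<and> (\<forall>p\<in>half_ball R.
    (g p * b p)\<^sup>2 + energy (\<lambda>p. g p * b p) (\<lambda>p. g p * b p) p \<le> c * ((g' p)\<^sup>2 + energy g' g' p) + c * ((h' p)\<^sup>2 + energy h' h' p))"
  proof (intro exI[of _ "2 * B1\<^sup>2 + 2 * \<bar>B2\<bar>"] exI[of _ g] conjI ballI g)
    fix p assume p': "p \<in> half_ball R"
    then have p: "p \<in> half_space" by (rule half_ballD)
    have "p \<in> cball 0 R" using half_ballD(2)[OF p'] by simp
    note Bp = B[OF this]
    have b2: "(b p)\<^sup>2 \<le> B1\<^sup>2" using Bp(1) by (metis abs_ge_zero power2_abs power_mono)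
    have e: "energy (\<lambda>p. g p * b p) (\<lambda>p. g p * b p) p \<le> 2 * (g p)\<^sup>2 * energy b b p + 2 * (b p)\<^sup>2 * energy g g p"
      by (rule energy_mult_le[OF C1_diff[OF C p] C1_diff[OF Cb p]])
    have "(g p)\<^sup>2 * energy b b p \<le> (g p)\<^sup>2 * \<bar>B2\<bar>" "(b p)\<^sup>2 * energy g g p \<le> B1\<^sup>2 * energy g g p" "(g p)\<^sup>2 * (b p)\<^sup>2 \<le> (g p)\<^sup>2 * B1\<^sup>2"
      using Bp b2 by (intro mult_left_mono mult_right_mono; auto)+
    moreover have "0 \<le> \<bar>B2\<bar> * energy g g p" "0 \<le> B1\<^sup>2 * energy g g p" "0 \<le> (g p)\<^sup>2 * B1\<^sup>2" "0 \<le> (g p)\<^sup>2 * \<bar>B2\<bar>"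
      by (intro mult_nonneg_nonneg; simp)+
    moreover have "(2 * B1\<^sup>2 + 2 * \<bar>B2\<bar>) * ((g p)\<^sup>2 + energy g g p) + (2 * B1\<^sup>2 + 2 * \<bar>B2\<bar>) * ((g p)\<^sup>2 + energy g g p)
      = 4 * ((g p)\<^sup>2 * B1\<^sup>2) + 4 * (B1\<^sup>2 * energy g g p) + 4 * ((g p)\<^sup>2 * \<bar>B2\<bar>) + 4 * (\<bar>B2\<bar> * energy g g p)"
      by (simp add: algebra_simps)
    ultimately show "(g p * b p)\<^sup>2 + energy (\<lambda>p. g p * b p) (\<lambda>p. g p * b p) p \<le> (2 * B1\<^sup>2 + 2 * \<bar>B2\<bar>) * ((g p)\<^sup>2 + energy g g p) + (2 * B1\<^sup>2 + 2 * \<bar>B2\<bar>) * ((g p)\<^sup>2 + energy g g p)"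
      using e unfolding power_mult_distrib mult.assoc by linarith
  qed
qed

section \<open>Stable solutions\<close>

lemma btr_flow:
  "btr (\<lambda>p. w (flow (fld k \<alpha> \<beta> \<tau>) t p)) x = btr w (bflow (fld k \<alpha> \<beta> \<tau>) t x)"
  "has_tr (\<lambda>p. w (flow (fld k \<alpha> \<beta> \<tau>) t p)) x \<longleftrightarrow> has_tr w (bflow (fld k \<alpha> \<beta> \<tau>) t x)"
  by (simp_all add: btr_def has_tr_def flow_pair)

lemma bflow_inverse [simp]: "bflow (fld k \<alpha> \<beta> \<tau>) (- t) (bflow (fld k \<alpha> \<beta> \<tau>) t x) = x"
proof -
  have "flow (fld k \<alpha> \<beta> \<tau>) (- t) (flow (fld k \<alpha> \<beta> \<tau>) t (x, 0)) = (x, 0)" by simp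
  then show ?thesis unfolding flow_pair by simp
qed

lemma integral_bflow:
  assumes "g \<in> borel_measurable borel"
  shows "(\<integral>x. g (bflow (fld k \<alpha> \<beta> \<tau>) t x) \<partial>lborel) = (\<integral>x. (g x :: real) \<partial>lborel)"
  using integral_distr[OF bflow_measurable, of g k \<alpha> \<beta> \<tau> t] assms unfolding distr_bflow by simp

lemma AE_bflow:
  assumes "AE x in lborel. P x"
  shows "AE x in lborel. P (bflow (fld k \<alpha> \<beta> \<tau>) t x)"
proof (rule AE_distrD[OF bflow_measurable])
  show "AE x in distr lborel lborel (bflow (fld k \<alpha> \<beta> \<tau>) t). P x" unfolding distr_bflow by (rule assms)
qed

lemma btr_mult: "has_tr w x \<Longrightarrow> has_tr z x \<Longrightarrow> has_tr (\<lambda>p. w p * z p) x \<and> btr (\<lambda>p. w p * z p) x = btr w x * btr z x"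
  using btrI[of "\<lambda>p. w p * z p" x, OF tendsto_mult[OF has_tr_tendsto has_tr_tendsto]] by blast

lemma btr_diff: "has_tr w x \<Longrightarrow> has_tr z x \<Longrightarrow> has_tr (\<lambda>p. w p - z p) x \<and> btr (\<lambda>p. w p - z p) x = btr w x - btr z x"
  using btrI[of "\<lambda>p. w p - z p" x, OF tendsto_diff[OF has_tr_tendsto has_tr_tendsto]] by blast

lemma btr_add: "has_tr w x \<Longrightarrow> has_tr z x \<Longrightarrow> has_tr (\<lambda>p. w p + z p) x \<and> btr (\<lambda>p. w p + z p) x = btr w x + btr z x"
  using btrI[of "\<lambda>p. w p + z p" x, OF tendsto_add[OF has_tr_tendsto has_tr_tendsto]] by blast

lemma btr_cmult: "has_tr w x \<Longrightarrow> has_tr (\<lambda>p. c * w p) x \<and> btr (\<lambda>p. c * w p) x = c * btr w x"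
  using btrI[of "\<lambda>p. c * w p" x, OF tendsto_mult_left[OF has_tr_tendsto]] by blast

lemma btr_continuous:
  assumes "continuous_on UNIV w"
  shows "has_tr w x \<and> btr w x = w (x, 0)"
proof -
  have "continuous_on UNIV (\<lambda>y. w (x, y))" by (intro continuous_on_compose2[OF assms] continuous_intros) auto
  then have "((\<lambda>y. w (x, y)) \<longlongrightarrow> w (x, 0)) (at_right 0)"
    by (metis UNIV_I continuous_on_def tendsto_within_subset subset_UNIV)
  then show ?thesis using btrI by blast
qed

lemma btr_bound:
  assumes "has_tr w x" "\<And>p. p \<in> half_space \<Longrightarrow> \<bar>w p\<bar> \<le> B"
  shows "\<bar>btr w x\<bar> \<le> B"
proof (rule tendsto_upperbound[OF tendsto_rabs[OF has_tr_tendsto[OF assms(1)]]])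
  show "\<forall>\<^sub>F y in at_right 0. \<bar>w (x, y)\<bar> \<le> B"
    unfolding eventually_at_right_field using assms(2) by (intro exI[of _ 1]) auto
qed simp

lemma btr_support:
  assumes "\<And>p. p \<in> half_space \<Longrightarrow> R \<le> norm p \<Longrightarrow> w p = 0" "R \<le> norm x"
  shows "btr w x = 0"
proof -
  have "w (x, inverse (real (Suc n))) = 0" for n
  proof (rule assms(1))
    have "norm x \<le> norm (x, inverse (real (Suc n)))" by (metis fst_conv norm_fst_le)
    then show "R \<le> norm (x, inverse (real (Suc n)))" using assms(2) by linarith
  qed simp
  then show ?thesis by (simp add: btr_def)
qed

lemma tst_btr_integrable:
  assumes a: "-1 < a" "a < 1" and t: "tst a \<xi>" and g: "g \<in> borel_measurable borel" "AE x in lborel. \<bar>g x\<bar> \<le> K"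
  shows "integrable lborel (\<lambda>x. g x * btr \<xi> x)"
proof -
  obtain R where R: "\<And>p. p \<in> half_space \<Longrightarrow> R \<le> norm p \<Longrightarrow> \<xi> p = 0" by (rule tst_support[OF t]) blast
  obtain B where B: "\<And>p. p \<in> half_space \<Longrightarrow> \<bar>\<xi> p\<bar> \<le> B" using t unfolding tst_def by blast
  show ?thesis
  proof (rule integrableI_bounded_set[where A = "ball 0 R" and B = "\<bar>K\<bar> * \<bar>B\<bar>"])
    show "(\<lambda>x. g x * btr \<xi> x) \<in> borel_measurable lborel"
      using g(1) btr_measurable[OF C1_cont[OF tst_C1[OF t]]] by simp
    show "emeasure lborel (ball (0::heis) R) < \<infinity>" by (rule emeasure_lborel_ball_finite)
    show "AE x\<in>ball 0 R in lborel. norm (g x * btr \<xi> x) \<le> \<bar>K\<bar> * \<bar>B\<bar>"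
      using g(2) tst_has_tr[OF a t]
    proof eventually_elim
      case (elim x)
      have "\<bar>g x\<bar> * \<bar>btr \<xi> x\<bar> \<le> \<bar>K\<bar> * \<bar>B\<bar>"
        using elim(1) btr_bound[OF elim(2) B] by (intro mult_mono) auto
      then show ?case by (simp add: abs_mult)
    qed
    show "AE x in lborel. x \<notin> ball 0 R \<longrightarrow> g x * btr \<xi> x = 0"
      using btr_support[OF R] by (intro AE_I2) simp
  qed simp
qed

section \<open>The solution: a priori bounds, traces and the tested equations\<close>

locale heis_sol =
  fixes a :: real and f :: "real \<Rightarrow> real" and u :: "hpt \<Rightarrow> real"
  assumes a1: "-1 < a" and a2: "a < 1"
    and f_diff: "\<And>t. f differentiable (at t)" and f'_cont: "continuous_on UNIV (deriv f)"
    and u2: "C2 u" and u_bdd: "bounded (u ` half_space)"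
    and weak: "weak_solution a f u" and stab: "stable a f u"
    and grad: "\<forall>R>0. Linf_on (half_ball R) (\<lambda>p. norm (gradH u p))"
begin

lemmas aa = a1 a2
lemmas u_C1 = C2_C1[OF u2]

lemma u_bound: obtains B where "B \<ge> 0" "\<And>p. p \<in> half_space \<Longrightarrow> \<bar>u p\<bar> \<le> B"
proof -
  obtain B where B: "\<And>p. p \<in> half_space \<Longrightarrow> \<bar>u p\<bar> \<le> B" using u_bdd by (rule bounded_image_abs) blast
  have "\<bar>u (0, 1)\<bar> \<le> B" by (rule B) simp
  then have "B \<ge> 0" by linarith
  then show ?thesis using B that by blast
qed

lemma f_DERIV: "(f has_real_derivative deriv f t) (at t)"
  using f_diff[of t] by (simp add: DERIV_deriv_iff_real_differentiable)

lemma f_cont: "continuous_on S f"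
  by (meson DERIV_isCont continuous_at_imp_continuous_on f_DERIV)

lemma f_measurable: "f \<in> borel_measurable borel" "deriv f \<in> borel_measurable borel"
  by (intro borel_measurable_continuous_onI f_cont f'_cont)+

lemma f_lipschitz:
  obtains K where "K > 0" "\<And>r t. \<bar>r\<bar> \<le> B \<Longrightarrow> \<bar>t\<bar> \<le> B \<Longrightarrow> \<bar>f r - f t\<bar> \<le> K * \<bar>r - t\<bar>"
    "\<And>t. \<bar>t\<bar> \<le> B \<Longrightarrow> \<bar>deriv f t\<bar> \<le> K"
proof -
  have "bounded (deriv f ` {-B..B})"
    by (intro compact_imp_bounded compact_continuous_image continuous_on_subset[OF f'_cont]) auto
  then obtain K0 where K0: "\<And>t. t \<in> {-B..B} \<Longrightarrow> \<bar>deriv f t\<bar> \<le> K0" by (rule bounded_image_abs) blast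
  define K where "K = \<bar>K0\<bar> + 1"
  have K: "K > 0" by (simp add: K_def)
  have K': "\<bar>deriv f t\<bar> \<le> K" if "\<bar>t\<bar> \<le> B" for t
    using K0[of t] that by (simp add: K_def abs_le_iff)
  have "\<bar>f r - f t\<bar> \<le> K * \<bar>r - t\<bar>" if "\<bar>r\<bar> \<le> B" "\<bar>t\<bar> \<le> B" for r t
  proof -
    have "norm (f r - f t) \<le> K * norm (r - t)"
    proof (rule field_differentiable_bound[of "{-B..B}" f "deriv f"])
      show "(f has_field_derivative deriv f z) (at z within {-B..B})" for z
        using f_DERIV by (rule has_field_derivative_at_within)
    qed (use that K K' in auto)
    then show ?thesis by simp
  qed
  then show ?thesis using that K K' by blast
qed

text \<open>An essential bound on a continuous function holds pointwise: the set where it fails is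
  open and null, hence empty. For R \<le> 0 the half-ball itself is empty.\<close>

lemma gradient_bound: "\<exists>M. \<forall>p\<in>half_ball R. \<bar>hX u p\<bar> \<le> M \<and> \<bar>hY u p\<bar> \<le> M"
proof (cases "R > 0")
  case False
  then have "p \<notin> half_ball R" for p using norm_ge_zero[of p] by (auto simp: half_ball_def simp del: norm_ge_zero)
  then show ?thesis by blast
next
  case True
  obtain C where C: "AE p in lebesgue_on (half_ball R). \<bar>norm (gradH u p)\<bar> \<le> C"
    using grad True unfolding Linf_on_def by blast
  let ?g = "\<lambda>p. (hX u p)\<^sup>2 + (hY u p)\<^sup>2"
  let ?S = "{p \<in> half_ball R. ?g p > C\<^sup>2}"
  have op: "open (half_ball R)" unfolding half_ball_def by (intro open_Int open_half_space open_ball)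
  have "continuous_on (half_ball R) ?g"
    by (intro continuous_intros continuous_on_subset[OF h_cont(1)[OF u_C1(1)]] continuous_on_subset[OF h_cont(2)[OF u_C1(1)]])
       (use half_ballD(1) in blast)+
  then have "open (half_ball R \<inter> ?g -` {C\<^sup>2<..})"
    by (rule continuous_open_preimage[OF _ op open_greaterThan])
  moreover have "half_ball R \<inter> ?g -` {C\<^sup>2<..} = ?S" by blast
  ultimately have oS: "open ?S" by simp
  have "AE p in lebesgue. p \<in> half_ball R \<longrightarrow> \<bar>norm (gradH u p)\<bar> \<le> C"
    using C by (subst (asm) AE_restrict_space_iff) auto
  then obtain N where N: "N \<in> null_sets lebesgue" "{p. \<not> (p \<in> half_ball R \<longrightarrow> \<bar>norm (gradH u p)\<bar> \<le> C)} \<subseteq> N"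
    unfolding eventually_ae_filter by auto
  have "?S \<subseteq> N"
  proof
    fix p assume p: "p \<in> ?S"
    have "\<not> \<bar>norm (gradH u p)\<bar> \<le> C"
    proof
      assume "\<bar>norm (gradH u p)\<bar> \<le> C"
      then have "(norm (gradH u p))\<^sup>2 \<le> C\<^sup>2" by (intro power_mono) auto
      then show False using p by (simp add: norm_gradH_sq)
    qed
    then show "p \<in> N" using N(2) p by blast
  qed
  moreover have "negligible N" using N(1) by (simp add: negligible_iff_null_sets)
  ultimately have "negligible ?S" using negligible_subset by blast
  then have S: "?S = {}" using oS open_not_negligible by blast
  have "\<bar>hX u p\<bar> \<le> \<bar>C\<bar> \<and> \<bar>hY u p\<bar> \<le> \<bar>C\<bar>" if "p \<in> half_ball R" for p
  proof -
    have "?g p \<le> C\<^sup>2" using S that by fastforce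
    moreover have "0 \<le> (hX u p)\<^sup>2" "0 \<le> (hY u p)\<^sup>2" by simp_all
    ultimately have "(hX u p)\<^sup>2 \<le> C\<^sup>2" "(hY u p)\<^sup>2 \<le> C\<^sup>2" by linarith+
    then show ?thesis by (simp add: abs_le_square_iff)
  qed
  then show ?thesis by blast
qed

lemma grad_locbdd: "locbdd (hX u)" "locbdd (hY u)"
  unfolding locbdd_def using gradient_bound by blast+

lemma Hloc_u: "Hloc a u"
  unfolding Hloc_def
proof (intro conjI allI)
  show "C1 half_space u" by (rule u_C1(1))
  fix R :: real
  \<comment> \<open>\<open>weak_solution\<close> speaks of positive radii, while \<open>Hloc\<close>
    ranges over all of them.\<close>
  let ?R = "\<bar>R\<bar> + 1"
  obtain B where B: "B \<ge> 0" "\<And>p. p \<in> half_space \<Longrightarrow> \<bar>u p\<bar> \<le> B" by (rule u_bound) blast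
  note m = Hloc_measurable[OF u_C1(1), of a]
  have mi: "(\<lambda>p. indicator (half_ball ?R) p * energy u u p) \<in> borel_measurable (wmeas a)"
    by (intro borel_measurable_times half_ball_indicator(1) m)
  have "set_integrable lebesgue (half_ball ?R) (\<lambda>p. snd p powr a * energy u u p)"
    using weak unfolding weak_solution_def norm_gradHh_sq by auto
  then have i: "integrable (wmeas a) (\<lambda>p. indicator (half_ball ?R) p * energy u u p)"
    by (rule wmeas_set_integral_subset(1)[OF mi, THEN iffD1, rotated]) (auto simp: half_ball_def)
  have "(\<integral>\<^sup>+p. ennreal ((u p)\<^sup>2 + energy u u p) * indicator (half_ball R) p \<partial>wmeas a)
    \<le> (\<integral>\<^sup>+p. ennreal (B\<^sup>2) * indicator (half_ball R) p + ennreal (indicator (half_ball ?R) p * energy u u p) \<partial>wmeas a)"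
  proof (rule nn_integral_mono)
    fix p assume "p \<in> space (wmeas a)"
    then have "\<bar>u p\<bar> \<le> B" using B by simp
    then have "(u p)\<^sup>2 \<le> B\<^sup>2" by (metis abs_ge_zero power2_abs power_mono)
    moreover have "p \<in> half_ball R \<Longrightarrow> p \<in> half_ball ?R" by (auto simp: half_ball_def)
    ultimately show "ennreal ((u p)\<^sup>2 + energy u u p) * indicator (half_ball R) p \<le>
       ennreal (B\<^sup>2) * indicator (half_ball R) p + ennreal (indicator (half_ball ?R) p * energy u u p)"
      by (cases "p \<in> half_ball R") (simp_all add: add_mono ennreal_leI)
  qed
  also have "\<dots> = ennreal (B\<^sup>2) * emeasure (wmeas a) (half_ball R) + (\<integral>\<^sup>+p. ennreal (indicator (half_ball ?R) p * energy u u p) \<partial>wmeas a)"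
    using mi by (subst nn_integral_add) (simp_all add: nn_integral_cmult_indicator borel_measurable_times_ennreal)
  also have "\<dots> = ennreal (B\<^sup>2) * emeasure (wmeas a) (half_ball R) + ennreal (\<integral>p. indicator (half_ball ?R) p * energy u u p \<partial>wmeas a)"
    by (subst nn_integral_eq_integral[OF i]) (auto simp: indicator_def)
  also have "\<dots> < \<infinity>" using emeasure_half_ball[OF a1, of R] by (simp add: ennreal_mult_less_top)
  finally show "(\<integral>\<^sup>+p. ennreal ((u p)\<^sup>2 + energy u u p) * indicator (half_ball R) p \<partial>wmeas a) < \<infinity>" .
qed

lemma u_has_tr: "AE x in lborel. has_tr u x"
  by (rule Hloc_has_tr[OF aa Hloc_u])

lemma btr_u_measurable: "btr u \<in> borel_measurable borel"
  by (rule btr_measurable[OF C1_cont[OF u_C1(1)]])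

lemma weak_tst:
  assumes t: "tst a \<xi>"
  shows "(\<integral>p. energy u \<xi> p \<partial>wmeas a) = (\<integral>x. f (btr u x) * btr \<xi> x \<partial>lborel)"
proof -
  have "(LINT p:half_space|lebesgue. snd p powr a * energy u \<xi> p) = (LINT x|lebesgue. f (trace0 u x) * trace0 \<xi> x)"
    using weak tst_admissible[OF t] unfolding weak_solution_def gradHh_inner by blast
  moreover have "(LINT p:half_space|lebesgue. snd p powr a * energy u \<xi> p) = (\<integral>p. energy u \<xi> p \<partial>wmeas a)"
    by (intro wmeas_set_integral(2) continuous_wmeas_measurable energy_cont u_C1 tst_C1[OF t])
  moreover have "(LINT x|lebesgue. f (trace0 u x) * trace0 \<xi> x) = (\<integral>x. f (btr u x) * btr \<xi> x \<partial>lborel)"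
  proof (rule lebesgue_integral_AE_borel)
    show "(\<lambda>x. f (btr u x) * btr \<xi> x) \<in> borel_measurable borel"
      by (intro borel_measurable_times measurable_compose[OF btr_u_measurable f_measurable(1)] btr_measurable C1_cont tst_C1[OF t])
    show "AE x in lborel. f (trace0 u x) * trace0 \<xi> x = f (btr u x) * btr \<xi> x"
      using u_has_tr tst_has_tr[OF aa t] by eventually_elim (simp add: has_tr_trace0)
  qed
  ultimately show ?thesis by simp
qed

lemma stable_tst:
  assumes t: "tst a \<xi>"
  shows "(\<integral>x. deriv f (btr u x) * (btr \<xi> x)\<^sup>2 \<partial>lborel) \<le> (\<integral>p. energy \<xi> \<xi> p \<partial>wmeas a)"
proof -
  have "(LINT p:half_space|lebesgue. snd p powr a * energy \<xi> \<xi> p) - (LINT x|lebesgue. deriv f (trace0 u x) * (trace0 \<xi> x)\<^sup>2) \<ge> 0"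
    using stab tst_admissible[OF t] unfolding stable_def norm_gradHh_sq by blast
  moreover have "(LINT p:half_space|lebesgue. snd p powr a * energy \<xi> \<xi> p) = (\<integral>p. energy \<xi> \<xi> p \<partial>wmeas a)"
    by (intro wmeas_set_integral(2) continuous_wmeas_measurable energy_cont tst_C1[OF t])
  moreover have "(LINT x|lebesgue. deriv f (trace0 u x) * (trace0 \<xi> x)\<^sup>2) = (\<integral>x. deriv f (btr u x) * (btr \<xi> x)\<^sup>2 \<partial>lborel)"
  proof (rule lebesgue_integral_AE_borel)
    show "(\<lambda>x. deriv f (btr u x) * (btr \<xi> x)\<^sup>2) \<in> borel_measurable borel"
      by (intro borel_measurable_times borel_measurable_power measurable_compose[OF btr_u_measurable f_measurable(2)] btr_measurable C1_cont tst_C1[OF t])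
    show "AE x in lborel. deriv f (trace0 u x) * (trace0 \<xi> x)\<^sup>2 = deriv f (btr u x) * (btr \<xi> x)\<^sup>2"
      using u_has_tr tst_has_tr[OF aa t] by eventually_elim (simp add: has_tr_trace0)
  qed
  ultimately show ?thesis by simp
qed

lemma f_btr_bound:
  obtains K where "K > 0" "AE x in lborel. \<bar>f (btr u x)\<bar> \<le> K \<and> \<bar>deriv f (btr u x)\<bar> \<le> K"
    "\<And>x y. has_tr u x \<Longrightarrow> has_tr u y \<Longrightarrow> \<bar>f (btr u x) - f (btr u y)\<bar> \<le> K * \<bar>btr u x - btr u y\<bar>"
proof -
  obtain B where B: "B \<ge> 0" "\<And>p. p \<in> half_space \<Longrightarrow> \<bar>u p\<bar> \<le> B" by (rule u_bound) blast
  obtain K where K: "K > 0" "\<And>r t. \<bar>r\<bar> \<le> B \<Longrightarrow> \<bar>t\<bar> \<le> B \<Longrightarrow> \<bar>f r - f t\<bar> \<le> K * \<bar>r - t\<bar>"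
    "\<And>t. \<bar>t\<bar> \<le> B \<Longrightarrow> \<bar>deriv f t\<bar> \<le> K" by (rule f_lipschitz[of B]) blast
  have fb: "\<bar>f t\<bar> \<le> K * B + \<bar>f 0\<bar>" if "\<bar>t\<bar> \<le> B" for t
  proof -
    have "K * \<bar>t - 0\<bar> \<le> K * B" using K(1) that by (intro mult_left_mono) auto
    then show ?thesis using K(2)[OF that, of 0] B(1) by simp
  qed
  have KB: "0 \<le> K * B" using K B by simp
  show ?thesis
  \<comment> \<open>One constant serves all the bounds: K is a Lipschitz constant of f on [-B, B],
    and |f(t)| \<le> K B + |f(0)| there.\<close>
  proof (rule that[of "K + K * B + \<bar>f 0\<bar>"])
    show "0 < K + K * B + \<bar>f 0\<bar>" using K(1) KB by linarith
    show "AE x in lborel. \<bar>f (btr u x)\<bar> \<le> K + K * B + \<bar>f 0\<bar> \<and> \<bar>deriv f (btr u x)\<bar> \<le> K + K * B + \<bar>f 0\<bar>"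
      using u_has_tr
    proof eventually_elim
      case (elim x)
      note b = btr_bound[OF elim B(2)]
      show ?case using fb[OF b] K(3)[OF b] K(1) KB by linarith
    qed
    fix x y assume t: "has_tr u x" "has_tr u y"
    have "\<bar>f (btr u x) - f (btr u y)\<bar> \<le> K * \<bar>btr u x - btr u y\<bar>"
      by (intro K(2) btr_bound B(2) t)
    also have "\<dots> \<le> (K + K * B + \<bar>f 0\<bar>) * \<bar>btr u x - btr u y\<bar>"
      using KB by (intro mult_right_mono) auto
    finally show "\<bar>f (btr u x) - f (btr u y)\<bar> \<le> (K + K * B + \<bar>f 0\<bar>) * \<bar>btr u x - btr u y\<bar>" .
  qed
qed

section \<open>Difference quotients of the solution\<close>

definition dq :: "(hpt \<Rightarrow> hpt) \<Rightarrow> real \<Rightarrow> real \<Rightarrow> hpt \<Rightarrow> real" where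
  "dq V t c p = c * (u (flow V t p) - u p)"

lemma dq_Hloc: "t \<in> {-1..1} \<Longrightarrow> Hloc a (dq (fld (-2) \<alpha> \<beta> \<tau>) t c)"
  unfolding dq_def[abs_def]
  using Hloc_mult_C1[OF Hloc_diff[OF Hloc_flow[OF Hloc_u] Hloc_u] C1_const[of _ c]] by (simp add: mult.commute)

lemma dq_bound: obtains B where "\<And>p. p \<in> half_space \<Longrightarrow> \<bar>dq (fld k \<alpha> \<beta> \<tau>) t c p\<bar> \<le> B"
proof -
  obtain B where B: "B \<ge> 0" "\<And>p. p \<in> half_space \<Longrightarrow> \<bar>u p\<bar> \<le> B" by (rule u_bound) blast
  have "\<bar>dq (fld k \<alpha> \<beta> \<tau>) t c p\<bar> \<le> \<bar>c\<bar> * (B + B)" if p: "p \<in> half_space" for p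
    unfolding dq_def abs_mult using B(2)[OF p] B(2)[of "flow (fld k \<alpha> \<beta> \<tau>) t p"] p
    by (intro mult_left_mono) auto
  then show ?thesis using that by blast
qed

lemma dq_locbdd: "locbdd (dq (fld k \<alpha> \<beta> \<tau>) t c)"
  unfolding locbdd_def
proof
  fix R
  obtain B where "\<And>p. p \<in> half_space \<Longrightarrow> \<bar>dq (fld k \<alpha> \<beta> \<tau>) t c p\<bar> \<le> B" by (rule dq_bound) blast
  then show "\<exists>B. \<forall>p\<in>half_ball R. \<bar>dq (fld k \<alpha> \<beta> \<tau>) t c p\<bar> \<le> B" using half_ballD(1) by blast
qed

text \<open>Test the weak equation with \<xi> carried by the inverse flow, and change variables both
  inside and on the boundary: the translate of u then satisfies the translated equation against
  \<xi>. Subtract the equation of u.\<close>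

lemma dq_equation:
  fixes \<alpha> \<beta> \<tau> :: real
  defines "V \<equiv> fld (-2) \<alpha> \<beta> \<tau>"
  assumes t: "tst a \<xi>" and h: "t \<in> {-1..1}"
  shows "(\<integral>p. energy (dq V t c) \<xi> p \<partial>wmeas a) = (\<integral>x. c * (f (btr u (bflow V t x)) - f (btr u x)) * btr \<xi> x \<partial>lborel)"
proof -
  let ?\<xi>' = "\<lambda>p. \<xi> (flow V (- t) p)"
  have t': "tst a ?\<xi>'" unfolding V_def by (rule tst_flow[OF t]) (use h in simp)
  note C\<xi> = tst_C1[OF t] note C\<xi>' = tst_C1[OF t'] note Cu = u_C1(1)
  let ?uV = "\<lambda>p. u (flow V t p)"
  have CuV: "C1 half_space ?uV" unfolding V_def by (rule C1_flow[OF Cu])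
  have HuV: "Hloc a ?uV" unfolding V_def by (rule Hloc_flow[OF Hloc_u h])
  have "(\<integral>p. energy u ?\<xi>' p \<partial>wmeas a) = (\<integral>p. energy u ?\<xi>' (flow V t p) \<partial>wmeas a)"
    unfolding V_def by (rule integral_flow[symmetric]) (intro continuous_wmeas_measurable energy_cont Cu C\<xi>'[unfolded V_def])
  also have "\<dots> = (\<integral>p. energy ?uV \<xi> p \<partial>wmeas a)"
  proof (rule wmeas_cong(1))
    fix p assume p: "p \<in> half_space"
    have "energy ?uV (\<lambda>q. ?\<xi>' (flow V t q)) p = energy u ?\<xi>' (flow V t p)"
      unfolding V_def by (rule energy_flow[OF Cu C\<xi>'[unfolded V_def] p])
    then show "energy u ?\<xi>' (flow V t p) = energy ?uV \<xi> p" by (simp add: V_def)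
  qed
  finally have e1: "(\<integral>p. energy ?uV \<xi> p \<partial>wmeas a) = (\<integral>x. f (btr u x) * btr ?\<xi>' x \<partial>lborel)"
    using weak_tst[OF t'] by simp
  have "\<dots> = (\<integral>x. f (btr u (bflow V t x)) * btr ?\<xi>' (bflow V t x) \<partial>lborel)"
    unfolding V_def by (rule integral_bflow[symmetric])
      (intro borel_measurable_times measurable_compose[OF btr_u_measurable f_measurable(1)] btr_measurable C1_cont C\<xi>'[unfolded V_def])
  also have "\<dots> = (\<integral>x. f (btr u (bflow V t x)) * btr \<xi> x \<partial>lborel)"
    by (simp add: V_def btr_flow)
  finally have e2: "(\<integral>p. energy ?uV \<xi> p \<partial>wmeas a) = (\<integral>x. f (btr u (bflow V t x)) * btr \<xi> x \<partial>lborel)"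
    using e1 by simp
  have m0: "(\<lambda>x. f (btr u x)) \<in> borel_measurable borel" by (rule measurable_compose[OF btr_u_measurable f_measurable(1)])
  obtain K where K: "AE x in lborel. \<bar>f (btr u x)\<bar> \<le> K \<and> \<bar>deriv f (btr u x)\<bar> \<le> K" by (rule f_btr_bound) blast
  then have K1: "AE x in lborel. \<bar>f (btr u x)\<bar> \<le> K" by eventually_elim simp
  have i1: "integrable lborel (\<lambda>x. f (btr u x) * btr \<xi> x)" by (rule tst_btr_integrable[OF aa t m0 K1])
  have m2: "(\<lambda>x. f (btr u (bflow V t x))) \<in> borel_measurable borel"
    using measurable_compose[OF bflow_measurable[of "-2" \<alpha> \<beta> \<tau> t, folded V_def], of "\<lambda>x. f (btr u x)" borel] m0 by simp
  have i2: "integrable lborel (\<lambda>x. f (btr u (bflow V t x)) * btr \<xi> x)"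
    by (rule tst_btr_integrable[OF aa t m2 AE_bflow[OF K1, of "-2" \<alpha> \<beta> \<tau> t, folded V_def]])
  have "(\<integral>p. energy (dq V t c) \<xi> p \<partial>wmeas a) = (\<integral>p. c * (energy ?uV \<xi> p - energy u \<xi> p) \<partial>wmeas a)"
  proof (rule wmeas_cong(1))
    fix p assume p: "p \<in> half_space"
    note d = C1_diff[OF CuV p] C1_diff[OF Cu p]
    show "energy (dq V t c) \<xi> p = c * (energy ?uV \<xi> p - energy u \<xi> p)"
      unfolding dq_def[abs_def] energy_cmult(1)[OF differentiable_diff[OF d]] energy_diff(1)[OF d] ..
  qed
  also have "\<dots> = c * ((\<integral>p. energy ?uV \<xi> p \<partial>wmeas a) - (\<integral>p. energy u \<xi> p \<partial>wmeas a))"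
    using energy_tst_integrable[OF HuV t] energy_tst_integrable[OF Hloc_u t] by simp
  also have "\<dots> = c * ((\<integral>x. f (btr u (bflow V t x)) * btr \<xi> x \<partial>lborel) - (\<integral>x. f (btr u x) * btr \<xi> x \<partial>lborel))"
    unfolding e2 weak_tst[OF t] ..
  also have "\<dots> = (\<integral>x. c * (f (btr u (bflow V t x)) - f (btr u x)) * btr \<xi> x \<partial>lborel)"
    using i1 i2 by (simp add: left_diff_distrib right_diff_distrib mult.assoc)
  finally show ?thesis .
qed

end

section \<open>The Caccioppoli inequality\<close>

lemma cut_integrable:
  assumes w: "Hloc a w" and \<psi>: "cut \<psi>"
  shows "integrable (wmeas a) (\<lambda>p. (\<psi> p)\<^sup>2 * (w p)\<^sup>2)"
    "integrable (wmeas a) (\<lambda>p. (\<psi> p)\<^sup>2 * energy w w p)"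
    "integrable (wmeas a) (\<lambda>p. energy \<psi> \<psi> p * (w p)\<^sup>2)"
    "integrable (wmeas a) (\<lambda>p. energy \<psi> \<psi> p * energy w w p)"
proof -
  obtain R B where RB: "R > 0" "B \<ge> 0" "\<And>p. \<bar>\<psi> p\<bar> \<le> B" "\<And>p. energy \<psi> \<psi> p \<le> B"
    "\<And>p. R \<le> norm p \<Longrightarrow> \<psi> p = 0" "\<And>p. R \<le> norm p \<Longrightarrow> energy \<psi> \<psi> p = 0"
    by (rule cut_bounds[OF \<psi>]) (rule that)
  note m = Hloc_measurable[OF cut_C1[OF \<psi>], of a]
  have 1: "\<bar>(\<psi> p)\<^sup>2\<bar> \<le> B\<^sup>2" for p using RB(3)[of p] by (metis abs_ge_zero abs_power2 power2_abs power_mono)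
  have 2: "\<bar>energy \<psi> \<psi> p\<bar> \<le> B" for p using RB(4)[of p] by simp
  have 3: "(\<psi> p)\<^sup>2 = 0" "energy \<psi> \<psi> p = 0" if "R \<le> norm p" for p using RB(5,6)[OF that] by simp_all
  show "integrable (wmeas a) (\<lambda>p. (\<psi> p)\<^sup>2 * (w p)\<^sup>2)" by (rule Hloc_integrable(1)[OF w m(2) 1 3(1)])
  show "integrable (wmeas a) (\<lambda>p. (\<psi> p)\<^sup>2 * energy w w p)" by (rule Hloc_integrable(2)[OF w m(2) 1 3(1)])
  show "integrable (wmeas a) (\<lambda>p. energy \<psi> \<psi> p * (w p)\<^sup>2)" by (rule Hloc_integrable(1)[OF w m(3) 2 3(2)])
  show "integrable (wmeas a) (\<lambda>p. energy \<psi> \<psi> p * energy w w p)" by (rule Hloc_integrable(2)[OF w m(3) 2 3(2)])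
qed

lemma slab_integrable:
  assumes a: "a > -1" and g: "continuous_on half_space g" "\<And>p. p \<in> half_space \<Longrightarrow> R \<le> norm p \<Longrightarrow> g p = 0" and \<delta>: "\<delta> > 0"
  shows "integrable (wmeas a) (\<lambda>p. indicator {p. \<delta> \<le> snd p} p * (g p :: real))"
proof -
  obtain B where B: "B \<ge> 0" "\<And>p. p \<in> slab \<delta> R \<Longrightarrow> \<bar>g p\<bar> \<le> B" by (rule continuous_slab_bounded[OF g(1) \<delta>]) (rule that)
  have "integrable (wmeas a) (\<lambda>p. indicator (slab \<delta> R) p * g p)"
  proof (rule integrableI_bounded_set[where A = "slab \<delta> R" and B = B])
    show "(\<lambda>p. indicator (slab \<delta> R) p * g p) \<in> borel_measurable (wmeas a)"
      by (intro borel_measurable_times continuous_wmeas_measurable g borel_measurable_indicator slab_sets \<delta>)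
    show "AE p\<in>slab \<delta> R in wmeas a. norm (indicator (slab \<delta> R) p * g p) \<le> B" using B by (intro AE_I2) simp
  qed (use slab_sets[OF \<delta>] slab_finite[OF a \<delta>] in auto)
  then show ?thesis
    by (rule wmeas_cong(2)[THEN iffD1, rotated])
       (use g(2) in \<open>force simp: indicator_def slab_def\<close>)
qed

lemma slab_indicator_measurable: "(\<lambda>p. indicator {p::hpt. \<delta> \<le> snd p} p :: real) \<in> borel_measurable (wmeas a)"
  by (intro borel_wmeas_measurable borel_measurable_indicator borel_closed closed_Collect_le continuous_intros)

text \<open>Carries statements proved on y \<ge> \<delta> over to the half-space, once the full
  integrand is known to be integrable.\<close>

lemma slab_limit:
  assumes int: "integrable (wmeas a) (F :: hpt \<Rightarrow> real)"
  shows "(\<lambda>n. \<integral>p. indicator {p. inverse (real (Suc n)) \<le> snd p} p * F p \<partial>wmeas a) \<longlonglongrightarrow> (\<integral>p. F p \<partial>wmeas a)"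
proof (rule integral_dominated_convergence[where w = "\<lambda>p. \<bar>F p\<bar>"])
  show "AE p in wmeas a. (\<lambda>n. indicator {p. inverse (real (Suc n)) \<le> snd p} p * F p) \<longlonglongrightarrow> F p"
  proof (intro AE_I2 tendsto_eventually)
    fix p assume "p \<in> space (wmeas a)"
    then have "snd p > 0" by (simp add: half_space_def)
    then have "eventually (\<lambda>n. inverse (real (Suc n)) < snd p) sequentially"
      using order_tendstoD(2)[OF LIMSEQ_inverse_real_of_nat] by blast
    then show "\<forall>\<^sub>F n in sequentially. indicator {p. inverse (real (Suc n)) \<le> snd p} p * F p = F p"
      by (rule eventually_mono) simp
  qed
  show "(\<lambda>p. indicator {p. inverse (real (Suc n)) \<le> snd p} p * F p) \<in> borel_measurable (wmeas a)" for n
    by (intro borel_measurable_times slab_indicator_measurable borel_measurable_integrable[OF int])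
  show "AE p in wmeas a. norm (indicator {p. inverse (real (Suc n)) \<le> snd p} p * F p) \<le> \<bar>F p\<bar>" for n
    by (intro AE_I2) (simp add: indicator_def)
qed (use int in auto)

lemma slab_bound_imp_bound:
  assumes "integrable (wmeas a) F" "\<And>\<delta>. \<delta> > 0 \<Longrightarrow> (\<integral>p. indicator {p. \<delta> \<le> snd p} p * F p \<partial>wmeas a) \<le> (N :: real)"
  shows "(\<integral>p. F p \<partial>wmeas a) \<le> N"
  by (rule LIMSEQ_le_const2[OF slab_limit[OF assms(1)]]) (use assms(2) in auto)

context heis_sol
begin

text \<open>Test the difference equation with D \<psi>^2. The Lipschitz bound of f turns the
  boundary term into K times the squared trace of D \<psi>, and the trace inequality with small
  \<epsilon> absorbs it into the energy on the left. The constant depends neither on the field nor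
  on t, c or \<psi>; this makes the bound uniform in the step size.\<close>

lemma caccioppoli:
  obtains C where "C > 0"
    "\<And>\<alpha> \<beta> \<tau> t c \<psi>. t \<in> {-1..1} \<Longrightarrow> cut \<psi> \<Longrightarrow>
      (\<integral>p. (\<psi> p)\<^sup>2 * energy (dq (fld (-2) \<alpha> \<beta> \<tau>) t c) (dq (fld (-2) \<alpha> \<beta> \<tau>) t c) p \<partial>wmeas a)
      \<le> C * (\<integral>p. energy \<psi> \<psi> p * (dq (fld (-2) \<alpha> \<beta> \<tau>) t c p)\<^sup>2 + (\<psi> p)\<^sup>2 * (dq (fld (-2) \<alpha> \<beta> \<tau>) t c p)\<^sup>2 \<partial>wmeas a)"
proof -
  obtain K where K: "K > 0" "\<And>x y. has_tr u x \<Longrightarrow> has_tr u y \<Longrightarrow> \<bar>f (btr u x) - f (btr u y)\<bar> \<le> K * \<bar>btr u x - btr u y\<bar>"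
    by (rule f_btr_bound) (rule that)
  \<comment> \<open>The trace term costs K \<epsilon> (2 Q + 2 A) = Q/4 + A/4, where A is the energy
    to be bounded and Q carries the derivatives of \<psi>; so A/4 is absorbed by the available
    A/2.\<close>
  define \<epsilon> where "\<epsilon> = 1 / (8 * K)"
  have \<epsilon>: "\<epsilon> > 0" "K * \<epsilon> = 1 / 8" using K by (simp_all add: \<epsilon>_def)
  obtain C \<delta> where C: "C \<ge> 0" and
    trI: "\<And>z. hcs a z \<Longrightarrow> integrable lborel (\<lambda>x. (btr z x)\<^sup>2)" and
    tr: "\<And>z. hcs a z \<Longrightarrow> (\<integral>x. (btr z x)\<^sup>2 \<partial>lborel) \<le> \<epsilon> * (\<integral>p. energy z z p \<partial>wmeas a)
        + C * (\<integral>p. indicator {p. snd p > \<delta>} p * (z p)\<^sup>2 \<partial>wmeas a)"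
    by (rule trace_inequality_hcs[OF aa \<epsilon>(1)]) (rule that)
  show ?thesis
  \<comment> \<open>From A/2 - 2 Q \<le> Q/4 + A/4 + K C P follows A \<le> 9 Q + 4 K C P.\<close>
  proof (rule that[of "9 + 4 * K * C"])
    have KC: "0 \<le> K * C" using K C by simp
    then show "0 < 9 + 4 * K * C" by linarith
    fix \<alpha> \<beta> \<tau> t c :: real and \<psi> assume t: "t \<in> {-1..1}" and \<psi>: "cut \<psi>"
    define V where "V = fld (-2) \<alpha> \<beta> \<tau>"
    define D where "D = dq V t c"
    have HD: "Hloc a D" unfolding D_def V_def by (rule dq_Hloc[OF t])
    have lD: "locbdd D" unfolding D_def V_def by (rule dq_locbdd)
    note CD = Hloc_C1[OF HD] note C\<psi> = cut_C1[OF \<psi>, of half_space]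
    let ?z = "\<lambda>p. D p * \<psi> p" let ?\<xi> = "\<lambda>p. D p * (\<psi> p * \<psi> p)"
    have tz: "tst a ?z" by (rule tst_mult_cut[OF HD lD \<psi>])
    have t\<xi>: "tst a ?\<xi>" by (rule tst_mult_cut[OF HD lD cut_mult[OF \<psi> \<psi>]])
    note I = cut_integrable[OF HD \<psi>]
    let ?A = "\<integral>p. (\<psi> p)\<^sup>2 * energy D D p \<partial>wmeas a"
    let ?Q = "\<integral>p. energy \<psi> \<psi> p * (D p)\<^sup>2 \<partial>wmeas a"
    let ?P = "\<integral>p. (\<psi> p)\<^sup>2 * (D p)\<^sup>2 \<partial>wmeas a"
    let ?T = "\<integral>x. (btr ?z x)\<^sup>2 \<partial>lborel"
    have low: "?A / 2 - 2 * ?Q \<le> (\<integral>p. energy D ?\<xi> p \<partial>wmeas a)"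
    proof -
      have "?A / 2 - 2 * ?Q = (\<integral>p. (\<psi> p)\<^sup>2 * energy D D p / 2 - 2 * (energy \<psi> \<psi> p * (D p)\<^sup>2) \<partial>wmeas a)"
        using I by simp
      also have "\<dots> \<le> (\<integral>p. energy D ?\<xi> p \<partial>wmeas a)"
      proof (rule wmeas_le_real)
        show "integrable (wmeas a) (\<lambda>p. (\<psi> p)\<^sup>2 * energy D D p / 2 - 2 * (energy \<psi> \<psi> p * (D p)\<^sup>2))" using I by simp
        show "integrable (wmeas a) (energy D ?\<xi>)" by (rule energy_tst_integrable[OF HD t\<xi>])
        fix p assume p: "p \<in> half_space"
        note d = C1_diff[OF CD p] C1_diff[OF C\<psi> p]
        have "energy D ?\<xi> p = (\<psi> p)\<^sup>2 * energy D D p + 2 * (D p * \<psi> p * energy D \<psi> p)"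
          unfolding energy_mult(2)[OF d(1) differentiable_mult[OF d(2,2)]] energy_mult(2)[OF d(2,2)]
          by (simp add: power2_eq_square algebra_simps)
        moreover have "2 * \<bar>(\<psi> p / 2) * (2 * D p) * energy D \<psi> p\<bar> \<le> (\<psi> p / 2)\<^sup>2 * energy D D p + (2 * D p)\<^sup>2 * energy \<psi> \<psi> p"
          by (rule energy_young)
        moreover have "(\<psi> p / 2) * (2 * D p) * energy D \<psi> p = D p * \<psi> p * energy D \<psi> p" by simp
        \<comment> \<open>Young's inequality with both factors scaled by sqrt 2, which divides the
          cross term into A/2 and 2 Q.\<close>
        moreover have "2 * \<bar>(\<psi> p / 2) * (2 * D p) * energy D \<psi> p\<bar> \<le> (\<psi> p)\<^sup>2 * energy D D p / 2 + 2 * (energy \<psi> \<psi> p * (D p)\<^sup>2)"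
          using energy_young[of "\<psi> p / 2 * sqrt 2" "D p * sqrt 2" D \<psi> p] by (simp add: power_mult_distrib power_divide algebra_simps abs_mult)
        ultimately show "(\<psi> p)\<^sup>2 * energy D D p / 2 - 2 * (energy \<psi> \<psi> p * (D p)\<^sup>2) \<le> energy D ?\<xi> p" by linarith
      qed
      finally show ?thesis .
    qed
    have up: "(\<integral>p. energy D ?\<xi> p \<partial>wmeas a) \<le> K * ?T"
    proof -
      have "(\<integral>p. energy D ?\<xi> p \<partial>wmeas a) = (\<integral>x. c * (f (btr u (bflow V t x)) - f (btr u x)) * btr ?\<xi> x \<partial>lborel)"
        unfolding D_def V_def by (rule dq_equation[OF t\<xi>[unfolded D_def V_def] t])
      also have "\<dots> \<le> (\<integral>x. K * (btr ?z x)\<^sup>2 \<partial>lborel)"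
      proof (rule integral_mono_AE')
        show "integrable lborel (\<lambda>x. K * (btr ?z x)\<^sup>2)" using trI[OF tst_hcs[OF a1 tz]] by simp
        show "AE x in lborel. 0 \<le> K * (btr ?z x)\<^sup>2" using K by (intro AE_I2) simp
        show "AE x in lborel. c * (f (btr u (bflow V t x)) - f (btr u x)) * btr ?\<xi> x \<le> K * (btr ?z x)\<^sup>2"
          using u_has_tr AE_bflow[OF u_has_tr, of "-2" \<alpha> \<beta> \<tau> t, folded V_def]
        proof eventually_elim
          case (elim x)
          have tr\<psi>: "has_tr \<psi> x" "btr \<psi> x = \<psi> (x, 0)" using btr_continuous[OF C1_cont[OF cut_C1[OF \<psi>]]] by blast+
          have h1: "has_tr (\<lambda>p. u (flow V t p)) x" "btr (\<lambda>p. u (flow V t p)) x = btr u (bflow V t x)"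
            using elim(2) unfolding V_def by (simp_all add: btr_flow)
          have trD: "has_tr D x" "btr D x = c * (btr u (bflow V t x) - btr u x)"
            unfolding D_def dq_def[abs_def] using btr_cmult btr_diff[OF h1(1) elim(1)] h1(2) by metis+
          have "btr ?z x = btr D x * \<psi> (x, 0)" using btr_mult[OF trD(1) tr\<psi>(1)] tr\<psi>(2) by simp
          moreover have "btr ?\<xi> x = btr D x * (\<psi> (x, 0) * \<psi> (x, 0))"
            using btr_mult[OF trD(1) conjunct1[OF btr_mult[OF tr\<psi>(1) tr\<psi>(1)]]] btr_mult[OF tr\<psi>(1) tr\<psi>(1)] tr\<psi>(2) by simp
          moreover have "c * (f (btr u (bflow V t x)) - f (btr u x)) * btr D x \<le> K * (btr D x)\<^sup>2"
          proof -
            have "\<bar>c\<bar> * \<bar>f (btr u (bflow V t x)) - f (btr u x)\<bar> \<le> \<bar>c\<bar> * (K * \<bar>btr u (bflow V t x) - btr u x\<bar>)"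
              by (intro mult_left_mono K(2) elim) simp
            also have "\<dots> = K * \<bar>btr D x\<bar>" by (simp add: trD(2) abs_mult)
            finally have "\<bar>c * (f (btr u (bflow V t x)) - f (btr u x))\<bar> * \<bar>btr D x\<bar> \<le> K * \<bar>btr D x\<bar> * \<bar>btr D x\<bar>"
              unfolding abs_mult by (rule mult_right_mono) simp
            then have "\<bar>c * (f (btr u (bflow V t x)) - f (btr u x)) * btr D x\<bar> \<le> K * (btr D x)\<^sup>2"
              by (simp add: abs_mult power2_eq_square mult.assoc)
            then show ?thesis by linarith
          qed
          from mult_right_mono[OF this, of "(\<psi> (x, 0))\<^sup>2"]
          have "c * (f (btr u (bflow V t x)) - f (btr u x)) * btr D x * (\<psi> (x, 0))\<^sup>2 \<le> K * (btr D x)\<^sup>2 * (\<psi> (x, 0))\<^sup>2" by simp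
          ultimately show ?case by (simp add: power2_eq_square mult.assoc mult.left_commute)
        qed
      qed
      finally show ?thesis by simp
    qed
    have E: "(\<integral>p. energy ?z ?z p \<partial>wmeas a) \<le> 2 * ?Q + 2 * ?A"
    proof -
      have "(\<integral>p. energy ?z ?z p \<partial>wmeas a) \<le> (\<integral>p. 2 * (energy \<psi> \<psi> p * (D p)\<^sup>2) + 2 * ((\<psi> p)\<^sup>2 * energy D D p) \<partial>wmeas a)"
      proof (rule wmeas_le_real[OF tst_integrable[OF tz]])
        show "integrable (wmeas a) (\<lambda>p. 2 * (energy \<psi> \<psi> p * (D p)\<^sup>2) + 2 * ((\<psi> p)\<^sup>2 * energy D D p))" using I by simp
        fix p assume p: "p \<in> half_space"
        show "energy ?z ?z p \<le> 2 * (energy \<psi> \<psi> p * (D p)\<^sup>2) + 2 * ((\<psi> p)\<^sup>2 * energy D D p)"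
          using energy_mult_le[OF C1_diff[OF CD p] C1_diff[OF C\<psi> p]] by (simp add: mult_ac)
      qed
      then show ?thesis using I by simp
    qed
    have S: "(\<integral>p. indicator {p. snd p > \<delta>} p * (?z p)\<^sup>2 \<partial>wmeas a) \<le> ?P"
      by (rule integral_mono_AE'[OF I(1)]) (auto intro!: AE_I2 simp: indicator_def power_mult_distrib)
    have "K * ?T \<le> K * (\<epsilon> * (2 * ?Q + 2 * ?A) + C * ?P)"
    proof (rule mult_left_mono)
      show "?T \<le> \<epsilon> * (2 * ?Q + 2 * ?A) + C * ?P"
        using tr[OF tst_hcs[OF a1 tz]] mult_left_mono[OF E, of \<epsilon>] mult_left_mono[OF S C] \<epsilon>(1) by linarith
    qed (use K in simp)
    also have "\<dots> = (K * \<epsilon>) * (2 * ?Q + 2 * ?A) + K * C * ?P" by (simp add: algebra_simps)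
    also have "\<dots> = ?Q / 4 + ?A / 4 + K * C * ?P" unfolding \<epsilon>(2) by simp
    finally have "?A / 2 - 2 * ?Q \<le> ?Q / 4 + ?A / 4 + K * C * ?P" using low up by linarith
    then have "?A \<le> 9 * ?Q + 4 * (K * C * ?P)" by linarith
    moreover have "0 \<le> ?Q" "0 \<le> ?P" by (intro integral_nonneg_AE AE_I2; simp)+
    then have "0 \<le> K * C * ?Q" "0 \<le> ?P" using KC by simp_all
    moreover have "(9 + 4 * K * C) * (?Q + ?P) = 9 * ?Q + 9 * ?P + 4 * (K * C * ?Q) + 4 * (K * C * ?P)"
      by (simp add: algebra_simps)
    ultimately have "?A \<le> (9 + 4 * K * C) * (?Q + ?P)" by linarith
    then show "(\<integral>p. (\<psi> p)\<^sup>2 * energy (dq (fld (-2) \<alpha> \<beta> \<tau>) t c) (dq (fld (-2) \<alpha> \<beta> \<tau>) t c) p \<partial>wmeas a)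
      \<le> (9 + 4 * K * C) * (\<integral>p. energy \<psi> \<psi> p * (dq (fld (-2) \<alpha> \<beta> \<tau>) t c p)\<^sup>2 + (\<psi> p)\<^sup>2 * (dq (fld (-2) \<alpha> \<beta> \<tau>) t c p)\<^sup>2 \<partial>wmeas a)"
      using I unfolding D_def V_def by simp
  qed
qed

text \<open>Caccioppoli for the cutoff \<open>\<psi>\<^sup>2\<close>, with the right-hand side bounded by \<open>\<integral> \<psi>\<^sup>2 D\<^sup>2\<close>.\<close>

lemma caccioppoli_sq:
  assumes \<psi>: "cut \<psi>"
  obtains C where "C \<ge> 0"
    "\<And>\<alpha> \<beta> \<tau> t c. t \<in> {-1..1} \<Longrightarrow>
      (\<integral>p. (\<psi> p * \<psi> p)\<^sup>2 * energy (dq (fld (-2) \<alpha> \<beta> \<tau>) t c) (dq (fld (-2) \<alpha> \<beta> \<tau>) t c) p \<partial>wmeas a)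
      \<le> C * (\<integral>p. (\<psi> p)\<^sup>2 * (dq (fld (-2) \<alpha> \<beta> \<tau>) t c p)\<^sup>2 \<partial>wmeas a)"
proof -
  obtain C where C: "C > 0" and cc: "\<And>\<alpha> \<beta> \<tau> t c \<psi>. t \<in> {-1..1} \<Longrightarrow> cut \<psi> \<Longrightarrow>
      (\<integral>p. (\<psi> p)\<^sup>2 * energy (dq (fld (-2) \<alpha> \<beta> \<tau>) t c) (dq (fld (-2) \<alpha> \<beta> \<tau>) t c) p \<partial>wmeas a)
      \<le> C * (\<integral>p. energy \<psi> \<psi> p * (dq (fld (-2) \<alpha> \<beta> \<tau>) t c p)\<^sup>2 + (\<psi> p)\<^sup>2 * (dq (fld (-2) \<alpha> \<beta> \<tau>) t c p)\<^sup>2 \<partial>wmeas a)"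
    by (rule caccioppoli) (rule that)
  obtain R B where RB: "R > 0" "B \<ge> 0" "\<And>p. \<bar>\<psi> p\<bar> \<le> B" "\<And>p. energy \<psi> \<psi> p \<le> B"
    "\<And>p. R \<le> norm p \<Longrightarrow> \<psi> p = 0" "\<And>p. R \<le> norm p \<Longrightarrow> energy \<psi> \<psi> p = 0"
    by (rule cut_bounds[OF \<psi>]) (rule that)
  note C\<psi> = cut_C1[OF \<psi>, of half_space]
  let ?\<psi>2 = "\<lambda>p. \<psi> p * \<psi> p"
  note c2 = cut_mult[OF \<psi> \<psi>]
  show ?thesis
  proof (rule that[of "C * (4 * B + B\<^sup>2)"])
    show "0 \<le> C * (4 * B + B\<^sup>2)" using C RB by simp
    fix \<alpha> \<beta> \<tau> t c :: real assume t: "t \<in> {-1..1}"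
    let ?D = "dq (fld (-2) \<alpha> \<beta> \<tau>) t c"
    have HD: "Hloc a ?D" by (rule dq_Hloc[OF t])
    note I = cut_integrable[OF HD c2] note I1 = cut_integrable[OF HD \<psi>]
    have "(\<integral>p. energy ?\<psi>2 ?\<psi>2 p * (?D p)\<^sup>2 + (?\<psi>2 p)\<^sup>2 * (?D p)\<^sup>2 \<partial>wmeas a) \<le> (\<integral>p. (4 * B + B\<^sup>2) * ((\<psi> p)\<^sup>2 * (?D p)\<^sup>2) \<partial>wmeas a)"
    proof (rule wmeas_le_real)
      show "integrable (wmeas a) (\<lambda>p. energy ?\<psi>2 ?\<psi>2 p * (?D p)\<^sup>2 + (?\<psi>2 p)\<^sup>2 * (?D p)\<^sup>2)" using I(1,3) by simp
      show "integrable (wmeas a) (\<lambda>p. (4 * B + B\<^sup>2) * ((\<psi> p)\<^sup>2 * (?D p)\<^sup>2))" using I1(1) by simp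
      fix p assume p: "p \<in> half_space"
      note d = C1_diff[OF C\<psi> p]
      have "energy ?\<psi>2 ?\<psi>2 p = 4 * (\<psi> p)\<^sup>2 * energy \<psi> \<psi> p"
        unfolding energy_mult(1)[OF d d] energy_mult(2)[OF d d] by (simp add: power2_eq_square)
      also have "\<dots> \<le> 4 * (\<psi> p)\<^sup>2 * B" using RB(4) by (intro mult_left_mono) auto
      finally have 1: "energy ?\<psi>2 ?\<psi>2 p \<le> 4 * B * (\<psi> p)\<^sup>2" by (simp add: mult_ac)
      have "(\<psi> p)\<^sup>2 \<le> B\<^sup>2" using RB(3)[of p] by (metis abs_ge_zero power2_abs power_mono)
      from mult_right_mono[OF this, of "(\<psi> p)\<^sup>2"] have 2: "(?\<psi>2 p)\<^sup>2 \<le> B\<^sup>2 * (\<psi> p)\<^sup>2" by (simp add: power_mult_distrib power2_eq_square)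
      have "(energy ?\<psi>2 ?\<psi>2 p + (?\<psi>2 p)\<^sup>2) * (?D p)\<^sup>2 \<le> ((4 * B + B\<^sup>2) * (\<psi> p)\<^sup>2) * (?D p)\<^sup>2"
        using 1 2 by (intro mult_right_mono) (simp_all add: distrib_right)
      then show "energy ?\<psi>2 ?\<psi>2 p * (?D p)\<^sup>2 + (?\<psi>2 p)\<^sup>2 * (?D p)\<^sup>2 \<le> (4 * B + B\<^sup>2) * ((\<psi> p)\<^sup>2 * (?D p)\<^sup>2)"
        by (simp add: distrib_right mult.assoc)
    qed
    from mult_left_mono[OF this less_imp_le[OF C]] cc[OF t c2, of \<alpha> \<beta> \<tau> c]
    show "(\<integral>p. (?\<psi>2 p)\<^sup>2 * energy ?D ?D p \<partial>wmeas a) \<le> C * (4 * B + B\<^sup>2) * (\<integral>p. (\<psi> p)\<^sup>2 * (?D p)\<^sup>2 \<partial>wmeas a)"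
      by simp
  qed
qed

end

section \<open>The derivative along the centre\<close>

lemma hX_hY_continuous_pd:
  assumes "C1 half_space F"
  shows "continuous_on half_space (\<lambda>p. pd (fld 2 1 0 0 p) F p)" "continuous_on half_space (\<lambda>p. pd (fld 2 0 1 0 p) F p)"
  using h_cont[OF assms] hX_pd[OF C1_diff[OF assms]] hY_pd[OF C1_diff[OF assms]]
  by (auto cong: continuous_on_cong)

lemma integral_slab_hX_zero:
  assumes a: "a > -1" and F: "C1 half_space F" and F0: "\<And>p. p \<in> half_space \<Longrightarrow> R \<le> norm p \<Longrightarrow> F p = 0" and \<delta>: "\<delta> > 0"
  shows "(\<integral>p. indicator {p. \<delta> \<le> snd p} p * hX F p \<partial>wmeas a) = 0"
    "(\<integral>p. indicator {p. \<delta> \<le> snd p} p * hY F p \<partial>wmeas a) = 0"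
proof -
  note c = hX_hY_continuous_pd[OF F]
  have "(\<integral>p. indicator {p. \<delta> \<le> snd p} p * pd (fld 2 1 0 0 p) F p \<partial>wmeas a) = 0"
    by (rule integral_slab_derivative_zero[OF a F c(1) F0 \<delta>])
  then show "(\<integral>p. indicator {p. \<delta> \<le> snd p} p * hX F p \<partial>wmeas a) = 0"
    by (subst wmeas_cong(1)[of _ "\<lambda>p. indicator {p. \<delta> \<le> snd p} p * pd (fld 2 1 0 0 p) F p"]) (simp_all add: hX_pd[OF C1_diff[OF F]])
  have "(\<integral>p. indicator {p. \<delta> \<le> snd p} p * pd (fld 2 0 1 0 p) F p \<partial>wmeas a) = 0"
    by (rule integral_slab_derivative_zero[OF a F c(2) F0 \<delta>])
  then show "(\<integral>p. indicator {p. \<delta> \<le> snd p} p * hY F p \<partial>wmeas a) = 0"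
    by (subst wmeas_cong(1)[of _ "\<lambda>p. indicator {p. \<delta> \<le> snd p} p * pd (fld 2 0 1 0 p) F p"]) (simp_all add: hY_pd[OF C1_diff[OF F]])
qed

text \<open>X and Y are tangential to y = 0, so no boundary term appears even if F does not vanish
  there; the slab identity passes to the limit.\<close>

lemma integral_hX_zero:
  assumes a: "a > -1" and F: "C1 half_space F" and F0: "\<And>p. p \<in> half_space \<Longrightarrow> R \<le> norm p \<Longrightarrow> F p = 0"
  shows "integrable (wmeas a) (hX F) \<Longrightarrow> (\<integral>p. hX F p \<partial>wmeas a) = 0"
    "integrable (wmeas a) (hY F) \<Longrightarrow> (\<integral>p. hY F p \<partial>wmeas a) = 0"
  using slab_limit[of a "hX F"] slab_limit[of a "hY F"] integral_slab_hX_zero[OF a F F0, of R]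
  by (simp_all add: LIMSEQ_const_iff)

lemma young_1: "\<kappa> > 0 \<Longrightarrow> \<bar>x::real\<bar> \<le> \<kappa> * x\<^sup>2 + 1 / (4 * \<kappa>)"
proof -
  assume l: "\<kappa> > 0"
  have "0 \<le> (2 * \<kappa> * \<bar>x\<bar> - 1)\<^sup>2 / (4 * \<kappa>)" using l by simp
  also have "\<dots> = \<kappa> * x\<^sup>2 + 1 / (4 * \<kappa>) - \<bar>x\<bar>" using l by (simp add: power2_eq_square field_simps)
  finally show ?thesis by simp
qed

lemma young_2: "\<kappa> > 0 \<Longrightarrow> \<bar>2 * x * y\<bar> \<le> \<kappa> * x\<^sup>2 + (y::real)\<^sup>2 / \<kappa>"
proof -
  assume l: "\<kappa> > 0"
  have "0 \<le> (\<kappa> * \<bar>x\<bar> - \<bar>y\<bar>)\<^sup>2 / \<kappa>" using l by simp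
  also have "\<dots> = \<kappa> * x\<^sup>2 + y\<^sup>2 / \<kappa> - \<bar>2 * x * y\<bar>" using l by (simp add: power2_eq_square abs_mult field_simps)
  finally show ?thesis by simp
qed

lemma half_ball_integrable: "a > -1 \<Longrightarrow> integrable (wmeas a) (\<lambda>p. indicator (half_ball R) p :: real)"
  using emeasure_half_ball[of a R] by simp

text \<open>First powers of the derivatives are integrable because the support is bounded and
  half-balls have finite mass.\<close>

lemma tst_grad_integrable:
  assumes a: "a > -1" and t: "tst a G"
  shows "integrable (wmeas a) (\<lambda>p. \<bar>hX G p\<bar> + \<bar>hY G p\<bar>)"
proof -
  obtain R where R: "\<And>p w. p \<in> half_space \<Longrightarrow> R \<le> norm p \<Longrightarrow> energy w G p = 0" by (rule tst_support[OF t]) blast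
  show ?thesis
  proof (rule Bochner_Integration.integrable_bound[OF Bochner_Integration.integrable_add[OF half_ball_integrable[OF a, of R] tst_integrable[OF t]]])
    show "(\<lambda>p. \<bar>hX G p\<bar> + \<bar>hY G p\<bar>) \<in> borel_measurable (wmeas a)"
      by (intro continuous_wmeas_measurable continuous_intros h_cont tst_C1[OF t])
    show "AE p in wmeas a. norm (\<bar>hX G p\<bar> + \<bar>hY G p\<bar>) \<le> norm (indicator (half_ball R) p + energy G G p)"
    proof (rule AE_I2)
      fix p assume "p \<in> space (wmeas a)"
      then have p: "p \<in> half_space" by simp
      show "norm (\<bar>hX G p\<bar> + \<bar>hY G p\<bar>) \<le> norm (indicator (half_ball R) p + energy G G p)"
      proof (cases "R \<le> norm p")
        case True
        have "(hX G p)\<^sup>2 \<le> 0" "(hY G p)\<^sup>2 \<le> 0" using energy_components[of G p] R[OF p True, of G] by simp_all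
        then show ?thesis by simp
      next
        case False
        then have "indicator (half_ball R) p = (1::real)" using half_ballI[OF p] by simp
        moreover have "\<bar>hX G p\<bar> + \<bar>hY G p\<bar> \<le> 1 + ((hX G p)\<^sup>2 + (hY G p)\<^sup>2)"
          using young_1[of 1 "hX G p"] young_1[of 1 "hY G p"] by simp
        moreover have "(hX G p)\<^sup>2 + (hY G p)\<^sup>2 \<le> energy G G p" by (simp add: energy_def power2_eq_square)
        ultimately show ?thesis by simp
      qed
    qed
  qed
qed

context heis_sol
begin

text \<open>Since \<open>4 \<partial>\<^sub>3 = - [X, Y]\<close>, an integral against \<open>\<partial>\<^sub>3 u\<close> is controlled, after integrating by
  parts, by the bounded horizontal gradient of \<open>u\<close>.\<close>

lemma T_derivative_bound:
  defines "V \<equiv> fld (-2) 0 0 1"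
  assumes t: "tst a G" and G0: "\<And>p. p \<in> half_space \<Longrightarrow> R \<le> norm p \<Longrightarrow> G p = 0" and s: "s \<in> {-1..1}"
    and R2: "\<And>t q. t \<in> {-1..1} \<Longrightarrow> norm q \<le> R \<Longrightarrow> norm (flow V t q) < R2"
    and M: "\<And>p. p \<in> half_ball R2 \<Longrightarrow> \<bar>hX u p\<bar> \<le> M \<and> \<bar>hY u p\<bar> \<le> M" and \<delta>: "\<delta> > 0"
  shows "\<bar>\<integral>p. indicator {p. \<delta> \<le> snd p} p * G p * pd b3 u (flow V s p) \<partial>wmeas a\<bar> \<le> M / 4 * (\<integral>p. \<bar>hX G p\<bar> + \<bar>hY G p\<bar> \<partial>wmeas a)"
proof -
  let ?c = "\<lambda>p::hpt. indicator {p. \<delta> \<le> snd p} p :: real"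
  let ?uX = "\<lambda>q. hX u (flow V s q)" let ?uY = "\<lambda>q. hY u (flow V s q)"
  note CG = tst_C1[OF t]
  have CX: "C1 half_space ?uX" "C1 half_space ?uY" unfolding V_def by (intro C1_flow u_C1)+
  let ?F1 = "\<lambda>q. G q * ?uY q" let ?F2 = "\<lambda>q. G q * ?uX q"
  have C1F: "C1 half_space ?F1" "C1 half_space ?F2" by (intro C1_mult CG CX)+
  have z: "(\<integral>p. ?c p * hX ?F1 p \<partial>wmeas a) = 0" "(\<integral>p. ?c p * hY ?F2 p \<partial>wmeas a) = 0"
    by (rule integral_slab_hX_zero[OF a1 C1F(1) _ \<delta>, of R] integral_slab_hX_zero[OF a1 C1F(2) _ \<delta>, of R], simp add: G0)+
  have van: "hX G p = 0" "hY G p = 0" if p: "p \<in> half_space" "\<bar>R\<bar> + 1 \<le> norm p" for p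
  proof -
    have o: "open (half_space \<inter> {p. \<bar>R\<bar> < norm p})" by (intro open_Int open_half_space open_outside)
    have m: "p \<in> half_space \<inter> {p. \<bar>R\<bar> < norm p}" using p by auto
    have g: "G q = 0" if "q \<in> half_space \<inter> {p. \<bar>R\<bar> < norm p}" for q
      using that by (intro G0) (auto intro: order_trans[OF abs_ge_self])
    show "hX G p = 0" "hY G p = 0" by (rule h_vanish(1,2)[OF o m], erule g)+
  qed
  have van': "hX G p = 0" "hY G p = 0" if p: "p \<in> half_space" "R < norm p" for p
  proof -
    have o: "open (half_space \<inter> {p. R < norm p})" by (intro open_Int open_half_space open_outside)
    have m: "p \<in> half_space \<inter> {p. R < norm p}" using p by auto
    have g: "G q = 0" if "q \<in> half_space \<inter> {p. R < norm p}" for q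
      using that by (intro G0) auto
    show "hX G p = 0" "hY G p = 0" by (rule h_vanish(1,2)[OF o m], erule g)+
  qed
  have vF: "?F1 p = 0" "?F2 p = 0" if "p \<in> half_space" "R \<le> norm p" for p using G0[OF that] by simp_all
  have vhF: "hX ?F1 p = 0" "hY ?F2 p = 0" if p: "p \<in> half_space" "\<bar>R\<bar> + 1 \<le> norm p" for p
  proof -
    note d = C1_diff[OF CG p(1)] C1_diff[OF CX(1) p(1)] C1_diff[OF CX(2) p(1)]
    have "G p = 0" using p by (intro G0) auto
    then show "hX ?F1 p = 0" "hY ?F2 p = 0" using van[OF p] by (simp_all add: h_mult d)
  qed
  let ?W = "\<lambda>p. ?uY p * hX G p - ?uX p * hY G p"
  have iW: "integrable (wmeas a) (\<lambda>p. ?c p * ?W p)"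
    by (rule slab_integrable[OF a1 _ _ \<delta>, of _ "\<bar>R\<bar> + 1"])
       (intro continuous_intros C1_cont[OF CX(1)] C1_cont[OF CX(2)] h_cont CG, simp add: van)
  have i1: "integrable (wmeas a) (\<lambda>p. ?c p * hX ?F1 p)" "integrable (wmeas a) (\<lambda>p. ?c p * hY ?F2 p)"
    by (rule slab_integrable[OF a1 h_cont(1)[OF C1F(1)] vhF(1) \<delta>], assumption+)
       (rule slab_integrable[OF a1 h_cont(2)[OF C1F(2)] vhF(2) \<delta>], assumption+)
  \<comment> \<open>Pointwise 4 G d_3 u = W - X(G Yu) + Y(G Xu) with W = Yu XG - Xu YG, the
    derivatives of u being taken at the translated point. The last two terms integrate to 0 over the
    slab.\<close>
  have "(\<integral>p. ?c p * G p * pd b3 u (flow V s p) \<partial>wmeas a) = (\<integral>p. (1/4) * (?c p * ?W p) - (1/4) * (?c p * hX ?F1 p - ?c p * hY ?F2 p) \<partial>wmeas a)"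
  proof (rule wmeas_cong(1))
    fix p assume p: "p \<in> half_space"
    then have p': "flow V s p \<in> half_space" by (simp add: V_def)
    note d = C1_diff[OF CG p(1)] C1_diff[OF CX(1) p(1)] C1_diff[OF CX(2) p(1)]
    have 1: "hX ?uY p = hX (hY u) (flow V s p)" "hY ?uX p = hY (hX u) (flow V s p)"
      unfolding V_def by (intro h_flow u_C1 p)+
    have 2: "hX (hY u) (flow V s p) = hY (hX u) (flow V s p) - 4 * pd b3 u (flow V s p)"
      using hX_hY_commutator[OF u2 p'] by linarith
    show "?c p * G p * pd b3 u (flow V s p) = (1/4) * (?c p * ?W p) - (1/4) * (?c p * hX ?F1 p - ?c p * hY ?F2 p)"
      unfolding h_mult(1)[OF d(1,3)] h_mult(2)[OF d(1,2)] 1 2 by (simp add: algebra_simps)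
  qed
  also have "\<dots> = (1/4) * (\<integral>p. ?c p * ?W p \<partial>wmeas a)" using iW i1 z by simp
  finally have e: "(\<integral>p. ?c p * G p * pd b3 u (flow V s p) \<partial>wmeas a) = (1/4) * (\<integral>p. ?c p * ?W p \<partial>wmeas a)" .
  have "\<bar>\<integral>p. ?c p * ?W p \<partial>wmeas a\<bar> \<le> (\<integral>p. M * (\<bar>hX G p\<bar> + \<bar>hY G p\<bar>) \<partial>wmeas a)"
  proof -
    have "norm (\<integral>p. ?c p * ?W p \<partial>wmeas a) \<le> (\<integral>p. M * (\<bar>hX G p\<bar> + \<bar>hY G p\<bar>) \<partial>wmeas a)"
    proof (rule Bochner_Integration.integral_norm_bound_integral[OF iW])
      show "integrable (wmeas a) (\<lambda>p. M * (\<bar>hX G p\<bar> + \<bar>hY G p\<bar>))" using tst_grad_integrable[OF a1 t] by simp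
      fix p assume "p \<in> space (wmeas a)"
      then have p: "p \<in> half_space" by simp
      show "norm (?c p * ?W p) \<le> M * (\<bar>hX G p\<bar> + \<bar>hY G p\<bar>)"
      proof (cases "R < norm p")
        case False
        then have "flow V s p \<in> half_ball R2" using R2[OF s, of p] p by (simp add: half_ball_def V_def)
        note m = M[OF this]
        have "\<bar>?W p\<bar> \<le> \<bar>?uY p\<bar> * \<bar>hX G p\<bar> + \<bar>?uX p\<bar> * \<bar>hY G p\<bar>"
          using abs_triangle_ineq4[of "?uY p * hX G p" "?uX p * hY G p"] by (simp add: abs_mult)
        also have "\<dots> \<le> M * \<bar>hX G p\<bar> + M * \<bar>hY G p\<bar>" using m by (intro add_mono mult_right_mono) auto
        finally have "\<bar>?W p\<bar> \<le> M * (\<bar>hX G p\<bar> + \<bar>hY G p\<bar>)" by (simp add: distrib_left)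
        moreover have "norm (?c p * ?W p) \<le> \<bar>?W p\<bar>" by (simp add: indicator_def)
        ultimately show ?thesis by linarith
      qed (use van'[OF p] in simp)
    qed
    then show ?thesis by simp
  qed
  then show ?thesis unfolding e by simp
qed

text \<open>The bootstrap. Let D be the quotient and P the integral of \<psi>^2 D^2. Writing one
  factor D as a mean of d_3 u along the flow gives P \<le> M/4 times the L^1 norm of the horizontal
  gradient of D \<psi>^2. Young's inequality bounds that norm by \<kappa> times the energy of D with
  weight \<psi>^4, plus 2 \<kappa> P, plus a constant; Caccioppoli bounds the energy by C P. A small
  \<kappa> closes the estimate uniformly in h.\<close>

lemma T_estimate:
  assumes \<psi>: "cut \<psi>"
  shows "\<exists>P. \<forall>h. 0 < h \<and> h \<le> 1 \<longrightarrow> (\<integral>p. (\<psi> p)\<^sup>2 * (dq (fld (-2) 0 0 1) h (1 / h) p)\<^sup>2 \<partial>wmeas a) \<le> P"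
proof -
  define V where "V = fld (-2) 0 0 1"
  obtain R B where RB: "R > 0" "B \<ge> 0" "\<And>p. \<bar>\<psi> p\<bar> \<le> B" "\<And>p. energy \<psi> \<psi> p \<le> B"
    "\<And>p. R \<le> norm p \<Longrightarrow> \<psi> p = 0" "\<And>p. R \<le> norm p \<Longrightarrow> energy \<psi> \<psi> p = 0"
    by (rule cut_bounds[OF \<psi>]) (rule that)
  obtain R2' where R2': "\<And>t q. t \<in> {-1..1} \<Longrightarrow> norm q \<le> R \<Longrightarrow> norm (flow V t q) \<le> R2'"
    using flow_bounded_image[of R "-2" 0 0 1] unfolding V_def by blast
  define R2 where "R2 = R2' + 1"
  have R2: "norm (flow V t q) < R2" if "t \<in> {-1..1}" "norm q \<le> R" for t q using R2'[OF that] by (simp add: R2_def)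
  obtain M0 where M0: "\<And>p. p \<in> half_ball R2 \<Longrightarrow> \<bar>hX u p\<bar> \<le> M0 \<and> \<bar>hY u p\<bar> \<le> M0" using gradient_bound by blast
  define M where "M = \<bar>M0\<bar>"
  have M: "M \<ge> 0" "\<And>p. p \<in> half_ball R2 \<Longrightarrow> \<bar>hX u p\<bar> \<le> M \<and> \<bar>hY u p\<bar> \<le> M"
    using M0 unfolding M_def by (auto intro: order_trans[OF _ abs_ge_self])
  obtain C where C: "C \<ge> 0" and cc0: "\<And>\<alpha> \<beta> \<tau> t c. t \<in> {-1..1} \<Longrightarrow>
      (\<integral>p. (\<psi> p * \<psi> p)\<^sup>2 * energy (dq (fld (-2) \<alpha> \<beta> \<tau>) t c) (dq (fld (-2) \<alpha> \<beta> \<tau>) t c) p \<partial>wmeas a)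
      \<le> C * (\<integral>p. (\<psi> p)\<^sup>2 * (dq (fld (-2) \<alpha> \<beta> \<tau>) t c p)\<^sup>2 \<partial>wmeas a)"
    by (rule caccioppoli_sq[OF \<psi>]) (rule that)
  note cc = cc0[of _ 0 0 1, folded V_def]
  \<comment> \<open>Ensures M (C + 2) \<kappa> \<le> 1, so that at most P/4 returns on the right;
    the summand 1 covers M = 0.\<close>
  define \<kappa> where "\<kappa> = 1 / (M * (C + 2) + 1)"
  have MC: "M * (C + 2) \<ge> 0" using M C by simp
  then have den: "M * (C + 2) + 1 > 0" by linarith
  then have \<kappa>: "\<kappa> > 0" "M * (C + 2) * \<kappa> \<le> 1" using MC by (simp_all add: \<kappa>_def field_simps)
  \<comment> \<open>1 / (2 \<kappa>) collects the constants of Young's inequality for X and Y, and B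
    / \<kappa> the terms with a derivative of \<psi>.\<close>
  define c where "c = 1 / (2 * \<kappa>) + B / \<kappa>"
  define m :: real where "m = (\<integral>p. indicator (half_ball R) p \<partial>wmeas a)"
  note C\<psi> = cut_C1[OF \<psi>, of half_space]
  have main: "(\<integral>p. (\<psi> p)\<^sup>2 * (dq V h (1 / h) p)\<^sup>2 \<partial>wmeas a) \<le> M * (c * m)" if h: "0 < h" "h \<le> 1" for h
  proof -
    have h1: "h \<in> {-1..1}" using h by simp
    define D where "D = dq V h (1 / h)"
    have HD: "Hloc a D" unfolding D_def V_def by (rule dq_Hloc[OF h1])
    have lD: "locbdd D" unfolding D_def V_def by (rule dq_locbdd)
    note CD = Hloc_C1[OF HD]
    let ?G = "\<lambda>p. D p * (\<psi> p * \<psi> p)"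
    have tG: "tst a ?G" by (rule tst_mult_cut[OF HD lD cut_mult[OF \<psi> \<psi>]])
    let ?N = "M / 4 * (\<integral>p. \<bar>hX ?G p\<bar> + \<bar>hY ?G p\<bar> \<partial>wmeas a)"
    let ?P = "\<integral>p. (\<psi> p)\<^sup>2 * (D p)\<^sup>2 \<partial>wmeas a"
    let ?A = "\<integral>p. (\<psi> p * \<psi> p)\<^sup>2 * energy D D p \<partial>wmeas a"
    note I = cut_integrable[OF HD \<psi>]
    note I2 = cut_integrable[OF HD cut_mult[OF \<psi> \<psi>]]
    have PN: "?P \<le> ?N"
    \<comment> \<open>The flow lemmas need a weight supported away from y = 0; the bound obtained
      does not depend on \<delta>.\<close>
    proof (rule slab_bound_imp_bound[OF I(1)])
      fix \<delta> :: real assume \<delta>: "\<delta> > 0"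
      let ?k = "\<lambda>p. indicator {p::hpt. \<delta> \<le> snd p} p * ?G p"
      obtain B1 where B1: "\<And>p. p \<in> half_space \<Longrightarrow> \<bar>?G p\<bar> \<le> B1" using tG unfolding tst_def by blast
      let ?k' = "\<lambda>p. indicator (slab \<delta> R) p * ?G p"
      have kk: "?k p = ?k' p" if "p \<in> half_space" for p
        using RB(5)[of p] by (cases "norm p \<le> R") (auto simp: slab_def indicator_def)
      have km: "?k' \<in> borel_measurable (wmeas a)"
        by (intro borel_measurable_times borel_measurable_indicator slab_sets \<delta> continuous_wmeas_measurable C1_cont CD C\<psi>)
      have kb: "\<bar>?k' p\<bar> \<le> \<bar>B1\<bar>" for p
      proof (cases "p \<in> slab \<delta> R")
        case True
        then have "\<bar>?G p\<bar> \<le> B1" using slab_half_space[OF \<delta>, of R] by (intro B1) blast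
        then show ?thesis using True by simp
      qed simp
      have k0: "?k' p = 0" if "p \<notin> slab \<delta> R" for p using that by simp
      have cV: "continuous_on half_space (\<lambda>p. pd (fld (-2) 0 0 1 p) u p)" by (rule C1_cont[OF C2_fld[OF u2]])
      have "\<bar>\<integral>p. ?k' p * (u (flow V h p) - u p) \<partial>wmeas a\<bar> \<le> h * ?N"
        unfolding V_def
      proof (rule flow_difference_bound[where R = R, OF a1 u_C1(1) cV km kb k0 \<delta>])
        fix t assume t: "t \<in> {0..h}"
        then have t1: "t \<in> {-1..1}" using h by simp
        have b3: "fld (-2) 0 0 1 q = b3" for q by (simp add: fld_eq)
        have e: "(\<integral>p. ?k' p * pd (fld (-2) 0 0 1 (flow (fld (-2) 0 0 1) t p)) u (flow (fld (-2) 0 0 1) t p) \<partial>wmeas a)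
          = (\<integral>p. ?k p * pd b3 u (flow (fld (-2) 0 0 1) t p) \<partial>wmeas a)"
          by (rule wmeas_cong(1)) (simp only: kk b3)
        have b: "\<bar>\<integral>p. ?k p * pd b3 u (flow (fld (-2) 0 0 1) t p) \<partial>wmeas a\<bar> \<le> ?N"
          by (rule T_derivative_bound[OF tG _ t1 R2[unfolded V_def] M(2) \<delta>]) (simp_all add: RB(5))
        show "\<bar>\<integral>p. ?k' p * pd (fld (-2) 0 0 1 (flow (fld (-2) 0 0 1) t p)) u (flow (fld (-2) 0 0 1) t p) \<partial>wmeas a\<bar> \<le> ?N"
          unfolding e by (rule b)
      qed (assumption | rule less_imp_le[OF h(1)])+
      then have "(1 / h) * \<bar>\<integral>p. ?k' p * (u (flow V h p) - u p) \<partial>wmeas a\<bar> \<le> ?N" using h by (simp add: field_simps)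
      moreover have "(\<integral>p. indicator {p. \<delta> \<le> snd p} p * ((\<psi> p)\<^sup>2 * (D p)\<^sup>2) \<partial>wmeas a) = (1 / h) * (\<integral>p. ?k' p * (u (flow V h p) - u p) \<partial>wmeas a)"
      proof -
        have "(\<integral>p. indicator {p. \<delta> \<le> snd p} p * ((\<psi> p)\<^sup>2 * (D p)\<^sup>2) \<partial>wmeas a) = (\<integral>p. (1 / h) * (?k' p * (u (flow V h p) - u p)) \<partial>wmeas a)"
        proof (rule wmeas_cong(1))
          fix p assume p: "p \<in> half_space"
          have "?k p * D p = indicator {p. \<delta> \<le> snd p} p * ((\<psi> p)\<^sup>2 * (D p)\<^sup>2)"
            by (simp add: power2_eq_square mult_ac)
          then have "?k' p * D p = indicator {p. \<delta> \<le> snd p} p * ((\<psi> p)\<^sup>2 * (D p)\<^sup>2)"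
            unfolding kk[OF p] .
          then show "indicator {p. \<delta> \<le> snd p} p * ((\<psi> p)\<^sup>2 * (D p)\<^sup>2) = (1 / h) * (?k' p * (u (flow V h p) - u p))"
            unfolding D_def dq_def by (simp only: mult.left_commute[of "1 / h"])
        qed
        then show ?thesis by simp
      qed
      ultimately show "(\<integral>p. indicator {p. \<delta> \<le> snd p} p * ((\<psi> p)\<^sup>2 * (D p)\<^sup>2) \<partial>wmeas a) \<le> ?N"
        using h by (smt (verit) mult_left_mono divide_nonneg_pos)
    qed
    have "(\<integral>p. \<bar>hX ?G p\<bar> + \<bar>hY ?G p\<bar> \<partial>wmeas a)
      \<le> (\<integral>p. \<kappa> * ((\<psi> p * \<psi> p)\<^sup>2 * energy D D p) + 2 * \<kappa> * ((\<psi> p)\<^sup>2 * (D p)\<^sup>2) + c * indicator (half_ball R) p \<partial>wmeas a)"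
    proof (rule wmeas_le_real[OF tst_grad_integrable[OF a1 tG]])
      show "integrable (wmeas a) (\<lambda>p. \<kappa> * ((\<psi> p * \<psi> p)\<^sup>2 * energy D D p) + 2 * \<kappa> * ((\<psi> p)\<^sup>2 * (D p)\<^sup>2) + c * indicator (half_ball R) p)"
        using I(1) I2(2) half_ball_integrable[OF a1, of R] by (intro Bochner_Integration.integrable_add integrable_mult_right)
      fix p assume p: "p \<in> half_space"
      note d = C1_diff[OF CD p] C1_diff[OF C\<psi> p]
      have e: "hX ?G p = \<psi> p * \<psi> p * hX D p + 2 * (\<psi> p * D p) * hX \<psi> p" "hY ?G p = \<psi> p * \<psi> p * hY D p + 2 * (\<psi> p * D p) * hY \<psi> p"
        unfolding h_mult(1,2)[OF d(1) differentiable_mult[OF d(2,2)]] h_mult(1,2)[OF d(2,2)] by (simp_all add: algebra_simps)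
      show "\<bar>hX ?G p\<bar> + \<bar>hY ?G p\<bar> \<le> \<kappa> * ((\<psi> p * \<psi> p)\<^sup>2 * energy D D p) + 2 * \<kappa> * ((\<psi> p)\<^sup>2 * (D p)\<^sup>2) + c * indicator (half_ball R) p"
      proof (cases "R \<le> norm p")
        case True
        then have "hX ?G p = 0" "hY ?G p = 0" unfolding e by (simp_all add: RB(5))
        then show ?thesis using \<kappa>(1) True by (simp add: RB(5) half_ball_def)
      next
        case False
        then have i: "indicator (half_ball R) p = (1::real)" using half_ballI[OF p] by simp
        have "\<bar>hX ?G p\<bar> \<le> \<kappa> * (\<psi> p * \<psi> p * hX D p)\<^sup>2 + 1 / (4 * \<kappa>) + (\<kappa> * (\<psi> p * D p)\<^sup>2 + (hX \<psi> p)\<^sup>2 / \<kappa>)"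
          unfolding e by (rule order_trans[OF abs_triangle_ineq add_mono[OF young_1[OF \<kappa>(1)] young_2[OF \<kappa>(1)]]])
        moreover have "\<bar>hY ?G p\<bar> \<le> \<kappa> * (\<psi> p * \<psi> p * hY D p)\<^sup>2 + 1 / (4 * \<kappa>) + (\<kappa> * (\<psi> p * D p)\<^sup>2 + (hY \<psi> p)\<^sup>2 / \<kappa>)"
          unfolding e by (rule order_trans[OF abs_triangle_ineq add_mono[OF young_1[OF \<kappa>(1)] young_2[OF \<kappa>(1)]]])
        moreover have "\<kappa> * (\<psi> p * \<psi> p * hX D p)\<^sup>2 + \<kappa> * (\<psi> p * \<psi> p * hY D p)\<^sup>2 \<le> \<kappa> * ((\<psi> p * \<psi> p)\<^sup>2 * energy D D p)"
        proof -
          have "(\<psi> p * \<psi> p)\<^sup>2 * ((hX D p)\<^sup>2 + (hY D p)\<^sup>2) \<le> (\<psi> p * \<psi> p)\<^sup>2 * energy D D p"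
            by (intro mult_left_mono) (simp_all add: energy_def power2_eq_square)
          from mult_left_mono[OF this, of \<kappa>] \<kappa>(1) show ?thesis by (simp add: power_mult_distrib algebra_simps)
        qed
        moreover have "(hX \<psi> p)\<^sup>2 / \<kappa> + (hY \<psi> p)\<^sup>2 / \<kappa> \<le> B / \<kappa>"
        proof -
          have "(hX \<psi> p)\<^sup>2 + (hY \<psi> p)\<^sup>2 \<le> energy \<psi> \<psi> p" by (simp add: energy_def power2_eq_square)
          then have "(hX \<psi> p)\<^sup>2 + (hY \<psi> p)\<^sup>2 \<le> B" using RB(4)[of p] by linarith
          then show ?thesis using \<kappa>(1) by (simp add: add_divide_distrib[symmetric] divide_right_mono)
        qed
        moreover have "1 / (4 * \<kappa>) + 1 / (4 * \<kappa>) = 1 / (2 * \<kappa>)" by simp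
        moreover have "(\<psi> p * D p)\<^sup>2 = (\<psi> p)\<^sup>2 * (D p)\<^sup>2" by (rule power_mult_distrib)
        ultimately show ?thesis unfolding i c_def by simp
      qed
    qed
    also have "\<dots> = \<kappa> * ?A + 2 * \<kappa> * ?P + c * m"
      using I(1) I2(2) half_ball_integrable[OF a1, of R] unfolding m_def by simp
    also have "\<dots> \<le> \<kappa> * (C * ?P) + 2 * \<kappa> * ?P + c * m"
      using mult_left_mono[OF cc[OF h1, of "1 / h", folded D_def], of \<kappa>] \<kappa>(1) by simp
    also have "\<dots> = \<kappa> * (C + 2) * ?P + c * m" by (simp add: algebra_simps)
    finally have "?P \<le> M / 4 * (\<kappa> * (C + 2) * ?P + c * m)"
      using PN mult_left_mono[of _ _ "M / 4"] M(1) by (smt (verit) divide_nonneg_pos)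
    also have "\<dots> = (M * (C + 2) * \<kappa>) * ?P / 4 + M * (c * m) / 4" by (simp add: algebra_simps)
    also have "\<dots> \<le> 1 * ?P / 4 + M * (c * m) / 4"
      using \<kappa>(2) by (intro add_right_mono divide_right_mono mult_right_mono integral_nonneg_AE AE_I2) simp_all
    finally have "?P \<le> M * (c * m) / 3" by linarith
    moreover have "0 \<le> ?P" by (intro integral_nonneg_AE AE_I2) simp
    ultimately show ?thesis unfolding D_def by linarith
  qed
  then show ?thesis unfolding V_def by blast
qed

end

section \<open>Invariant derivatives of the solution\<close>

lemma difference_quotient_tendsto:
  fixes \<alpha> \<beta> \<tau> k :: real
  assumes "C1 half_space g" "p \<in> half_space"
  defines "V \<equiv> fld k \<alpha> \<beta> \<tau>"
  shows "(\<lambda>n. (1 / inverse (real (Suc n))) * (g (flow V (inverse (real (Suc n))) p) - g p)) \<longlonglongrightarrow> pd (V p) g p"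
proof -
  have "((\<lambda>t. g (flow V t p)) has_real_derivative pd (V (flow V 0 p)) g (flow V 0 p)) (at 0)"
    unfolding V_def by (rule flow_line_deriv[OF assms(1,2)])
  then have 1: "((\<lambda>h. (g (flow V (0 + h) p) - g (flow V 0 p)) / h) \<longlongrightarrow> pd (V p) g p) (at 0)"
    unfolding DERIV_def by simp
  have "filterlim (\<lambda>n. inverse (real (Suc n))) (at 0) sequentially"
    unfolding filterlim_at using LIMSEQ_inverse_real_of_nat by simp
  from filterlim_compose[OF 1 this] show ?thesis by (simp add: divide_inverse mult.commute)
qed

context heis_sol
begin

text \<open>The quotients along the field are bounded in weighted L^2 on bounded sets reaching y =
  0, uniformly in h. Caccioppoli and Fatou upgrade this to membership of the derivative in
  \<open>Hloc\<close>.\<close>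

definition good :: "real \<Rightarrow> real \<Rightarrow> real \<Rightarrow> bool" where
  "good \<alpha> \<beta> \<tau> \<longleftrightarrow> (\<forall>\<psi>. cut \<psi> \<longrightarrow> (\<exists>P. \<forall>h. 0 < h \<and> h \<le> 1 \<longrightarrow>
     (\<integral>p. (\<psi> p)\<^sup>2 * (dq (fld (-2) \<alpha> \<beta> \<tau>) h (1 / h) p)\<^sup>2 \<partial>wmeas a) \<le> P))"

text \<open>A quotient is the mean of the derivative along the flow, and the flow preserves the
  measure. In dual form: P is the integral of D \<psi>^2 against that mean, and Young's inequality
  gives P \<le> P/2 + K/2, hence P \<le> K.\<close>

lemma goodI_L2:
  fixes \<alpha> \<beta> \<tau> :: real
  defines "V \<equiv> fld (-2) \<alpha> \<beta> \<tau>"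
  assumes L2: "\<And>R. integrable (wmeas a) (\<lambda>p. indicator (half_ball R) p * (pd (V p) u p)\<^sup>2)"
  shows "good \<alpha> \<beta> \<tau>"
  unfolding good_def V_def[symmetric]
proof (intro allI impI)
  fix \<psi> assume \<psi>: "cut \<psi>"
  let ?w = "\<lambda>p. pd (V p) u p"
  have Cw: "C1 half_space ?w" unfolding V_def by (rule C2_fld[OF u2])
  note cw = C1_cont[OF Cw]
  obtain R B where RB: "R > 0" "B \<ge> 0" "\<And>p. \<bar>\<psi> p\<bar> \<le> B" "\<And>p. energy \<psi> \<psi> p \<le> B"
    "\<And>p. R \<le> norm p \<Longrightarrow> \<psi> p = 0" "\<And>p. R \<le> norm p \<Longrightarrow> energy \<psi> \<psi> p = 0"
    by (rule cut_bounds[OF \<psi>]) (rule that)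
  obtain R2 where R2: "\<And>t q. t \<in> {-1..1} \<Longrightarrow> norm q \<le> R \<Longrightarrow> norm (flow V t q) \<le> R2"
    using flow_bounded_image[of R "-2" \<alpha> \<beta> \<tau>] unfolding V_def by blast
  \<comment> \<open>The open half-ball of radius R2 + 1 contains all points that the flow reaches
    from the support of \<psi> within the half-space, so the indicator equals 1 wherever it is
    evaluated to effect.\<close>
  let ?I = "\<lambda>p. indicator (half_ball (R2 + 1)) p * (?w p)\<^sup>2"
  define K where "K = B\<^sup>2 * (\<integral>p. ?I p \<partial>wmeas a)"
  note C\<psi> = cut_C1[OF \<psi>, of half_space]
  show "\<exists>P. \<forall>h. 0 < h \<and> h \<le> 1 \<longrightarrow> (\<integral>p. (\<psi> p)\<^sup>2 * (dq V h (1 / h) p)\<^sup>2 \<partial>wmeas a) \<le> P"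
  proof (intro exI[of _ K] allI impI)
    fix h :: real assume h': "0 < h \<and> h \<le> 1"
    then have h: "0 < h" "h \<le> 1" by simp_all
    have h1: "h \<in> {-1..1}" using h by simp
    define D where "D = dq V h (1 / h)"
    have HD: "Hloc a D" unfolding D_def V_def by (rule dq_Hloc[OF h1])
    have lD: "locbdd D" unfolding D_def V_def by (rule dq_locbdd)
    note CD = Hloc_C1[OF HD]
    let ?G = "\<lambda>p. D p * (\<psi> p * \<psi> p)"
    have tG: "tst a ?G" by (rule tst_mult_cut[OF HD lD cut_mult[OF \<psi> \<psi>]])
    note CG = tst_C1[OF tG]
    let ?P = "\<integral>p. (\<psi> p)\<^sup>2 * (D p)\<^sup>2 \<partial>wmeas a"
    let ?N = "?P / 2 + K / 2"
    note I = cut_integrable[OF HD \<psi>]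
    have "?P \<le> ?N"
    proof (rule slab_bound_imp_bound[OF I(1)])
      fix \<delta> :: real assume \<delta>: "\<delta> > 0"
      let ?k = "\<lambda>p. indicator {p::hpt. \<delta> \<le> snd p} p * ?G p"
      obtain B1 where B1: "\<And>p. p \<in> half_space \<Longrightarrow> \<bar>?G p\<bar> \<le> B1" using tG unfolding tst_def by blast
      let ?k' = "\<lambda>p. indicator (slab \<delta> R) p * ?G p"
      have kk: "?k p = ?k' p" if "p \<in> half_space" for p
        using RB(5)[of p] by (cases "norm p \<le> R") (auto simp: slab_def indicator_def)
      have km: "?k' \<in> borel_measurable (wmeas a)"
        by (intro borel_measurable_times borel_measurable_indicator slab_sets \<delta> continuous_wmeas_measurable C1_cont CD C\<psi>)
      have kb: "\<bar>?k' p\<bar> \<le> \<bar>B1\<bar>" for p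
      proof (cases "p \<in> slab \<delta> R")
        case True
        then have "\<bar>?G p\<bar> \<le> B1" using slab_half_space[OF \<delta>, of R] by (intro B1) blast
        then show ?thesis using True by simp
      qed simp
      have k0: "?k' p = 0" if "p \<notin> slab \<delta> R" for p using that by simp
      have "\<bar>\<integral>p. ?k' p * (u (flow V h p) - u p) \<partial>wmeas a\<bar> \<le> h * ?N"
        unfolding V_def
      proof (rule flow_difference_bound[where R = R, OF a1 u_C1(1) cw[unfolded V_def] km kb k0 \<delta> less_imp_le[OF h(1)]])
        fix t assume t: "t \<in> {0..h}"
        then have t1: "t \<in> {-1..1}" using h by simp
        let ?wt = "\<lambda>p. ?w (flow V t p)"
        have cwt: "continuous_on half_space ?wt"
          using C1_cont[OF C1_flow[OF Cw]] unfolding V_def by blast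
        have e: "(\<integral>p. ?k' p * ?wt p \<partial>wmeas a) = (\<integral>p. ?k p * ?wt p \<partial>wmeas a)"
          by (rule wmeas_cong(1)) (simp only: kk)
        have Im: "?I \<in> borel_measurable (wmeas a)" by (rule borel_measurable_integrable[OF L2])
        have iI: "integrable (wmeas a) (\<lambda>p. ?I (flow V t p))"
          using integrable_flow[OF Im, of "-2" \<alpha> \<beta> \<tau> t, folded V_def] L2 by blast
        have "norm (\<integral>p. ?k p * ?wt p \<partial>wmeas a) \<le> (\<integral>p. (\<psi> p)\<^sup>2 * (D p)\<^sup>2 / 2 + (B\<^sup>2 / 2) * ?I (flow V t p) \<partial>wmeas a)"
        proof (rule Bochner_Integration.integral_norm_bound_integral)
          have "integrable (wmeas a) (\<lambda>p. indicator {p. \<delta> \<le> snd p} p * (?G p * ?wt p))"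
            by (rule slab_integrable[OF a1 _ _ \<delta>, of _ R]) (intro continuous_on_mult C1_cont[OF CD] C1_cont[OF C\<psi>] cwt, simp add: RB(5))
          then show "integrable (wmeas a) (\<lambda>p. ?k p * ?wt p)" by (simp only: mult.assoc)
          show "integrable (wmeas a) (\<lambda>p. (\<psi> p)\<^sup>2 * (D p)\<^sup>2 / 2 + (B\<^sup>2 / 2) * ?I (flow V t p))"
            using I(1) iI by (intro Bochner_Integration.integrable_add integrable_mult_right integrable_divide)
          fix p assume "p \<in> space (wmeas a)"
          then have p: "p \<in> half_space" by simp
          show "norm (?k p * ?wt p) \<le> (\<psi> p)\<^sup>2 * (D p)\<^sup>2 / 2 + (B\<^sup>2 / 2) * ?I (flow V t p)"
          proof (cases "R \<le> norm p")
            case True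
            then show ?thesis by (simp add: RB(5))
          next
            case False
            then have "norm (flow V t p) \<le> R2" by (intro R2 t1) simp
            then have "flow V t p \<in> half_ball (R2 + 1)" using p by (simp add: half_ball_def V_def)
            then have 1: "?I (flow V t p) = (?wt p)\<^sup>2" by simp
            have "\<bar>?G p * ?wt p\<bar> = (\<psi> p)\<^sup>2 * \<bar>D p * ?wt p\<bar>" by (simp add: abs_mult power2_eq_square)
            also have "\<dots> \<le> (\<psi> p)\<^sup>2 * ((D p)\<^sup>2 / 2 + (?wt p)\<^sup>2 / 2)"
              using young_2[of 1 "D p" "?wt p"] by (intro mult_left_mono) simp_all
            also have "\<dots> = (\<psi> p)\<^sup>2 * (D p)\<^sup>2 / 2 + (\<psi> p)\<^sup>2 * (?wt p)\<^sup>2 / 2" by (simp add: distrib_left)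
            also have "\<dots> \<le> (\<psi> p)\<^sup>2 * (D p)\<^sup>2 / 2 + B\<^sup>2 * (?wt p)\<^sup>2 / 2"
            proof -
              have "(\<psi> p)\<^sup>2 \<le> B\<^sup>2" using RB(3)[of p] by (metis abs_ge_zero power2_abs power_mono)
              from mult_right_mono[OF this, of "(?wt p)\<^sup>2"] show ?thesis by simp
            qed
            finally have "\<bar>?G p * ?wt p\<bar> \<le> (\<psi> p)\<^sup>2 * (D p)\<^sup>2 / 2 + B\<^sup>2 * (?wt p)\<^sup>2 / 2" .
            moreover have "norm (?k p * ?wt p) \<le> \<bar>?G p * ?wt p\<bar>" by (simp add: indicator_def abs_mult)
            ultimately show ?thesis unfolding 1 by linarith
          qed
        qed
        also have "\<dots> = ?P / 2 + (B\<^sup>2 / 2) * (\<integral>p. ?I (flow V t p) \<partial>wmeas a)"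
          using I(1) iI by simp
        also have "(\<integral>p. ?I (flow V t p) \<partial>wmeas a) = (\<integral>p. ?I p \<partial>wmeas a)"
          using integral_flow[OF Im, of "-2" \<alpha> \<beta> \<tau> t, folded V_def] by blast
        finally have "\<bar>\<integral>p. ?k p * ?wt p \<partial>wmeas a\<bar> \<le> ?N" by (simp add: K_def)
        then show "\<bar>\<integral>p. ?k' p * pd (fld (-2) \<alpha> \<beta> \<tau> (flow (fld (-2) \<alpha> \<beta> \<tau>) t p)) u (flow (fld (-2) \<alpha> \<beta> \<tau>) t p) \<partial>wmeas a\<bar> \<le> ?N"
          unfolding V_def[symmetric] e .
      qed
      then have "(1 / h) * \<bar>\<integral>p. ?k' p * (u (flow V h p) - u p) \<partial>wmeas a\<bar> \<le> ?N" using h by (simp add: field_simps)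
      moreover have "(\<integral>p. indicator {p. \<delta> \<le> snd p} p * ((\<psi> p)\<^sup>2 * (D p)\<^sup>2) \<partial>wmeas a) = (1 / h) * (\<integral>p. ?k' p * (u (flow V h p) - u p) \<partial>wmeas a)"
      proof -
        have "(\<integral>p. indicator {p. \<delta> \<le> snd p} p * ((\<psi> p)\<^sup>2 * (D p)\<^sup>2) \<partial>wmeas a) = (\<integral>p. (1 / h) * (?k' p * (u (flow V h p) - u p)) \<partial>wmeas a)"
        proof (rule wmeas_cong(1))
          fix p assume p: "p \<in> half_space"
          have "?k p * D p = indicator {p. \<delta> \<le> snd p} p * ((\<psi> p)\<^sup>2 * (D p)\<^sup>2)"
            by (simp add: power2_eq_square mult_ac)
          then have "?k' p * D p = indicator {p. \<delta> \<le> snd p} p * ((\<psi> p)\<^sup>2 * (D p)\<^sup>2)"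
            unfolding kk[OF p] .
          then show "indicator {p. \<delta> \<le> snd p} p * ((\<psi> p)\<^sup>2 * (D p)\<^sup>2) = (1 / h) * (?k' p * (u (flow V h p) - u p))"
            unfolding D_def dq_def by (simp only: mult.left_commute[of "1 / h"])
        qed
        then show ?thesis by simp
      qed
      ultimately show "(\<integral>p. indicator {p. \<delta> \<le> snd p} p * ((\<psi> p)\<^sup>2 * (D p)\<^sup>2) \<partial>wmeas a) \<le> ?N"
        using h by (smt (verit) mult_left_mono divide_nonneg_pos)
    qed
    then show "(\<integral>p. (\<psi> p)\<^sup>2 * (dq V h (1 / h) p)\<^sup>2 \<partial>wmeas a) \<le> K" unfolding D_def by linarith
  qed
qed

text \<open>The fields with k = -2 commute with X, Y and d_y. So these derivatives of the quotient
  are themselves quotients of Xu, Yu and d_y u, and they converge because u is C^2.\<close>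

lemma dq_tendsto:
  fixes \<alpha> \<beta> \<tau> :: real
  assumes p: "p \<in> half_space"
  defines "V \<equiv> fld (-2) \<alpha> \<beta> \<tau>"
  defines "w \<equiv> \<lambda>q. pd (V q) u q"
  defines "D \<equiv> \<lambda>n. dq V (inverse (real (Suc n))) (1 / inverse (real (Suc n)))"
  shows "(\<lambda>n. D n p) \<longlonglongrightarrow> w p" "(\<lambda>n. hX (D n) p) \<longlonglongrightarrow> hX w p" "(\<lambda>n. hY (D n) p) \<longlonglongrightarrow> hY w p"
    "(\<lambda>n. dy (D n) p) \<longlonglongrightarrow> dy w p"
proof -
  have d: "(\<lambda>q. u (flow V t q)) differentiable (at p)" "u differentiable (at p)"
    "(\<lambda>q. u (flow V t q) - u q) differentiable (at p)" for t
    unfolding V_def by (intro differentiable_diff C1_diff[OF C1_flow[OF u_C1(1)] p] C1_diff[OF u_C1(1) p])+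
  note fl = h_flow[OF u_C1(1) p, of \<alpha> \<beta> \<tau>, folded V_def]
  have e: "hX (dq V t c) p = c * (hX u (flow V t p) - hX u p)" "hY (dq V t c) p = c * (hY u (flow V t p) - hY u p)"
    "dy (dq V t c) p = c * (dy u (flow V t p) - dy u p)" for t c
    unfolding dq_def[abs_def] h_cmult[OF d(3)] h_diff[OF d(1,2)] fl by (rule refl)+
  note fc = fld_commute[OF u2 p, of \<alpha> \<beta> \<tau>, folded V_def w_def]
  show "(\<lambda>n. D n p) \<longlonglongrightarrow> w p"
    unfolding D_def dq_def w_def V_def by (rule difference_quotient_tendsto[OF u_C1(1) p])
  show "(\<lambda>n. hX (D n) p) \<longlonglongrightarrow> hX w p" "(\<lambda>n. hY (D n) p) \<longlonglongrightarrow> hY w p" "(\<lambda>n. dy (D n) p) \<longlonglongrightarrow> dy w p"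
    unfolding D_def e fc unfolding V_def
    by (rule difference_quotient_tendsto[OF u_C1(3) p] difference_quotient_tendsto[OF u_C1(4) p] difference_quotient_tendsto[OF u_C1(5) p])+
qed

lemma dq_energy_bound:
  assumes g: "good \<alpha> \<beta> \<tau>" and \<psi>: "cut \<psi>"
  shows "\<exists>P\<ge>0. \<forall>h. 0 < h \<and> h \<le> 1 \<longrightarrow>
     (\<integral>p. (\<psi> p)\<^sup>2 * (dq (fld (-2) \<alpha> \<beta> \<tau>) h (1 / h) p)\<^sup>2 \<partial>wmeas a) \<le> P \<and>
     (\<integral>p. (\<psi> p * \<psi> p)\<^sup>2 * energy (dq (fld (-2) \<alpha> \<beta> \<tau>) h (1 / h)) (dq (fld (-2) \<alpha> \<beta> \<tau>) h (1 / h)) p \<partial>wmeas a) \<le> P"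
proof -
  obtain P where P: "\<And>h. 0 < h \<and> h \<le> 1 \<Longrightarrow> (\<integral>p. (\<psi> p)\<^sup>2 * (dq (fld (-2) \<alpha> \<beta> \<tau>) h (1 / h) p)\<^sup>2 \<partial>wmeas a) \<le> P"
    using g \<psi> unfolding good_def by blast
  obtain C where C: "C \<ge> 0" and cc: "\<And>\<alpha> \<beta> \<tau> t c. t \<in> {-1..1} \<Longrightarrow>
      (\<integral>p. (\<psi> p * \<psi> p)\<^sup>2 * energy (dq (fld (-2) \<alpha> \<beta> \<tau>) t c) (dq (fld (-2) \<alpha> \<beta> \<tau>) t c) p \<partial>wmeas a)
      \<le> C * (\<integral>p. (\<psi> p)\<^sup>2 * (dq (fld (-2) \<alpha> \<beta> \<tau>) t c p)\<^sup>2 \<partial>wmeas a)"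
    by (rule caccioppoli_sq[OF \<psi>]) (rule that)
  have CP: "0 \<le> C * \<bar>P\<bar>" using C by simp
  show ?thesis
  proof (intro exI[of _ "\<bar>P\<bar> + C * \<bar>P\<bar>"] conjI allI impI)
    show "0 \<le> \<bar>P\<bar> + C * \<bar>P\<bar>" using CP by linarith
    fix h :: real assume h: "0 < h \<and> h \<le> 1"
    have l: "(\<integral>p. (\<psi> p)\<^sup>2 * (dq (fld (-2) \<alpha> \<beta> \<tau>) h (1 / h) p)\<^sup>2 \<partial>wmeas a) \<le> \<bar>P\<bar>"
      using P[OF h] by linarith
    then show "(\<integral>p. (\<psi> p)\<^sup>2 * (dq (fld (-2) \<alpha> \<beta> \<tau>) h (1 / h) p)\<^sup>2 \<partial>wmeas a) \<le> \<bar>P\<bar> + C * \<bar>P\<bar>"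
      using CP by linarith
    have "h \<in> {-1..1}" using h by simp
    from cc[OF this, of \<alpha> \<beta> \<tau> "1 / h"] mult_left_mono[OF l C]
    show "(\<integral>p. (\<psi> p * \<psi> p)\<^sup>2 * energy (dq (fld (-2) \<alpha> \<beta> \<tau>) h (1 / h)) (dq (fld (-2) \<alpha> \<beta> \<tau>) h (1 / h)) p \<partial>wmeas a) \<le> \<bar>P\<bar> + C * \<bar>P\<bar>"
      by linarith
  qed
qed

lemma good_Hloc:
  fixes \<alpha> \<beta> \<tau> :: real
  defines "V \<equiv> fld (-2) \<alpha> \<beta> \<tau>"
  defines "w \<equiv> \<lambda>q. pd (V q) u q"
  assumes g: "good \<alpha> \<beta> \<tau>"
  shows "Hloc a w"
  unfolding Hloc_def
proof (intro conjI allI)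
  show Cw: "C1 half_space w" unfolding w_def V_def by (rule C2_fld[OF u2])
  fix R :: real
  obtain \<psi> where \<psi>: "cut \<psi>" "\<And>p. \<psi> p \<ge> 0" "\<And>p. norm p \<le> \<bar>R\<bar> + 1 \<Longrightarrow> \<psi> p \<ge> 1"
    by (rule cut_exists[of "\<bar>R\<bar> + 1"]) (simp, rule that)
  obtain P where P0: "P \<ge> 0" and P: "\<And>h. 0 < h \<and> h \<le> 1 \<Longrightarrow>
     (\<integral>p. (\<psi> p)\<^sup>2 * (dq V h (1 / h) p)\<^sup>2 \<partial>wmeas a) \<le> P \<and>
     (\<integral>p. (\<psi> p * \<psi> p)\<^sup>2 * energy (dq V h (1 / h)) (dq V h (1 / h)) p \<partial>wmeas a) \<le> P"
    using dq_energy_bound[OF g \<psi>(1)] unfolding V_def by blast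
  define D where "D = (\<lambda>n. dq V (inverse (real (Suc n))) (1 / inverse (real (Suc n))))"
  have hn: "inverse (real (Suc n)) \<in> {-1..1}" "0 < inverse (real (Suc n)) \<and> inverse (real (Suc n)) \<le> 1" for n
    by (auto simp: inverse_eq_divide intro: order_trans[of _ 0])
  have HD: "Hloc a (D n)" for n unfolding D_def V_def by (rule dq_Hloc[OF hn(1)])
  let ?F = "\<lambda>n p. (\<psi> p)\<^sup>2 * (D n p)\<^sup>2 + (\<psi> p * \<psi> p)\<^sup>2 * energy (D n) (D n) p"
  let ?f = "\<lambda>p. (\<psi> p)\<^sup>2 * (w p)\<^sup>2 + (\<psi> p * \<psi> p)\<^sup>2 * energy w w p"
  have iF: "integrable (wmeas a) (?F n)" for n
    using cut_integrable(1)[OF HD \<psi>(1)] cut_integrable(2)[OF HD cut_mult[OF \<psi>(1) \<psi>(1)]] by (intro Bochner_Integration.integrable_add)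
  have F0: "0 \<le> ?F n p" for n p by simp
  have bF: "(\<integral>\<^sup>+p. ennreal (?F n p) \<partial>wmeas a) \<le> ennreal (2 * P)" for n
  proof -
    have "(\<integral>p. ?F n p \<partial>wmeas a) \<le> 2 * P"
      using P[OF hn(2), of n] cut_integrable(1)[OF HD \<psi>(1), of n] cut_integrable(2)[OF HD cut_mult[OF \<psi>(1) \<psi>(1)], of n]
      by (simp add: D_def)
    then show ?thesis using nn_integral_eq_integral[OF iF, of n] F0 by (simp add: ennreal_leI)
  qed
  have lim: "(\<lambda>n. ennreal (?F n p)) \<longlonglongrightarrow> ennreal (?f p)" if p: "p \<in> half_space" for p
  proof -
    note t = dq_tendsto[OF p, of \<alpha> \<beta> \<tau>, folded V_def, folded w_def]
    have t1: "(\<lambda>n. dq V (inverse (real (Suc n))) (1 / inverse (real (Suc n))) p) \<longlonglongrightarrow> w p"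
      using dq_tendsto(1)[OF p, of \<alpha> \<beta> \<tau>] unfolding w_def V_def .
    show ?thesis unfolding energy_def D_def
      by (intro tendsto_ennrealI tendsto_add tendsto_mult tendsto_power tendsto_const t1 t(2-4))
  qed
  have "(\<integral>\<^sup>+p. ennreal (?f p) \<partial>wmeas a) = (\<integral>\<^sup>+p. liminf (\<lambda>n. ennreal (?F n p)) \<partial>wmeas a)"
    by (rule nn_integral_cong, rule lim_imp_Liminf[OF _ lim, symmetric]) simp_all
  also have "\<dots> \<le> liminf (\<lambda>n. \<integral>\<^sup>+p. ennreal (?F n p) \<partial>wmeas a)"
    by (intro nn_integral_liminf measurable_compose[OF borel_measurable_integrable[OF iF] measurable_ennreal])
  also have "\<dots> \<le> liminf (\<lambda>n::nat. ennreal (2 * P))"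
    by (intro Liminf_mono always_eventually allI bF)
  also have "\<dots> = ennreal (2 * P)" by (simp add: Liminf_const)
  finally have fin: "(\<integral>\<^sup>+p. ennreal (?f p) \<partial>wmeas a) < \<infinity>" by (rule order_le_less_trans) simp
  have "(\<integral>\<^sup>+p. ennreal ((w p)\<^sup>2 + energy w w p) * indicator (half_ball R) p \<partial>wmeas a) \<le> (\<integral>\<^sup>+p. ennreal (?f p) \<partial>wmeas a)"
  proof (rule nn_integral_mono)
    fix p
    show "ennreal ((w p)\<^sup>2 + energy w w p) * indicator (half_ball R) p \<le> ennreal (?f p)"
    proof (cases "p \<in> half_ball R")
      case True
      then have 1: "1 \<le> \<psi> p" using half_ballD(2)[OF True] by (intro \<psi>(3)) linarith
      then have 2: "1 \<le> (\<psi> p)\<^sup>2" "1 \<le> (\<psi> p * \<psi> p)\<^sup>2" by (simp_all add: one_le_power power_mult_distrib mult_ge1_I)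
      have "1 * (w p)\<^sup>2 \<le> (\<psi> p)\<^sup>2 * (w p)\<^sup>2" "1 * energy w w p \<le> (\<psi> p * \<psi> p)\<^sup>2 * energy w w p"
        by (intro mult_right_mono 2; simp)+
      then have "(w p)\<^sup>2 + energy w w p \<le> ?f p" by linarith
      from ennreal_leI[OF this] True show ?thesis by simp
    qed simp
  qed
  then show "(\<integral>\<^sup>+p. ennreal ((w p)\<^sup>2 + energy w w p) * indicator (half_ball R) p \<partial>wmeas a) < \<infinity>"
    using fin by (rule order_le_less_trans)
qed

lemma fld_T: "fld k 0 0 1 = (\<lambda>q. b3)"
  by (rule ext) (simp add: fld_eq)

lemma good_T: "good 0 0 1"
  unfolding good_def using T_estimate by blast

lemma Hloc_T: "Hloc a (pd b3 u)"
  using good_Hloc[OF good_T] unfolding fld_T .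

lemma left_fields:
  assumes "p \<in> half_space"
  shows "pd (fld (-2) 1 0 0 p) u p = hX u p - 4 * fst p $ 2 * pd b3 u p"
    "pd (fld (-2) 0 1 0 p) u p = hY u p + 4 * fst p $ 1 * pd b3 u p"
  unfolding pd_fld[OF C1_diff[OF u_C1(1) assms]] hX_def hY_def by simp_all

text \<open>A right-invariant derivative differs from a horizontal one by 4 x_i d_3 u. The
  horizontal one is locally bounded and d_3 u is locally square integrable, so
  \<open>goodI_L2\<close> applies; this is why d_3 has to be settled before the other two fields.
  The 32 R^2 is 2 (4 R)^2.\<close>

lemma good_left_aux:
  assumes w: "continuous_on half_space w" and g: "locbdd g"
    and e: "\<And>p. p \<in> half_space \<Longrightarrow> \<bar>w p\<bar> \<le> \<bar>g p\<bar> + 4 * norm p * \<bar>pd b3 u p\<bar>"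
  shows "integrable (wmeas a) (\<lambda>p. indicator (half_ball R) p * (w p)\<^sup>2)"
proof -
  obtain M where M: "\<And>p. p \<in> half_ball R \<Longrightarrow> \<bar>g p\<bar> \<le> M" using g unfolding locbdd_def by blast
  have i: "integrable (wmeas a) (\<lambda>p. 2 * M\<^sup>2 * indicator (half_ball R) p + 32 * R\<^sup>2 * (indicator (half_ball R) p * (pd b3 u p)\<^sup>2))"
    by (intro Bochner_Integration.integrable_add integrable_mult_right half_ball_integrable a1
       Hloc_integrable(1)[OF Hloc_T half_ball_indicator])
  show ?thesis
  proof (rule Bochner_Integration.integrable_bound[OF i])
    show "(\<lambda>p. indicator (half_ball R) p * (w p)\<^sup>2) \<in> borel_measurable (wmeas a)"
      by (intro borel_measurable_times half_ball_indicator continuous_wmeas_measurable continuous_intros w)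
    show "AE p in wmeas a. norm (indicator (half_ball R) p * (w p)\<^sup>2) \<le> norm (2 * M\<^sup>2 * indicator (half_ball R) p + 32 * R\<^sup>2 * (indicator (half_ball R) p * (pd b3 u p)\<^sup>2))"
    proof (rule AE_I2)
      fix p
      show "norm (indicator (half_ball R) p * (w p)\<^sup>2) \<le> norm (2 * M\<^sup>2 * indicator (half_ball R) p + 32 * R\<^sup>2 * (indicator (half_ball R) p * (pd b3 u p)\<^sup>2))"
      proof (cases "p \<in> half_ball R")
        case True
        have "\<bar>w p\<bar> \<le> M + 4 * R * \<bar>pd b3 u p\<bar>"
        proof -
          have "4 * norm p * \<bar>pd b3 u p\<bar> \<le> 4 * R * \<bar>pd b3 u p\<bar>" using half_ballD(2)[OF True] by (intro mult_right_mono) auto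
          then show ?thesis using e[OF half_ballD(1)[OF True]] M[OF True] by linarith
        qed
        then have "\<bar>w p\<bar>\<^sup>2 \<le> (M + 4 * R * \<bar>pd b3 u p\<bar>)\<^sup>2" by (rule power_mono) simp
        also have "\<dots> \<le> 2 * M\<^sup>2 + 2 * (4 * R * \<bar>pd b3 u p\<bar>)\<^sup>2" using sq_diff_le[of M "- (4 * R * \<bar>pd b3 u p\<bar>)"] by simp
        also have "\<dots> = 2 * M\<^sup>2 + 32 * R\<^sup>2 * (pd b3 u p)\<^sup>2" by (simp add: power_mult_distrib)
        finally show ?thesis using True by simp
      qed simp
    qed
  qed
qed

lemma coord_le_norm: "\<bar>fst p $ i\<bar> \<le> norm (p :: hpt)"
  using component_le_norm_cart[of "fst p" i] norm_fst_le[of "fst p" "snd p"] by simp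

lemma good_LX: "good 1 0 0"
proof (rule goodI_L2[of 1 0 0], rule good_left_aux[OF C1_cont[OF C2_fld[OF u2]] grad_locbdd(1)])
  fix p assume p: "p \<in> half_space"
  have "\<bar>4 * fst p $ 2 * pd b3 u p\<bar> \<le> 4 * norm p * \<bar>pd b3 u p\<bar>"
    unfolding abs_mult using coord_le_norm[of p 2] by (intro mult_right_mono) auto
  then show "\<bar>pd (fld (-2) 1 0 0 p) u p\<bar> \<le> \<bar>hX u p\<bar> + 4 * norm p * \<bar>pd b3 u p\<bar>"
    unfolding left_fields[OF p] by linarith
qed

lemma good_LY: "good 0 1 0"
proof (rule goodI_L2[of 0 1 0], rule good_left_aux[OF C1_cont[OF C2_fld[OF u2]] grad_locbdd(2)])
  fix p assume p: "p \<in> half_space"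
  have "\<bar>4 * fst p $ 1 * pd b3 u p\<bar> \<le> 4 * norm p * \<bar>pd b3 u p\<bar>"
    unfolding abs_mult using coord_le_norm[of p 1] by (intro mult_right_mono) auto
  then show "\<bar>pd (fld (-2) 0 1 0 p) u p\<bar> \<le> \<bar>hY u p\<bar> + 4 * norm p * \<bar>pd b3 u p\<bar>"
    unfolding left_fields[OF p] by linarith
qed

end

section \<open>Convergence of difference quotients\<close>

text \<open>On y \<ge> 1/(m+1) the local bounds allow dominated convergence. The strip below is
  controlled by Young's inequality, from the uniform L^2 bound of the sequence and the small mass of
  \<eta>^2 in the strip.\<close>

lemma weak_convergence:
  fixes g :: "hpt \<Rightarrow> real" and gn :: "nat \<Rightarrow> hpt \<Rightarrow> real"
  assumes a: "a > -1"
    and gm: "\<And>n. gn n \<in> borel_measurable (wmeas a)" "g \<in> borel_measurable (wmeas a)" "\<eta> \<in> borel_measurable (wmeas a)"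
    and lim: "\<And>p. p \<in> half_space \<Longrightarrow> (\<lambda>n. gn n p) \<longlonglongrightarrow> g p"
    and bdd: "\<And>\<delta>. \<delta> > 0 \<Longrightarrow> \<exists>B. \<forall>n. \<forall>p\<in>slab \<delta> R. \<bar>gn n p\<bar> \<le> B"
    and \<eta>0: "\<And>p. p \<in> half_space \<Longrightarrow> R \<le> norm p \<Longrightarrow> \<eta> p = 0" and \<eta>2: "integrable (wmeas a) (\<lambda>p. (\<eta> p)\<^sup>2)"
    and gi: "\<And>n. integrable (wmeas a) (\<lambda>p. indicator (half_ball R) p * (gn n p)\<^sup>2)"
      "integrable (wmeas a) (\<lambda>p. indicator (half_ball R) p * (g p)\<^sup>2)"
    and gb: "\<And>n. (\<integral>p. indicator (half_ball R) p * (gn n p)\<^sup>2 \<partial>wmeas a) \<le> C"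
      "(\<integral>p. indicator (half_ball R) p * (g p)\<^sup>2 \<partial>wmeas a) \<le> C"
  shows "(\<lambda>n. \<integral>p. gn n p * \<eta> p \<partial>wmeas a) \<longlonglongrightarrow> (\<integral>p. g p * \<eta> p \<partial>wmeas a)"
proof -
  let ?I = "\<lambda>p. indicator (half_ball R) p :: real"
  have I1: "?I p = 1" if "p \<in> half_space" "\<not> R \<le> norm p" for p using half_ballI[OF that] by simp
  have prod: "integrable (wmeas a) (\<lambda>p. v p * \<eta> p)"
    if v: "v \<in> borel_measurable (wmeas a)" "integrable (wmeas a) (\<lambda>p. ?I p * (v p)\<^sup>2)" for v
  proof (rule Bochner_Integration.integrable_bound[OF Bochner_Integration.integrable_add[OF v(2) \<eta>2]])
    show "(\<lambda>p. v p * \<eta> p) \<in> borel_measurable (wmeas a)" by (intro borel_measurable_times v gm)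
    show "AE p in wmeas a. norm (v p * \<eta> p) \<le> norm (?I p * (v p)\<^sup>2 + (\<eta> p)\<^sup>2)"
    proof (rule AE_I2)
      fix p assume "p \<in> space (wmeas a)"
      then have p: "p \<in> half_space" by simp
      show "norm (v p * \<eta> p) \<le> norm (?I p * (v p)\<^sup>2 + (\<eta> p)\<^sup>2)"
      proof (cases "R \<le> norm p")
        case False
        have "2 * \<bar>v p * \<eta> p\<bar> \<le> (v p)\<^sup>2 + (\<eta> p)\<^sup>2" using young_2[of 1 "v p" "\<eta> p"] by (simp add: abs_mult)
        then show ?thesis using I1[OF p False] by simp
      qed (use \<eta>0[OF p] in simp)
    qed
  qed
  let ?c = "\<lambda>m p. indicator {p::hpt. inverse (real (Suc m)) \<le> snd p} p :: real"
  let ?d = "\<lambda>n p. gn n p - g p"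
  have di: "integrable (wmeas a) (\<lambda>p. ?I p * (?d n p)\<^sup>2)" for n
  proof (rule Bochner_Integration.integrable_bound[OF Bochner_Integration.integrable_add[OF integrable_mult_right[OF gi(1)[of n], of 2] integrable_mult_right[OF gi(2), of 2]]])
    show "(\<lambda>p. ?I p * (?d n p)\<^sup>2) \<in> borel_measurable (wmeas a)"
      by (intro borel_measurable_times half_ball_indicator borel_measurable_power borel_measurable_diff gm)
    show "AE p in wmeas a. norm (?I p * (?d n p)\<^sup>2) \<le> norm (2 * (?I p * (gn n p)\<^sup>2) + 2 * (?I p * (g p)\<^sup>2))"
      using sq_diff_le[of "gn n _" "g _"] by (intro AE_I2) (simp add: indicator_def)
  qed
  have db: "(\<integral>p. ?I p * (?d n p)\<^sup>2 \<partial>wmeas a) \<le> 4 * C" for n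
  proof -
    have "(\<integral>p. ?I p * (?d n p)\<^sup>2 \<partial>wmeas a) \<le> (\<integral>p. 2 * (?I p * (gn n p)\<^sup>2) + 2 * (?I p * (g p)\<^sup>2) \<partial>wmeas a)"
      by (rule wmeas_le_real[OF di Bochner_Integration.integrable_add[OF integrable_mult_right[OF gi(1)[of n], of 2] integrable_mult_right[OF gi(2), of 2]]])
         (use sq_diff_le[of "gn n _" "g _"] in \<open>simp add: indicator_def\<close>)
    also have "\<dots> = 2 * (\<integral>p. ?I p * (gn n p)\<^sup>2 \<partial>wmeas a) + 2 * (\<integral>p. ?I p * (g p)\<^sup>2 \<partial>wmeas a)"
      using gi by simp
    finally show ?thesis using gb(1)[of n] gb(2) by linarith
  qed
  have C0: "0 \<le> C" using gb(2) by (rule order_trans[rotated]) (intro integral_nonneg_AE AE_I2, simp)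
  have dm: "?d n \<in> borel_measurable (wmeas a)" for n by (intro borel_measurable_diff gm)
  have dprod: "integrable (wmeas a) (\<lambda>p. ?d n p * \<eta> p)" for n by (rule prod[OF dm di])
  have cm: "?c m \<in> borel_measurable (wmeas a)" for m by (rule slab_indicator_measurable)
  have \<eta>1: "integrable (wmeas a) (\<lambda>p. \<bar>\<eta> p\<bar>)"
  proof -
    have "integrable (wmeas a) (\<lambda>p. 1 * \<eta> p)"
      by (rule prod) (use half_ball_integrable[OF a, of R] in simp_all)
    then show ?thesis by simp
  qed
  have near: "(\<lambda>n. \<integral>p. ?c m p * (?d n p * \<eta> p) \<partial>wmeas a) \<longlonglongrightarrow> 0" for m
  proof -
    obtain B0 where B0: "\<And>n p. p \<in> slab (inverse (real (Suc m))) R \<Longrightarrow> \<bar>gn n p\<bar> \<le> B0"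
      using bdd[of "inverse (real (Suc m))"] by auto
    define B where "B = \<bar>B0\<bar>"
    have Bn: "0 \<le> B" by (simp add: B_def)
    have B: "\<bar>gn n p\<bar> \<le> B" if "p \<in> slab (inverse (real (Suc m))) R" for n p
      using B0[OF that, of n] unfolding B_def by linarith
    have "(\<lambda>n. \<integral>p. ?c m p * (?d n p * \<eta> p) \<partial>wmeas a) \<longlonglongrightarrow> (\<integral>p. 0 \<partial>wmeas a)"
    proof (rule integral_dominated_convergence[where w = "\<lambda>p. 2 * B * \<bar>\<eta> p\<bar>"])
      show "integrable (wmeas a) (\<lambda>p. 2 * B * \<bar>\<eta> p\<bar>)" using \<eta>1 by simp
      show "(\<lambda>p. ?c m p * (?d n p * \<eta> p)) \<in> borel_measurable (wmeas a)" for n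
        by (intro borel_measurable_times cm dm gm)
      show "AE p in wmeas a. (\<lambda>n. ?c m p * (?d n p * \<eta> p)) \<longlonglongrightarrow> 0"
      proof (rule AE_I2)
        fix p assume "p \<in> space (wmeas a)"
        then have p: "p \<in> half_space" by simp
        have "(\<lambda>n. ?c m p * ((gn n p - g p) * \<eta> p)) \<longlonglongrightarrow> ?c m p * ((g p - g p) * \<eta> p)"
          by (intro tendsto_intros lim p)
        then show "(\<lambda>n. ?c m p * (?d n p * \<eta> p)) \<longlonglongrightarrow> 0" by simp
      qed
      show "AE p in wmeas a. norm (?c m p * (?d n p * \<eta> p)) \<le> 2 * B * \<bar>\<eta> p\<bar>" for n
      proof (rule AE_I2)
        fix p assume "p \<in> space (wmeas a)"
        then have p: "p \<in> half_space" by simp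
        show "norm (?c m p * (?d n p * \<eta> p)) \<le> 2 * B * \<bar>\<eta> p\<bar>"
        proof (cases "p \<in> slab (inverse (real (Suc m))) R")
          case True
          have "\<bar>g p\<bar> \<le> B"
            by (rule LIMSEQ_le_const2[OF tendsto_rabs[OF lim[OF p]]]) (use B[OF True] in auto)
          then have "\<bar>?d n p\<bar> \<le> 2 * B" using B[OF True, of n] by linarith
          then have "\<bar>?d n p\<bar> * \<bar>\<eta> p\<bar> \<le> 2 * B * \<bar>\<eta> p\<bar>" by (rule mult_right_mono) simp
          then show ?thesis using True by (simp add: slab_def abs_mult)
        next
          case F: False
          show ?thesis
          proof (cases "R \<le> norm p")
            case True then show ?thesis using \<eta>0[OF p] by simp
          next
            case False
            then have "?c m p = 0" using F by (simp add: slab_def)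
            then show ?thesis using Bn by simp
          qed
        qed
      qed
    qed simp
    then show ?thesis by simp
  qed
  have "(\<lambda>n. \<integral>p. ?d n p * \<eta> p \<partial>wmeas a) \<longlonglongrightarrow> 0"
  proof (rule LIMSEQ_I)
    fix e :: real assume e: "e > 0"
    \<comment> \<open>The strip may cost e/2: \<kappa> 4 C \<le> e/4, and a mass of \<eta>^2 below
      \<kappa> e contributes at most \<kappa> e / (4 \<kappa>) = e/4.\<close>
    define \<kappa> where "\<kappa> = e / (16 * (C + 1))"
    have \<kappa>: "\<kappa> > 0" using e C0 by (simp add: \<kappa>_def)
    have \<kappa>C: "\<kappa> * (4 * C) \<le> e / 4"
    proof -
      have "\<kappa> * (4 * C) \<le> \<kappa> * (4 * (C + 1))" using \<kappa> by (intro mult_left_mono) auto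
      also have "\<dots> = e / 4" using C0 by (simp add: \<kappa>_def field_simps)
      finally show ?thesis .
    qed
    have "(\<lambda>m. \<integral>p. ?c m p * (\<eta> p)\<^sup>2 \<partial>wmeas a) \<longlonglongrightarrow> (\<integral>p. (\<eta> p)\<^sup>2 \<partial>wmeas a)" by (rule slab_limit[OF \<eta>2])
    from LIMSEQ_D[OF this, of "\<kappa> * e"] obtain m where
      m: "\<bar>(\<integral>p. ?c m p * (\<eta> p)\<^sup>2 \<partial>wmeas a) - (\<integral>p. (\<eta> p)\<^sup>2 \<partial>wmeas a)\<bar> < \<kappa> * e" using \<kappa> e by auto
    have ci: "integrable (wmeas a) (\<lambda>p. ?c m p * (\<eta> p)\<^sup>2)"
      by (rule Bochner_Integration.integrable_bound[OF \<eta>2]) (intro borel_measurable_times borel_measurable_power cm gm, simp add: indicator_def)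
    have cdi: "integrable (wmeas a) (\<lambda>p. ?c m p * (?d n p * \<eta> p))" for n
      by (rule Bochner_Integration.integrable_bound[OF dprod[of n]]) (intro borel_measurable_times cm dm gm, simp add: indicator_def)
    have tail: "\<bar>\<integral>p. ?d n p * \<eta> p - ?c m p * (?d n p * \<eta> p) \<partial>wmeas a\<bar> \<le> e / 2" for n
    proof -
      have "norm (\<integral>p. ?d n p * \<eta> p - ?c m p * (?d n p * \<eta> p) \<partial>wmeas a)
        \<le> (\<integral>p. \<kappa> * (?I p * (?d n p)\<^sup>2) + (1 / (4 * \<kappa>)) * ((\<eta> p)\<^sup>2 - ?c m p * (\<eta> p)\<^sup>2) \<partial>wmeas a)"
      proof (rule Bochner_Integration.integral_norm_bound_integral)
        show "integrable (wmeas a) (\<lambda>p. ?d n p * \<eta> p - ?c m p * (?d n p * \<eta> p))"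
          by (intro Bochner_Integration.integrable_diff dprod cdi)
        show "integrable (wmeas a) (\<lambda>p. \<kappa> * (?I p * (?d n p)\<^sup>2) + (1 / (4 * \<kappa>)) * ((\<eta> p)\<^sup>2 - ?c m p * (\<eta> p)\<^sup>2))"
          by (intro Bochner_Integration.integrable_add integrable_mult_right Bochner_Integration.integrable_diff di ci \<eta>2)
        fix p assume "p \<in> space (wmeas a)"
        then have p: "p \<in> half_space" by simp
        show "norm (?d n p * \<eta> p - ?c m p * (?d n p * \<eta> p)) \<le> \<kappa> * (?I p * (?d n p)\<^sup>2) + (1 / (4 * \<kappa>)) * ((\<eta> p)\<^sup>2 - ?c m p * (\<eta> p)\<^sup>2)"
        proof (cases "R \<le> norm p")
          case True then show ?thesis using \<eta>0[OF p] \<kappa> by simp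
        next
          case False
          have "\<bar>2 * ?d n p * (\<eta> p / 2)\<bar> \<le> \<kappa> * (?d n p)\<^sup>2 + (\<eta> p / 2)\<^sup>2 / \<kappa>"
            by (rule young_2[OF \<kappa>])
          moreover have "2 * ?d n p * (\<eta> p / 2) = ?d n p * \<eta> p" by simp
          moreover have "(\<eta> p / 2)\<^sup>2 / \<kappa> = (1 / (4 * \<kappa>)) * (\<eta> p)\<^sup>2" by (simp add: power_divide)
          ultimately have "\<bar>?d n p * \<eta> p\<bar> \<le> \<kappa> * (?d n p)\<^sup>2 + (1 / (4 * \<kappa>)) * (\<eta> p)\<^sup>2" by (simp only:)
          then show ?thesis using I1[OF p False] \<kappa> by (simp add: indicator_def)
        qed
      qed
      also have "\<dots> = \<kappa> * (\<integral>p. ?I p * (?d n p)\<^sup>2 \<partial>wmeas a) + (1 / (4 * \<kappa>)) * ((\<integral>p. (\<eta> p)\<^sup>2 \<partial>wmeas a) - (\<integral>p. ?c m p * (\<eta> p)\<^sup>2 \<partial>wmeas a))"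
        using di[of n] ci \<eta>2 by simp
      also have "\<dots> \<le> \<kappa> * (4 * C) + (1 / (4 * \<kappa>)) * (\<kappa> * e)"
        using m \<kappa> by (intro add_mono mult_left_mono db) auto
      also have "\<dots> \<le> e / 2" using \<kappa>C \<kappa> by simp
      finally show ?thesis by simp
    qed
    from LIMSEQ_D[OF near[of m], of "e / 2"] e obtain N where
      N: "\<And>n. n \<ge> N \<Longrightarrow> \<bar>\<integral>p. ?c m p * (?d n p * \<eta> p) \<partial>wmeas a\<bar> < e / 2" by auto
    show "\<exists>N. \<forall>n\<ge>N. norm ((\<integral>p. ?d n p * \<eta> p \<partial>wmeas a) - 0) < e"
    proof (intro exI[of _ N] allI impI)
      fix n assume n: "n \<ge> N"
      have "(\<integral>p. ?d n p * \<eta> p - ?c m p * (?d n p * \<eta> p) \<partial>wmeas a) = (\<integral>p. ?d n p * \<eta> p \<partial>wmeas a) - (\<integral>p. ?c m p * (?d n p * \<eta> p) \<partial>wmeas a)"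
        by (rule Bochner_Integration.integral_diff[OF dprod cdi])
      then show "norm ((\<integral>p. ?d n p * \<eta> p \<partial>wmeas a) - 0) < e"
        using tail[of n] N[OF n] unfolding real_norm_def by linarith
    qed
  qed
  moreover have "(\<integral>p. ?d n p * \<eta> p \<partial>wmeas a) = (\<integral>p. gn n p * \<eta> p \<partial>wmeas a) - (\<integral>p. g p * \<eta> p \<partial>wmeas a)" for n
    unfolding left_diff_distrib by (intro Bochner_Integration.integral_diff prod gm gi)
  ultimately show ?thesis by (simp add: LIM_zero_iff)
qed

text \<open>Mean value theorem along flow lines: for times up to 1 they stay in a wider slab with
  the same lower height, on which the derivative is bounded.\<close>

lemma difference_quotient_slab_bound:
  fixes \<alpha> \<beta> \<tau> k :: real
  defines "V \<equiv> fld k \<alpha> \<beta> \<tau>"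
  assumes g: "C1 half_space g" and \<delta>: "\<delta> > 0"
  shows "\<exists>B. \<forall>h. 0 < h \<and> h \<le> 1 \<longrightarrow> (\<forall>p\<in>slab \<delta> R. \<bar>(1 / h) * (g (flow V h p) - g p)\<bar> \<le> B)"
proof -
  obtain R2 where R2: "\<And>t q. t \<in> {-1..1} \<Longrightarrow> norm q \<le> R \<Longrightarrow> norm (flow V t q) \<le> R2"
    using flow_bounded_image[of R k \<alpha> \<beta> \<tau>] unfolding V_def by blast
  have "continuous_on half_space (\<lambda>p. pd (V p) g p)"
  proof (rule continuous_on_eq)
    show "continuous_on half_space (\<lambda>p. \<alpha> * pd b1 g p + \<beta> * pd b2 g p + (k * (\<alpha> * fst p $ 2 - \<beta> * fst p $ 1) + \<tau>) * pd b3 g p)"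
      by (intro continuous_intros C1_pd[OF g])
    show "\<alpha> * pd b1 g p + \<beta> * pd b2 g p + (k * (\<alpha> * fst p $ 2 - \<beta> * fst p $ 1) + \<tau>) * pd b3 g p = pd (V p) g p" if "p \<in> half_space" for p
      unfolding V_def by (rule pd_fld[OF C1_diff[OF g that], symmetric])
  qed
  from continuous_slab_bounded[OF this \<delta>, of R2]
  obtain B where B: "\<And>p. p \<in> slab \<delta> R2 \<Longrightarrow> \<bar>pd (V p) g p\<bar> \<le> B" by blast
  show ?thesis
  proof (intro exI[of _ B] allI impI ballI)
    fix h :: real and p assume h: "0 < h \<and> h \<le> 1" and p: "p \<in> slab \<delta> R"
    have ph: "p \<in> half_space" using slab_half_space[OF \<delta>] p by blast
    have "\<exists>z. 0 < z \<and> z < h \<and> g (flow V h p) - g (flow V 0 p) = (h - 0) * pd (V (flow V z p)) g (flow V z p)"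
      by (rule MVT2) (use h in simp, unfold V_def, rule flow_line_deriv[OF g ph])
    then obtain z where z: "0 < z" "z < h" "g (flow V h p) - g p = h * pd (V (flow V z p)) g (flow V z p)" by auto
    have "flow V z p \<in> slab \<delta> R2" using p z h R2[of z p] by (simp add: slab_def V_def)
    then have "\<bar>pd (V (flow V z p)) g (flow V z p)\<bar> \<le> B" by (rule B)
    then show "\<bar>(1 / h) * (g (flow V h p) - g p)\<bar> \<le> B" using z(3) h by simp
  qed
qed

lemma component_integrable:
  assumes w: "Hloc a w" and t: "tst a \<xi>"
  shows "integrable (wmeas a) (\<lambda>p. hX w p * hX \<xi> p)" "integrable (wmeas a) (\<lambda>p. hY w p * hY \<xi> p)"
    "integrable (wmeas a) (\<lambda>p. dy w p * dy \<xi> p)"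
proof -
  obtain R where R: "\<And>p w. p \<in> half_space \<Longrightarrow> R \<le> norm p \<Longrightarrow> energy w \<xi> p = 0" by (rule tst_support[OF t]) blast
  have 1: "integrable (wmeas a) (\<lambda>p. indicator (half_ball R) p * energy w w p + energy \<xi> \<xi> p)"
    by (intro Bochner_Integration.integrable_add Hloc_integrable(2)[OF w half_ball_indicator] tst_integrable t)
  note m1 = Hloc_measurable(4-6)[OF Hloc_C1[OF w]] and m2 = Hloc_measurable(4-6)[OF tst_C1[OF t]]
  have b: "norm (x * y) \<le> norm (indicator (half_ball R) p * energy w w p + energy \<xi> \<xi> p)"
    if p: "p \<in> space (wmeas a)" and x: "x\<^sup>2 \<le> energy w w p" and y: "y\<^sup>2 \<le> energy \<xi> \<xi> p" for p and x y :: real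
  proof (cases "R \<le> norm p")
    case True
    have "energy \<xi> \<xi> p = 0" using p by (intro R True) simp
    then have "y\<^sup>2 \<le> 0" using y by simp
    then show ?thesis by simp
  next
    case False
    then have "indicator (half_ball R) p = (1::real)" using half_ballI p by simp
    moreover have "\<bar>2 * x * y\<bar> \<le> 1 * x\<^sup>2 + y\<^sup>2 / 1" by (rule young_2) simp
    then have "2 * (\<bar>x\<bar> * \<bar>y\<bar>) \<le> x\<^sup>2 + y\<^sup>2" by (simp add: abs_mult)
    then have "\<bar>x * y\<bar> \<le> x\<^sup>2 + y\<^sup>2" unfolding abs_mult using mult_nonneg_nonneg[OF abs_ge_zero[of x] abs_ge_zero[of y]] by linarith
    ultimately show ?thesis using x y by simp
  qed
  show "integrable (wmeas a) (\<lambda>p. hX w p * hX \<xi> p)"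
    by (rule Bochner_Integration.integrable_bound[OF 1], rule borel_measurable_times[OF m1(1) m2(1)],
      rule AE_I2, erule b, rule energy_components(1), rule energy_components(1))
  show "integrable (wmeas a) (\<lambda>p. hY w p * hY \<xi> p)"
    by (rule Bochner_Integration.integrable_bound[OF 1], rule borel_measurable_times[OF m1(2) m2(2)],
      rule AE_I2, erule b, rule energy_components(2), rule energy_components(2))
  show "integrable (wmeas a) (\<lambda>p. dy w p * dy \<xi> p)"
    by (rule Bochner_Integration.integrable_bound[OF 1], rule borel_measurable_times[OF m1(3) m2(3)],
      rule AE_I2, erule b, rule energy_components(3), rule energy_components(3))
qed

text \<open>The constant c and the radius R depend on \<psi> alone, so the bounds apply to all
  quotients at once.\<close>

lemma hcs_cut:
  assumes \<psi>: "cut \<psi>"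
  obtains R c where "c \<ge> 0" "\<And>w. Hloc a w \<Longrightarrow> hcs a (\<lambda>p. w p * \<psi> p)"
    "\<And>p. R \<le> norm p \<Longrightarrow> \<psi> p = 0"
    "\<And>w. Hloc a w \<Longrightarrow> (\<integral>p. energy (\<lambda>p. w p * \<psi> p) (\<lambda>p. w p * \<psi> p) p \<partial>wmeas a) \<le>
      c * ((\<integral>p. indicator (half_ball R) p * (w p)\<^sup>2 \<partial>wmeas a) + (\<integral>p. indicator (half_ball R) p * energy w w p \<partial>wmeas a))"
    "\<And>w. Hloc a w \<Longrightarrow> (\<integral>p. (w p * \<psi> p)\<^sup>2 \<partial>wmeas a) \<le> c * (\<integral>p. indicator (half_ball R) p * (w p)\<^sup>2 \<partial>wmeas a)"
proof -
  obtain R B where RB: "R > 0" "B \<ge> 0" "\<And>p. \<bar>\<psi> p\<bar> \<le> B" "\<And>p. energy \<psi> \<psi> p \<le> B"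
    "\<And>p. R \<le> norm p \<Longrightarrow> \<psi> p = 0" "\<And>p. R \<le> norm p \<Longrightarrow> energy \<psi> \<psi> p = 0"
    by (rule cut_bounds[OF \<psi>]) (rule that)
  note C\<psi> = cut_C1[OF \<psi>, of half_space]
  have b2: "(\<psi> p)\<^sup>2 \<le> B\<^sup>2" for p using RB(3)[of p] by (metis abs_ge_zero power2_abs power_mono)
  let ?I = "\<lambda>p. indicator (half_ball R) p :: real"
  have I1: "?I p = 1" if "p \<in> half_space" "\<not> R \<le> norm p" for p using half_ballI[OF that] by simp
  show ?thesis
  proof (rule that[of "2 * B + 2 * B\<^sup>2" R])
    show "0 \<le> 2 * B + 2 * B\<^sup>2" using RB by simp
    show "\<And>p. R \<le> norm p \<Longrightarrow> \<psi> p = 0" by (rule RB(5))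
    fix w assume w: "Hloc a w"
    note Cw = Hloc_C1[OF w]
    show hc: "hcs a (\<lambda>p. w p * \<psi> p)"
      unfolding hcs_def
    proof (intro conjI exI[of _ R] ballI impI)
      show "Hloc a (\<lambda>p. w p * \<psi> p)" by (rule Hloc_mult_C1[OF w]) (use \<psi> in \<open>simp add: cut_def\<close>)
    qed (simp add: RB(5))
    note i1 = Hloc_integrable(1)[OF w half_ball_indicator, of R] and i2 = Hloc_integrable(2)[OF w half_ball_indicator, of R]
    have "(\<integral>p. energy (\<lambda>p. w p * \<psi> p) (\<lambda>p. w p * \<psi> p) p \<partial>wmeas a) \<le>
      (\<integral>p. (2 * B + 2 * B\<^sup>2) * (?I p * (w p)\<^sup>2 + ?I p * energy w w p) \<partial>wmeas a)"
    proof (rule wmeas_le_real[OF hcs_integrable(2)[OF hc]])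
      show "integrable (wmeas a) (\<lambda>p. (2 * B + 2 * B\<^sup>2) * (?I p * (w p)\<^sup>2 + ?I p * energy w w p))"
        by (intro integrable_mult_right Bochner_Integration.integrable_add i1 i2)
      fix p assume p: "p \<in> half_space"
      have e: "energy (\<lambda>p. w p * \<psi> p) (\<lambda>p. w p * \<psi> p) p \<le> 2 * (w p)\<^sup>2 * energy \<psi> \<psi> p + 2 * (\<psi> p)\<^sup>2 * energy w w p"
        by (rule energy_mult_le[OF C1_diff[OF Cw p] C1_diff[OF C\<psi> p]])
      show "energy (\<lambda>p. w p * \<psi> p) (\<lambda>p. w p * \<psi> p) p \<le> (2 * B + 2 * B\<^sup>2) * (?I p * (w p)\<^sup>2 + ?I p * energy w w p)"
      proof (cases "R \<le> norm p")
        case True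
        then show ?thesis using e RB(2) by (simp add: RB(5,6) half_ball_def)
      next
        case False
        have "(w p)\<^sup>2 * energy \<psi> \<psi> p \<le> (w p)\<^sup>2 * B" using RB(4) by (intro mult_left_mono) auto
        moreover have "(\<psi> p)\<^sup>2 * energy w w p \<le> B\<^sup>2 * energy w w p" using b2 by (intro mult_right_mono) auto
        moreover have "0 \<le> B * energy w w p" "0 \<le> B\<^sup>2 * (w p)\<^sup>2" using RB(2) by simp_all
        moreover have "(2 * B + 2 * B\<^sup>2) * (1 * (w p)\<^sup>2 + 1 * energy w w p) =
           2 * ((w p)\<^sup>2 * B) + 2 * (B * energy w w p) + 2 * (B\<^sup>2 * (w p)\<^sup>2) + 2 * (B\<^sup>2 * energy w w p)"
          by (simp add: algebra_simps)
        ultimately show ?thesis using e unfolding I1[OF p False] mult.assoc by linarith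
      qed
    qed
    then show "(\<integral>p. energy (\<lambda>p. w p * \<psi> p) (\<lambda>p. w p * \<psi> p) p \<partial>wmeas a) \<le>
      (2 * B + 2 * B\<^sup>2) * ((\<integral>p. ?I p * (w p)\<^sup>2 \<partial>wmeas a) + (\<integral>p. ?I p * energy w w p \<partial>wmeas a))"
      using i1 i2 by simp
    have "(\<integral>p. (w p * \<psi> p)\<^sup>2 \<partial>wmeas a) \<le> (\<integral>p. (2 * B + 2 * B\<^sup>2) * (?I p * (w p)\<^sup>2) \<partial>wmeas a)"
    proof (rule wmeas_le_real[OF hcs_integrable(1)[OF hc]])
      show "integrable (wmeas a) (\<lambda>p. (2 * B + 2 * B\<^sup>2) * (?I p * (w p)\<^sup>2))" by (intro integrable_mult_right i1)
      fix p assume p: "p \<in> half_space"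
      show "(w p * \<psi> p)\<^sup>2 \<le> (2 * B + 2 * B\<^sup>2) * (?I p * (w p)\<^sup>2)"
      proof (cases "R \<le> norm p")
        case True
        then show ?thesis using RB(2) by (simp add: RB(5) half_ball_def)
      next
        case False
        have "(\<psi> p)\<^sup>2 * (w p)\<^sup>2 \<le> B\<^sup>2 * (w p)\<^sup>2" using b2 by (intro mult_right_mono) auto
        moreover have "0 \<le> B * (w p)\<^sup>2" "0 \<le> B\<^sup>2 * (w p)\<^sup>2" using RB(2) by simp_all
        moreover have "(2 * B + 2 * B\<^sup>2) * (1 * (w p)\<^sup>2) = 2 * (B * (w p)\<^sup>2) + 2 * (B\<^sup>2 * (w p)\<^sup>2)" by (simp add: algebra_simps)
        ultimately show ?thesis unfolding I1[OF p False] power_mult_distrib mult.commute[of "(w p)\<^sup>2" "(\<psi> p)\<^sup>2"] by linarith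
      qed
    qed
    then show "(\<integral>p. (w p * \<psi> p)\<^sup>2 \<partial>wmeas a) \<le> (2 * B + 2 * B\<^sup>2) * (\<integral>p. ?I p * (w p)\<^sup>2 \<partial>wmeas a)" by simp
  qed
qed

context heis_sol
begin

section \<open>Limits of the difference quotients and of their traces\<close>

definition dn :: "real \<Rightarrow> real \<Rightarrow> real \<Rightarrow> nat \<Rightarrow> hpt \<Rightarrow> real" where
  "dn \<alpha> \<beta> \<tau> n = dq (fld (-2) \<alpha> \<beta> \<tau>) (inverse (real (Suc n))) (1 / inverse (real (Suc n)))"

definition lw :: "real \<Rightarrow> real \<Rightarrow> real \<Rightarrow> hpt \<Rightarrow> real" where
  "lw \<alpha> \<beta> \<tau> q = pd (fld (-2) \<alpha> \<beta> \<tau> q) u q"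

lemma hn: "inverse (real (Suc n)) \<in> {-1..1}" "0 < inverse (real (Suc n)) \<and> inverse (real (Suc n)) \<le> 1"
  by (auto simp: inverse_eq_divide intro: order_trans[of _ 0])

lemma dn_Hloc: "Hloc a (dn \<alpha> \<beta> \<tau> n)"
  unfolding dn_def by (rule dq_Hloc[OF hn(1)])

lemma lw_Hloc: "good \<alpha> \<beta> \<tau> \<Longrightarrow> Hloc a (lw \<alpha> \<beta> \<tau>)"
  unfolding lw_def[abs_def] by (rule good_Hloc)

lemma dn_tendsto:
  assumes "p \<in> half_space"
  shows "(\<lambda>n. dn \<alpha> \<beta> \<tau> n p) \<longlonglongrightarrow> lw \<alpha> \<beta> \<tau> p" "(\<lambda>n. hX (dn \<alpha> \<beta> \<tau> n) p) \<longlonglongrightarrow> hX (lw \<alpha> \<beta> \<tau>) p"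
    "(\<lambda>n. hY (dn \<alpha> \<beta> \<tau> n) p) \<longlonglongrightarrow> hY (lw \<alpha> \<beta> \<tau>) p" "(\<lambda>n. dy (dn \<alpha> \<beta> \<tau> n) p) \<longlonglongrightarrow> dy (lw \<alpha> \<beta> \<tau>) p"
  unfolding dn_def lw_def[abs_def] by (rule dq_tendsto[OF assms])+

lemma dn_ball_bound:
  assumes "good \<alpha> \<beta> \<tau>"
  obtains L where "L \<ge> 0" "\<And>n. (\<integral>p. indicator (half_ball R) p * (dn \<alpha> \<beta> \<tau> n p)\<^sup>2 \<partial>wmeas a) \<le> L"
    "\<And>n. (\<integral>p. indicator (half_ball R) p * energy (dn \<alpha> \<beta> \<tau> n) (dn \<alpha> \<beta> \<tau> n) p \<partial>wmeas a) \<le> L"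
proof -
  obtain \<psi> where \<psi>: "cut \<psi>" "\<And>p. \<psi> p \<ge> 0" "\<And>p. norm p \<le> \<bar>R\<bar> + 1 \<Longrightarrow> \<psi> p \<ge> 1"
    by (rule cut_exists[of "\<bar>R\<bar> + 1"]) (simp, rule that)
  obtain P where P0: "P \<ge> 0" and P: "\<And>h. 0 < h \<and> h \<le> 1 \<Longrightarrow>
     (\<integral>p. (\<psi> p)\<^sup>2 * (dq (fld (-2) \<alpha> \<beta> \<tau>) h (1 / h) p)\<^sup>2 \<partial>wmeas a) \<le> P \<and>
     (\<integral>p. (\<psi> p * \<psi> p)\<^sup>2 * energy (dq (fld (-2) \<alpha> \<beta> \<tau>) h (1 / h)) (dq (fld (-2) \<alpha> \<beta> \<tau>) h (1 / h)) p \<partial>wmeas a) \<le> P"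
    using dq_energy_bound[OF assms \<psi>(1)] by blast
  have 2: "1 \<le> (\<psi> p)\<^sup>2" "1 \<le> (\<psi> p * \<psi> p)\<^sup>2" if "p \<in> half_ball R" for p
  proof -
    have "1 \<le> \<psi> p" using half_ballD(2)[OF that] by (intro \<psi>(3)) linarith
    then show "1 \<le> (\<psi> p)\<^sup>2" "1 \<le> (\<psi> p * \<psi> p)\<^sup>2" by (simp_all add: one_le_power power_mult_distrib mult_ge1_I)
  qed
  show ?thesis
  proof (rule that[OF P0])
    fix n
    have le: "indicator (half_ball R) p * x \<le> c * x" if "p \<in> half_ball R \<Longrightarrow> 1 \<le> c" "0 \<le> x" "0 \<le> c" for p :: hpt and c x :: real
      using mult_right_mono[OF that(1) that(2)] that by (simp add: indicator_def)
    have "(\<integral>p. indicator (half_ball R) p * (dn \<alpha> \<beta> \<tau> n p)\<^sup>2 \<partial>wmeas a) \<le> (\<integral>p. (\<psi> p)\<^sup>2 * (dn \<alpha> \<beta> \<tau> n p)\<^sup>2 \<partial>wmeas a)"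
      by (rule wmeas_le_real[OF Hloc_integrable(1)[OF dn_Hloc[of \<alpha> \<beta> \<tau> n] half_ball_indicator, of R] cut_integrable(1)[OF dn_Hloc \<psi>(1)]])
         (assumption, rule le, erule 2(1), simp_all)
    then show "(\<integral>p. indicator (half_ball R) p * (dn \<alpha> \<beta> \<tau> n p)\<^sup>2 \<partial>wmeas a) \<le> P"
      using P[OF hn(2), of n] unfolding dn_def by linarith
    have "(\<integral>p. indicator (half_ball R) p * energy (dn \<alpha> \<beta> \<tau> n) (dn \<alpha> \<beta> \<tau> n) p \<partial>wmeas a)
       \<le> (\<integral>p. (\<psi> p * \<psi> p)\<^sup>2 * energy (dn \<alpha> \<beta> \<tau> n) (dn \<alpha> \<beta> \<tau> n) p \<partial>wmeas a)"
      by (rule wmeas_le_real[OF Hloc_integrable(2)[OF dn_Hloc[of \<alpha> \<beta> \<tau> n] half_ball_indicator, of R] cut_integrable(2)[OF dn_Hloc cut_mult[OF \<psi>(1) \<psi>(1)]]])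
         (assumption, rule le, erule 2(2), simp_all)
    then show "(\<integral>p. indicator (half_ball R) p * energy (dn \<alpha> \<beta> \<tau> n) (dn \<alpha> \<beta> \<tau> n) p \<partial>wmeas a) \<le> P"
      using P[OF hn(2), of n] unfolding dn_def by linarith
  qed
qed

lemma dq_components:
  assumes p: "p \<in> half_space"
  shows "hX (dq (fld (-2) \<alpha> \<beta> \<tau>) t c) p = c * (hX u (flow (fld (-2) \<alpha> \<beta> \<tau>) t p) - hX u p)"
    "hY (dq (fld (-2) \<alpha> \<beta> \<tau>) t c) p = c * (hY u (flow (fld (-2) \<alpha> \<beta> \<tau>) t p) - hY u p)"
    "dy (dq (fld (-2) \<alpha> \<beta> \<tau>) t c) p = c * (dy u (flow (fld (-2) \<alpha> \<beta> \<tau>) t p) - dy u p)"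
proof -
  have d: "(\<lambda>q. u (flow (fld (-2) \<alpha> \<beta> \<tau>) t q)) differentiable (at p)" "u differentiable (at p)"
    "(\<lambda>q. u (flow (fld (-2) \<alpha> \<beta> \<tau>) t q) - u q) differentiable (at p)"
    by (intro differentiable_diff C1_diff[OF C1_flow[OF u_C1(1)] p] C1_diff[OF u_C1(1) p])+
  show "hX (dq (fld (-2) \<alpha> \<beta> \<tau>) t c) p = c * (hX u (flow (fld (-2) \<alpha> \<beta> \<tau>) t p) - hX u p)"
    "hY (dq (fld (-2) \<alpha> \<beta> \<tau>) t c) p = c * (hY u (flow (fld (-2) \<alpha> \<beta> \<tau>) t p) - hY u p)"
    "dy (dq (fld (-2) \<alpha> \<beta> \<tau>) t c) p = c * (dy u (flow (fld (-2) \<alpha> \<beta> \<tau>) t p) - dy u p)"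
    unfolding dq_def[abs_def] h_cmult[OF d(3)] h_diff[OF d(1,2)] h_flow[OF u_C1(1) p, of \<alpha> \<beta> \<tau>] by (rule refl)+
qed

lemma dn_slab_bound:
  assumes \<delta>: "\<delta> > 0"
  shows "\<exists>B. \<forall>n. \<forall>p\<in>slab \<delta> R. \<bar>dn \<alpha> \<beta> \<tau> n p\<bar> \<le> B" "\<exists>B. \<forall>n. \<forall>p\<in>slab \<delta> R. \<bar>hX (dn \<alpha> \<beta> \<tau> n) p\<bar> \<le> B"
    "\<exists>B. \<forall>n. \<forall>p\<in>slab \<delta> R. \<bar>hY (dn \<alpha> \<beta> \<tau> n) p\<bar> \<le> B" "\<exists>B. \<forall>n. \<forall>p\<in>slab \<delta> R. \<bar>dy (dn \<alpha> \<beta> \<tau> n) p\<bar> \<le> B"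
proof -
  have hs: "p \<in> half_space" if "p \<in> slab \<delta> R" for p using slab_half_space[OF \<delta>] that by blast
  have *: "\<exists>B. \<forall>n. \<forall>p\<in>slab \<delta> R. \<bar>G n p\<bar> \<le> B" if g: "C1 half_space g" and
    e: "\<And>n p. p \<in> half_space \<Longrightarrow> G n p = (1 / inverse (real (Suc n))) * (g (flow (fld (-2) \<alpha> \<beta> \<tau>) (inverse (real (Suc n))) p) - g p)"
    for g and G :: "nat \<Rightarrow> hpt \<Rightarrow> real"
  proof -
    obtain B where B: "\<And>h p. 0 < h \<and> h \<le> 1 \<Longrightarrow> p \<in> slab \<delta> R \<Longrightarrow> \<bar>(1 / h) * (g (flow (fld (-2) \<alpha> \<beta> \<tau>) h p) - g p)\<bar> \<le> B"
      using difference_quotient_slab_bound[OF g \<delta>, of R "-2" \<alpha> \<beta> \<tau>] by blast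
    show ?thesis
    proof (intro exI[of _ B] allI ballI)
      fix n p assume p: "p \<in> slab \<delta> R"
      show "\<bar>G n p\<bar> \<le> B" unfolding e[OF hs[OF p]] by (rule B[OF hn(2) p])
    qed
  qed
  show "\<exists>B. \<forall>n. \<forall>p\<in>slab \<delta> R. \<bar>dn \<alpha> \<beta> \<tau> n p\<bar> \<le> B"
    by (rule *[OF u_C1(1)]) (simp only: dn_def dq_def)
  show "\<exists>B. \<forall>n. \<forall>p\<in>slab \<delta> R. \<bar>hX (dn \<alpha> \<beta> \<tau> n) p\<bar> \<le> B"
    by (rule *[OF u_C1(3)]) (simp only: dn_def dq_components)
  show "\<exists>B. \<forall>n. \<forall>p\<in>slab \<delta> R. \<bar>hY (dn \<alpha> \<beta> \<tau> n) p\<bar> \<le> B"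
    by (rule *[OF u_C1(4)]) (simp only: dn_def dq_components)
  show "\<exists>B. \<forall>n. \<forall>p\<in>slab \<delta> R. \<bar>dy (dn \<alpha> \<beta> \<tau> n) p\<bar> \<le> B"
    by (rule *[OF u_C1(5)]) (simp only: dn_def dq_components)
qed

text \<open>Weak convergence is applied separately to X, Y and d_y of the quotients, with the
  matching derivative of \<xi> as weight; \<open>part\<close> treats the three components
  alike.\<close>

lemma dn_interior_limit:
  assumes g: "good \<alpha> \<beta> \<tau>" and t: "tst a \<xi>"
  shows "(\<lambda>n. \<integral>p. energy (dn \<alpha> \<beta> \<tau> n) \<xi> p \<partial>wmeas a) \<longlonglongrightarrow> (\<integral>p. energy (lw \<alpha> \<beta> \<tau>) \<xi> p \<partial>wmeas a)"
proof -
  let ?D = "dn \<alpha> \<beta> \<tau>" and ?w = "lw \<alpha> \<beta> \<tau>"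
  note Hw = lw_Hloc[OF g]
  obtain R where R: "R > 0" "\<And>p. p \<in> half_space \<Longrightarrow> R \<le> norm p \<Longrightarrow> \<xi> p = 0"
    "\<And>p w. p \<in> half_space \<Longrightarrow> R \<le> norm p \<Longrightarrow> energy w \<xi> p = 0" by (rule tst_support[OF t]) (rule that)
  obtain L where L: "L \<ge> 0" "\<And>n. (\<integral>p. indicator (half_ball R) p * (?D n p)\<^sup>2 \<partial>wmeas a) \<le> L"
    "\<And>n. (\<integral>p. indicator (half_ball R) p * energy (?D n) (?D n) p \<partial>wmeas a) \<le> L"
    by (rule dn_ball_bound[OF g, of R]) (rule that)
  define L' where "L' = (\<integral>p. indicator (half_ball R) p * energy ?w ?w p \<partial>wmeas a)"
  have Rc: "hX \<xi> p = 0 \<and> hY \<xi> p = 0 \<and> dy \<xi> p = 0" if "p \<in> half_space" "R \<le> norm p" for p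
    using energy_components[of \<xi> p] R(3)[OF that, of \<xi>] by simp
  have part: "(\<lambda>n. \<integral>p. F (?D n) p * F \<xi> p \<partial>wmeas a) \<longlonglongrightarrow> (\<integral>p. F ?w p * F \<xi> p \<partial>wmeas a)"
    if m: "\<And>v. C1 half_space v \<Longrightarrow> continuous_on half_space (F v)" and
      c: "\<And>v p. (F v p)\<^sup>2 \<le> energy v v p" and lim: "\<And>p. p \<in> half_space \<Longrightarrow> (\<lambda>n. F (?D n) p) \<longlonglongrightarrow> F ?w p" and
      b: "\<And>\<delta>. \<delta> > 0 \<Longrightarrow> \<exists>B. \<forall>n. \<forall>p\<in>slab \<delta> R. \<bar>F (?D n) p\<bar> \<le> B" and
      z: "\<And>p. p \<in> half_space \<Longrightarrow> R \<le> norm p \<Longrightarrow> F \<xi> p = 0" for F :: "(hpt \<Rightarrow> real) \<Rightarrow> hpt \<Rightarrow> real"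
  proof (rule weak_convergence[OF a1, where C = "L + \<bar>L'\<bar>", OF _ _ _ lim b z])
    note cF = continuous_wmeas_measurable[OF m]
    show "F (?D n) \<in> borel_measurable (wmeas a)" for n by (rule cF[OF Hloc_C1[OF dn_Hloc]])
    show "F ?w \<in> borel_measurable (wmeas a)" by (rule cF[OF Hloc_C1[OF Hw]])
    show "F \<xi> \<in> borel_measurable (wmeas a)" by (rule cF[OF tst_C1[OF t]])
    show "integrable (wmeas a) (\<lambda>p. (F \<xi> p)\<^sup>2)"
      by (rule Bochner_Integration.integrable_bound[OF tst_integrable[OF t]])
         (intro borel_measurable_power cF tst_C1[OF t], use c in simp)
    have i: "integrable (wmeas a) (\<lambda>p. indicator (half_ball R) p * (F v p)\<^sup>2) \<and>
      (\<integral>p. indicator (half_ball R) p * (F v p)\<^sup>2 \<partial>wmeas a) \<le> (\<integral>p. indicator (half_ball R) p * energy v v p \<partial>wmeas a)"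
      if v: "Hloc a v" for v
    proof -
      note iE = Hloc_integrable(2)[OF v half_ball_indicator, of R]
      have le: "indicator (half_ball R) p * (F v p)\<^sup>2 \<le> indicator (half_ball R) p * energy v v p" for p
        using c by (intro mult_left_mono) (simp_all add: indicator_def)
      have "integrable (wmeas a) (\<lambda>p. indicator (half_ball R) p * (F v p)\<^sup>2)"
      proof (rule Bochner_Integration.integrable_bound[OF iE])
        show "(\<lambda>p. indicator (half_ball R) p * (F v p)\<^sup>2) \<in> borel_measurable (wmeas a)"
          by (intro borel_measurable_times half_ball_indicator borel_measurable_power cF Hloc_C1[OF v])
        show "AE p in wmeas a. norm (indicator (half_ball R) p * (F v p)\<^sup>2) \<le> norm (indicator (half_ball R) p * energy v v p)"
          using le by (intro AE_I2) (simp add: abs_mult indicator_def)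
      qed
      then show ?thesis using wmeas_le_real[OF _ iE] le by blast
    qed
    show "integrable (wmeas a) (\<lambda>p. indicator (half_ball R) p * (F (?D n) p)\<^sup>2)" for n using i[OF dn_Hloc] by blast
    show "integrable (wmeas a) (\<lambda>p. indicator (half_ball R) p * (F ?w p)\<^sup>2)" using i[OF Hw] by blast
    show "(\<integral>p. indicator (half_ball R) p * (F (?D n) p)\<^sup>2 \<partial>wmeas a) \<le> L + \<bar>L'\<bar>" for n
      using conjunct2[OF i[OF dn_Hloc[of \<alpha> \<beta> \<tau> n]]] L(3)[of n] by linarith
    show "(\<integral>p. indicator (half_ball R) p * (F ?w p)\<^sup>2 \<partial>wmeas a) \<le> L + \<bar>L'\<bar>"
      using conjunct2[OF i[OF Hw]] L(1) unfolding L'_def by linarith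
  qed
  have p1: "(\<lambda>n. \<integral>p. hX (?D n) p * hX \<xi> p \<partial>wmeas a) \<longlonglongrightarrow> (\<integral>p. hX ?w p * hX \<xi> p \<partial>wmeas a)"
    by (rule part[of hX]) (simp_all add: h_cont energy_components dn_tendsto dn_slab_bound Rc)
  have p2: "(\<lambda>n. \<integral>p. hY (?D n) p * hY \<xi> p \<partial>wmeas a) \<longlonglongrightarrow> (\<integral>p. hY ?w p * hY \<xi> p \<partial>wmeas a)"
    by (rule part[of hY]) (simp_all add: h_cont energy_components dn_tendsto dn_slab_bound Rc)
  have p3: "(\<lambda>n. \<integral>p. dy (?D n) p * dy \<xi> p \<partial>wmeas a) \<longlonglongrightarrow> (\<integral>p. dy ?w p * dy \<xi> p \<partial>wmeas a)"
    by (rule part[of dy]) (simp_all add: h_cont energy_components dn_tendsto dn_slab_bound Rc)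
  have e: "(\<integral>p. energy v \<xi> p \<partial>wmeas a) = (\<integral>p. hX v p * hX \<xi> p \<partial>wmeas a) + (\<integral>p. hY v p * hY \<xi> p \<partial>wmeas a) + (\<integral>p. dy v p * dy \<xi> p \<partial>wmeas a)"
    if "Hloc a v" for v
    unfolding energy_def using component_integrable[OF that t] by simp
  show ?thesis unfolding e[OF dn_Hloc] e[OF Hw] by (intro tendsto_add p1 p2 p3)
qed

text \<open>The trace inequality with \<epsilon> = 1 is enough, since only boundedness of the traces
  is sought here.\<close>

lemma dn_trace_bound:
  assumes g: "good \<alpha> \<beta> \<tau>" and \<psi>: "cut \<psi>"
  obtains L where "L \<ge> 0" "\<And>n. integrable lborel (\<lambda>x. (btr (\<lambda>p. dn \<alpha> \<beta> \<tau> n p * \<psi> p) x)\<^sup>2)"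
    "\<And>n. (\<integral>x. (btr (\<lambda>p. dn \<alpha> \<beta> \<tau> n p * \<psi> p) x)\<^sup>2 \<partial>lborel) \<le> L"
proof -
  obtain C \<delta> where C: "C \<ge> 0" and
    trI: "\<And>z. hcs a z \<Longrightarrow> integrable lborel (\<lambda>x. (btr z x)\<^sup>2)" and
    tr: "\<And>z. hcs a z \<Longrightarrow> (\<integral>x. (btr z x)\<^sup>2 \<partial>lborel) \<le> 1 * (\<integral>p. energy z z p \<partial>wmeas a)
        + C * (\<integral>p. indicator {p. snd p > \<delta>} p * (z p)\<^sup>2 \<partial>wmeas a)"
    by (rule trace_inequality_hcs[OF aa zero_less_one]) (rule that)
  obtain R c where c: "c \<ge> 0" and hc: "\<And>w. Hloc a w \<Longrightarrow> hcs a (\<lambda>p. w p * \<psi> p)"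
    and cE: "\<And>w. Hloc a w \<Longrightarrow> (\<integral>p. energy (\<lambda>p. w p * \<psi> p) (\<lambda>p. w p * \<psi> p) p \<partial>wmeas a) \<le>
      c * ((\<integral>p. indicator (half_ball R) p * (w p)\<^sup>2 \<partial>wmeas a) + (\<integral>p. indicator (half_ball R) p * energy w w p \<partial>wmeas a))"
    and cS: "\<And>w. Hloc a w \<Longrightarrow> (\<integral>p. (w p * \<psi> p)\<^sup>2 \<partial>wmeas a) \<le> c * (\<integral>p. indicator (half_ball R) p * (w p)\<^sup>2 \<partial>wmeas a)"
    by (rule hcs_cut[OF \<psi>, of a]) (rule that)
  obtain L where L: "L \<ge> 0" "\<And>n. (\<integral>p. indicator (half_ball R) p * (dn \<alpha> \<beta> \<tau> n p)\<^sup>2 \<partial>wmeas a) \<le> L"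
    "\<And>n. (\<integral>p. indicator (half_ball R) p * energy (dn \<alpha> \<beta> \<tau> n) (dn \<alpha> \<beta> \<tau> n) p \<partial>wmeas a) \<le> L"
    by (rule dn_ball_bound[OF g, of R]) (rule that)
  show ?thesis
  proof (rule that[of "c * (L + L) + C * (c * L)"])
    show "0 \<le> c * (L + L) + C * (c * L)" using c L(1) C by simp
    fix n
    let ?z = "\<lambda>p. dn \<alpha> \<beta> \<tau> n p * \<psi> p"
    note hz = hc[OF dn_Hloc[of \<alpha> \<beta> \<tau> n]]
    show "integrable lborel (\<lambda>x. (btr ?z x)\<^sup>2)" by (rule trI[OF hz])
    have E: "(\<integral>p. energy ?z ?z p \<partial>wmeas a) \<le> c * (L + L)"
      using cE[OF dn_Hloc[of \<alpha> \<beta> \<tau> n]] mult_left_mono[OF add_mono[OF L(2)[of n] L(3)[of n]] c] by linarith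
    have "(\<integral>p. indicator {p. snd p > \<delta>} p * (?z p)\<^sup>2 \<partial>wmeas a) \<le> (\<integral>p. (?z p)\<^sup>2 \<partial>wmeas a)"
      by (rule integral_mono_AE'[OF hcs_integrable(1)[OF hz]]) (auto intro!: AE_I2 simp: indicator_def)
    also have "\<dots> \<le> c * L"
      using cS[OF dn_Hloc[of \<alpha> \<beta> \<tau> n]] mult_left_mono[OF L(2)[of n] c] by linarith
    finally have "C * (\<integral>p. indicator {p. snd p > \<delta>} p * (?z p)\<^sup>2 \<partial>wmeas a) \<le> C * (c * L)" by (rule mult_left_mono[OF _ C])
    then show "(\<integral>x. (btr ?z x)\<^sup>2 \<partial>lborel) \<le> c * (L + L) + C * (c * L)"
      using tr[OF hz] E by linarith
  qed
qed

text \<open>Traces converge strongly even though gradients are only bounded: in the trace inequality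
  the energies carry an arbitrary \<epsilon>, and the other term, living above height \<delta>,
  tends to 0 by dominated convergence.\<close>

lemma dn_trace_limit:
  assumes g: "good \<alpha> \<beta> \<tau>" and \<psi>: "cut \<psi>"
  shows "(\<lambda>n. \<integral>x. (btr (\<lambda>p. (dn \<alpha> \<beta> \<tau> n p - lw \<alpha> \<beta> \<tau> p) * \<psi> p) x)\<^sup>2 \<partial>lborel) \<longlonglongrightarrow> 0"
    "integrable lborel (\<lambda>x. (btr (\<lambda>p. (dn \<alpha> \<beta> \<tau> n p - lw \<alpha> \<beta> \<tau> p) * \<psi> p) x)\<^sup>2)"
proof -
  let ?D = "dn \<alpha> \<beta> \<tau>" and ?w = "lw \<alpha> \<beta> \<tau>"
  note Hw = lw_Hloc[OF g]
  have Hd: "Hloc a (\<lambda>p. ?D n p - ?w p)" for n by (rule Hloc_diff[OF dn_Hloc Hw])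
  obtain R c where c: "c \<ge> 0" and hc: "\<And>w. Hloc a w \<Longrightarrow> hcs a (\<lambda>p. w p * \<psi> p)"
    and R: "\<And>p. R \<le> norm p \<Longrightarrow> \<psi> p = 0"
    and cE: "\<And>w. Hloc a w \<Longrightarrow> (\<integral>p. energy (\<lambda>p. w p * \<psi> p) (\<lambda>p. w p * \<psi> p) p \<partial>wmeas a) \<le>
      c * ((\<integral>p. indicator (half_ball R) p * (w p)\<^sup>2 \<partial>wmeas a) + (\<integral>p. indicator (half_ball R) p * energy w w p \<partial>wmeas a))"
    by (rule hcs_cut[OF \<psi>, of a]) (rule that)
  let ?z = "\<lambda>n p. (?D n p - ?w p) * \<psi> p"
  have hz: "hcs a (?z n)" for n by (rule hc[OF Hd])
  obtain L where L: "L \<ge> 0" "\<And>n. (\<integral>p. indicator (half_ball R) p * (?D n p)\<^sup>2 \<partial>wmeas a) \<le> L"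
    "\<And>n. (\<integral>p. indicator (half_ball R) p * energy (?D n) (?D n) p \<partial>wmeas a) \<le> L"
    by (rule dn_ball_bound[OF g, of R]) (rule that)
  define W where "W = (\<integral>p. indicator (half_ball R) p * (?w p)\<^sup>2 \<partial>wmeas a) + (\<integral>p. indicator (half_ball R) p * energy ?w ?w p \<partial>wmeas a)"
  \<comment> \<open>Because (x - y)^2 \<le> 2 x^2 + 2 y^2, the bounds L on the values and on the
    energy of the quotients contribute 2 L each, and the limit contributes 2 W.\<close>
  define M where "M = c * (4 * L + 2 * W)"
  have W0: "0 \<le> W" unfolding W_def by (intro add_nonneg_nonneg integral_nonneg_AE AE_I2) simp_all
  then have M0: "0 \<le> M" unfolding M_def using c L(1) by simp
  have EM: "(\<integral>p. energy (?z n) (?z n) p \<partial>wmeas a) \<le> M" for n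
  proof -
    note iD = Hloc_integrable[OF dn_Hloc[of \<alpha> \<beta> \<tau> n] half_ball_indicator, of R]
      and iw = Hloc_integrable[OF Hw half_ball_indicator, of R] and id = Hloc_integrable[OF Hd[of n] half_ball_indicator, of R]
    have 1: "(\<integral>p. indicator (half_ball R) p * (?D n p - ?w p)\<^sup>2 \<partial>wmeas a) \<le>
      (\<integral>p. 2 * (indicator (half_ball R) p * (?D n p)\<^sup>2) + 2 * (indicator (half_ball R) p * (?w p)\<^sup>2) \<partial>wmeas a)"
      by (rule wmeas_le_real[OF id(1)])
         (assumption, intro Bochner_Integration.integrable_add integrable_mult_right iD iw, assumption+, use sq_diff_le[of "?D n _" "?w _"] in \<open>simp add: indicator_def\<close>)
    have 2: "(\<integral>p. indicator (half_ball R) p * energy (\<lambda>p. ?D n p - ?w p) (\<lambda>p. ?D n p - ?w p) p \<partial>wmeas a) \<le>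
      (\<integral>p. 2 * (indicator (half_ball R) p * energy (?D n) (?D n) p) + 2 * (indicator (half_ball R) p * energy ?w ?w p) \<partial>wmeas a)"
    proof (rule wmeas_le_real[OF id(2)])
      show "integrable (wmeas a) (\<lambda>p. 2 * (indicator (half_ball R) p * energy (?D n) (?D n) p) + 2 * (indicator (half_ball R) p * energy ?w ?w p))"
        by (intro Bochner_Integration.integrable_add integrable_mult_right iD iw)
      fix p assume p: "p \<in> half_space"
      show "indicator (half_ball R) p * energy (\<lambda>p. ?D n p - ?w p) (\<lambda>p. ?D n p - ?w p) p
        \<le> 2 * (indicator (half_ball R) p * energy (?D n) (?D n) p) + 2 * (indicator (half_ball R) p * energy ?w ?w p)"
        using energy_diff_le[OF C1_diff[OF Hloc_C1[OF dn_Hloc[of \<alpha> \<beta> \<tau> n]] p] C1_diff[OF Hloc_C1[OF Hw] p]] by (simp add: indicator_def)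
    qed
    have 3: "(\<integral>p. indicator (half_ball R) p * (?D n p - ?w p)\<^sup>2 \<partial>wmeas a) + (\<integral>p. indicator (half_ball R) p * energy (\<lambda>p. ?D n p - ?w p) (\<lambda>p. ?D n p - ?w p) p \<partial>wmeas a)
      \<le> 4 * L + 2 * W"
      using 1 2 L(2)[of n] L(3)[of n] iD iw unfolding W_def by simp
    show ?thesis unfolding M_def using cE[OF Hd[of n]] mult_left_mono[OF 3 c] by linarith
  qed
  obtain C0 \<delta>0 where trI: "\<And>z. hcs a z \<Longrightarrow> integrable lborel (\<lambda>x. (btr z x)\<^sup>2)"
    by (rule trace_inequality_hcs[OF aa zero_less_one]) (rule that)
  show "integrable lborel (\<lambda>x. (btr (?z n) x)\<^sup>2)" by (rule trI[OF hz])
  show "(\<lambda>n. \<integral>x. (btr (?z n) x)\<^sup>2 \<partial>lborel) \<longlonglongrightarrow> 0"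
  proof (rule LIMSEQ_I)
    fix e :: real assume e: "e > 0"
    \<comment> \<open>The order matters: \<epsilon> is fixed by e and M, then the trace inequality
      supplies C and \<delta>, and only then N is chosen.\<close>
    define \<epsilon> where "\<epsilon> = e / (2 * (M + 1))"
    have \<epsilon>: "\<epsilon> > 0" using e M0 by (simp add: \<epsilon>_def)
    have \<epsilon>M: "\<epsilon> * M < e / 2"
    proof -
      have "\<epsilon> * M < \<epsilon> * (M + 1)" using \<epsilon> by simp
      also have "\<dots> = e / 2" using M0 by (simp add: \<epsilon>_def field_simps)
      finally show ?thesis .
    qed
    obtain C \<delta> where C: "C \<ge> 0" "\<delta> > 0" and
      tr: "\<And>z. hcs a z \<Longrightarrow> (\<integral>x. (btr z x)\<^sup>2 \<partial>lborel) \<le> \<epsilon> * (\<integral>p. energy z z p \<partial>wmeas a)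
        + C * (\<integral>p. indicator {p. snd p > \<delta>} p * (z p)\<^sup>2 \<partial>wmeas a)"
      by (rule trace_inequality_hcs[OF aa \<epsilon>]) (rule that)
    have "{p::hpt. snd p > \<delta>} \<in> sets borel" by (intro borel_open open_Collect_less continuous_intros)
    then have im: "(\<lambda>p. indicator {p. snd p > \<delta>} p :: real) \<in> borel_measurable (wmeas a)"
      by (intro borel_wmeas_measurable borel_measurable_indicator)
    obtain B where B0: "\<And>n p. p \<in> slab \<delta> R \<Longrightarrow> \<bar>?D n p\<bar> \<le> B"
      using dn_slab_bound(1)[OF C(2), of R \<alpha> \<beta> \<tau>] by blast
    have lim: "(\<lambda>n. \<integral>p. indicator {p. snd p > \<delta>} p * (?z n p)\<^sup>2 \<partial>wmeas a) \<longlonglongrightarrow> (\<integral>p. 0 \<partial>wmeas a)"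
    proof (rule integral_dominated_convergence[where w = "\<lambda>p. (2 * B)\<^sup>2 * (indicator (half_ball R) p * (\<psi> p)\<^sup>2)"])
      have "Hloc a (\<lambda>p. 1 * \<psi> p)"
      proof -
        have "Hloc a (\<lambda>p. 1::real)" unfolding Hloc_def
        proof (intro conjI allI C1_const)
          fix R
          have "(\<integral>\<^sup>+p. ennreal (1\<^sup>2 + energy (\<lambda>p. 1) (\<lambda>p. 1) p) * indicator (half_ball R) p \<partial>wmeas a) = emeasure (wmeas a) (half_ball R)"
            by (simp add: energy_def)
          then show "(\<integral>\<^sup>+p. ennreal (1\<^sup>2 + energy (\<lambda>p. 1) (\<lambda>p. 1) p) * indicator (half_ball R) p \<partial>wmeas a) < \<infinity>"
            using emeasure_half_ball[OF a1, of R] by simp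
        qed
        then show ?thesis by (rule Hloc_mult_C1) (use \<psi> in \<open>simp add: cut_def\<close>)
      qed
      from Hloc_integrable(1)[OF this half_ball_indicator, of R]
      show "integrable (wmeas a) (\<lambda>p. (2 * B)\<^sup>2 * (indicator (half_ball R) p * (\<psi> p)\<^sup>2))"
        by (intro integrable_mult_right) simp
      show "(\<lambda>p. indicator {p. snd p > \<delta>} p * (?z n p)\<^sup>2) \<in> borel_measurable (wmeas a)" for n
        by (intro borel_measurable_times im Hloc_measurable(2) hcs_C1[OF hz])
      show "AE p in wmeas a. (\<lambda>n. indicator {p. snd p > \<delta>} p * (?z n p)\<^sup>2) \<longlonglongrightarrow> 0"
      proof (rule AE_I2)
        fix p assume "p \<in> space (wmeas a)"
        then have p: "p \<in> half_space" by simp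
        have "(\<lambda>n. indicator {p. snd p > \<delta>} p * (((?D n p - ?w p) * \<psi> p)\<^sup>2)) \<longlonglongrightarrow> indicator {p. snd p > \<delta>} p * (((?w p - ?w p) * \<psi> p)\<^sup>2)"
          by (intro tendsto_intros dn_tendsto p)
        then show "(\<lambda>n. indicator {p. snd p > \<delta>} p * (?z n p)\<^sup>2) \<longlonglongrightarrow> 0" by simp
      qed
      show "AE p in wmeas a. norm (indicator {p. snd p > \<delta>} p * (?z n p)\<^sup>2) \<le> (2 * B)\<^sup>2 * (indicator (half_ball R) p * (\<psi> p)\<^sup>2)" for n
      proof (rule AE_I2)
        fix p assume "p \<in> space (wmeas a)"
        then have p: "p \<in> half_space" by simp
        show "norm (indicator {p. snd p > \<delta>} p * (?z n p)\<^sup>2) \<le> (2 * B)\<^sup>2 * (indicator (half_ball R) p * (\<psi> p)\<^sup>2)"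
        proof (cases "R \<le> norm p \<or> \<not> \<delta> < snd p")
          case True
          then show ?thesis
          proof
            assume "R \<le> norm p" then show ?thesis by (simp add: R)
          next
            assume "\<not> \<delta> < snd p" then show ?thesis by (simp add: indicator_def)
          qed
        next
          case False
          then have s: "p \<in> slab \<delta> R" and hb: "p \<in> half_ball R" using half_ballI[OF p] by (simp_all add: slab_def)
          have "\<bar>?w p\<bar> \<le> B"
            by (rule LIMSEQ_le_const2[OF tendsto_rabs[OF dn_tendsto(1)[OF p]]]) (use B0[OF s] in auto)
          then have "\<bar>?D n p - ?w p\<bar> \<le> 2 * B" using B0[OF s, of n] by linarith
          then have "(?D n p - ?w p)\<^sup>2 \<le> (2 * B)\<^sup>2" by (metis abs_ge_zero power2_abs power_mono)
          then have "(?D n p - ?w p)\<^sup>2 * (\<psi> p)\<^sup>2 \<le> (2 * B)\<^sup>2 * (\<psi> p)\<^sup>2" by (rule mult_right_mono) simp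
          then show ?thesis using hb False by (simp add: power_mult_distrib)
        qed
      qed
    qed simp
    then have "(\<lambda>n. C * (\<integral>p. indicator {p. snd p > \<delta>} p * (?z n p)\<^sup>2 \<partial>wmeas a)) \<longlonglongrightarrow> C * 0"
      by (intro tendsto_mult tendsto_const) simp
    from LIMSEQ_D[OF this, of "e / 2"] e obtain N where
      N: "\<And>n. n \<ge> N \<Longrightarrow> \<bar>C * (\<integral>p. indicator {p. snd p > \<delta>} p * (?z n p)\<^sup>2 \<partial>wmeas a)\<bar> < e / 2" by auto
    show "\<exists>N. \<forall>n\<ge>N. norm ((\<integral>x. (btr (?z n) x)\<^sup>2 \<partial>lborel) - 0) < e"
    proof (intro exI[of _ N] allI impI)
      fix n assume n: "n \<ge> N"
      have "(\<integral>x. (btr (?z n) x)\<^sup>2 \<partial>lborel) < e"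
        using tr[OF hz[of n]] mult_left_mono[OF EM[of n] less_imp_le[OF \<epsilon>]] \<epsilon>M N[OF n] by linarith
      moreover have "0 \<le> (\<integral>x. (btr (?z n) x)\<^sup>2 \<partial>lborel)" by (intro integral_nonneg_AE AE_I2) simp
      ultimately show "norm ((\<integral>x. (btr (?z n) x)\<^sup>2 \<partial>lborel) - 0) < e" by simp
    qed
  qed
qed

text \<open>For near arguments: uniform continuity of f' on [-B, B] and the mean value theorem for
  f(x) - f'(t) x. For |r - t| \<ge> d the crude bound 2 K |r - t| is at most (2 K / d) (r - t)^2.
  The quadratic term is harmless, as it keeps a factor h after division by h.\<close>

lemma f_taylor:
  assumes e: "e > 0"
  obtains C where "C \<ge> 0" "\<And>r t. \<bar>r\<bar> \<le> B \<Longrightarrow> \<bar>t\<bar> \<le> B \<Longrightarrow>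
    \<bar>f r - f t - deriv f t * (r - t)\<bar> \<le> e * \<bar>r - t\<bar> + C * (r - t)\<^sup>2"
proof -
  obtain K where K: "K > 0" "\<And>r t. \<bar>r\<bar> \<le> B \<Longrightarrow> \<bar>t\<bar> \<le> B \<Longrightarrow> \<bar>f r - f t\<bar> \<le> K * \<bar>r - t\<bar>"
    "\<And>t. \<bar>t\<bar> \<le> B \<Longrightarrow> \<bar>deriv f t\<bar> \<le> K" by (rule f_lipschitz[of B]) blast
  have "uniformly_continuous_on {-B..B} (deriv f)"
    by (intro compact_uniformly_continuous continuous_on_subset[OF f'_cont]) auto
  then obtain d where d: "d > 0" "\<And>r t. r \<in> {-B..B} \<Longrightarrow> t \<in> {-B..B} \<Longrightarrow> dist r t < d \<Longrightarrow> dist (deriv f r) (deriv f t) < e"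
    using e unfolding uniformly_continuous_on_def by metis
  show ?thesis
  proof (rule that[of "2 * K / d"])
    show "0 \<le> 2 * K / d" using K d by simp
    fix r t assume r: "\<bar>r\<bar> \<le> B" and t: "\<bar>t\<bar> \<le> B"
    show "\<bar>f r - f t - deriv f t * (r - t)\<bar> \<le> e * \<bar>r - t\<bar> + 2 * K / d * (r - t)\<^sup>2"
    proof (cases "\<bar>r - t\<bar> < d")
      case True
      have "norm ((f r - deriv f t * r) - (f t - deriv f t * t)) \<le> e * norm (r - t)"
      proof (rule field_differentiable_bound[of "closed_segment t r" "\<lambda>x. f x - deriv f t * x" "\<lambda>x. deriv f x - deriv f t"])
        fix z assume z: "z \<in> closed_segment t r"
        show "((\<lambda>x. f x - deriv f t * x) has_field_derivative deriv f z - deriv f t) (at z within closed_segment t r)"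
          by (rule has_field_derivative_at_within) (auto intro!: derivative_eq_intros f_DERIV)
        have "\<bar>z\<bar> \<le> B" "\<bar>z - t\<bar> \<le> \<bar>r - t\<bar>" using z r t by (auto simp: closed_segment_eq_real_ivl split: if_splits)
        then have "dist (deriv f z) (deriv f t) < e" using True t by (intro d(2)) (auto simp: dist_real_def)
        then show "norm (deriv f z - deriv f t) \<le> e" by (simp add: dist_real_def)
      qed auto
      moreover have "0 \<le> 2 * K / d * (r - t)\<^sup>2" using K d by simp
      ultimately show ?thesis by (simp add: right_diff_distrib)
    next
      case False
      have "\<bar>f r - f t - deriv f t * (r - t)\<bar> \<le> \<bar>f r - f t\<bar> + \<bar>deriv f t\<bar> * \<bar>r - t\<bar>"
        using abs_triangle_ineq4[of "f r - f t" "deriv f t * (r - t)"] by (simp add: abs_mult)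
      also have "\<dots> \<le> K * \<bar>r - t\<bar> + K * \<bar>r - t\<bar>" using K(2)[OF r t] K(3)[OF t] by (intro add_mono mult_right_mono) auto
      also have "\<dots> = 2 * K / d * (d * \<bar>r - t\<bar>)" using d by simp
      also have "\<dots> \<le> 2 * K / d * (\<bar>r - t\<bar> * \<bar>r - t\<bar>)" using False K d by (intro mult_left_mono mult_right_mono) auto
      also have "\<dots> = 2 * K / d * (r - t)\<^sup>2" by (simp add: power2_eq_square)
      finally show ?thesis using e by (simp add: add_increasing)
    qed
  qed
qed

section \<open>The linearised equation\<close>

text \<open>The limit of the difference equations. Inside, weak convergence suffices. On the
  boundary, with A and W the traces of quotient and limit, q that of \<xi> and F the increment of
  f(u), the error is (F/h - f' A) q + f' (A - W) q: the first part is handled by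
  \<open>f_taylor\<close>, the second by strong convergence of traces.\<close>

lemma linearised_equation:
  assumes g: "good \<alpha> \<beta> \<tau>" and t: "tst a \<xi>"
  shows "integrable lborel (\<lambda>x. deriv f (btr u x) * btr (lw \<alpha> \<beta> \<tau>) x * btr \<xi> x)"
    "(\<integral>p. energy (lw \<alpha> \<beta> \<tau>) \<xi> p \<partial>wmeas a) = (\<integral>x. deriv f (btr u x) * btr (lw \<alpha> \<beta> \<tau>) x * btr \<xi> x \<partial>lborel)"
proof -
  let ?D = "dn \<alpha> \<beta> \<tau>" and ?w = "lw \<alpha> \<beta> \<tau>"
  define V where "V = fld (-2) \<alpha> \<beta> \<tau>"
  define h where "h = (\<lambda>n. inverse (real (Suc n)))"
  have h0: "h n > 0" for n by (simp add: h_def)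
  note Hw = lw_Hloc[OF g]
  obtain R where R: "R > 0" "\<And>p. p \<in> half_space \<Longrightarrow> R \<le> norm p \<Longrightarrow> \<xi> p = 0"
    "\<And>p w. p \<in> half_space \<Longrightarrow> R \<le> norm p \<Longrightarrow> energy w \<xi> p = 0" by (rule tst_support[OF t]) (rule that)
  obtain B where B: "\<And>p. p \<in> half_space \<Longrightarrow> \<bar>\<xi> p\<bar> \<le> B" using t unfolding tst_def by blast
  \<comment> \<open>Square integrability of the traces of the quotients is known after a cutoff.
    Since \<psi> \<ge> 1 wherever \<xi> may be nonzero, inserting \<psi> only enlarges the
    bounds.\<close>
  obtain \<psi> where \<psi>: "cut \<psi>" "\<And>p. \<psi> p \<ge> 0" "\<And>p. norm p \<le> R \<Longrightarrow> \<psi> p \<ge> 1"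
    by (rule cut_exists[OF R(1)]) (rule that)
  obtain L where L: "L \<ge> 0" "\<And>n. integrable lborel (\<lambda>x. (btr (\<lambda>p. ?D n p * \<psi> p) x)\<^sup>2)"
    "\<And>n. (\<integral>x. (btr (\<lambda>p. ?D n p * \<psi> p) x)\<^sup>2 \<partial>lborel) \<le> L"
    by (rule dn_trace_bound[OF g \<psi>(1)]) (rule that)
  define r where "r = (\<lambda>n. \<integral>x. (btr (\<lambda>p. (?D n p - ?w p) * \<psi> p) x)\<^sup>2 \<partial>lborel)"
  have r: "r \<longlonglongrightarrow> 0" unfolding r_def by (rule dn_trace_limit(1)[OF g \<psi>(1)])
  have ri: "integrable lborel (\<lambda>x. (btr (\<lambda>p. (?D n p - ?w p) * \<psi> p) x)\<^sup>2)" for n by (rule dn_trace_limit(2)[OF g \<psi>(1)])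
  obtain C0 \<delta>0 where trI: "\<And>z. hcs a z \<Longrightarrow> integrable lborel (\<lambda>x. (btr z x)\<^sup>2)"
    by (rule trace_inequality_hcs[OF aa zero_less_one]) (rule that)
  have xi2: "integrable lborel (\<lambda>x. (btr \<xi> x)\<^sup>2)" by (rule trI[OF tst_hcs[OF a1 t]])
  define X where "X = (\<integral>x. (btr \<xi> x)\<^sup>2 \<partial>lborel)"
  have X0: "X \<ge> 0" unfolding X_def by (intro integral_nonneg_AE AE_I2) simp
  have w\<psi>: "hcs a (\<lambda>p. ?w p * \<psi> p)" by (rule hcs_cut[OF \<psi>(1), of a]) (use Hw in blast)
  have w2: "integrable lborel (\<lambda>x. (btr (\<lambda>p. ?w p * \<psi> p) x)\<^sup>2)" by (rule trI[OF w\<psi>])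
  obtain K where K: "K > 0" "AE x in lborel. \<bar>f (btr u x)\<bar> \<le> K \<and> \<bar>deriv f (btr u x)\<bar> \<le> K" by (rule f_btr_bound) blast
  obtain Bu where Bu: "Bu \<ge> 0" "\<And>p. p \<in> half_space \<Longrightarrow> \<bar>u p\<bar> \<le> Bu" by (rule u_bound) blast
  have trs: "AE x in lborel. has_tr u x \<and> has_tr u (bflow V (h n) x) \<and> has_tr ?w x \<and> has_tr \<xi> x" for n
    using u_has_tr AE_bflow[OF u_has_tr, of "-2" \<alpha> \<beta> \<tau> "h n", folded V_def] Hloc_has_tr[OF aa Hw] tst_has_tr[OF aa t]
    by eventually_elim simp
  have tr\<psi>: "has_tr \<psi> x" "btr \<psi> x = \<psi> (x, 0)" for x using btr_continuous[OF C1_cont[OF cut_C1[OF \<psi>(1)]]] by blast+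
  have xi\<psi>: "btr \<xi> x = 0 \<or> 1 \<le> \<psi> (x, 0)" for x
  proof (cases "R \<le> norm x")
    case True
    have "btr \<xi> x = 0" by (rule btr_support[where R = R], erule (1) R(2), rule True)
    then show ?thesis ..
  next
    case False
    then have "norm (x, 0::real) \<le> R" by (simp add: norm_Pair)
    then show ?thesis using \<psi>(3) by blast
  qed
  have trD: "has_tr (?D n) x \<and> btr (?D n) x = (1 / h n) * (btr u (bflow V (h n) x) - btr u x)"
    if "has_tr u x" "has_tr u (bflow V (h n) x)" for n x
  proof -
    have h1: "has_tr (\<lambda>p. u (flow V (h n) p)) x" "btr (\<lambda>p. u (flow V (h n) p)) x = btr u (bflow V (h n) x)"
      using that(2) unfolding V_def by (simp_all add: btr_flow)
    have e: "?D n = (\<lambda>p. (1 / h n) * (u (flow V (h n) p) - u p))"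
      unfolding dn_def dq_def[abs_def] h_def V_def ..
    show ?thesis
      unfolding e
      using btr_cmult[OF conjunct1[OF btr_diff[OF h1(1) that(1)]], of "1 / h n"] btr_diff[OF h1(1) that(1)] h1(2)
      by simp
  qed
  have fm: "(\<lambda>x. f (btr u x)) \<in> borel_measurable borel" "(\<lambda>x. deriv f (btr u x)) \<in> borel_measurable borel"
    by (rule measurable_compose[OF btr_u_measurable f_measurable(1)], rule measurable_compose[OF btr_u_measurable f_measurable(2)])
  have bm: "btr ?w \<in> borel_measurable borel" "btr \<xi> \<in> borel_measurable borel"
    by (intro btr_measurable C1_cont Hloc_C1[OF Hw] tst_C1[OF t])+
  show iT: "integrable lborel (\<lambda>x. deriv f (btr u x) * btr ?w x * btr \<xi> x)"
  proof (rule Bochner_Integration.integrable_bound)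
    show "integrable lborel (\<lambda>x. K * (btr (\<lambda>p. ?w p * \<psi> p) x)\<^sup>2 + K * (btr \<xi> x)\<^sup>2)"
      by (intro Bochner_Integration.integrable_add integrable_mult_right w2 xi2)
    show "(\<lambda>x. deriv f (btr u x) * btr ?w x * btr \<xi> x) \<in> borel_measurable lborel"
      using fm bm by simp
    show "AE x in lborel. norm (deriv f (btr u x) * btr ?w x * btr \<xi> x) \<le> norm (K * (btr (\<lambda>p. ?w p * \<psi> p) x)\<^sup>2 + K * (btr \<xi> x)\<^sup>2)"
      using trs[of 0] K(2)
    proof eventually_elim
      case (elim x)
      have bw: "btr (\<lambda>p. ?w p * \<psi> p) x = btr ?w x * \<psi> (x, 0)" using btr_mult[of ?w x \<psi>] elim tr\<psi> by simp
      have "\<bar>btr ?w x * btr \<xi> x\<bar> \<le> (btr ?w x * \<psi> (x, 0))\<^sup>2 + (btr \<xi> x)\<^sup>2"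
      proof (cases "btr \<xi> x = 0")
        case False
        then have p1: "1 \<le> \<psi> (x, 0)" using xi\<psi> by blast
        then have "1 * (btr ?w x)\<^sup>2 \<le> (\<psi> (x, 0))\<^sup>2 * (btr ?w x)\<^sup>2" by (intro mult_right_mono) (simp_all add: one_le_power)
        moreover have "\<bar>2 * btr ?w x * btr \<xi> x\<bar> \<le> 1 * (btr ?w x)\<^sup>2 + (btr \<xi> x)\<^sup>2 / 1" by (rule young_2) simp
        moreover have "\<bar>2 * btr ?w x * btr \<xi> x\<bar> = 2 * \<bar>btr ?w x * btr \<xi> x\<bar>" by (simp add: abs_mult)
        moreover have "(btr ?w x * \<psi> (x, 0))\<^sup>2 = (\<psi> (x, 0))\<^sup>2 * (btr ?w x)\<^sup>2" by (simp add: power_mult_distrib)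
        moreover have "0 \<le> \<bar>btr ?w x * btr \<xi> x\<bar>" by simp
        ultimately show ?thesis by linarith
      qed simp
      then have "\<bar>deriv f (btr u x)\<bar> * \<bar>btr ?w x * btr \<xi> x\<bar> \<le> K * ((btr ?w x * \<psi> (x, 0))\<^sup>2 + (btr \<xi> x)\<^sup>2)"
        using elim K(1) by (intro mult_mono) auto
      moreover have "norm (deriv f (btr u x) * btr ?w x * btr \<xi> x) = \<bar>deriv f (btr u x)\<bar> * \<bar>btr ?w x * btr \<xi> x\<bar>"
        by (simp add: abs_mult mult.assoc)
      ultimately show ?case unfolding bw distrib_left by simp
    qed
  qed
  define J where "J = (\<lambda>n. \<integral>x. (1 / h n) * (f (btr u (bflow V (h n) x)) - f (btr u x)) * btr \<xi> x \<partial>lborel)"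
  define J0 where "J0 = (\<integral>x. deriv f (btr u x) * btr ?w x * btr \<xi> x \<partial>lborel)"
  have Jeq: "(\<integral>p. energy (?D n) \<xi> p \<partial>wmeas a) = J n" for n
    unfolding J_def dn_def V_def h_def by (rule dq_equation[OF t hn(1)])
  have iJ: "integrable lborel (\<lambda>x. (1 / h n) * (f (btr u (bflow V (h n) x)) - f (btr u x)) * btr \<xi> x)" for n
  proof (rule tst_btr_integrable[OF aa t])
    have "(\<lambda>x. f (btr u (bflow V (h n) x))) \<in> borel_measurable borel"
      using measurable_compose[OF bflow_measurable[of "-2" \<alpha> \<beta> \<tau> "h n", folded V_def], of "\<lambda>x. f (btr u x)" borel] fm by simp
    then show "(\<lambda>x. (1 / h n) * (f (btr u (bflow V (h n) x)) - f (btr u x))) \<in> borel_measurable borel"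
      using fm by simp
    show "AE x in lborel. \<bar>(1 / h n) * (f (btr u (bflow V (h n) x)) - f (btr u x))\<bar> \<le> (1 / h n) * (K + K)"
      using K(2) AE_bflow[OF K(2), of "-2" \<alpha> \<beta> \<tau> "h n", folded V_def]
    proof eventually_elim
      case (elim x)
      then have "\<bar>f (btr u (bflow V (h n) x)) - f (btr u x)\<bar> \<le> K + K" by linarith
      then show ?case unfolding abs_mult using h0[of n] by (intro mult_mono) simp_all
    qed
  qed
  \<comment> \<open>The error budget: the linear part of the Taylor remainder, its quadratic part
    with the surviving factor h, the squared distance of the traces, and the trace of \<xi> paid for
    by Young's inequality with parameter \<kappa>.\<close>
  have key: "\<bar>J n - J0\<bar> \<le> e * (L + X) + C * \<bar>B\<bar> * h n * L + K * (\<kappa> * r n) + K * (X / (4 * \<kappa>))"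
    if e: "e > 0" and C: "C \<ge> 0" and \<kappa>: "\<kappa> > 0" and
      T: "\<And>r t. \<bar>r\<bar> \<le> Bu \<Longrightarrow> \<bar>t\<bar> \<le> Bu \<Longrightarrow> \<bar>f r - f t - deriv f t * (r - t)\<bar> \<le> e * \<bar>r - t\<bar> + C * (r - t)\<^sup>2"
    for e C \<kappa> n
  proof -
    let ?b = "\<lambda>x. (e + C * \<bar>B\<bar> * h n) * (btr (\<lambda>p. ?D n p * \<psi> p) x)\<^sup>2 + (e + K / (4 * \<kappa>)) * (btr \<xi> x)\<^sup>2
       + K * \<kappa> * (btr (\<lambda>p. (?D n p - ?w p) * \<psi> p) x)\<^sup>2"
    have ib: "integrable lborel ?b"
      by (intro Bochner_Integration.integrable_add integrable_mult_right L(2) xi2 ri)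
    have j1: "J n - J0 = (\<integral>x. (1 / h n) * (f (btr u (bflow V (h n) x)) - f (btr u x)) * btr \<xi> x - deriv f (btr u x) * btr ?w x * btr \<xi> x \<partial>lborel)"
      unfolding J_def J0_def by (rule Bochner_Integration.integral_diff[OF iJ iT, symmetric])
    have j2: "\<bar>J n - J0\<bar> \<le> (\<integral>x. ?b x \<partial>lborel)"
    proof -
      have pt: "AE x in lborel. \<bar>(1 / h n) * (f (btr u (bflow V (h n) x)) - f (btr u x)) * btr \<xi> x - deriv f (btr u x) * btr ?w x * btr \<xi> x\<bar> \<le> ?b x"
        using trs[of n] K(2)
      proof eventually_elim
        case (elim x)
        note D = trD[OF conjunct1[OF elim(1)] conjunct1[OF conjunct2[OF elim(1)]]]
        have hw: "has_tr ?w x" and hu: "has_tr u x" and hu': "has_tr u (bflow V (h n) x)" and hxi: "has_tr \<xi> x" using elim by simp_all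
        define A where "A = btr (?D n) x"
        define W where "W = btr ?w x"
        define q where "q = btr \<xi> x"
        define s where "s = \<psi> (x, 0)"
        define d where "d = btr u (bflow V (h n) x) - btr u x"
        define F where "F = f (btr u (bflow V (h n) x)) - f (btr u x)"
        define f' where "f' = deriv f (btr u x)"
        have A: "A = (1 / h n) * d" using D by (simp add: A_def d_def)
        have b1: "btr (\<lambda>p. ?D n p * \<psi> p) x = A * s" using btr_mult[OF conjunct1[OF D] tr\<psi>(1)] tr\<psi>(2) by (simp add: A_def s_def)
        have b2: "btr (\<lambda>p. (?D n p - ?w p) * \<psi> p) x = (A - W) * s"
          using btr_mult[OF conjunct1[OF btr_diff[OF conjunct1[OF D] hw]] tr\<psi>(1)] btr_diff[OF conjunct1[OF D] hw] tr\<psi>(2)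
          by (simp add: A_def W_def s_def)
        have f'K: "\<bar>f'\<bar> \<le> K" using elim by (simp add: f'_def)
        have qB: "\<bar>q\<bar> \<le> \<bar>B\<bar>" using btr_bound[OF hxi B] unfolding q_def by linarith
        have T1: "\<bar>F - f' * d\<bar> \<le> e * \<bar>d\<bar> + C * d\<^sup>2"
          unfolding F_def f'_def d_def by (intro T btr_bound Bu(2) hu hu')
        \<comment> \<open>The increment d of the trace of u equals h A, so dividing by h turns the
          quadratic remainder into C h A^2.\<close>
        have T2: "\<bar>(1 / h n) * F - f' * A\<bar> \<le> e * \<bar>A\<bar> + C * h n * A\<^sup>2"
        proof -
          have "\<bar>(1 / h n) * F - f' * A\<bar> = (1 / h n) * \<bar>F - f' * d\<bar>"
            using h0[of n] unfolding A by (simp add: right_diff_distrib[symmetric] abs_mult mult.left_commute diff_divide_distrib[symmetric])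
          also have "\<dots> \<le> (1 / h n) * (e * \<bar>d\<bar> + C * d\<^sup>2)" using T1 h0[of n] by (intro mult_left_mono) simp_all
          also have "\<dots> = e * \<bar>A\<bar> + C * h n * A\<^sup>2"
            using h0[of n] unfolding A by (simp add: abs_mult power2_eq_square field_simps)
          finally show ?thesis .
        qed
        have "\<bar>(1 / h n) * F * q - f' * W * q\<bar> \<le> (e + C * \<bar>B\<bar> * h n) * (A * s)\<^sup>2 + (e + K / (4 * \<kappa>)) * q\<^sup>2 + K * \<kappa> * ((A - W) * s)\<^sup>2"
        proof (cases "q = 0")
          case True
          have "0 \<le> (e + C * \<bar>B\<bar> * h n) * (A * s)\<^sup>2" "0 \<le> K * \<kappa> * ((A - W) * s)\<^sup>2"
            using e C h0[of n] K(1) \<kappa> by (simp_all add: add_nonneg_nonneg less_imp_le)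
          then show ?thesis using True by simp
        next
          case False
          then have s1: "1 \<le> s\<^sup>2" using xi\<psi>[of x] by (simp add: q_def s_def one_le_power)
          have As: "A\<^sup>2 \<le> (A * s)\<^sup>2" "(A - W)\<^sup>2 \<le> ((A - W) * s)\<^sup>2"
            using mult_left_mono[OF s1, of "A\<^sup>2"] mult_left_mono[OF s1, of "(A - W)\<^sup>2"] by (simp_all add: power_mult_distrib)
          have "(1 / h n) * F * q - f' * W * q = ((1 / h n) * F - f' * A) * q + f' * ((A - W) * q)" by (simp add: algebra_simps)
          then have "\<bar>(1 / h n) * F * q - f' * W * q\<bar> \<le> \<bar>(1 / h n) * F - f' * A\<bar> * \<bar>q\<bar> + \<bar>f'\<bar> * \<bar>(A - W) * q\<bar>"
            using abs_triangle_ineq[of "((1 / h n) * F - f' * A) * q" "f' * ((A - W) * q)"] by (simp add: abs_mult)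
          also have "\<dots> \<le> (e * \<bar>A\<bar> + C * h n * A\<^sup>2) * \<bar>q\<bar> + K * (\<kappa> * (A - W)\<^sup>2 + q\<^sup>2 / (4 * \<kappa>))"
          proof (intro add_mono mult_right_mono T2 mult_mono f'K)
            have "\<bar>2 * (A - W) * (q / 2)\<bar> \<le> \<kappa> * (A - W)\<^sup>2 + (q / 2)\<^sup>2 / \<kappa>" by (rule young_2[OF \<kappa>])
            moreover have "2 * (A - W) * (q / 2) = (A - W) * q" by simp
            moreover have "(q / 2)\<^sup>2 / \<kappa> = q\<^sup>2 / (4 * \<kappa>)" by (simp add: power_divide)
            ultimately show "\<bar>(A - W) * q\<bar> \<le> \<kappa> * (A - W)\<^sup>2 + q\<^sup>2 / (4 * \<kappa>)" by (simp only:)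
          qed (use K in simp_all)
          also have "\<dots> \<le> e * ((A * s)\<^sup>2 + q\<^sup>2) + C * h n * (\<bar>B\<bar> * (A * s)\<^sup>2) + K * (\<kappa> * ((A - W) * s)\<^sup>2 + q\<^sup>2 / (4 * \<kappa>))"
          proof -
            have "\<bar>2 * A * q\<bar> \<le> 1 * A\<^sup>2 + q\<^sup>2 / 1" by (rule young_2) simp
            moreover have "\<bar>2 * A * q\<bar> = 2 * (\<bar>A\<bar> * \<bar>q\<bar>)" by (simp add: abs_mult)
            moreover have "0 \<le> \<bar>A\<bar> * \<bar>q\<bar>" by simp
            ultimately have "\<bar>A\<bar> * \<bar>q\<bar> \<le> (A * s)\<^sup>2 + q\<^sup>2" using As(1) by linarith
            from mult_left_mono[OF this less_imp_le[OF e]] have 1: "e * (\<bar>A\<bar> * \<bar>q\<bar>) \<le> e * ((A * s)\<^sup>2 + q\<^sup>2)" .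
            have "\<bar>q\<bar> * A\<^sup>2 \<le> \<bar>B\<bar> * (A * s)\<^sup>2" by (intro mult_mono qB As) simp_all
            moreover have "0 \<le> C * h n" using C h0[of n] by simp
            ultimately have 2: "C * h n * (\<bar>q\<bar> * A\<^sup>2) \<le> C * h n * (\<bar>B\<bar> * (A * s)\<^sup>2)" by (rule mult_left_mono)
            have "\<kappa> * (A - W)\<^sup>2 + q\<^sup>2 / (4 * \<kappa>) \<le> \<kappa> * ((A - W) * s)\<^sup>2 + q\<^sup>2 / (4 * \<kappa>)"
              using As(2) \<kappa> by (intro add_right_mono mult_left_mono) simp_all
            from mult_left_mono[OF this less_imp_le[OF K(1)]]
            have 3: "K * (\<kappa> * (A - W)\<^sup>2 + q\<^sup>2 / (4 * \<kappa>)) \<le> K * (\<kappa> * ((A - W) * s)\<^sup>2 + q\<^sup>2 / (4 * \<kappa>))" .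
            have "(e * \<bar>A\<bar> + C * h n * A\<^sup>2) * \<bar>q\<bar> = e * (\<bar>A\<bar> * \<bar>q\<bar>) + C * h n * (\<bar>q\<bar> * A\<^sup>2)" by (simp add: algebra_simps)
            then show ?thesis using 1 2 3 by linarith
          qed
          also have "\<dots> = (e + C * \<bar>B\<bar> * h n) * (A * s)\<^sup>2 + (e + K / (4 * \<kappa>)) * q\<^sup>2 + K * \<kappa> * ((A - W) * s)\<^sup>2"
            by (simp add: distrib_left distrib_right mult_ac)
          finally show ?thesis .
        qed
        then show ?case unfolding b1 b2 unfolding F_def f'_def W_def q_def .
      qed
      have "\<bar>\<integral>x. (1 / h n) * (f (btr u (bflow V (h n) x)) - f (btr u x)) * btr \<xi> x - deriv f (btr u x) * btr ?w x * btr \<xi> x \<partial>lborel\<bar>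
        \<le> (\<integral>x. \<bar>(1 / h n) * (f (btr u (bflow V (h n) x)) - f (btr u x)) * btr \<xi> x - deriv f (btr u x) * btr ?w x * btr \<xi> x\<bar> \<partial>lborel)"
        by (rule integral_abs_bound)
      also have "\<dots> \<le> (\<integral>x. ?b x \<partial>lborel)"
        by (rule integral_mono_AE[OF _ ib pt]) (intro integrable_abs Bochner_Integration.integrable_diff iJ iT)
      finally show ?thesis unfolding j1 .
    qed
    have j3: "(\<integral>x. ?b x \<partial>lborel) = (e + C * \<bar>B\<bar> * h n) * (\<integral>x. (btr (\<lambda>p. ?D n p * \<psi> p) x)\<^sup>2 \<partial>lborel) + (e + K / (4 * \<kappa>)) * X + K * \<kappa> * r n"
    proof -
      have l: "(\<integral>x. c1 * g1 x + c2 * g2 x + c3 * g3 x \<partial>lborel) = c1 * integral\<^sup>L lborel g1 + c2 * integral\<^sup>L lborel g2 + c3 * integral\<^sup>L lborel g3"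
        if "integrable lborel g1" "integrable lborel g2" "integrable lborel g3" for c1 c2 c3 :: real and g1 g2 g3 :: "heis \<Rightarrow> real"
        using that by simp
      show ?thesis unfolding X_def r_def by (rule l[OF L(2) xi2 ri])
    qed
    have "\<bar>J n - J0\<bar> \<le> (e + C * \<bar>B\<bar> * h n) * (\<integral>x. (btr (\<lambda>p. ?D n p * \<psi> p) x)\<^sup>2 \<partial>lborel) + (e + K / (4 * \<kappa>)) * X + K * \<kappa> * r n"
      using j2 unfolding j3 .
    also have "\<dots> \<le> (e + C * \<bar>B\<bar> * h n) * L + (e + K / (4 * \<kappa>)) * X + K * \<kappa> * r n"
      using e C h0[of n] by (intro add_right_mono mult_left_mono L(3)) (simp add: add_nonneg_nonneg less_imp_le)
    also have "\<dots> = e * (L + X) + C * \<bar>B\<bar> * h n * L + K * (\<kappa> * r n) + K * (X / (4 * \<kappa>))"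
      by (simp add: distrib_left distrib_right mult_ac)
    finally show ?thesis .
  qed
  have "J \<longlonglongrightarrow> J0"
  proof (rule LIMSEQ_I)
    fix E :: real assume E: "E > 0"
    \<comment> \<open>The four error terms share E: a quarter goes to the one with e, a quarter to
      the one with 1 / \<kappa>, and N pushes the remaining two together below a quarter.\<close>
    define e where "e = E / (4 * (L + X + 1))"
    have LX: "L + X + 1 > 0" using L(1) X0 by linarith
    have e: "e > 0" "e * (L + X) \<le> E / 4"
    proof -
      show "e > 0" using E LX by (simp add: e_def)
      then have "e * (L + X) \<le> e * (L + X + 1)" by (intro mult_left_mono) simp_all
      also have "\<dots> = E / 4"
      proof -
        have "E / (4 * M) * M = E / 4" if "M > 0" for M using that by simp
        from this[OF LX] show ?thesis unfolding e_def .
      qed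
      finally show "e * (L + X) \<le> E / 4" .
    qed
    \<comment> \<open>Makes K X / (4 \<kappa>) equal to (X / (X + 1)) (E / 4); X + 1 in place of X
      keeps \<kappa> positive.\<close>
    define \<kappa> where "\<kappa> = K * (X + 1) / E"
    have \<kappa>: "\<kappa> > 0" "K * (X / (4 * \<kappa>)) \<le> E / 4"
    proof -
      show "\<kappa> > 0" using E K(1) X0 by (simp add: \<kappa>_def)
      have "K * (X / (4 * (K * M / E))) = (X / M) * (E / 4)" if "M > 0" for M
        using E K(1) that by (simp add: field_simps)
      from this[of "X + 1"] X0 have "K * (X / (4 * \<kappa>)) = (X / (X + 1)) * (E / 4)" unfolding \<kappa>_def by linarith
      also have "\<dots> \<le> 1 * (E / 4)" using E X0 by (intro mult_right_mono) simp_all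
      finally show "K * (X / (4 * \<kappa>)) \<le> E / 4" by simp
    qed
    obtain C where C: "C \<ge> 0" "\<And>r t. \<bar>r\<bar> \<le> Bu \<Longrightarrow> \<bar>t\<bar> \<le> Bu \<Longrightarrow> \<bar>f r - f t - deriv f t * (r - t)\<bar> \<le> e * \<bar>r - t\<bar> + C * (r - t)\<^sup>2"
      by (rule f_taylor[OF e(1), of Bu]) (rule that)
    have "(\<lambda>n. C * \<bar>B\<bar> * h n * L + K * (\<kappa> * r n)) \<longlonglongrightarrow> C * \<bar>B\<bar> * 0 * L + K * (\<kappa> * 0)"
      unfolding h_def by (intro tendsto_intros r LIMSEQ_inverse_real_of_nat)
    from LIMSEQ_D[OF this, of "E / 4"] E obtain N where
      N: "\<And>n. n \<ge> N \<Longrightarrow> \<bar>C * \<bar>B\<bar> * h n * L + K * (\<kappa> * r n)\<bar> < E / 4" by auto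
    show "\<exists>N. \<forall>n\<ge>N. norm (J n - J0) < E"
    proof (intro exI[of _ N] allI impI)
      fix n assume n: "n \<ge> N"
      show "norm (J n - J0) < E"
        using key[OF e(1) C(1) \<kappa>(1) C(2), of n] e(2) \<kappa>(2) N[OF n] E unfolding real_norm_def by linarith
    qed
  qed
  moreover have "J \<longlonglongrightarrow> (\<integral>p. energy ?w \<xi> p \<partial>wmeas a)"
    using dn_interior_limit[OF g t] unfolding Jeq by simp
  ultimately show "(\<integral>p. energy ?w \<xi> p \<partial>wmeas a) = J0" using LIMSEQ_unique by blast
qed

end

section \<open>Equations for the horizontal derivatives\<close>

lemma energy_cong:
  assumes "\<And>q. q \<in> half_space \<Longrightarrow> f q = g q" "p \<in> half_space"
  shows "energy f z p = energy g z p"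
  using h_cong[OF open_half_space assms(2) assms(1)] by (simp add: energy_def)

lemma Hloc_cong:
  assumes "Hloc a f" "\<And>q. q \<in> half_space \<Longrightarrow> f q = g q"
  shows "Hloc a g"
proof (rule HlocI)
  show "C1 half_space g" by (rule C1_cong[OF open_half_space Hloc_C1[OF assms(1)] assms(2)])
  fix R
  show "\<exists>c g' h. Hloc a g' \<and> Hloc a h \<and> (\<forall>p\<in>half_ball R. (g p)\<^sup>2 + energy g g p \<le> c * ((g' p)\<^sup>2 + energy g' g' p) + c * ((h p)\<^sup>2 + energy h h p))"
  proof (rule exI[of _ 1], rule exI[of _ f], rule exI[of _ f], intro conjI ballI assms(1))
    fix p assume "p \<in> half_ball R"
    then have p: "p \<in> half_space" by (rule half_ballD)
    have "energy g g p = energy f f p"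
      using energy_cong[OF assms(2) p, where z = g] energy_cong[OF assms(2) p, where z = f] energy_sym[of f g p] by (simp only:)
    moreover have "0 \<le> (f p)\<^sup>2 + energy f f p" by simp
    ultimately show "(g p)\<^sup>2 + energy g g p \<le> 1 * ((f p)\<^sup>2 + energy f f p) + 1 * ((f p)\<^sup>2 + energy f f p)"
      using assms(2)[OF p] by simp
  qed
qed

lemma Hloc_add:
  assumes g: "Hloc a g" and h: "Hloc a h"
  shows "Hloc a (\<lambda>p. g p + h p)"
proof -
  have "Hloc a (\<lambda>p. h p * (- 1))" by (rule Hloc_mult_C1[OF h C1_const])
  from Hloc_diff[OF g this] show ?thesis by simp
qed

lemma hcs_product_integrable:
  fixes z v :: "hpt \<Rightarrow> real"
  assumes z: "integrable (wmeas a) (\<lambda>p. (z p)\<^sup>2)" "z \<in> borel_measurable (wmeas a)"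
    "\<And>p. p \<in> half_space \<Longrightarrow> R \<le> norm p \<Longrightarrow> z p = 0"
    and v: "integrable (wmeas a) (\<lambda>p. indicator (half_ball R) p * (v p)\<^sup>2)" "v \<in> borel_measurable (wmeas a)"
  shows "integrable (wmeas a) (\<lambda>p. z p * v p)"
proof (rule Bochner_Integration.integrable_bound[OF Bochner_Integration.integrable_add[OF z(1) v(1)]])
  show "(\<lambda>p. z p * v p) \<in> borel_measurable (wmeas a)" by (intro borel_measurable_times z v)
  show "AE p in wmeas a. norm (z p * v p) \<le> norm ((z p)\<^sup>2 + indicator (half_ball R) p * (v p)\<^sup>2)"
  proof (rule AE_I2)
    fix p assume "p \<in> space (wmeas a)"
    then have p: "p \<in> half_space" by simp
    show "norm (z p * v p) \<le> norm ((z p)\<^sup>2 + indicator (half_ball R) p * (v p)\<^sup>2)"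
    proof (cases "R \<le> norm p")
      case False
      have "\<bar>2 * z p * v p\<bar> \<le> 1 * (z p)\<^sup>2 + (v p)\<^sup>2 / 1" by (rule young_2) simp
      then have "2 * (\<bar>z p\<bar> * \<bar>v p\<bar>) \<le> (z p)\<^sup>2 + (v p)\<^sup>2" by (simp add: abs_mult)
      then have "\<bar>z p * v p\<bar> \<le> (z p)\<^sup>2 + (v p)\<^sup>2"
        unfolding abs_mult using mult_nonneg_nonneg[OF abs_ge_zero[of "z p"] abs_ge_zero[of "v p"]] by linarith
      then show ?thesis using half_ballI[OF p False] by simp
    qed (use z(3)[OF p] in simp)
  qed
qed

lemma grad_ball_integrable:
  assumes w: "Hloc a w"
  shows "integrable (wmeas a) (\<lambda>p. indicator (half_ball R) p * (hX w p)\<^sup>2)"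
    "integrable (wmeas a) (\<lambda>p. indicator (half_ball R) p * (hY w p)\<^sup>2)"
proof -
  note iE = Hloc_integrable(2)[OF w half_ball_indicator, of R]
  note m = Hloc_measurable[OF Hloc_C1[OF w], of a]
  show "integrable (wmeas a) (\<lambda>p. indicator (half_ball R) p * (hX w p)\<^sup>2)"
    by (rule Bochner_Integration.integrable_bound[OF iE], assumption,
      intro borel_measurable_times half_ball_indicator borel_measurable_power m)
      (use energy_components(1)[of w] in \<open>auto intro!: AE_I2 simp: indicator_def\<close>)
  show "integrable (wmeas a) (\<lambda>p. indicator (half_ball R) p * (hY w p)\<^sup>2)"
    by (rule Bochner_Integration.integrable_bound[OF iE], assumption,
      intro borel_measurable_times half_ball_indicator borel_measurable_power m)
      (use energy_components(2)[of w] in \<open>auto intro!: AE_I2 simp: indicator_def\<close>)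
qed

lemma tst_grad_sq_integrable:
  assumes t: "tst a \<xi>"
  shows "integrable (wmeas a) (\<lambda>p. (hX \<xi> p)\<^sup>2)" "integrable (wmeas a) (\<lambda>p. (hY \<xi> p)\<^sup>2)"
proof -
  note m = Hloc_measurable[OF tst_C1[OF t], of a]
  show "integrable (wmeas a) (\<lambda>p. (hX \<xi> p)\<^sup>2)"
    by (rule Bochner_Integration.integrable_bound[OF tst_integrable[OF t]], intro borel_measurable_power m)
       (use energy_components(1)[of \<xi>] in \<open>auto intro!: AE_I2\<close>)
  show "integrable (wmeas a) (\<lambda>p. (hY \<xi> p)\<^sup>2)"
    by (rule Bochner_Integration.integrable_bound[OF tst_integrable[OF t]], intro borel_measurable_power m)
       (use energy_components(2)[of \<xi>] in \<open>auto intro!: AE_I2\<close>)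
qed

context heis_sol
begin

abbreviation "w3 \<equiv> pd b3 u"

lemma lw_T: "lw 0 0 1 = w3"
  unfolding lw_def[abs_def] fld_T ..

text \<open>This transfers the regularity and the equations of the three right-invariant derivatives
  to Xu and Yu.\<close>

lemma grad_decomposition:
  assumes "p \<in> half_space"
  shows "hX u p = lw 1 0 0 p + w3 p * (4 * fst p $ 2)" "hY u p = lw 0 1 0 p + w3 p * (- 4 * fst p $ 1)"
  unfolding lw_def left_fields[OF assms] by simp_all

lemma C1_coord_mult: "C1 UNIV (\<lambda>p::hpt. c * fst p $ i)"
  by (intro C1_cmult C1_coord)

lemma Hloc_grad: "Hloc a (hX u)" "Hloc a (hY u)"
proof -
  have "Hloc a (\<lambda>p. lw 1 0 0 p + w3 p * (4 * fst p $ 2))"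
    by (intro Hloc_add lw_Hloc good_LX Hloc_mult_C1 Hloc_T C1_coord_mult)
  then show "Hloc a (hX u)" by (rule Hloc_cong) (simp add: grad_decomposition)
  have "Hloc a (\<lambda>p. lw 0 1 0 p + w3 p * (- 4 * fst p $ 1))"
    by (intro Hloc_add lw_Hloc good_LY Hloc_mult_C1 Hloc_T C1_coord_mult)
  then show "Hloc a (hY u)" by (rule Hloc_cong) (simp add: grad_decomposition)
qed

text \<open>The coordinates are continuous up to y = 0, so traces may be taken term by term wherever
  the three right-invariant derivatives possess one.\<close>

lemma btr_grad:
  "AE x in lborel. has_tr (hX u) x \<and> has_tr (hY u) x \<and> has_tr w3 x \<and>
     btr (hX u) x = btr (lw 1 0 0) x + btr w3 x * (4 * x $ 2) \<and>
     btr (hY u) x = btr (lw 0 1 0) x + btr w3 x * (- 4 * x $ 1)"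
proof -
  have c: "has_tr (\<lambda>p. k * fst p $ i) x \<and> btr (\<lambda>p. k * fst p $ i) x = k * x $ i" for k i x
    using btr_continuous[OF C1_cont[OF C1_coord_mult[of k i]], of x] by simp
  have eq: "btr w x = btr w' x \<and> (has_tr w x \<longleftrightarrow> has_tr w' x)" if "\<And>p. p \<in> half_space \<Longrightarrow> w p = w' p" for w w' x
  proof -
    have "eventually (\<lambda>y. w (x, y) = w' (x, y)) (at_right 0)"
      unfolding eventually_at_right_field using that by (intro exI[of _ 1]) auto
    then have "((\<lambda>y. w (x, y)) \<longlongrightarrow> l) (at_right 0) \<longleftrightarrow> ((\<lambda>y. w' (x, y)) \<longlongrightarrow> l) (at_right 0)" for l
      by (rule tendsto_cong)
    moreover have "btr w x = btr w' x" unfolding btr_def using that by simp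
    ultimately show ?thesis unfolding has_tr_def by blast
  qed
  show ?thesis
    using Hloc_has_tr[OF aa lw_Hloc[OF good_LX]] Hloc_has_tr[OF aa lw_Hloc[OF good_LY]] Hloc_has_tr[OF aa Hloc_T]
  proof eventually_elim
    case (elim x)
    note m1 = btr_mult[OF elim(3) conjunct1[OF c[of 4 2 x]], unfolded conjunct2[OF c[of 4 2 x]]]
    note m2 = btr_mult[OF elim(3) conjunct1[OF c[of "-4" 1 x]], unfolded conjunct2[OF c[of "-4" 1 x]]]
    note e1 = eq[of "hX u" "\<lambda>p. lw 1 0 0 p + w3 p * (4 * fst p $ 2)" x, OF grad_decomposition(1)]
    note e2 = eq[of "hY u" "\<lambda>p. lw 0 1 0 p + w3 p * (- 4 * fst p $ 1)" x, OF grad_decomposition(2)]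
    note s1 = btr_add[OF elim(1) conjunct1[OF m1], unfolded conjunct2[OF m1]]
    note s2 = btr_add[OF elim(2) conjunct1[OF m2], unfolded conjunct2[OF m2]]
    have "has_tr (hX u) x" "has_tr (hY u) x" using e1 e2 s1 s2 by blast+
    moreover have "btr (hX u) x = btr (lw 1 0 0) x + btr w3 x * (4 * x $ 2)" by (rule trans[OF conjunct1[OF e1] conjunct2[OF s1]])
    moreover have "btr (hY u) x = btr (lw 0 1 0) x + btr w3 x * (- 4 * x $ 1)" by (rule trans[OF conjunct1[OF e2] conjunct2[OF s2]])
    ultimately show ?case using elim(3) by blast
  qed
qed

text \<open>Integration by parts for the product of d_3 u and \<xi>, whose horizontal derivatives
  are integrable because both factors have square-integrable gradients. As X and Y are tangential,
  nothing remains at y = 0.\<close>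

lemma commutator_parts:
  assumes v: "Hloc a v" "locbdd v" and \<eta>: "cut \<eta>"
  defines "\<xi> \<equiv> \<lambda>p. v p * \<eta> p"
  shows "integrable (wmeas a) (\<lambda>p. \<xi> p * hX w3 p)" "integrable (wmeas a) (\<lambda>p. \<xi> p * hY w3 p)"
    "integrable (wmeas a) (\<lambda>p. w3 p * hX \<xi> p)" "integrable (wmeas a) (\<lambda>p. w3 p * hY \<xi> p)"
    "(\<integral>p. w3 p * hX \<xi> p \<partial>wmeas a) = - (\<integral>p. \<xi> p * hX w3 p \<partial>wmeas a)"
    "(\<integral>p. w3 p * hY \<xi> p \<partial>wmeas a) = - (\<integral>p. \<xi> p * hY w3 p \<partial>wmeas a)"
proof -
  have t: "tst a \<xi>" unfolding \<xi>_def by (rule tst_mult_cut[OF v \<eta>])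
  note C\<xi> = tst_C1[OF t] note Cw = Hloc_C1[OF Hloc_T]
  note m\<xi> = Hloc_measurable[OF C\<xi>, of a] and mw = Hloc_measurable[OF Cw, of a]
  obtain R where R: "R > 0" "\<And>p. p \<in> half_space \<Longrightarrow> R \<le> norm p \<Longrightarrow> \<xi> p = 0"
    "\<And>p w. p \<in> half_space \<Longrightarrow> R \<le> norm p \<Longrightarrow> energy w \<xi> p = 0" by (rule tst_support[OF t]) (rule that)
  have Rc: "hX \<xi> p = 0" "hY \<xi> p = 0" if "p \<in> half_space" "R \<le> norm p" for p
    using energy_components[of \<xi> p] R(3)[OF that, of \<xi>] by simp_all
  note sq = tst_sq_integrable[OF a1 t]
  show i1: "integrable (wmeas a) (\<lambda>p. \<xi> p * hX w3 p)"
    by (rule hcs_product_integrable[OF sq m\<xi>(1) R(2) grad_ball_integrable(1)[OF Hloc_T] mw(4)])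
  show i2: "integrable (wmeas a) (\<lambda>p. \<xi> p * hY w3 p)"
    by (rule hcs_product_integrable[OF sq m\<xi>(1) R(2) grad_ball_integrable(2)[OF Hloc_T] mw(5)])
  note w2 = Hloc_integrable(1)[OF Hloc_T half_ball_indicator, of R]
  have "integrable (wmeas a) (\<lambda>p. hX \<xi> p * w3 p)"
    by (rule hcs_product_integrable[OF tst_grad_sq_integrable(1)[OF t] m\<xi>(4) Rc(1) w2 mw(1)])
  then show i3: "integrable (wmeas a) (\<lambda>p. w3 p * hX \<xi> p)" by (simp only: mult.commute)
  have "integrable (wmeas a) (\<lambda>p. hY \<xi> p * w3 p)"
    by (rule hcs_product_integrable[OF tst_grad_sq_integrable(2)[OF t] m\<xi>(5) Rc(2) w2 mw(1)])
  then show i4: "integrable (wmeas a) (\<lambda>p. w3 p * hY \<xi> p)" by (simp only: mult.commute)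
  let ?F = "\<lambda>p. w3 p * \<xi> p"
  have CF: "C1 half_space ?F" by (rule C1_mult[OF Cw C\<xi>])
  have eX: "hX ?F p = w3 p * hX \<xi> p + \<xi> p * hX w3 p" "hY ?F p = w3 p * hY \<xi> p + \<xi> p * hY w3 p" if p: "p \<in> half_space" for p
    by (rule h_mult[OF C1_diff[OF Cw p] C1_diff[OF C\<xi> p]])+
  have F0: "?F p = 0" if "p \<in> half_space" "R \<le> norm p" for p using R(2)[OF that] by simp
  have "integrable (wmeas a) (hX ?F)"
    by (rule wmeas_cong(2)[THEN iffD2, OF eX(1) Bochner_Integration.integrable_add[OF i3 i1]])
  then have "(\<integral>p. hX ?F p \<partial>wmeas a) = 0" using integral_hX_zero(1)[OF a1 CF F0] by blast
  then show "(\<integral>p. w3 p * hX \<xi> p \<partial>wmeas a) = - (\<integral>p. \<xi> p * hX w3 p \<partial>wmeas a)"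
    using wmeas_cong(1)[of "hX ?F", OF eX(1)] i1 i3 by simp
  have "integrable (wmeas a) (hY ?F)"
    by (rule wmeas_cong(2)[THEN iffD2, OF eX(2) Bochner_Integration.integrable_add[OF i4 i2]])
  then have "(\<integral>p. hY ?F p \<partial>wmeas a) = 0" using integral_hX_zero(2)[OF a1 CF F0] by blast
  then show "(\<integral>p. w3 p * hY \<xi> p \<partial>wmeas a) = - (\<integral>p. \<xi> p * hY w3 p \<partial>wmeas a)"
    using wmeas_cong(1)[of "hY ?F", OF eX(2)] i2 i4 by simp
qed

text \<open>The affine coefficient of d_3 u is put into the test function, so that the linearised
  equation of d_3 u can be used. Moving 4 x_2 across the energy form leaves 4 (w3 Y\<xi> - \<xi> Y
  w3), and integration by parts doubles the second term to -8 \<xi> Y w3. For Yu the coefficient -4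
  x_1 gives +8 \<xi> X w3.\<close>

lemma gradient_equations:
  assumes v: "Hloc a v" "locbdd v" and \<eta>: "cut \<eta>"
  defines "\<xi> \<equiv> \<lambda>p. v p * \<eta> p"
  shows "integrable lborel (\<lambda>x. deriv f (btr u x) * btr (hX u) x * btr \<xi> x)"
    "integrable lborel (\<lambda>x. deriv f (btr u x) * btr (hY u) x * btr \<xi> x)"
    "(\<integral>p. energy (hX u) \<xi> p \<partial>wmeas a) = (\<integral>x. deriv f (btr u x) * btr (hX u) x * btr \<xi> x \<partial>lborel) - 8 * (\<integral>p. \<xi> p * hY w3 p \<partial>wmeas a)"
    "(\<integral>p. energy (hY u) \<xi> p \<partial>wmeas a) = (\<integral>x. deriv f (btr u x) * btr (hY u) x * btr \<xi> x \<partial>lborel) + 8 * (\<integral>p. \<xi> p * hX w3 p \<partial>wmeas a)"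
proof -
  have t: "tst a \<xi>" unfolding \<xi>_def by (rule tst_mult_cut[OF v \<eta>])
  note C\<xi> = tst_C1[OF t] note Cw = Hloc_C1[OF Hloc_T]
  have P: "integrable (wmeas a) (\<lambda>p. \<xi> p * hX w3 p)" "integrable (wmeas a) (\<lambda>p. \<xi> p * hY w3 p)"
    "integrable (wmeas a) (\<lambda>p. w3 p * hX \<xi> p)" "integrable (wmeas a) (\<lambda>p. w3 p * hY \<xi> p)"
    "(\<integral>p. w3 p * hX \<xi> p \<partial>wmeas a) = - (\<integral>p. \<xi> p * hX w3 p \<partial>wmeas a)"
    "(\<integral>p. w3 p * hY \<xi> p \<partial>wmeas a) = - (\<integral>p. \<xi> p * hY w3 p \<partial>wmeas a)"
    unfolding \<xi>_def by (rule commutator_parts[OF v \<eta>])+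
  have c\<eta>: "cut (\<lambda>p. \<eta> p * (k * fst p $ i))" for k i by (rule cut_mult_C1[OF \<eta> C1_coord_mult])
  let ?x = "\<lambda>k i p. v p * (\<eta> p * (k * fst p $ i))"
  have tx: "tst a (?x k i)" for k i by (rule tst_mult_cut[OF v c\<eta>])
  have xe: "?x k i = (\<lambda>p. \<xi> p * (k * fst p $ i))" for k i by (simp add: \<xi>_def mult.assoc)
  have bx: "AE x in lborel. btr (?x k i) x = btr \<xi> x * (k * x $ i)" for k i
    using tst_has_tr[OF aa t]
  proof eventually_elim
    case (elim x)
    have "has_tr (\<lambda>p. k * fst p $ i) x \<and> btr (\<lambda>p. k * fst p $ i) x = k * x $ i"
      using btr_continuous[OF C1_cont[OF C1_coord_mult[of k i]], of x] by simp
    then show ?case unfolding xe using btr_mult[OF elim, of "\<lambda>p. k * fst p $ i"] by simp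
  qed
  note LX = linearised_equation[OF good_LX t] and LY = linearised_equation[OF good_LY t]
  note LT = linearised_equation[OF good_T, unfolded lw_T, OF tx]
  let ?f = "\<lambda>x. deriv f (btr u x)"
  have m: "?f \<in> borel_measurable borel" "btr (hX u) \<in> borel_measurable borel" "btr (hY u) \<in> borel_measurable borel" "btr \<xi> \<in> borel_measurable borel"
    by (rule measurable_compose[OF btr_u_measurable f_measurable(2)], (intro btr_measurable C1_cont u_C1 C\<xi>)+)
  have LTm: "(\<lambda>x. ?f x * btr w3 x * btr (?x k i) x) \<in> borel_measurable lborel" for k i
    by (rule borel_measurable_integrable[OF LT(1)])
  have alg: "F * b * q = F * l * q + F * w * d" if "b = l + w * c" "d = q * c" for F b q l w d c :: real
    using that by (simp add: algebra_simps)
  have aeX: "AE x in lborel. ?f x * btr (hX u) x * btr \<xi> x = ?f x * btr (lw 1 0 0) x * btr \<xi> x + ?f x * btr w3 x * btr (?x 4 2) x"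
    using btr_grad bx[of 4 2]
  proof eventually_elim
    case (elim x)
    show ?case by (rule alg[OF _ elim(2)]) (use elim(1) in blast)
  qed
  have aeY: "AE x in lborel. ?f x * btr (hY u) x * btr \<xi> x = ?f x * btr (lw 0 1 0) x * btr \<xi> x + ?f x * btr w3 x * btr (?x (-4) 1) x"
    using btr_grad bx[of "-4" 1]
  proof eventually_elim
    case (elim x)
    show ?case by (rule alg[OF _ elim(2)]) (use elim(1) in blast)
  qed
  have mX: "(\<lambda>x. ?f x * btr (hX u) x * btr \<xi> x) \<in> borel_measurable lborel" "(\<lambda>x. ?f x * btr (hY u) x * btr \<xi> x) \<in> borel_measurable lborel"
    using m by simp_all
  note sX = Bochner_Integration.integrable_add[OF LX(1) LT(1)[of 4 2]] and sY = Bochner_Integration.integrable_add[OF LY(1) LT(1)[of "-4" 1]]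
  show "integrable lborel (\<lambda>x. ?f x * btr (hX u) x * btr \<xi> x)"
    by (rule integrable_cong_AE[THEN iffD2, OF mX(1) borel_measurable_integrable[OF sX] aeX sX])
  show "integrable lborel (\<lambda>x. ?f x * btr (hY u) x * btr \<xi> x)"
    by (rule integrable_cong_AE[THEN iffD2, OF mX(2) borel_measurable_integrable[OF sY] aeY sY])
  have bX: "(\<integral>x. ?f x * btr (hX u) x * btr \<xi> x \<partial>lborel) = (\<integral>p. energy (lw 1 0 0) \<xi> p \<partial>wmeas a) + (\<integral>p. energy w3 (?x 4 2) p \<partial>wmeas a)"
    unfolding LX(2) LT(2) integral_cong_AE[OF mX(1) borel_measurable_integrable[OF sX] aeX]
    by (rule Bochner_Integration.integral_add[OF LX(1) LT(1)])
  have bY: "(\<integral>x. ?f x * btr (hY u) x * btr \<xi> x \<partial>lborel) = (\<integral>p. energy (lw 0 1 0) \<xi> p \<partial>wmeas a) + (\<integral>p. energy w3 (?x (-4) 1) p \<partial>wmeas a)"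
    unfolding LY(2) LT(2) integral_cong_AE[OF mX(2) borel_measurable_integrable[OF sY] aeY]
    by (rule Bochner_Integration.integral_add[OF LY(1) LT(1)])
  have E1: "energy (hX u) \<xi> p = energy (lw 1 0 0) \<xi> p + energy w3 (?x 4 2) p + 4 * (w3 p * hY \<xi> p - \<xi> p * hY w3 p)"
    and E2: "energy (hY u) \<xi> p = energy (lw 0 1 0) \<xi> p + energy w3 (?x (-4) 1) p + (-4) * (w3 p * hX \<xi> p - \<xi> p * hX w3 p)"
    if p: "p \<in> half_space" for p
  proof -
    note d1 = C1_diff[OF Hloc_C1[OF lw_Hloc[OF good_LX]] p] C1_diff[OF Hloc_C1[OF lw_Hloc[OF good_LY]] p]
    note dw = C1_diff[OF Cw p] note d\<xi> = C1_diff[OF C\<xi> p]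
    have dc: "(\<lambda>p::hpt. k * fst p $ i) differentiable (at p)" for k i by (rule C1_diff[OF C1_coord_mult]) simp
    note dm = differentiable_mult[OF dw dc]
    \<comment> \<open>The extended gradients of x_1 and x_2 are (1, 0, 0) and (0, 1, 0), so pairing
      with a coordinate picks out X or Y.\<close>
    have cE: "energy (\<lambda>p. k * fst p $ 2) z p = k * hY z p" "energy (\<lambda>p. k * fst p $ 1) z p = k * hX z p"
      "energy z (\<lambda>p. k * fst p $ 2) p = k * hY z p" "energy z (\<lambda>p. k * fst p $ 1) p = k * hX z p" for k z
      unfolding energy_cmult[OF differentiable_coord] by (simp_all add: energy_def)
    have "energy (hX u) \<xi> p = energy (\<lambda>p. lw 1 0 0 p + w3 p * (4 * fst p $ 2)) \<xi> p"
      by (rule energy_cong[OF grad_decomposition(1) p])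
    then show "energy (hX u) \<xi> p = energy (lw 1 0 0) \<xi> p + energy w3 (?x 4 2) p + 4 * (w3 p * hY \<xi> p - \<xi> p * hY w3 p)"
      unfolding energy_add(1)[OF d1(1) dm] energy_mult(1)[OF dw dc] xe energy_mult(2)[OF d\<xi> dc] cE
      by (simp add: algebra_simps)
    have "energy (hY u) \<xi> p = energy (\<lambda>p. lw 0 1 0 p + w3 p * (- 4 * fst p $ 1)) \<xi> p"
      by (rule energy_cong[OF grad_decomposition(2) p])
    then show "energy (hY u) \<xi> p = energy (lw 0 1 0) \<xi> p + energy w3 (?x (-4) 1) p + (-4) * (w3 p * hX \<xi> p - \<xi> p * hX w3 p)"
      unfolding energy_add(1)[OF d1(2) dm] energy_mult(1)[OF dw dc] xe energy_mult(2)[OF d\<xi> dc] cE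
      by (simp add: algebra_simps)
  qed
  note i = energy_tst_integrable[OF lw_Hloc[OF good_LX] t] energy_tst_integrable[OF lw_Hloc[OF good_LY] t] energy_tst_integrable[OF Hloc_T tx]
  have l: "(\<integral>p. e1 p + e2 p + c * (g p - h p) \<partial>wmeas a) = integral\<^sup>L (wmeas a) e1 + integral\<^sup>L (wmeas a) e2 + c * (integral\<^sup>L (wmeas a) g - integral\<^sup>L (wmeas a) h)"
    if "integrable (wmeas a) e1" "integrable (wmeas a) e2" "integrable (wmeas a) g" "integrable (wmeas a) h" for e1 e2 g h :: "hpt \<Rightarrow> real" and c
    using that by simp
  show "(\<integral>p. energy (hX u) \<xi> p \<partial>wmeas a) = (\<integral>x. ?f x * btr (hX u) x * btr \<xi> x \<partial>lborel) - 8 * (\<integral>p. \<xi> p * hY w3 p \<partial>wmeas a)"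
    using trans[OF wmeas_cong(1)[where a = a, OF E1] l[OF i(1) i(3) P(4) P(2)]] P(6) unfolding bX by simp
  show "(\<integral>p. energy (hY u) \<xi> p \<partial>wmeas a) = (\<integral>x. ?f x * btr (hY u) x * btr \<xi> x \<partial>lborel) + 8 * (\<integral>p. \<xi> p * hX w3 p \<partial>wmeas a)"
    using trans[OF wmeas_cong(1)[where a = a, OF E2] l[OF i(2) i(3) P(3) P(1)]] P(5) unfolding bY by simp
qed

end

section \<open>Regularising the length of the gradient\<close>

text \<open>Two components at a time: nesting it with the constant \<epsilon> in the innermost place
  gives a three-component length that never vanishes.\<close>

definition hyp :: "(hpt \<Rightarrow> real) \<Rightarrow> (hpt \<Rightarrow> real) \<Rightarrow> hpt \<Rightarrow> real" where
  "hyp v w p = sqrt ((v p)\<^sup>2 + (w p)\<^sup>2)"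

lemma hyp_sq [simp]: "(hyp v w p)\<^sup>2 = (v p)\<^sup>2 + (w p)\<^sup>2"
  by (simp add: hyp_def)

lemma hyp_nonneg [simp]: "0 \<le> hyp v w p"
  by (simp add: hyp_def)

lemma hyp_le: "hyp v w p \<le> \<bar>v p\<bar> + \<bar>w p\<bar>"
  unfolding hyp_def by (rule sqrt_sum_squares_le_sum_abs)

lemma h_sum_power2:
  assumes "v differentiable (at p)" "w differentiable (at p)"
  shows "hX (\<lambda>q. (v q)\<^sup>2 + (w q)\<^sup>2) p = 2 * (v p * hX v p + w p * hX w p)"
    "hY (\<lambda>q. (v q)\<^sup>2 + (w q)\<^sup>2) p = 2 * (v p * hY v p + w p * hY w p)"
    "dy (\<lambda>q. (v q)\<^sup>2 + (w q)\<^sup>2) p = 2 * (v p * dy v p + w p * dy w p)"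
  unfolding power2_eq_square
  by (simp_all add: h_add h_mult assms diff_rules)

lemma hyp_C1:
  assumes v: "C1 half_space v" and w: "C1 half_space w" and pos: "\<forall>p\<in>half_space. (v p)\<^sup>2 + (w p)\<^sup>2 > 0"
  shows "C1 half_space (hyp v w)"
    "p \<in> half_space \<Longrightarrow> hyp v w p * hX (hyp v w) p = v p * hX v p + w p * hX w p"
    "p \<in> half_space \<Longrightarrow> hyp v w p * hY (hyp v w) p = v p * hY v p + w p * hY w p"
    "p \<in> half_space \<Longrightarrow> hyp v w p * dy (hyp v w) p = v p * dy v p + w p * dy w p"
proof -
  let ?g = "\<lambda>q. (v q)\<^sup>2 + (w q)\<^sup>2"
  have h: "hyp v w = (\<lambda>q. sqrt (?g q))" by (simp add: hyp_def fun_eq_iff)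
  have g: "C1 half_space ?g" by (intro C1_add C1_power2 v w)
  have D: "(sqrt has_real_derivative inverse (sqrt (?g q)) / 2) (at (?g q))" if "q \<in> half_space" for q
    by (rule DERIV_real_sqrt[OF bspec[OF pos that]])
  show "C1 half_space (hyp v w)" unfolding h
  proof (rule C1_chain[OF g D])
    show "continuous_on (?g ` half_space) (\<lambda>t. inverse (sqrt t) / 2)"
    proof (intro continuous_intros ballI)
      fix t assume "t \<in> ?g ` half_space"
      then obtain q where q: "t = ?g q" "q \<in> half_space" by (rule imageE) (rule that)
      from real_sqrt_gt_zero[OF bspec[OF pos q(2)]] show "sqrt t \<noteq> 0" unfolding q(1) by linarith
    qed simp
  qed
  show "hyp v w p * hX (hyp v w) p = v p * hX v p + w p * hX w p"
    "hyp v w p * hY (hyp v w) p = v p * hY v p + w p * hY w p"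
    "hyp v w p * dy (hyp v w) p = v p * dy v p + w p * dy w p" if p: "p \<in> half_space"
  proof -
    have n: "sqrt (?g p) \<noteq> 0" using real_sqrt_gt_zero[OF bspec[OF pos p]] by linarith
    have c: "sqrt (?g p) * (inverse (sqrt (?g p)) / 2 * (2 * k)) = k" for k using n by simp
    note sq = h_sum_power2[OF C1_diff[OF v p] C1_diff[OF w p]]
    show "hyp v w p * hX (hyp v w) p = v p * hX v p + w p * hX w p"
      "hyp v w p * hY (hyp v w) p = v p * hY v p + w p * hY w p"
      "hyp v w p * dy (hyp v w) p = v p * dy v p + w p * dy w p"
      unfolding h h_chain[OF C1_diff[OF g p] D[OF p]] sq by (rule c)+
  qed
qed

text \<open>Lagrange's identity (x^2 + y^2) (c^2 + e^2) - (x c + y e)^2 = (x e - y c)^2. In use, r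
  is the length of (x, y), possibly regularised, and d a derivative of r, so that r d = x c + y e.
  The first bound holds at zeros of (x, y) as well; the second is sharper off them.\<close>

lemma cauchy_schwarz_quotient:
  fixes r d x y c e :: real
  assumes "r * d = x * c + y * e" "x\<^sup>2 + y\<^sup>2 \<le> r\<^sup>2" "r > 0"
  shows "d\<^sup>2 \<le> c\<^sup>2 + e\<^sup>2" "x\<^sup>2 + y\<^sup>2 > 0 \<Longrightarrow> d\<^sup>2 \<le> (x * c + y * e)\<^sup>2 / (x\<^sup>2 + y\<^sup>2)"
proof -
  have d: "r\<^sup>2 * d\<^sup>2 = (x * c + y * e)\<^sup>2" using assms(1) by (metis power_mult_distrib)
  have "(x\<^sup>2 + y\<^sup>2) * (c\<^sup>2 + e\<^sup>2) - (x * c + y * e)\<^sup>2 = (x * e - y * c)\<^sup>2"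
    by (simp add: power2_eq_square algebra_simps)
  moreover have "0 \<le> (x * e - y * c)\<^sup>2" by simp
  ultimately have "(x * c + y * e)\<^sup>2 \<le> (x\<^sup>2 + y\<^sup>2) * (c\<^sup>2 + e\<^sup>2)" by linarith
  also have "\<dots> \<le> r\<^sup>2 * (c\<^sup>2 + e\<^sup>2)" using assms(2) by (intro mult_right_mono) simp_all
  finally have "r\<^sup>2 * d\<^sup>2 \<le> r\<^sup>2 * (c\<^sup>2 + e\<^sup>2)" unfolding d .
  then show "d\<^sup>2 \<le> c\<^sup>2 + e\<^sup>2" by (rule mult_left_le_imp_le) (use assms(3) in simp)
  show "d\<^sup>2 \<le> (x * c + y * e)\<^sup>2 / (x\<^sup>2 + y\<^sup>2)" if s: "x\<^sup>2 + y\<^sup>2 > 0"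
  proof -
    have "(x\<^sup>2 + y\<^sup>2) * d\<^sup>2 \<le> (x * c + y * e)\<^sup>2"
      unfolding d[symmetric] using assms(2) by (intro mult_right_mono) simp_all
    then show ?thesis using s by (simp add: pos_le_divide_eq mult.commute)
  qed
qed

text \<open>Cauchy-Schwarz in each derivative: the length of a pair varies no faster than the pair
  itself.\<close>

lemma hyp_Hloc:
  assumes v: "Hloc a v" and w: "Hloc a w" and pos: "\<forall>p\<in>half_space. (v p)\<^sup>2 + (w p)\<^sup>2 > 0"
  shows "Hloc a (hyp v w)" "p \<in> half_space \<Longrightarrow> energy (hyp v w) (hyp v w) p \<le> energy v v p + energy w w p"
proof -
  note H = hyp_C1[OF Hloc_C1[OF v] Hloc_C1[OF w] pos]
  show E: "energy (hyp v w) (hyp v w) p \<le> energy v v p + energy w w p" if p: "p \<in> half_space" for p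
  proof -
    have r: "hyp v w p > 0" using bspec[OF pos p] by (simp add: hyp_def)
    have "(hX (hyp v w) p)\<^sup>2 \<le> (hX v p)\<^sup>2 + (hX w p)\<^sup>2" "(hY (hyp v w) p)\<^sup>2 \<le> (hY v p)\<^sup>2 + (hY w p)\<^sup>2"
      "(dy (hyp v w) p)\<^sup>2 \<le> (dy v p)\<^sup>2 + (dy w p)\<^sup>2"
      by (rule cauchy_schwarz_quotient(1)[OF H(2)[OF p] _ r] cauchy_schwarz_quotient(1)[OF H(3)[OF p] _ r]
            cauchy_schwarz_quotient(1)[OF H(4)[OF p] _ r], simp)+
    then show ?thesis unfolding energy_def power2_eq_square by linarith
  qed
  show "Hloc a (hyp v w)"
  proof (rule HlocI[OF H(1)])
    fix R
    show "\<exists>c g h. Hloc a g \<and> Hloc a h \<and> (\<forall>p\<in>half_ball R. (hyp v w p)\<^sup>2 + energy (hyp v w) (hyp v w) p \<le> c * ((g p)\<^sup>2 + energy g g p) + c * ((h p)\<^sup>2 + energy h h p))"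
    proof (rule exI[of _ 1], rule exI[of _ v], rule exI[of _ w], intro conjI ballI v w)
      fix p assume "p \<in> half_ball R"
      then have "p \<in> half_space" by (rule half_ballD)
      from E[OF this] show "(hyp v w p)\<^sup>2 + energy (hyp v w) (hyp v w) p \<le> 1 * ((v p)\<^sup>2 + energy v v p) + 1 * ((w p)\<^sup>2 + energy w w p)"
        by simp
    qed
  qed
qed

lemma Hloc_const:
  assumes "-1 < a"
  shows "Hloc a (\<lambda>p. c)"
  unfolding Hloc_def
proof (intro conjI allI C1_const)
  fix R
  have "energy (\<lambda>p. c) (\<lambda>p. c) p = 0" for p by (simp add: energy_def)
  then have "(\<integral>\<^sup>+p. ennreal (c\<^sup>2 + energy (\<lambda>p. c) (\<lambda>p. c) p) * indicator (half_ball R) p \<partial>wmeas a)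
    = ennreal (c\<^sup>2) * emeasure (wmeas a) (half_ball R)"
    by (simp add: nn_integral_cmult_indicator)
  also have "\<dots> < \<infinity>" using emeasure_half_ball[OF assms, of R] by (simp add: ennreal_mult_less_top)
  finally show "(\<integral>\<^sup>+p. ennreal (c\<^sup>2 + energy (\<lambda>p. c) (\<lambda>p. c) p) * indicator (half_ball R) p \<partial>wmeas a) < \<infinity>" .
qed

lemma locbdd_const: "locbdd (\<lambda>p. c)"
  unfolding locbdd_def by blast

lemma locbdd_hyp:
  assumes "locbdd v" "locbdd w"
  shows "locbdd (hyp v w)"
  unfolding locbdd_def
proof
  fix R
  obtain B D where "\<And>p. p \<in> half_ball R \<Longrightarrow> \<bar>v p\<bar> \<le> B" "\<And>p. p \<in> half_ball R \<Longrightarrow> \<bar>w p\<bar> \<le> D"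
    using assms unfolding locbdd_def by blast
  then have "\<bar>hyp v w p\<bar> \<le> B + D" if "p \<in> half_ball R" for p
    unfolding abs_of_nonneg[OF hyp_nonneg] using hyp_le[of v w p] that by (meson add_mono order_trans)
  then show "\<exists>B. \<forall>p\<in>half_ball R. \<bar>hyp v w p\<bar> \<le> B" by blast
qed

lemma btr_hyp:
  assumes "has_tr v x" "has_tr w x"
  shows "has_tr (hyp v w) x \<and> btr (hyp v w) x = sqrt ((btr v x)\<^sup>2 + (btr w x)\<^sup>2)"
proof -
  have "((\<lambda>y. hyp v w (x, y)) \<longlongrightarrow> sqrt ((btr v x)\<^sup>2 + (btr w x)\<^sup>2)) (at_right 0)"
    unfolding hyp_def by (intro tendsto_intros has_tr_tendsto assms)
  then show ?thesis using btrI by blast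
qed

lemma smooth_compact_support_cut:
  assumes "smooth_compact_support \<phi>"
  shows "cut \<phi>"
proof -
  have "Ck_on (Suc 0) UNIV \<phi>" using assms unfolding smooth_compact_support_def by blast
  then have C: "C1 UNIV \<phi>" by (rule Ck_on_1_imp_C1)
  have "bounded (closure {p. \<phi> p \<noteq> 0})"
    using assms unfolding smooth_compact_support_def by (intro compact_imp_bounded) blast
  then obtain B where B: "\<And>p. p \<in> closure {p. \<phi> p \<noteq> 0} \<Longrightarrow> norm p \<le> B" unfolding bounded_iff by blast
  have "\<phi> p = 0" if "B + 1 \<le> norm p" for p
  proof (rule ccontr)
    assume "\<phi> p \<noteq> 0"
    then have "p \<in> {p. \<phi> p \<noteq> 0}" by (rule CollectI)
    then have "norm p \<le> B" by (rule B[OF subsetD[OF closure_subset]])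
    then show False using that by linarith
  qed
  then show ?thesis unfolding cut_def using C by blast
qed

section \<open>The level sets\<close>

lemma gradH_nth [simp]: "gradH u p $ 1 = hX u p" "gradH u p $ 2 = hY u p"
  by (simp_all add: gradH_def)

lemma norm_gradH: "norm (gradH u p) = sqrt ((hX u p)\<^sup>2 + (hY u p)\<^sup>2)"
  unfolding norm_gradH_sq[symmetric] by simp

lemma regular_set_iff: "p \<in> regular_set u \<longleftrightarrow> p \<in> half_space \<and> (hX u p)\<^sup>2 + (hY u p)\<^sup>2 > 0"
proof -
  have "gradH u p \<noteq> 0 \<longleftrightarrow> (norm (gradH u p))\<^sup>2 > 0" by simp
  then show ?thesis unfolding norm_gradH_sq regular_set_def by blast
qed

lemma open_regular_set:
  assumes "C2 u"
  shows "open (regular_set u)"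
proof -
  have "continuous_on half_space (\<lambda>p. (hX u p)\<^sup>2 + (hY u p)\<^sup>2)"
    by (intro continuous_intros C1_cont C2_C1 assms)
  from continuous_open_preimage[OF this open_half_space open_greaterThan[of 0]]
  have "open (half_space \<inter> (\<lambda>p. (hX u p)\<^sup>2 + (hY u p)\<^sup>2) -` {0<..})" .
  moreover have "half_space \<inter> (\<lambda>p. (hX u p)\<^sup>2 + (hY u p)\<^sup>2) -` {0<..} = regular_set u"
    using regular_set_iff by blast
  ultimately show ?thesis by simp
qed

lemma h_linear:
  assumes "\<And>v. pd v g p = \<alpha> * pd v w p + \<beta> * pd v z p"
  shows "hX g p = \<alpha> * hX w p + \<beta> * hX z p" "hY g p = \<alpha> * hY w p + \<beta> * hY z p" "hT g p = \<alpha> * hT w p + \<beta> * hT z p"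
  by (simp_all add: hX_def hY_def hT_def assms algebra_simps)

text \<open>Normalising a vector projects its derivative onto the orthogonal direction and divides
  by the length. With i = 1/|grad u| and (x, y) = (Xu, Yu) the matrix is i^3 times the one with rows
  (y^2, -x y) and (-x y, x^2).\<close>

lemma pd_nu:
  assumes u: "C2 u" and p: "p \<in> regular_set u"
  defines "i \<equiv> inverse (norm (gradH u p))"
  shows "pd v (\<lambda>q. nu u q $ 1) p = i ^ 3 * (hY u p)\<^sup>2 * pd v (hX u) p + - (i ^ 3 * hX u p * hY u p) * pd v (hY u) p"
    "pd v (\<lambda>q. nu u q $ 2) p = - (i ^ 3 * hX u p * hY u p) * pd v (hX u) p + i ^ 3 * (hX u p)\<^sup>2 * pd v (hY u) p"
proof -
  let ?g = "\<lambda>q. (hX u q)\<^sup>2 + (hY u q)\<^sup>2"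
  let ?k = "\<lambda>q. inverse (sqrt (?g q))"
  have hp: "p \<in> half_space" and g0: "?g p > 0" using p unfolding regular_set_iff by blast+
  have i: "i = ?k p" unfolding i_def norm_gradH ..
  have dX: "hX u differentiable (at p)" and dY: "hY u differentiable (at p)"
    by (rule C1_diff[OF C2_C1(3)[OF u] hp], rule C1_diff[OF C2_C1(4)[OF u] hp])
  have dg: "?g differentiable (at p)" unfolding power2_eq_square by (intro diff_rules dX dY)
  have pg: "pd v ?g p = 2 * (hX u p * pd v (hX u) p + hY u p * pd v (hY u) p)"
    unfolding power2_eq_square by (simp add: pd_add pd_mult dX dY diff_rules)
  have D: "((\<lambda>t. inverse (sqrt t)) has_real_derivative - (i ^ 3) / 2) (at (?g p))"
    using g0 unfolding i
    by (auto intro!: derivative_eq_intros simp: field_simps power3_eq_cube)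
  have pk: "pd v ?k p = - (i ^ 3) / 2 * (2 * (hX u p * pd v (hX u) p + hY u p * pd v (hY u) p))"
    unfolding pd_chain[OF dg D] pg ..
  have dk: "?k differentiable (at p)"
  proof -
    from has_derivative_compose[OF has_derivative_pd[OF dg] D[unfolded has_field_derivative_def]]
    show ?thesis unfolding differentiable_def by blast
  qed
  \<comment> \<open>Rewriting the single factor i as i^3 (x^2 + y^2) gives all terms the same power
    of i, so that one square cancels.\<close>
  have i3: "i = i ^ 3 * ((hX u p)\<^sup>2 + (hY u p)\<^sup>2)"
  proof -
    have "r = r ^ 3 * z" if "r\<^sup>2 * z = 1" for r z :: real
      using that by (simp add: power2_eq_square power3_eq_cube mult.assoc)
    moreover have "i\<^sup>2 * ?g p = 1"
      unfolding i power_inverse real_sqrt_pow2[OF less_imp_le[OF g0]] by (rule left_inverse) (use g0 in linarith)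
    ultimately show ?thesis by blast
  qed
  have n: "nu u q $ 1 = hX u q * ?k q" "nu u q $ 2 = hY u q * ?k q" for q
    unfolding nu_def norm_gradH[symmetric] by simp_all
  show "pd v (\<lambda>q. nu u q $ 1) p = i ^ 3 * (hY u p)\<^sup>2 * pd v (hX u) p + - (i ^ 3 * hX u p * hY u p) * pd v (hY u) p"
    unfolding n pd_mult[OF dX dk] pk i[symmetric]
    by (subst (2) i3) (simp add: power2_eq_square algebra_simps)
  show "pd v (\<lambda>q. nu u q $ 2) p = - (i ^ 3 * hX u p * hY u p) * pd v (hX u) p + i ^ 3 * (hX u p)\<^sup>2 * pd v (hY u) p"
    unfolding n pd_mult[OF dY dk] pk i[symmetric]
    by (subst (2) i3) (simp add: power2_eq_square algebra_simps)
qed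

text \<open>Since \<open>mat_sq\<close> multiplies Hu by its transpose, the quadratic form is the
  squared length of the transpose of Hu applied to the normal, whose entries are X|grad u| and
  Y|grad u|. What remains is |Hu|^2 minus the squared horizontal gradient of |grad u|.\<close>

lemma hess_terms:
  assumes "p \<in> regular_set u"
  shows "sum_sq_entries (hess u p) - (mat_sq (hess u p) *v nu u p) \<bullet> nu u p
    = (hX (hX u) p)\<^sup>2 + (hY (hX u) p)\<^sup>2 + (hX (hY u) p)\<^sup>2 + (hY (hY u) p)\<^sup>2
      - ((hX u p * hX (hX u) p + hY u p * hX (hY u) p)\<^sup>2 + (hX u p * hY (hX u) p + hY u p * hY (hY u) p)\<^sup>2)
        / ((hX u p)\<^sup>2 + (hY u p)\<^sup>2)"
proof -
  have n: "nu u p $ 1 = hX u p / norm (gradH u p)" "nu u p $ 2 = hY u p / norm (gradH u p)"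
    by (simp_all add: nu_def divide_inverse)
  have s: "sum_sq_entries (hess u p) = (hX (hX u) p)\<^sup>2 + (hY (hX u) p)\<^sup>2 + (hX (hY u) p)\<^sup>2 + (hY (hY u) p)\<^sup>2"
    by (simp add: sum_sq_entries_def hess_def sum_2)
  have "(mat_sq (hess u p) *v nu u p) \<bullet> nu u p
    = (nu u p $ 1 * hX (hX u) p + nu u p $ 2 * hX (hY u) p)\<^sup>2 + (nu u p $ 1 * hY (hX u) p + nu u p $ 2 * hY (hY u) p)\<^sup>2"
    by (simp add: mat_sq_def hess_def matrix_matrix_mult_def matrix_vector_mult_def transpose_def inner_vec_def sum_2
      power2_eq_square algebra_simps)
  also have "\<dots> = ((hX u p * hX (hX u) p + hY u p * hX (hY u) p)\<^sup>2 + (hX u p * hY (hX u) p + hY u p * hY (hY u) p)\<^sup>2)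
        / (norm (gradH u p))\<^sup>2"
    unfolding n by (simp add: power_divide flip: add_divide_distrib)
  finally show ?thesis unfolding s norm_gradH_sq by simp
qed

text \<open>With x = Xu, y = Yu put y1 = y X(Xu) - x X(Yu) and y2 = y Y(Xu) - x Y(Yu). Mean
  curvature is i^3 (y y1 - x y2), and the bracket with the imaginary curvature is i^3 (x y1 + y y2).
  These are a scaled orthogonal image of (y1, y2), so their squares add up to i^4 (y1^2 + y2^2); by
  Lagrange's identity i^2 (y1^2 + y2^2) is |Hu|^2 minus the part along the normal.\<close>

lemma hessian_eq_curvature:
  assumes u: "C2 u" and p: "p \<in> regular_set u"
  shows "hessian_integrand a u \<phi> p = curvature_integrand a u \<phi> p"
proof -
  have hp: "p \<in> half_space" and g0: "(hX u p)\<^sup>2 + (hY u p)\<^sup>2 > 0" using p unfolding regular_set_iff by blast+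
  define x y c d e k where "x = hX u p" "y = hY u p" "c = hX (hX u) p" "d = hY (hX u) p" "e = hX (hY u) p" "k = hY (hY u) p"
  note abb = this
  define m n where "m = hT (hX u) p" "n = hT (hY u) p"
  define i where "i = inverse (norm (gradH u p))"
  define N where "N = norm (gradH u p)"
  have N2: "N\<^sup>2 = x\<^sup>2 + y\<^sup>2" unfolding N_def abb by (rule norm_gradH_sq)
  \<comment> \<open>What follows is polynomial algebra modulo this relation, i being the inverse of
    |grad u|.\<close>
  have i2: "i\<^sup>2 * (x\<^sup>2 + y\<^sup>2) = 1"
  proof -
    have "N \<noteq> 0" using g0 N2 unfolding abb[symmetric] by auto
    then have "i\<^sup>2 * N\<^sup>2 = 1" unfolding i_def N_def[symmetric] power_mult_distrib[symmetric] by simp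
    then show ?thesis unfolding N2 .
  qed
  note P = pd_nu[OF u p, folded i_def]
  note nu1 = h_linear[OF P(1)] and nu2 = h_linear[OF P(2)]
  let ?y1 = "y * c - x * e" and ?y2 = "y * d - x * k"
  have h: "mean_curv u p = i ^ 3 * (y * ?y1 - x * ?y2)"
    unfolding mean_curv_def divH_def nu1 nu2 abb[symmetric] by (simp add: power2_eq_square algebra_simps)
  have Tn: "T_nu u p $ 1 = i ^ 3 * y * (y * m - x * n)" "T_nu u p $ 2 = - (i ^ 3 * x * (y * m - x * n))"
    unfolding T_nu_def vector_2 nu1 nu2 abb[symmetric] m_n_def[symmetric] by (simp_all add: power2_eq_square algebra_simps)
  have tg: "tang u p $ 1 = i * y" "tang u p $ 2 = - (i * x)" and nn: "nu u p $ 1 = i * x" "nu u p $ 2 = i * y"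
    unfolding tang_def nu_def i_def abb by simp_all
  have Tv: "T_nu u p \<bullet> tang u p = i\<^sup>2 * (i\<^sup>2 * (x\<^sup>2 + y\<^sup>2)) * (y * m - x * n)"
    unfolding inner_vec_def sum_2 Tn tg by (simp add: power2_eq_square power3_eq_cube algebra_simps)
  have t: "hT u p = e - d"
    unfolding hT_def abb using hX_hY_commutator[OF u hp] by simp
  have H: "(hess u p *v tang u p) $ 1 = c * (i * y) + d * (- (i * x))" "(hess u p *v tang u p) $ 2 = e * (i * y) + k * (- (i * x))"
    unfolding matrix_vector_mult_def hess_def abb[symmetric] by (simp_all add: sum_2 tg)
  have "imag_curv u p + ((hess u p *v tang u p) \<bullet> nu u p) / norm (gradH u p)
    = - (e - d) * i + ((c * (i * y) + d * (- (i * x))) * (i * x) + (e * (i * y) + k * (- (i * x))) * (i * y)) * i"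
    unfolding imag_curv_def t divide_inverse i_def[symmetric] inner_vec_def sum_2 nn H inner_real_def ..
  also have "\<dots> = i * (d - e) + i ^ 3 * (x * (c * y - d * x) + y * (e * y - k * x))"
    by (simp add: power3_eq_cube algebra_simps)
  \<comment> \<open>Inserting a factor 1 makes the term from Tu homogeneous of degree 3 in i like
    the Hessian term, so the two combine.\<close>
  also have "i * (d - e) = i * (i\<^sup>2 * (x\<^sup>2 + y\<^sup>2)) * (d - e)" unfolding i2 by simp
  also have "i * (i\<^sup>2 * (x\<^sup>2 + y\<^sup>2)) * (d - e) + i ^ 3 * (x * (c * y - d * x) + y * (e * y - k * x)) = i ^ 3 * (x * ?y1 + y * ?y2)"
    by (simp add: power2_eq_square power3_eq_cube algebra_simps)
  finally have C: "imag_curv u p + ((hess u p *v tang u p) \<bullet> nu u p) / norm (gradH u p) = i ^ 3 * (x * ?y1 + y * ?y2)" .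
  have "N\<^sup>2 * ((mean_curv u p)\<^sup>2 + (i ^ 3 * (x * ?y1 + y * ?y2))\<^sup>2 + 2 * (T_nu u p \<bullet> tang u p))
    = i\<^sup>2 * (i\<^sup>2 * (x\<^sup>2 + y\<^sup>2))\<^sup>2 * (?y1\<^sup>2 + ?y2\<^sup>2) + 2 * (i\<^sup>2 * (x\<^sup>2 + y\<^sup>2))\<^sup>2 * (y * m - x * n)"
    unfolding h Tv N2 by (simp add: power2_eq_square power3_eq_cube algebra_simps)
  also have "\<dots> = i\<^sup>2 * (?y1\<^sup>2 + ?y2\<^sup>2) + 2 * (y * m - x * n)" unfolding i2 by simp
  also have "i\<^sup>2 * (?y1\<^sup>2 + ?y2\<^sup>2) = (i\<^sup>2 * (x\<^sup>2 + y\<^sup>2)) * (c\<^sup>2 + d\<^sup>2 + e\<^sup>2 + k\<^sup>2) - i\<^sup>2 * ((x * c + y * e)\<^sup>2 + (x * d + y * k)\<^sup>2)"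
    by (simp add: power2_eq_square algebra_simps)
  also have "\<dots> = c\<^sup>2 + d\<^sup>2 + e\<^sup>2 + k\<^sup>2 - ((x * c + y * e)\<^sup>2 + (x * d + y * k)\<^sup>2) / (x\<^sup>2 + y\<^sup>2)"
  proof -
    have "i\<^sup>2 * z = z / (x\<^sup>2 + y\<^sup>2)" for z
      unfolding N2[symmetric] i_def N_def[symmetric] by (simp add: divide_inverse power_inverse)
    then show ?thesis unfolding i2 by simp
  qed
  also have "\<dots> = sum_sq_entries (hess u p) - (mat_sq (hess u p) *v nu u p) \<bullet> nu u p"
    unfolding hess_terms[OF p] abb ..
  finally have F: "N\<^sup>2 * ((mean_curv u p)\<^sup>2 + (i ^ 3 * (x * ?y1 + y * ?y2))\<^sup>2 + 2 * (T_nu u p \<bullet> tang u p))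
    = sum_sq_entries (hess u p) - (mat_sq (hess u p) *v nu u p) \<bullet> nu u p - 2 * (n * x - m * y)" by (simp add: algebra_simps)
  show ?thesis
    unfolding hessian_integrand_def curvature_integrand_def N_def[symmetric]
      C[folded N_def, unfolded abb] F[unfolded m_n_def abb, symmetric] by (simp only: mult.assoc)
qed

context heis_sol
begin

section \<open>The weighted Poincare inequality\<close>

text \<open>This is sqrt((Xu)^2 + (Yu)^2 + \<epsilon>^2), of class C^1 also where the horizontal
  gradient vanishes.\<close>

definition rho :: "real \<Rightarrow> hpt \<Rightarrow> real" where
  "rho \<epsilon> = hyp (hX u) (hyp (hY u) (\<lambda>p. \<epsilon>))"

text \<open>The commutator terms that the equations of Xu and Yu leave after testing with Xu
  \<phi>^2 and Yu \<phi>^2, with \<phi>^2 divided out. Because T = -4 d_3 it is the T-term of the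
  integrand (\<open>twist_eq\<close>).\<close>

definition twist :: "hpt \<Rightarrow> real" where
  "twist p = 8 * (hX u p * hY w3 p - hY u p * hX w3 p)"

lemma rho_sq: "(rho \<epsilon> p)\<^sup>2 = (hX u p)\<^sup>2 + (hY u p)\<^sup>2 + \<epsilon>\<^sup>2"
  by (simp add: rho_def)

lemma
  assumes \<epsilon>: "\<epsilon> > 0"
  shows rho_Hloc: "Hloc a (rho \<epsilon>)" and rho_locbdd: "locbdd (rho \<epsilon>)"
    and rho_hX: "p \<in> half_space \<Longrightarrow> rho \<epsilon> p * hX (rho \<epsilon>) p = hX u p * hX (hX u) p + hY u p * hX (hY u) p"
    and rho_hY: "p \<in> half_space \<Longrightarrow> rho \<epsilon> p * hY (rho \<epsilon>) p = hX u p * hY (hX u) p + hY u p * hY (hY u) p"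
    and rho_dy: "p \<in> half_space \<Longrightarrow> rho \<epsilon> p * dy (rho \<epsilon>) p = hX u p * dy (hX u) p + hY u p * dy (hY u) p"
    and rho_pos: "rho \<epsilon> p > 0"
proof -
  let ?q = "hyp (hY u) (\<lambda>p. \<epsilon>)"
  have e2: "\<epsilon>\<^sup>2 > 0" using \<epsilon> by simp
  have q: "\<forall>p\<in>half_space. (hY u p)\<^sup>2 + \<epsilon>\<^sup>2 > 0" using e2 by (simp add: add_nonneg_pos)
  have r0: "(hX u p)\<^sup>2 + (?q p)\<^sup>2 > 0" for p
  proof -
    have "0 \<le> (hX u p)\<^sup>2" "0 \<le> (hY u p)\<^sup>2" by simp_all
    then show ?thesis unfolding hyp_sq using e2 by linarith
  qed
  then have r: "\<forall>p\<in>half_space. (hX u p)\<^sup>2 + (?q p)\<^sup>2 > 0" by blast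
  note Hc = Hloc_const[OF a1, of \<epsilon>]
  note Hq = hyp_Hloc(1)[OF Hloc_grad(2) Hc q]
  note D = hyp_C1(2-4)[OF Hloc_C1[OF Hloc_grad(2)] Hloc_C1[OF Hc] q]
  note E = hyp_C1(2-4)[OF Hloc_C1[OF Hloc_grad(1)] Hloc_C1[OF Hq] r]
  show "Hloc a (rho \<epsilon>)" unfolding rho_def by (rule hyp_Hloc(1)[OF Hloc_grad(1) Hq r])
  show "locbdd (rho \<epsilon>)" unfolding rho_def by (intro locbdd_hyp grad_locbdd locbdd_const)
  show "rho \<epsilon> p > 0" unfolding rho_def hyp_def[of "hX u"] by (rule real_sqrt_gt_zero[OF r0])
  assume p: "p \<in> half_space"
  show "rho \<epsilon> p * hX (rho \<epsilon>) p = hX u p * hX (hX u) p + hY u p * hX (hY u) p"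
    unfolding rho_def E(1)[OF p] D(1)[OF p] by simp
  show "rho \<epsilon> p * hY (rho \<epsilon>) p = hX u p * hY (hX u) p + hY u p * hY (hY u) p"
    unfolding rho_def E(2)[OF p] D(2)[OF p] by simp
  show "rho \<epsilon> p * dy (rho \<epsilon>) p = hX u p * dy (hX u) p + hY u p * dy (hY u) p"
    unfolding rho_def E(3)[OF p] D(3)[OF p] by simp
qed

text \<open>For each of the three derivatives D one has \<rho> D\<rho> = Xu D(Xu) + Yu D(Yu). This
  makes the cross terms with \<phi> in the stability inequality match those of the tested
  equations.\<close>

lemma rho_energy:
  assumes "\<epsilon> > 0" "p \<in> half_space"
  shows "rho \<epsilon> p * energy (rho \<epsilon>) z p = hX u p * energy (hX u) z p + hY u p * energy (hY u) z p"
proof -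
  have "rho \<epsilon> p * energy (rho \<epsilon>) z p = (rho \<epsilon> p * hX (rho \<epsilon>) p) * hX z p
    + (rho \<epsilon> p * hY (rho \<epsilon>) p) * hY z p + (rho \<epsilon> p * dy (rho \<epsilon>) p) * dy z p"
    by (simp add: energy_def algebra_simps)
  then show ?thesis unfolding rho_hX[OF assms] rho_hY[OF assms] rho_dy[OF assms]
    by (simp add: energy_def algebra_simps)
qed

lemma twist_eq:
  assumes "p \<in> half_space"
  shows "- 2 * (hT (hY u) p * hX u p - hT (hX u) p * hY u p) = twist p"
  unfolding twist_def hT_def b3_commute[OF u2 assms] by (simp add: algebra_simps)

text \<open>Test the equations of \<open>Xu\<close> and \<open>Yu\<close> with \<open>Xu \<phi>\<^sup>2\<close> and \<open>Yu \<phi>\<^sup>2\<close>, and the stability inequality with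
  \<open>\<rho> \<phi>\<close>, where \<open>\<rho>\<close> is a smooth regularisation of the length of the horizontal gradient.\<close>

lemma regularised_inequality:
  assumes \<phi>: "cut \<phi>" and \<epsilon>: "\<epsilon> > 0"
    and i: "integrable (wmeas a) H"
    and H: "\<And>p. p \<in> half_space \<Longrightarrow>
      H p \<le> (\<phi> p)\<^sup>2 * (energy (hX u) (hX u) p + energy (hY u) (hY u) p - energy (rho \<epsilon>) (rho \<epsilon>) p + twist p)"
  shows "(\<integral>p. H p \<partial>wmeas a) \<le> (\<integral>p. ((hX u p)\<^sup>2 + (hY u p)\<^sup>2) * energy \<phi> \<phi> p \<partial>wmeas a)
    + \<epsilon>\<^sup>2 * ((\<integral>p. energy \<phi> \<phi> p \<partial>wmeas a) - (\<integral>x. deriv f (btr u x) * (\<phi> (x, 0))\<^sup>2 \<partial>lborel))"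
proof -
  let ?f = "\<lambda>x. deriv f (btr u x)"
  define \<eta> where "\<eta> = (\<lambda>p. \<phi> p * \<phi> p)"
  have \<eta>: "cut \<eta>" unfolding \<eta>_def by (rule cut_mult[OF \<phi> \<phi>])
  let ?x = "\<lambda>p. hX u p * \<eta> p" and ?y = "\<lambda>p. hY u p * \<eta> p"
  define z where "z = (\<lambda>p. rho \<epsilon> p * \<phi> p)"
  have tz: "tst a z" unfolding z_def by (rule tst_mult_cut[OF rho_Hloc[OF \<epsilon>] rho_locbdd[OF \<epsilon>] \<phi>])
  have tx: "tst a ?x" and ty: "tst a ?y" by (rule tst_mult_cut[OF Hloc_grad(1) grad_locbdd(1) \<eta>], rule tst_mult_cut[OF Hloc_grad(2) grad_locbdd(2) \<eta>])
  note X = gradient_equations(1,3)[OF Hloc_grad(1) grad_locbdd(1) \<eta>]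
  note Y = gradient_equations(2,4)[OF Hloc_grad(2) grad_locbdd(2) \<eta>]
  note PX = commutator_parts(2)[OF Hloc_grad(1) grad_locbdd(1) \<eta>]
  note PY = commutator_parts(1)[OF Hloc_grad(2) grad_locbdd(2) \<eta>]
  note EX = energy_tst_integrable[OF Hloc_grad(1) tx] and EY = energy_tst_integrable[OF Hloc_grad(2) ty]
  have "tst a (\<lambda>p. 1 * \<eta> p)" by (rule tst_mult_cut[OF Hloc_const[OF a1] locbdd_const \<eta>])
  then have t\<eta>: "tst a \<eta>" by simp
  have fm: "?f \<in> borel_measurable borel" by (rule measurable_compose[OF btr_u_measurable f_measurable(2)])
  obtain K where "AE x in lborel. \<bar>f (btr u x)\<bar> \<le> K \<and> \<bar>?f x\<bar> \<le> K" by (rule f_btr_bound) blast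
  then have "AE x in lborel. \<bar>?f x\<bar> \<le> K" by eventually_elim (rule conjunct2)
  from tst_btr_integrable[OF aa t\<eta> fm this] have i\<eta>: "integrable lborel (\<lambda>x. ?f x * btr \<eta> x)" .
  have b\<phi>: "has_tr \<phi> x \<and> btr \<phi> x = \<phi> (x, 0)" and b\<eta>: "has_tr \<eta> x \<and> btr \<eta> x = \<phi> (x, 0) * \<phi> (x, 0)" for x
    using btr_continuous[OF C1_cont[OF cut_C1[OF \<phi>]], of x] btr_continuous[OF C1_cont[OF cut_C1[OF \<eta>]], of x]
    unfolding \<eta>_def by blast+
  have i\<phi>: "integrable lborel (\<lambda>x. ?f x * (\<phi> (x, 0))\<^sup>2)" and I\<phi>: "(\<integral>x. ?f x * btr \<eta> x \<partial>lborel) = (\<integral>x. ?f x * (\<phi> (x, 0))\<^sup>2 \<partial>lborel)"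
    using i\<eta> b\<eta> by (simp_all add: power2_eq_square)
  \<comment> \<open>The squared trace of \<rho> \<phi> is the sum of the boundary products of both
    tested equations plus an \<epsilon>^2 term, so f'(u) contributes equally to stability and to the
    equations.\<close>
  let ?B = "\<lambda>x. ?f x * btr (hX u) x * btr ?x x + ?f x * btr (hY u) x * btr ?y x + \<epsilon>\<^sup>2 * (?f x * (\<phi> (x, 0))\<^sup>2)"
  have iB: "integrable lborel ?B" by (intro Bochner_Integration.integrable_add integrable_mult_right X(1) Y(1) i\<phi>)
  have aeB: "AE x in lborel. ?f x * (btr z x)\<^sup>2 = ?B x"
    using btr_grad
  proof eventually_elim
    case (elim x)
    then have tr: "has_tr (hX u) x" "has_tr (hY u) x" by blast+
    have tc: "has_tr (\<lambda>p. \<epsilon>) x \<and> btr (\<lambda>p. \<epsilon>) x = \<epsilon>" by (rule btr_continuous) simp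
    note q = btr_hyp[OF tr(2) conjunct1[OF tc], unfolded conjunct2[OF tc]]
    note r = btr_hyp[OF tr(1) conjunct1[OF q], unfolded conjunct2[OF q], folded rho_def]
    have bz: "btr z x = btr (rho \<epsilon>) x * \<phi> (x, 0)"
      unfolding z_def using btr_mult[OF conjunct1[OF r] conjunct1[OF b\<phi>[of x]]] b\<phi>[of x] by simp
    have "(btr (rho \<epsilon>) x)\<^sup>2 = (btr (hX u) x)\<^sup>2 + (btr (hY u) x)\<^sup>2 + \<epsilon>\<^sup>2"
      unfolding conjunct2[OF r] by simp
    moreover have "btr ?x x = btr (hX u) x * (\<phi> (x, 0) * \<phi> (x, 0))" "btr ?y x = btr (hY u) x * (\<phi> (x, 0) * \<phi> (x, 0))"
      using btr_mult[OF tr(1) conjunct1[OF b\<eta>[of x]]] btr_mult[OF tr(2) conjunct1[OF b\<eta>[of x]]] b\<eta>[of x] by simp_all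
    ultimately show ?case unfolding bz power_mult_distrib by (simp add: power2_eq_square algebra_simps)
  qed
  have mz: "(\<lambda>x. ?f x * (btr z x)\<^sup>2) \<in> borel_measurable lborel"
    using fm btr_measurable[OF C1_cont[OF tst_C1[OF tz]]] by simp
  have bd: "(\<integral>x. ?f x * (btr z x)\<^sup>2 \<partial>lborel) = (\<integral>x. ?f x * btr (hX u) x * btr ?x x \<partial>lborel)
    + (\<integral>x. ?f x * btr (hY u) x * btr ?y x \<partial>lborel) + \<epsilon>\<^sup>2 * (\<integral>x. ?f x * (\<phi> (x, 0))\<^sup>2 \<partial>lborel)"
    unfolding integral_cong_AE[OF mz borel_measurable_integrable[OF iB] aeB]
    using X(1) Y(1) i\<phi> by simp
  have iM: "integrable (wmeas a) (energy \<phi> \<phi>)" using cut_integrable(3)[OF Hloc_const[OF a1, of 1] \<phi>] by simp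
  note iX = cut_integrable(3)[OF Hloc_grad(1) \<phi>] and iY = cut_integrable(3)[OF Hloc_grad(2) \<phi>]
  let ?L = "\<lambda>p. ((hX u p)\<^sup>2 + (hY u p)\<^sup>2) * energy \<phi> \<phi> p"
  have iL: "integrable (wmeas a) ?L"
  proof -
    have "?L = (\<lambda>p. energy \<phi> \<phi> p * (hX u p)\<^sup>2 + energy \<phi> \<phi> p * (hY u p)\<^sup>2)" by (simp add: fun_eq_iff algebra_simps)
    then show ?thesis using Bochner_Integration.integrable_add[OF iX iY] by simp
  qed
  \<comment> \<open>Left sides of the two equations, commutator terms included, minus the energy in
    the stability inequality. Adding \<open>?L\<close> and the \<epsilon>^2 term removes what is
    quadratic in the gradient of \<phi>; the terms linear in it cancel by
    \<open>rho_energy\<close>.\<close>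
  let ?G = "\<lambda>p. energy (hX u) ?x p + energy (hY u) ?y p + 8 * (?x p * hY w3 p) - 8 * (?y p * hX w3 p) - energy z z p + ?L p + \<epsilon>\<^sup>2 * energy \<phi> \<phi> p"
  have iG: "integrable (wmeas a) ?G"
    by (intro Bochner_Integration.integrable_add Bochner_Integration.integrable_diff integrable_mult_right EX EY PX PY tst_integrable[OF tz] iL iM)
  have le: "H p \<le> ?G p" if p: "p \<in> half_space" for p
  proof -
    have d\<phi>: "\<phi> differentiable (at p)" by (rule C1_diff[OF cut_C1[OF \<phi>] p])
    have dr: "rho \<epsilon> differentiable (at p)" by (rule C1_diff[OF Hloc_C1[OF rho_Hloc[OF \<epsilon>]] p])
    have d\<eta>: "\<eta> differentiable (at p)" by (rule C1_diff[OF cut_C1[OF \<eta>] p])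
    note dX = C1_diff[OF Hloc_C1[OF Hloc_grad(1)] p] and dY = C1_diff[OF Hloc_C1[OF Hloc_grad(2)] p]
    have e\<eta>: "energy w \<eta> p = 2 * \<phi> p * energy w \<phi> p" for w unfolding \<eta>_def energy_mult(2)[OF d\<phi> d\<phi>] by simp
    have eX: "energy (hX u) ?x p = (\<phi> p)\<^sup>2 * energy (hX u) (hX u) p + 2 * \<phi> p * (hX u p * energy (hX u) \<phi> p)"
      and eY: "energy (hY u) ?y p = (\<phi> p)\<^sup>2 * energy (hY u) (hY u) p + 2 * \<phi> p * (hY u p * energy (hY u) \<phi> p)"
      unfolding energy_mult(2)[OF dX d\<eta>] energy_mult(2)[OF dY d\<eta>] e\<eta> by (simp_all add: \<eta>_def power2_eq_square algebra_simps)
    have "energy z z p = (rho \<epsilon> p)\<^sup>2 * energy \<phi> \<phi> p + (\<phi> p)\<^sup>2 * energy (rho \<epsilon>) (rho \<epsilon>) p + 2 * \<phi> p * (rho \<epsilon> p * energy (rho \<epsilon>) \<phi> p)"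
      unfolding z_def energy_mult[OF dr d\<phi>] energy_sym[of \<phi> "rho \<epsilon>"] by (simp add: power2_eq_square algebra_simps)
    then have ez: "energy z z p = ((hX u p)\<^sup>2 + (hY u p)\<^sup>2 + \<epsilon>\<^sup>2) * energy \<phi> \<phi> p + (\<phi> p)\<^sup>2 * energy (rho \<epsilon>) (rho \<epsilon>) p
      + 2 * \<phi> p * (hX u p * energy (hX u) \<phi> p + hY u p * energy (hY u) \<phi> p)"
      unfolding rho_sq rho_energy[OF \<epsilon> p] .
    have "?G p = (\<phi> p)\<^sup>2 * (energy (hX u) (hX u) p + energy (hY u) (hY u) p - energy (rho \<epsilon>) (rho \<epsilon>) p + twist p)"
      unfolding eX eY ez twist_def by (simp add: \<eta>_def power2_eq_square algebra_simps)
    then show ?thesis using H[OF p] by linarith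
  qed
  have l: "(\<integral>p. g1 p + g2 p + 8 * g3 p - 8 * g4 p - g5 p + g6 p + \<epsilon>\<^sup>2 * g7 p \<partial>wmeas a)
    = integral\<^sup>L (wmeas a) g1 + integral\<^sup>L (wmeas a) g2 + 8 * integral\<^sup>L (wmeas a) g3 - 8 * integral\<^sup>L (wmeas a) g4
      - integral\<^sup>L (wmeas a) g5 + integral\<^sup>L (wmeas a) g6 + \<epsilon>\<^sup>2 * integral\<^sup>L (wmeas a) g7"
    if "integrable (wmeas a) g1" "integrable (wmeas a) g2" "integrable (wmeas a) g3" "integrable (wmeas a) g4"
      "integrable (wmeas a) g5" "integrable (wmeas a) g6" "integrable (wmeas a) g7" for g1 g2 g3 g4 g5 g6 g7 :: "hpt \<Rightarrow> real"
    using that by simp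
  have "(\<integral>p. H p \<partial>wmeas a) \<le> (\<integral>p. ?G p \<partial>wmeas a)" by (rule wmeas_le_real[OF i iG le])
  then show ?thesis
    using stable_tst[OF tz] unfolding l[OF EX EY PX PY tst_integrable[OF tz] iL iM] X(2) Y(2) bd
    by (simp add: right_diff_distrib)
qed

text \<open>On the regular set, Cauchy-Schwarz bounds the squares of X\<rho> and Y\<rho> by those of
  X|grad u| and Y|grad u|, and the d_y terms, being nonnegative, are dropped. Elsewhere the left
  side is 0, \<open>twist\<close> vanishes together with Xu and Yu, and the energies of Xu and Yu
  still dominate that of \<rho>.\<close>

lemma hessian_le_energy:
  assumes \<epsilon>: "\<epsilon> > 0" and p: "p \<in> half_space"
  shows "indicator (regular_set u) p * ((sum_sq_entries (hess u p) - (mat_sq (hess u p) *v nu u p) \<bullet> nu u p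
      - 2 * (hT (hY u) p * hX u p - hT (hX u) p * hY u p)) * (\<phi> p)\<^sup>2)
    \<le> (\<phi> p)\<^sup>2 * (energy (hX u) (hX u) p + energy (hY u) (hY u) p - energy (rho \<epsilon>) (rho \<epsilon>) p + twist p)"
proof -
  have s: "(hX u p)\<^sup>2 + (hY u p)\<^sup>2 \<le> (rho \<epsilon> p)\<^sup>2" unfolding rho_sq by simp
  note cX = cauchy_schwarz_quotient[OF rho_hX[OF \<epsilon> p] s rho_pos[OF \<epsilon>]]
  note cY = cauchy_schwarz_quotient[OF rho_hY[OF \<epsilon> p] s rho_pos[OF \<epsilon>]]
  note cd = cauchy_schwarz_quotient[OF rho_dy[OF \<epsilon> p] s rho_pos[OF \<epsilon>]]
  let ?e = "energy (hX u) (hX u) p + energy (hY u) (hY u) p - energy (rho \<epsilon>) (rho \<epsilon>) p"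
  have e: "?e = ((hX (hX u) p)\<^sup>2 + (hX (hY u) p)\<^sup>2 - (hX (rho \<epsilon>) p)\<^sup>2) + ((hY (hX u) p)\<^sup>2 + (hY (hY u) p)\<^sup>2 - (hY (rho \<epsilon>) p)\<^sup>2)
     + ((dy (hX u) p)\<^sup>2 + (dy (hY u) p)\<^sup>2 - (dy (rho \<epsilon>) p)\<^sup>2)"
    by (simp add: energy_def power2_eq_square)
  show ?thesis
  proof (cases "p \<in> regular_set u")
    case True
    then have g0: "(hX u p)\<^sup>2 + (hY u p)\<^sup>2 > 0" unfolding regular_set_iff by blast
    have "sum_sq_entries (hess u p) - (mat_sq (hess u p) *v nu u p) \<bullet> nu u p \<le> ?e"
      unfolding e hess_terms[OF True] add_divide_distrib using cX(2)[OF g0] cY(2)[OF g0] cd(1) by linarith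
    then have "(sum_sq_entries (hess u p) - (mat_sq (hess u p) *v nu u p) \<bullet> nu u p
      - 2 * (hT (hY u) p * hX u p - hT (hX u) p * hY u p)) \<le> ?e + twist p"
      using twist_eq[OF p] by linarith
    from mult_right_mono[OF this zero_le_power2[of "\<phi> p"]] show ?thesis using True by (simp add: mult.commute)
  next
    case False
    then have "\<not> (hX u p)\<^sup>2 + (hY u p)\<^sup>2 > 0" using p unfolding regular_set_iff by blast
    then have "hX u p = 0" "hY u p = 0" by (simp_all add: sum_power2_gt_zero_iff)
    then have "twist p = 0" by (simp add: twist_def)
    moreover have "0 \<le> ?e" unfolding e using cX(1) cY(1) cd(1) by linarith
    ultimately have "0 \<le> (\<phi> p)\<^sup>2 * (?e + twist p)" by simp
    then show ?thesis using False by simp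
  qed
qed

text \<open>The quadratic part lies between 0 and the energies of Xu and Yu, which are integrable
  against \<phi>^2. The T-term is integrable because it pairs Xu \<phi>^2 and Yu \<phi>^2 with the
  horizontal gradient of d_3 u.\<close>

lemma hessian_term_integrable:
  fixes \<phi> :: "hpt \<Rightarrow> real"
  assumes \<phi>: "cut \<phi>"
  defines "H \<equiv> \<lambda>p. indicator (regular_set u) p * ((sum_sq_entries (hess u p) - (mat_sq (hess u p) *v nu u p) \<bullet> nu u p
      - 2 * (hT (hY u) p * hX u p - hT (hX u) p * hY u p)) * (\<phi> p)\<^sup>2)"
  shows "integrable (wmeas a) H"
proof -
  define \<eta> where "\<eta> = (\<lambda>p. \<phi> p * \<phi> p)"
  have \<eta>: "cut \<eta>" unfolding \<eta>_def by (rule cut_mult[OF \<phi> \<phi>])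
  let ?x = "\<lambda>p. hX u p * \<eta> p" and ?y = "\<lambda>p. hY u p * \<eta> p"
  note PX = commutator_parts(2)[OF Hloc_grad(1) grad_locbdd(1) \<eta>]
  note PY = commutator_parts(1)[OF Hloc_grad(2) grad_locbdd(2) \<eta>]
  have "integrable (wmeas a) (\<lambda>p. 8 * (?x p * hY w3 p) - 8 * (?y p * hX w3 p))"
    by (intro Bochner_Integration.integrable_diff integrable_mult_right PX PY)
  moreover have "8 * (?x p * hY w3 p) - 8 * (?y p * hX w3 p) = (\<phi> p)\<^sup>2 * twist p" for p
    by (simp add: \<eta>_def twist_def power2_eq_square algebra_simps)
  ultimately have iT: "integrable (wmeas a) (\<lambda>p. (\<phi> p)\<^sup>2 * twist p)" by simp
  note iX = cut_integrable(2)[OF Hloc_grad(1) \<phi>] and iY = cut_integrable(2)[OF Hloc_grad(2) \<phi>]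
  let ?Q = "\<lambda>p. (hX (hX u) p)\<^sup>2 + (hY (hX u) p)\<^sup>2 + (hX (hY u) p)\<^sup>2 + (hY (hY u) p)\<^sup>2
      - ((hX u p * hX (hX u) p + hY u p * hX (hY u) p)\<^sup>2 + (hX u p * hY (hX u) p + hY u p * hY (hY u) p)\<^sup>2)
        / ((hX u p)\<^sup>2 + (hY u p)\<^sup>2)"
  let ?I = "\<lambda>p. indicator (regular_set u) p :: real"
  have He: "H p = ?I p * ((\<phi> p)\<^sup>2 * ?Q p + (\<phi> p)\<^sup>2 * twist p)" if p: "p \<in> half_space" for p
  proof (cases "p \<in> regular_set u")
    case True
    then have "H p = (sum_sq_entries (hess u p) - (mat_sq (hess u p) *v nu u p) \<bullet> nu u p
      - 2 * (hT (hY u) p * hX u p - hT (hX u) p * hY u p)) * (\<phi> p)\<^sup>2" by (simp add: H_def)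
    also have "\<dots> = (?Q p + twist p) * (\<phi> p)\<^sup>2" unfolding hess_terms[OF True] twist_eq[OF p, symmetric] by simp
    finally show ?thesis using True by (simp only: indicator_simps algebra_simps mult_1 mult_1_right)
  qed (simp add: H_def)
  have mS: "?I \<in> borel_measurable (wmeas a)"
    by (intro borel_measurable_indicator borel_set_wmeas borel_open open_regular_set u2) (simp add: regular_set_def)
  note m = Hloc_measurable[OF Hloc_C1[OF Hloc_grad(1)], of a] Hloc_measurable[OF Hloc_C1[OF Hloc_grad(2)], of a] Hloc_measurable[OF cut_C1[OF \<phi>], of a]
  have mQ: "?Q \<in> borel_measurable (wmeas a)"
    by (intro borel_measurable_add borel_measurable_diff borel_measurable_divide borel_measurable_power borel_measurable_times m)
  have "integrable (wmeas a) (\<lambda>p. ?I p * ((\<phi> p)\<^sup>2 * ?Q p + (\<phi> p)\<^sup>2 * twist p))"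
  proof (rule Bochner_Integration.integrable_bound[OF Bochner_Integration.integrable_add[OF Bochner_Integration.integrable_add[OF iX iY] integrable_abs[OF iT]]])
    show "(\<lambda>p. ?I p * ((\<phi> p)\<^sup>2 * ?Q p + (\<phi> p)\<^sup>2 * twist p)) \<in> borel_measurable (wmeas a)"
      by (intro borel_measurable_times[OF mS] borel_measurable_add[OF borel_measurable_times[OF m(14) mQ] borel_measurable_integrable[OF iT]])
    show "AE p in wmeas a. norm (?I p * ((\<phi> p)\<^sup>2 * ?Q p + (\<phi> p)\<^sup>2 * twist p))
       \<le> norm ((\<phi> p)\<^sup>2 * energy (hX u) (hX u) p + (\<phi> p)\<^sup>2 * energy (hY u) (hY u) p + \<bar>(\<phi> p)\<^sup>2 * twist p\<bar>)"
    proof (rule AE_I2)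
      fix p
      \<comment> \<open>Cauchy-Schwarz for one column of the Hessian; if x^2 + y^2 = 0 the quotient
        is 0 by the convention for division by zero.\<close>
      have q: "0 \<le> c\<^sup>2 + e\<^sup>2 - (x * c + y * e)\<^sup>2 / (x\<^sup>2 + y\<^sup>2)" for c e x y :: real
      proof (cases "x\<^sup>2 + y\<^sup>2 > 0")
        case True
        have "(x\<^sup>2 + y\<^sup>2) * (c\<^sup>2 + e\<^sup>2) - (x * c + y * e)\<^sup>2 = (x * e - y * c)\<^sup>2"
          by (simp add: power2_eq_square algebra_simps)
        moreover have "0 \<le> (x * e - y * c)\<^sup>2" by simp
        ultimately have "(x * c + y * e)\<^sup>2 \<le> (c\<^sup>2 + e\<^sup>2) * (x\<^sup>2 + y\<^sup>2)" unfolding mult.commute[of "c\<^sup>2 + e\<^sup>2"] by linarith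
        then show ?thesis using pos_divide_le_eq[OF True] by simp
      next
        case False
        then have "x\<^sup>2 + y\<^sup>2 = 0" by (metis add_nonneg_nonneg le_less zero_le_power2)
        then show ?thesis by simp
      qed
      have Q0: "0 \<le> ?Q p"
        using q[of "hX (hX u) p" "hX (hY u) p" "hX u p" "hY u p"] q[of "hY (hX u) p" "hY (hY u) p" "hX u p" "hY u p"]
        unfolding add_divide_distrib by linarith
      have "0 \<le> ((hX u p * hX (hX u) p + hY u p * hX (hY u) p)\<^sup>2 + (hX u p * hY (hX u) p + hY u p * hY (hY u) p)\<^sup>2)
        / ((hX u p)\<^sup>2 + (hY u p)\<^sup>2)"
        by (intro divide_nonneg_nonneg add_nonneg_nonneg zero_le_power2)
      then have Q1: "?Q p \<le> energy (hX u) (hX u) p + energy (hY u) (hY u) p"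
        using zero_le_power2[of "dy (hX u) p"] zero_le_power2[of "dy (hY u) p"]
        unfolding energy_def power2_eq_square[symmetric] by linarith
      have "\<bar>(\<phi> p)\<^sup>2 * ?Q p + (\<phi> p)\<^sup>2 * twist p\<bar> \<le> (\<phi> p)\<^sup>2 * ?Q p + \<bar>(\<phi> p)\<^sup>2 * twist p\<bar>"
        using mult_nonneg_nonneg[OF zero_le_power2[of "\<phi> p"] Q0] by linarith
      also have "\<dots> \<le> (\<phi> p)\<^sup>2 * (energy (hX u) (hX u) p + energy (hY u) (hY u) p) + \<bar>(\<phi> p)\<^sup>2 * twist p\<bar>"
        by (intro add_right_mono mult_left_mono Q1) simp
      finally have b: "\<bar>(\<phi> p)\<^sup>2 * ?Q p + (\<phi> p)\<^sup>2 * twist p\<bar> \<le> (\<phi> p)\<^sup>2 * energy (hX u) (hX u) p + (\<phi> p)\<^sup>2 * energy (hY u) (hY u) p + \<bar>(\<phi> p)\<^sup>2 * twist p\<bar>"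
        by (simp only: distrib_left)
      have "\<bar>k * t\<bar> \<le> \<bar>t\<bar>" if "k = 0 \<or> k = 1" for k t :: real using that by auto
      from this[of "?I p" "(\<phi> p)\<^sup>2 * ?Q p + (\<phi> p)\<^sup>2 * twist p"]
      have "\<bar>?I p * ((\<phi> p)\<^sup>2 * ?Q p + (\<phi> p)\<^sup>2 * twist p)\<bar> \<le> \<bar>(\<phi> p)\<^sup>2 * ?Q p + (\<phi> p)\<^sup>2 * twist p\<bar>"
        by (simp add: indicator_def)
      with b show "norm (?I p * ((\<phi> p)\<^sup>2 * ?Q p + (\<phi> p)\<^sup>2 * twist p))
       \<le> norm ((\<phi> p)\<^sup>2 * energy (hX u) (hX u) p + (\<phi> p)\<^sup>2 * energy (hY u) (hY u) p + \<bar>(\<phi> p)\<^sup>2 * twist p\<bar>)"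
        unfolding real_norm_def by linarith
    qed
  qed
  moreover have "integrable (wmeas a) H \<longleftrightarrow> integrable (wmeas a) (\<lambda>p. ?I p * ((\<phi> p)\<^sup>2 * ?Q p + (\<phi> p)\<^sup>2 * twist p))"
    by (rule wmeas_cong(2)) (rule He)
  ultimately show ?thesis by blast
qed

text \<open>Let \<epsilon> tend to 0 in the regularised inequality: the left side is free of
  \<epsilon>, and the error on the right is \<epsilon>^2 M with M independent of \<epsilon>.\<close>

lemma stability_inequality:
  assumes \<phi>: "cut \<phi>"
  shows "set_integrable lebesgue half_space (lhs_integrand a u \<phi>)"
    "set_integrable lebesgue (regular_set u) (hessian_integrand a u \<phi>)"
    "(LINT p:regular_set u|lebesgue. hessian_integrand a u \<phi> p) \<le> (LINT p:half_space|lebesgue. lhs_integrand a u \<phi> p)"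
proof -
  let ?L = "\<lambda>p. ((hX u p)\<^sup>2 + (hY u p)\<^sup>2) * energy \<phi> \<phi> p"
  let ?h = "\<lambda>p. (sum_sq_entries (hess u p) - (mat_sq (hess u p) *v nu u p) \<bullet> nu u p
      - 2 * (hT (hY u) p * hX u p - hT (hX u) p * hY u p)) * (\<phi> p)\<^sup>2"
  let ?H = "\<lambda>p. indicator (regular_set u) p * ?h p"
  have L: "lhs_integrand a u \<phi> = (\<lambda>p. snd p powr a * ?L p)"
    unfolding lhs_integrand_def[abs_def] norm_gradHh_sq norm_gradH_sq mult.assoc ..
  have h: "hessian_integrand a u \<phi> = (\<lambda>p. snd p powr a * ?h p)"
    unfolding hessian_integrand_def[abs_def] mult.assoc ..
  note iX = cut_integrable(3)[OF Hloc_grad(1) \<phi>] and iY = cut_integrable(3)[OF Hloc_grad(2) \<phi>]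
  have "?L = (\<lambda>p. energy \<phi> \<phi> p * (hX u p)\<^sup>2 + energy \<phi> \<phi> p * (hY u p)\<^sup>2)" by (simp add: fun_eq_iff algebra_simps)
  then have iL: "integrable (wmeas a) ?L" using Bochner_Integration.integrable_add[OF iX iY] by simp
  note mL = borel_measurable_integrable[OF iL]
  note iH = hessian_term_integrable[OF \<phi>]
  note mH = borel_measurable_integrable[OF iH]
  have S: "regular_set u \<subseteq> half_space" by (simp add: regular_set_def)
  show "set_integrable lebesgue half_space (lhs_integrand a u \<phi>)"
    unfolding L using wmeas_set_integral(1)[OF mL] iL by blast
  show "set_integrable lebesgue (regular_set u) (hessian_integrand a u \<phi>)"
    unfolding h using wmeas_set_integral_subset(1)[OF mH S] iH by blast
  define M where "M = (\<integral>p. energy \<phi> \<phi> p \<partial>wmeas a) - (\<integral>x. deriv f (btr u x) * (\<phi> (x, 0))\<^sup>2 \<partial>lborel)"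
  have e: "(\<integral>p. ?H p \<partial>wmeas a) \<le> (\<integral>p. ?L p \<partial>wmeas a) + \<epsilon>\<^sup>2 * M" if "\<epsilon> > 0" for \<epsilon>
    unfolding M_def by (rule regularised_inequality[OF \<phi> that iH hessian_le_energy[OF that, where \<phi> = \<phi>]])
  have "(\<lambda>n. (\<integral>p. ?L p \<partial>wmeas a) + (inverse (real (Suc n)))\<^sup>2 * M) \<longlonglongrightarrow> (\<integral>p. ?L p \<partial>wmeas a) + 0\<^sup>2 * M"
    by (intro tendsto_intros LIMSEQ_inverse_real_of_nat)
  then have lim: "(\<lambda>n. (\<integral>p. ?L p \<partial>wmeas a) + (inverse (real (Suc n)))\<^sup>2 * M) \<longlonglongrightarrow> (\<integral>p. ?L p \<partial>wmeas a)" by simp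
  have "(\<integral>p. ?H p \<partial>wmeas a) \<le> (\<integral>p. ?L p \<partial>wmeas a)"
    by (rule LIMSEQ_le_const[OF lim]) (intro exI[of _ 0] allI impI e, simp)
  then show "(LINT p:regular_set u|lebesgue. hessian_integrand a u \<phi> p) \<le> (LINT p:half_space|lebesgue. lhs_integrand a u \<phi> p)"
    unfolding L h wmeas_set_integral(2)[OF mL] wmeas_set_integral_subset(2)[OF mH S] .
qed

end

theorem theorem1p2:
  fixes s a \<gamma> :: real and f :: "real \<Rightarrow> real" and u \<phi> :: "hpt \<Rightarrow> real"
  assumes "0 < s" and "s < 1" and "a = 1 - 2 * s"
    and "\<gamma> > max 0 (1 - 2 * s)" and "C1_hoelder \<gamma> f"
    and "Ck_on 2 half_space u" and "bounded (u ` half_space)"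
    and "weak_solution a f u" and "stable a f u"
    and "\<forall>R>0. Linf_on (half_ball R) (\<lambda>p. norm (gradH u p))"
    and "smooth_compact_support \<phi>"
  shows "set_integrable lebesgue half_space (lhs_integrand a u \<phi>)
    \<and> set_integrable lebesgue (regular_set u) (hessian_integrand a u \<phi>)
    \<and> set_integrable lebesgue (regular_set u) (curvature_integrand a u \<phi>)
    \<and> (LINT p:half_space|lebesgue. lhs_integrand a u \<phi> p)
        \<ge> (LINT p:regular_set u|lebesgue. hessian_integrand a u \<phi> p)
    \<and> (LINT p:regular_set u|lebesgue. hessian_integrand a u \<phi> p)
        = (LINT p:regular_set u|lebesgue. curvature_integrand a u \<phi> p)"
proof -
  have u: "C2 u" by (rule Ck_on_2_imp_C2[OF assms(6)])
  interpret heis_sol a f u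
  proof
    show "-1 < a" "a < 1" using assms(1-3) by simp_all
    show "f differentiable (at t)" for t using assms(5) unfolding C1_hoelder_def by blast
    show "continuous_on UNIV (deriv f)" using assms(5) unfolding C1_hoelder_def by blast
  qed (fact u assms)+
  note I = stability_inequality[OF smooth_compact_support_cut[OF assms(11)]]
  \<comment> \<open>The two integrands agree pointwise on the regular set and the indicator removes
    the rest, so integrability and integral transfer together.\<close>
  have e: "indicator (regular_set u) p *\<^sub>R hessian_integrand a u \<phi> p = indicator (regular_set u) p *\<^sub>R curvature_integrand a u \<phi> p" for p
    using hessian_eq_curvature[OF u] by (cases "p \<in> regular_set u") simp_all
  have "set_integrable lebesgue (regular_set u) (curvature_integrand a u \<phi>)"
    using I(2) unfolding set_integrable_def e .
  moreover have "(LINT p:regular_set u|lebesgue. hessian_integrand a u \<phi> p) = (LINT p:regular_set u|lebesgue. curvature_integrand a u \<phi> p)"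
    unfolding set_lebesgue_integral_def e ..
  ultimately show ?thesis using I by blast
qed

end
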